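(* For every irrational $\alpha$ and every real $\theta$, the spectrum $\sigma(H_{\alpha,\theta})$ of the critical almost Mathieu operator $H_{\alpha,\theta}$ satisfies $\dim_{\mathrm H}(\sigma(H_{\alpha,\theta}))\le 1/2$.
   Context: The critical almost Mathieu operator $H_{\alpha,\theta}$ is the bounded self-adjoint operator on $\ell^2(\mathbb Z)$ given by $$(H_{\alpha,\theta}\phi)(n)=\phi(n-1)+\phi(n+1)+2\cos\big(2\pi(\alpha n+\theta)\big)\phi(n),\qquad n\in\mathbb Z.$$ $\dim_{\mathrm H}(A)$ denotes the Hausdorff dimension of a set $A\subset\mathbb R$. *)

theory Defs
  imports "HOL-Analysis.Analysis"
begin

subsection \<open>Bounded operators on the Hilbert space of square-summable bilateral sequences\<close>

definition ell2 :: "(int \<Rightarrow> complex) set" where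
  "ell2 = {\<phi>. (\<lambda>n. (cmod (\<phi> n))\<^sup>2) summable_on UNIV}"

definition ell2_norm :: "(int \<Rightarrow> complex) \<Rightarrow> real" where
  "ell2_norm \<phi> = sqrt (\<Sum>\<^sub>\<infinity>n. (cmod (\<phi> n))\<^sup>2)"

text \<open>Operators are functions on all sequences; only their restriction to \<open>ell2\<close> matters.\<close>

definition ell2_bounded_op :: "((int \<Rightarrow> complex) \<Rightarrow> (int \<Rightarrow> complex)) \<Rightarrow> bool" where
  "ell2_bounded_op T \<longleftrightarrow>
     (\<forall>\<phi>\<in>ell2. T \<phi> \<in> ell2) \<and>
     (\<forall>\<phi>\<in>ell2. \<forall>\<psi>\<in>ell2. \<forall>a b. T (\<lambda>n. a * \<phi> n + b * \<psi> n) = (\<lambda>n. a * T \<phi> n + b * T \<psi> n)) \<and>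
     (\<exists>K. \<forall>\<phi>\<in>ell2. ell2_norm (T \<phi>) \<le> K * ell2_norm \<phi>)"

definition ell2_resolvent_set :: "((int \<Rightarrow> complex) \<Rightarrow> (int \<Rightarrow> complex)) \<Rightarrow> complex set" where
  "ell2_resolvent_set T =
     {z. \<exists>R. ell2_bounded_op R \<and>
          (\<forall>\<phi>\<in>ell2. R (\<lambda>n. T \<phi> n - z * \<phi> n) = \<phi>) \<and>
          (\<forall>\<phi>\<in>ell2. (\<lambda>n. T (R \<phi>) n - z * R \<phi> n) = \<phi>)}"

definition ell2_spectrum :: "((int \<Rightarrow> complex) \<Rightarrow> (int \<Rightarrow> complex)) \<Rightarrow> complex set" where
  "ell2_spectrum T = - ell2_resolvent_set T"

subsection \<open>The critical almost Mathieu operator\<close>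

definition critical_amo :: "real \<Rightarrow> real \<Rightarrow> (int \<Rightarrow> complex) \<Rightarrow> (int \<Rightarrow> complex)" where
  "critical_amo \<alpha> \<theta> \<phi> =
     (\<lambda>n. \<phi> (n - 1) + \<phi> (n + 1)
          + complex_of_real (2 * cos (2 * pi * (\<alpha> * real_of_int n + \<theta>))) * \<phi> n)"

lemma ell2_bounded_op_critical_amo: "ell2_bounded_op (critical_amo \<alpha> \<theta>)"
proof -
  have main: "critical_amo \<alpha> \<theta> \<phi> \<in> ell2 \<and>
      ell2_norm (critical_amo \<alpha> \<theta> \<phi>) \<le> sqrt 18 * ell2_norm \<phi>" if "\<phi> \<in> ell2" for \<phi>
  proof -
    define f where "f = (\<lambda>n. (cmod (\<phi> n))\<^sup>2)"
    define g where "g = (\<lambda>n. 3 * f (n - 1) + 3 * f (n + 1) + 12 * f n)"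
    define h where "h = (\<lambda>n. (cmod (critical_amo \<alpha> \<theta> \<phi> n))\<^sup>2)"
    have f: "(f has_sum infsum f UNIV) UNIV"
      using that by (simp add: ell2_def f_def)
    have bij: "bij_betw (\<lambda>n::int. n - 1) UNIV UNIV" "bij_betw (\<lambda>n::int. n + 1) UNIV UNIV"
      by (rule bij_betw_byWitness[where f' = "\<lambda>n. n + 1"], auto)
         (rule bij_betw_byWitness[where f' = "\<lambda>n. n - 1"], auto)
    have shift: "((\<lambda>n. f (n - 1)) has_sum infsum f UNIV) UNIV"
                "((\<lambda>n. f (n + 1)) has_sum infsum f UNIV) UNIV"
      using f has_sum_reindex_bij_betw[OF bij(1), of f] has_sum_reindex_bij_betw[OF bij(2), of f]
      by simp_all
    have "(g has_sum (3 * infsum f UNIV + 3 * infsum f UNIV + 12 * infsum f UNIV)) UNIV"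
      unfolding g_def by (intro has_sum_add has_sum_cmult_right f shift)
    then have g: "(g has_sum (18 * infsum f UNIV)) UNIV" by simp
    have hg: "h n \<le> g n" for n
    proof -
      let ?a = "cmod (\<phi> (n - 1))" and ?b = "cmod (\<phi> (n + 1))" and ?c = "cmod (\<phi> n)"
      let ?w = "complex_of_real (2 * cos (2 * pi * (\<alpha> * real_of_int n + \<theta>)))"
      have "cmod ?w \<le> 2" unfolding norm_of_real by (simp add: abs_mult)
      then have "cmod (?w * \<phi> n) \<le> 2 * ?c" unfolding norm_mult by (intro mult_right_mono) auto
      then have "cmod (critical_amo \<alpha> \<theta> \<phi> n) \<le> ?a + ?b + 2 * ?c"
        unfolding critical_amo_def by (intro norm_triangle_le add_mono) auto
      then have "h n \<le> (?a + ?b + 2 * ?c)\<^sup>2"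
        unfolding h_def by (intro power_mono) auto
      also have "\<dots> \<le> 3 * ?a\<^sup>2 + 3 * ?b\<^sup>2 + 12 * ?c\<^sup>2"
      proof -
        have "0 \<le> (?a - ?b)\<^sup>2 + (?a - 2 * ?c)\<^sup>2 + (?b - 2 * ?c)\<^sup>2" by simp
        then show ?thesis by (simp add: power2_eq_square algebra_simps)
      qed
      finally show ?thesis by (simp add: g_def f_def)
    qed
    have hs: "h summable_on UNIV"
      using summable_on_comparison_test[OF has_sum_imp_summable[OF g], of h] hg
      by (auto simp: h_def)
    have "infsum h UNIV \<le> 18 * infsum f UNIV"
      using infsum_mono[OF hs has_sum_imp_summable[OF g]] hg infsumI[OF g] by simp
    then have "sqrt (infsum h UNIV) \<le> sqrt 18 * sqrt (infsum f UNIV)"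
      by (metis real_sqrt_le_mono real_sqrt_mult)
    with hs show ?thesis by (simp add: ell2_def ell2_norm_def h_def f_def)
  qed
  show ?thesis
    unfolding ell2_bounded_op_def
  proof (intro conjI ballI allI)
    show "\<exists>K. \<forall>\<phi>\<in>ell2. ell2_norm (critical_amo \<alpha> \<theta> \<phi>) \<le> K * ell2_norm \<phi>"
      using main by blast
  qed (use main in \<open>auto simp: critical_amo_def algebra_simps\<close>)
qed

subsection \<open>Hausdorff measure and Hausdorff dimension\<close>

text \<open>
  The contribution \<open>(diam U)\<^sup>s\<close> of a covering set, with the conventions that the empty set
  contributes \<open>0\<close> and that \<open>0\<^sup>0 = 1\<close> for nonempty sets (in contrast to \<open>0 powr 0 = 0\<close>).
\<close>

definition hausdorff_gauge :: "real \<Rightarrow> 'a::metric_space set \<Rightarrow> ennreal" where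
  "hausdorff_gauge s U =
     (if U = {} then 0 else if s = 0 then 1 else ennreal (diameter U powr s))"

text \<open>
  Boundedness is required explicitly because \<^const>\<open>diameter\<close> is unspecified on unbounded sets.
  Finite covers are included, since covering sets may be empty.
\<close>

definition hausdorff_cover :: "real \<Rightarrow> 'a::metric_space set \<Rightarrow> (nat \<Rightarrow> 'a set) \<Rightarrow> bool" where
  "hausdorff_cover \<delta> A U \<longleftrightarrow>
     A \<subseteq> (\<Union>i. U i) \<and> (\<forall>i. bounded (U i) \<and> diameter (U i) \<le> \<delta>)"

definition hausdorff_premeasure :: "real \<Rightarrow> real \<Rightarrow> 'a::metric_space set \<Rightarrow> ennreal" where
  "hausdorff_premeasure s \<delta> A = (INF U\<in>Collect (hausdorff_cover \<delta> A). \<Sum>i. hausdorff_gauge s (U i))"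

definition hausdorff_measure :: "real \<Rightarrow> 'a::metric_space set \<Rightarrow> ennreal" where
  "hausdorff_measure s A = (SUP \<delta>\<in>{0<..}. hausdorff_premeasure s \<delta> A)"

text \<open>The value is \<open>\<infinity>\<close> if no \<open>s\<close>-dimensional Hausdorff measure of \<open>A\<close> vanishes.\<close>

definition hausdorff_dim :: "'a::metric_space set \<Rightarrow> ereal" where
  "hausdorff_dim A = (INF s\<in>{s. 0 \<le> s \<and> hausdorff_measure s A = 0}. ereal s)"

end

theory Submission
  imports Defs "Jordan_Normal_Form.Determinant" "HOL-Analysis.Kronecker_Approximation_Theorem"
    "HOL-Computational_Algebra.Fundamental_Theorem_Algebra" "HOL-Real_Asymp.Real_Asymp"
begin

text \<open>
  A gauge transformation over the quasi-momenta turns the operator into a family of chains: Jacobi matrices with zero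
  diagonal and off-diagonal entries \<open>c j = 2 cos (\<pi> (y + \<alpha> j))\<close>. Write \<open>D n\<close> for their characteristic polynomials.

  On the spectrum \<open>D n\<close> grows subexponentially, uniformly in \<open>y\<close>. Otherwise, by repulsion of bad phases, the approximate
  solutions at \<open>E\<close> decay exponentially away from one site; the Fourier transform of such a solution is an exponential sum
  of low degree which, along the rotation orbit, solves a chain of the same kind, so that it is tiny on a net of phases
  and hence, by interpolation, everywhere, which contradicts Parseval.

  Let \<open>h = \<surd>\<eta>\<close>. For a suitable \<open>y\<close> the mean of \<open>ln (max \<bar>c j\<bar> h)\<close> is at least \<open>h / 20\<close>. If \<open>ln \<bar>D n (E + i \<eta>)\<bar>\<close> is below
  \<open>n h / 40\<close>, then cutting the chain at its bonds \<open>\<bar>c j\<bar> \<le> h\<close> gives corner Green functions of average at least \<open>1 / h\<close>, which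
  is possible only for about \<open>\<eta> powr (- 1/2)\<close> cells of length \<open>\<eta>\<close>. Otherwise, as \<open>ln \<bar>D n (E + i t)\<bar>\<close> is \<open>o(n)\<close> for small
  \<open>t\<close>, the logarithmic potential of the eigenvalues changes by order \<open>h\<close> between the heights \<open>t\<close> and \<open>\<eta>\<close>; then a proportion
  at least \<open>\<rho> powr s\<close>, with \<open>s > 1/2\<close>, of the eigenvalues lies within some dyadic distance \<open>\<rho>\<close> of \<open>E\<close>, which happens in at
  most \<open>3 / \<rho> powr s\<close> cells of length \<open>\<rho>\<close>.
\<close>

text \<open>The exponent 1/2 is a balance. Cutting at bonds below h leaves about h / \<eta> cells up
  to a logarithm, so a small h is wanted; yet the gain from truncating the logarithm is itself only
  of order h and must exceed the change of the potential, which is at most of order \<eta> powr a,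
  with a slightly above 1/2, when no dyadic interval is crowded. Hence h = sqrt \<eta>. The obstacle
  is that bonds come arbitrarily close to 0, so transfer matrices are unbounded. The growth
  estimates therefore use determinants, which are polynomials in the squared bonds and 1-periodic in
  the phase. At this coupling duality returns a chain with the same growth rate; one positive rate
  would make a solution localised and its dual regular at once, and this is what cannot happen. All
  estimates concern finite chains. Constants depend on \<eta>, and the length n is chosen after
  them, so no limiting density of states enters.\<close>

subsection \<open>Jacobi determinants\<close>

text \<open>\<open>det (z - J)\<close> for the Jacobi matrix \<open>J\<close> on the sites \<open>1, \<dots>, n\<close> with zero diagonal and bond \<open>c j\<close> between \<open>j\<close> and \<open>j + 1\<close>.\<close>

fun jdet :: "(nat \<Rightarrow> real) \<Rightarrow> complex \<Rightarrow> nat \<Rightarrow> complex" where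
  "jdet c z 0 = 1"
| "jdet c z (Suc 0) = z"
| "jdet c z (Suc (Suc n)) = z * jdet c z (Suc n) - (complex_of_real (c (Suc n)))\<^sup>2 * jdet c z n"

lemma jdet_split:
  "jdet c z (Suc m + Suc p) = jdet c z (Suc m) * jdet (\<lambda>j. c (Suc m + j)) z (Suc p)
     - (complex_of_real (c (Suc m)))\<^sup>2 * jdet c z m * jdet (\<lambda>j. c (Suc (Suc m) + j)) z p"
proof (induction p rule: induct_nat_012)
  case 0
  then show ?case by (simp add: algebra_simps)
next
  case 1
  then show ?case by (simp add: algebra_simps)
next
  case (ge2 n)
  have "jdet c z (Suc m + Suc (Suc (Suc n))) =
     z * jdet c z (Suc m + Suc (Suc n)) - (complex_of_real (c (Suc m + Suc (Suc n))))\<^sup>2 * jdet c z (Suc m + Suc n)"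
    by simp
  then show ?case unfolding ge2 by (simp add: algebra_simps)
qed

lemma jdet_left:
  "jdet c z (Suc (Suc n)) = z * jdet (\<lambda>j. c (Suc j)) z (Suc n)
     - (complex_of_real (c 1))\<^sup>2 * jdet (\<lambda>j. c (Suc (Suc j))) z n"
  using jdet_split[of c z 0 n] by simp

text \<open>The ratio r of consecutive determinants obeys r' = z - c^2 / r, and - c^2 / r stays in
  the closed upper half plane when r lies in the upper one. No determinant can therefore vanish off
  the real axis.\<close>

lemma jdet_Im_ratio:
  assumes "Im z > 0"
  shows "jdet c z n \<noteq> 0 \<and> Im (jdet c z (Suc n) / jdet c z n) \<ge> Im z"
proof (induction n)
  case 0
  then show ?case by simp
next
  case (Suc n)
  define r where "r = jdet c z (Suc n) / jdet c z n"
  have r: "Im r \<ge> Im z" "jdet c z n \<noteq> 0" using Suc by (auto simp: r_def)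
  then have rpos: "Im r > 0" using assms by simp
  then have r0: "r \<noteq> 0" by auto
  have nz: "jdet c z (Suc n) \<noteq> 0" using r0 by (auto simp: r_def)
  have "jdet c z (Suc (Suc n)) / jdet c z (Suc n) = z - (complex_of_real (c (Suc n)))\<^sup>2 / r"
    using nz r(2) by (simp add: r_def field_simps)
  moreover have "Im ((complex_of_real (c (Suc n)))\<^sup>2 / r) \<le> 0"
  proof -
    have "Im ((complex_of_real (c (Suc n)))\<^sup>2 / r) = Im (complex_of_real ((c (Suc n))\<^sup>2) / r)" by simp
    also have "\<dots> = - ((c (Suc n))\<^sup>2 * Im r) / (cmod r)\<^sup>2"
      by (simp add: Im_divide cmod_power2 del: of_real_power)
    also have "\<dots> \<le> 0" using rpos by (simp add: divide_nonpos_nonneg)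
    finally show ?thesis .
  qed
  ultimately show ?case using nz by simp
qed

lemma jdet_nonzero: "Im z > 0 \<Longrightarrow> jdet c z n \<noteq> 0"
  using jdet_Im_ratio by blast

lemma jdet_cnj: "jdet c (cnj z) n = cnj (jdet c z n)"
  by (induction n rule: induct_nat_012) auto

lemma jdet_nonzero': "Im z \<noteq> 0 \<Longrightarrow> jdet c z n \<noteq> 0"
  using jdet_nonzero[of z c n] jdet_nonzero[of "cnj z" c n] jdet_cnj[of c z n]
  by (cases "Im z > 0") auto

lemma cmod_jdet_le:
  assumes "cmod z \<le> 5" "\<And>j. \<bar>c j\<bar> \<le> 2"
  shows "cmod (jdet c z n) \<le> 6 ^ n"
proof (induction n rule: induct_nat_012)
  case (ge2 n)
  have c: "(c (Suc n))\<^sup>2 \<le> 4" using assms(2)[of "Suc n"] by (simp add: abs_le_square_iff[of _ 2, simplified])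
  have "cmod (jdet c z (Suc (Suc n))) \<le> cmod z * cmod (jdet c z (Suc n)) + (c (Suc n))\<^sup>2 * cmod (jdet c z n)"
    by (auto intro!: norm_triangle_ineq4[THEN order_trans] simp: norm_mult norm_power)
  also have "\<dots> \<le> 5 * 6 ^ Suc n + 4 * 6 ^ n"
    using ge2 assms c by (intro add_mono mult_mono) auto
  also have "\<dots> \<le> 6 ^ Suc (Suc n)" by simp
  finally show ?case .
qed (use assms in auto)

lemma jdet_lipschitz:
  assumes "cmod z \<le> 5" "cmod z' \<le> 5" "\<And>j. \<bar>c j\<bar> \<le> 2"
  shows "cmod (jdet c z n - jdet c z' n) \<le> cmod (z - z') * 7 ^ n"
proof (induction n rule: induct_nat_012)
  case 0
  then show ?case by simp
next
  case 1
  then show ?case using norm_ge_zero[of "z - z'"] by auto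
next
  case (ge2 n)
  have c: "(c (Suc n))\<^sup>2 \<le> 4" using assms(3)[of "Suc n"] by (simp add: abs_le_square_iff[of _ 2, simplified])
  have "jdet c z (Suc (Suc n)) - jdet c z' (Suc (Suc n)) =
     z * (jdet c z (Suc n) - jdet c z' (Suc n)) + (z - z') * jdet c z' (Suc n)
     - (complex_of_real (c (Suc n)))\<^sup>2 * (jdet c z n - jdet c z' n)"
    by (simp add: algebra_simps)
  then have "cmod (jdet c z (Suc (Suc n)) - jdet c z' (Suc (Suc n))) \<le>
     cmod z * cmod (jdet c z (Suc n) - jdet c z' (Suc n)) + cmod (z - z') * cmod (jdet c z' (Suc n))
     + (c (Suc n))\<^sup>2 * cmod (jdet c z n - jdet c z' n)"
    by (auto intro!: norm_triangle_ineq4[THEN order_trans] norm_triangle_ineq[THEN order_trans] simp: norm_mult norm_power)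
  also have "\<dots> \<le> 5 * (cmod (z - z') * 7 ^ Suc n) + cmod (z - z') * 6 ^ Suc n + 4 * (cmod (z - z') * 7 ^ n)"
    using ge2 assms c cmod_jdet_le[of z' c "Suc n"] by (intro add_mono mult_mono) auto
  also have "\<dots> \<le> cmod (z - z') * 7 ^ Suc (Suc n)"
  proof -
    have "(6::real) ^ n \<le> 7 ^ n" by (intro power_mono) auto
    then have "cmod (z - z') * 6 ^ n \<le> cmod (z - z') * 7 ^ n" by (intro mult_left_mono) auto
    moreover have "0 \<le> cmod (z - z') * 7 ^ n" by simp
    moreover have "5 * (cmod (z - z') * 7 ^ Suc n) + cmod (z - z') * 6 ^ Suc n + 4 * (cmod (z - z') * 7 ^ n)
      = 39 * (cmod (z - z') * 7 ^ n) + 6 * (cmod (z - z') * 6 ^ n)" by (simp add: algebra_simps)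
    moreover have "cmod (z - z') * 7 ^ Suc (Suc n) = 49 * (cmod (z - z') * 7 ^ n)" by simp
    ultimately show ?thesis by linarith
  qed
  finally show ?case .
qed

text \<open>Weighting the equations at the sites 1 to \<open>Suc m\<close> by cofactors removes all
  interior values except \<open>u 1\<close> without dividing by a bond, so vanishing bonds are
  harmless. The bond \<open>c (j - 1)\<close> joins \<open>j - 1\<close> and \<open>j\<close>; hence
  \<open>c 0\<close> couples the window to \<open>u 0\<close>.\<close>

lemma jdet_elim_right:
  fixes u :: "nat \<Rightarrow> complex"
  assumes z: "cmod z \<le> 5" and c: "\<And>j. \<bar>c j\<bar> \<le> 2"
    and g: "\<And>j. 1 \<le> j \<Longrightarrow> j \<le> Suc m \<Longrightarrow> cmod (z * u j - c j * u (Suc j) - c (j - 1) * u (j - 1)) \<le> \<gamma>"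
    and \<gamma>: "\<gamma> \<ge> 0"
  shows "cmod (jdet c z (Suc m) * u 1 - c 0 * jdet (\<lambda>j. c (Suc j)) z m * u 0
           - complex_of_real (\<Prod>j\<in>{1..Suc m}. c j) * u (Suc (Suc m))) \<le> 10 ^ Suc m * \<gamma>"
  using c g
proof (induction m arbitrary: c u)
  case 0
  then show ?case using 0(2)[of 1] \<gamma> by (auto simp: algebra_simps)
next
  case (Suc m)
  define e' where "e' = jdet (\<lambda>j. c (Suc j)) z (Suc m) * u 2 - c 1 * jdet (\<lambda>j. c (Suc (Suc j))) z m * u 1
           - complex_of_real (\<Prod>j\<in>{1..Suc m}. c (Suc j)) * u (Suc (Suc (Suc m)))"
  have e': "cmod e' \<le> 10 ^ Suc m * \<gamma>"
  proof -
    have "cmod (z * u (Suc j) - c (Suc j) * u (Suc (Suc j)) - c (Suc (j - 1)) * u (Suc (j - 1))) \<le> \<gamma>"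
      if "1 \<le> j" "j \<le> Suc m" for j
      using Suc(3)[of "Suc j"] that by simp
    from Suc.IH[of "\<lambda>j. c (Suc j)" "\<lambda>j. u (Suc j)", OF Suc(2) this]
    show ?thesis by (simp add: e'_def numeral_2_eq_2)
  qed
  define g1 where "g1 = z * u 1 - c 1 * u 2 - c 0 * u 0"
  have g1: "cmod g1 \<le> \<gamma>" using Suc(3)[of 1] by (simp add: g1_def numeral_2_eq_2)
  have pr: "(\<Prod>j\<in>{1..Suc (Suc m)}. c j) = c 1 * (\<Prod>j\<in>{1..Suc m}. c (Suc j))"
  proof -
    have "(\<Prod>j\<in>{1..Suc (Suc m)}. c j) = c 1 * (\<Prod>j\<in>{Suc 1..Suc (Suc m)}. c j)"
      by (intro prod.atLeast_Suc_atMost) simp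
    also have "(\<Prod>j\<in>{Suc 1..Suc (Suc m)}. c j) = (\<Prod>j\<in>{1..Suc m}. c (Suc j))"
      by (rule prod.shift_bounds_cl_Suc_ivl)
    finally show ?thesis .
  qed
  have "jdet c z (Suc (Suc m)) * u 1 - c 0 * jdet (\<lambda>j. c (Suc j)) z (Suc m) * u 0
           - complex_of_real (\<Prod>j\<in>{1..Suc (Suc m)}. c j) * u (Suc (Suc (Suc m)))
       = c 1 * e' + g1 * jdet (\<lambda>j. c (Suc j)) z (Suc m)"
    unfolding jdet_left[of c z m] pr e'_def g1_def of_real_mult by (simp add: algebra_simps power2_eq_square)
  then have "cmod (jdet c z (Suc (Suc m)) * u 1 - c 0 * jdet (\<lambda>j. c (Suc j)) z (Suc m) * u 0
           - complex_of_real (\<Prod>j\<in>{1..Suc (Suc m)}. c j) * u (Suc (Suc (Suc m))))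
       \<le> \<bar>c 1\<bar> * cmod e' + cmod g1 * cmod (jdet (\<lambda>j. c (Suc j)) z (Suc m))"
    by (auto intro!: norm_triangle_ineq[THEN order_trans] simp: norm_mult)
  also have "\<dots> \<le> 2 * (10 ^ Suc m * \<gamma>) + \<gamma> * 6 ^ Suc m"
    using Suc(2) e' g1 \<gamma> z by (intro add_mono mult_mono cmod_jdet_le) auto
  also have "\<dots> \<le> 2 * (10 ^ Suc m * \<gamma>) + \<gamma> * 10 ^ Suc m"
    using \<gamma> by (intro add_left_mono mult_left_mono power_mono) auto
  also have "\<dots> \<le> 10 ^ Suc (Suc m) * \<gamma>" using \<gamma> by (simp add: algebra_simps)
  finally show ?case .
qed

text \<open>The mirror image: the interior value kept is that of the last site, and the sweep starts
  at the left end.\<close>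

lemma jdet_elim_left:
  fixes u :: "nat \<Rightarrow> complex"
  assumes z: "cmod z \<le> 5" and c: "\<And>j. \<bar>c j\<bar> \<le> 2"
    and g: "\<And>j. 1 \<le> j \<Longrightarrow> j \<le> Suc m \<Longrightarrow> cmod (z * u j - c j * u (Suc j) - c (j - 1) * u (j - 1)) \<le> \<gamma>"
    and \<gamma>: "\<gamma> \<ge> 0"
  shows "cmod (jdet c z (Suc m) * u (Suc m) - complex_of_real (\<Prod>j<Suc m. c j) * u 0
           - c (Suc m) * jdet c z m * u (Suc (Suc m))) \<le> 10 ^ Suc m * \<gamma>"
  using g
proof (induction m)
  case 0
  then show ?case using 0[of 1] \<gamma> by (auto simp: algebra_simps)
next
  case (Suc m)
  define e' where "e' = jdet c z (Suc m) * u (Suc m) - complex_of_real (\<Prod>j<Suc m. c j) * u 0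
           - c (Suc m) * jdet c z m * u (Suc (Suc m))"
  have e': "cmod e' \<le> 10 ^ Suc m * \<gamma>" using Suc.IH Suc.prems by (simp add: e'_def)
  define g1 where "g1 = z * u (Suc (Suc m)) - c (Suc (Suc m)) * u (Suc (Suc (Suc m))) - c (Suc m) * u (Suc m)"
  have g1: "cmod g1 \<le> \<gamma>" using Suc.prems[of "Suc (Suc m)"] by (simp add: g1_def)
  have "jdet c z (Suc (Suc m)) * u (Suc (Suc m)) - complex_of_real (\<Prod>j<Suc (Suc m). c j) * u 0
           - c (Suc (Suc m)) * jdet c z (Suc m) * u (Suc (Suc (Suc m)))
       = c (Suc m) * e' + g1 * jdet c z (Suc m)"
    unfolding e'_def g1_def jdet.simps prod.lessThan_Suc[of _ "Suc m"] of_real_mult by (simp add: algebra_simps power2_eq_square)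
  then have "cmod (jdet c z (Suc (Suc m)) * u (Suc (Suc m)) - complex_of_real (\<Prod>j<Suc (Suc m). c j) * u 0
           - c (Suc (Suc m)) * jdet c z (Suc m) * u (Suc (Suc (Suc m))))
       \<le> \<bar>c (Suc m)\<bar> * cmod e' + cmod g1 * cmod (jdet c z (Suc m))"
    by (auto intro!: norm_triangle_ineq[THEN order_trans] simp: norm_mult)
  also have "\<dots> \<le> 2 * (10 ^ Suc m * \<gamma>) + \<gamma> * 6 ^ Suc m"
    using c e' g1 \<gamma> z by (intro add_mono mult_mono cmod_jdet_le) auto
  also have "\<dots> \<le> 2 * (10 ^ Suc m * \<gamma>) + \<gamma> * 10 ^ Suc m"
    using \<gamma> by (intro add_left_mono mult_left_mono power_mono) auto
  also have "\<dots> \<le> 10 ^ Suc (Suc m) * \<gamma>" using \<gamma> by (simp add: algebra_simps)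
  finally show ?case .
qed

text \<open>Cramer's rule for an approximate solution on a window, with the boundary values as data.\<close>

lemma jdet_window:
  fixes u :: "nat \<Rightarrow> complex"
  assumes z: "cmod z \<le> 5" and c: "\<And>j. \<bar>c j\<bar> \<le> 2"
    and g: "\<And>j. 1 \<le> j \<Longrightarrow> j \<le> m \<Longrightarrow> cmod (z * u j - c j * u (Suc j) - c (j - 1) * u (j - 1)) \<le> \<gamma>"
    and \<gamma>: "\<gamma> \<ge> 0" and i: "1 \<le> i" "i \<le> m"
  shows "cmod (jdet c z m) * cmod (u i) \<le>
           (\<Prod>j<i. \<bar>c j\<bar>) * cmod (jdet (\<lambda>j. c (i + j)) z (m - i)) * cmod (u 0)
         + (\<Prod>j\<in>{i..m}. \<bar>c j\<bar>) * cmod (jdet c z (i - 1)) * cmod (u (Suc m)) + 3 * 100 ^ m * \<gamma>"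
proof -
  obtain i' where i': "i = Suc i'" using i by (cases i) auto
  define L where "L = jdet c z i * u i - complex_of_real (\<Prod>j<i. c j) * u 0 - c i * jdet c z (i - 1) * u (Suc i)"
  have L: "cmod L \<le> 10 ^ i * \<gamma>"
    using jdet_elim_left[where c=c and u=u and m=i', OF z c _ \<gamma>] g i by (simp add: L_def i')
  define P where "P = (\<Prod>j\<in>{i..m}. \<bar>c j\<bar>)"
  show ?thesis
  proof (cases "i = m")
    case True
    then have "jdet c z m * u i = L + complex_of_real (\<Prod>j<i. c j) * u 0 + c i * jdet c z (i - 1) * u (Suc i)"
      by (simp add: L_def)
    then have "cmod (jdet c z m * u i) \<le> cmod L + (\<Prod>j<i. \<bar>c j\<bar>) * cmod (u 0) + \<bar>c i\<bar> * cmod (jdet c z (i - 1)) * cmod (u (Suc i))"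
      by (auto intro!: norm_triangle_ineq[THEN order_trans] simp: norm_mult abs_prod simp del: of_real_prod)
    moreover have "10 ^ i * \<gamma> \<le> 3 * 100 ^ m * \<gamma>"
    proof -
      have "(10::real) ^ i \<le> 100 ^ i" by (intro power_mono) auto
      moreover have "(100::real) ^ i \<le> 3 * 100 ^ i" by simp
      ultimately have "(10::real) ^ i \<le> 3 * 100 ^ m" unfolding True by linarith
      then show ?thesis using \<gamma> by (intro mult_right_mono) auto
    qed
    ultimately show ?thesis using L True by (simp add: norm_mult)
  next
    case False
    then obtain p where p: "m = i + Suc p" using i by (metis add_Suc_right less_iff_Suc_add le_neq_implies_less)
    define R where "R = jdet (\<lambda>j. c (i + j)) z (Suc p) * u (Suc i) - c i * jdet (\<lambda>j. c (Suc i + j)) z p * u i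
           - complex_of_real (\<Prod>j\<in>{1..Suc p}. c (i + j)) * u (Suc m)"
    have R: "cmod R \<le> 10 ^ Suc p * \<gamma>"
    proof -
      have "cmod (z * u (i + j) - c (i + j) * u (i + Suc j) - c (i + (j - 1)) * u (i + (j - 1))) \<le> \<gamma>"
        if "1 \<le> j" "j \<le> Suc p" for j
        using g[of "i + j"] that p by simp
      from jdet_elim_right[where c="\<lambda>j. c (i + j)" and m=p and u="\<lambda>j. u (i + j)", OF z _ this \<gamma>]
      show ?thesis using c by (simp add: R_def p)
    qed
    have pr: "(\<Prod>j\<in>{1..Suc p}. c (i + j)) * c i = (\<Prod>j\<in>{i..m}. c j)"
    proof -
      have "(\<Prod>j\<in>{i..m}. c j) = c i * (\<Prod>j\<in>{Suc i..m}. c j)"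
        using p by (intro prod.atLeast_Suc_atMost) simp
      also have "(\<Prod>j\<in>{Suc i..m}. c j) = (\<Prod>j\<in>{1..Suc p}. c (i + j))"
        using prod.shift_bounds_cl_nat_ivl[of c 1 i "Suc p"] by (simp add: p add.commute)
      finally show ?thesis by simp
    qed
    have D: "jdet c z m = jdet c z i * jdet (\<lambda>j. c (i + j)) z (Suc p)
      - (complex_of_real (c i))\<^sup>2 * jdet c z (i - 1) * jdet (\<lambda>j. c (Suc i + j)) z p"
      using jdet_split[of c z i' p] by (simp add: p i')
    \<comment> \<open>The right determinant times \<open>L\<close> plus \<open>c i\<close> times the
      left one times \<open>R\<close>: the terms in \<open>u (Suc i)\<close> cancel, and the
      coefficient of \<open>u i\<close> becomes \<open>jdet c z m\<close> by
      \<open>D\<close>.\<close>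
    have "jdet c z m * u i = complex_of_real (\<Prod>j<i. c j) * jdet (\<lambda>j. c (i + j)) z (Suc p) * u 0
        + complex_of_real (\<Prod>j\<in>{i..m}. c j) * jdet c z (i - 1) * u (Suc m)
        + (c i * jdet c z (i - 1) * R + jdet (\<lambda>j. c (i + j)) z (Suc p) * L)"
      unfolding D pr[symmetric] L_def R_def of_real_mult by (simp add: algebra_simps power2_eq_square)
    then have "cmod (jdet c z m * u i) \<le> (\<Prod>j<i. \<bar>c j\<bar>) * cmod (jdet (\<lambda>j. c (i + j)) z (Suc p)) * cmod (u 0)
        + P * cmod (jdet c z (i - 1)) * cmod (u (Suc m))
        + (\<bar>c i\<bar> * cmod (jdet c z (i - 1)) * cmod R + cmod (jdet (\<lambda>j. c (i + j)) z (Suc p)) * cmod L)"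
      unfolding P_def
      by (simp only:) (rule order_trans[OF norm_triangle_ineq] order_refl add_mono | simp add: norm_mult abs_prod mult_ac del: of_real_prod)+
    moreover have "\<bar>c i\<bar> * cmod (jdet c z (i - 1)) * cmod R \<le> 2 * 6 ^ (i - 1) * (10 ^ Suc p * \<gamma>)"
      using c R \<gamma> z by (intro mult_mono cmod_jdet_le) auto
    moreover have "2 * 6 ^ (i - 1) * (10 ^ Suc p * \<gamma>) \<le> 2 * (10 ^ m * 10 ^ m * \<gamma>)"
    proof -
      have "(6::real) ^ (i - 1) \<le> 10 ^ (i - 1)" by (intro power_mono) auto
      also have "\<dots> \<le> 10 ^ m" using p by (intro power_increasing) auto
      finally have 1: "(6::real) ^ (i - 1) \<le> 10 ^ m" .
      have 2: "(10::real) ^ Suc p \<le> 10 ^ m" using p by (intro power_increasing) auto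
      have "(6::real) ^ (i - 1) * 10 ^ Suc p \<le> 10 ^ m * 10 ^ m" using 1 2 by (intro mult_mono) auto
      from mult_right_mono[OF this \<gamma>] show ?thesis by (simp only: mult.assoc)
    qed
    moreover have "cmod (jdet (\<lambda>j. c (i + j)) z (Suc p)) * cmod L \<le> 6 ^ Suc p * (10 ^ i * \<gamma>)"
      using c L \<gamma> z by (intro mult_mono cmod_jdet_le) auto
    moreover have "6 ^ Suc p * (10 ^ i * \<gamma>) \<le> 10 ^ m * 10 ^ m * \<gamma>"
    proof -
      have "(6::real) ^ Suc p \<le> 10 ^ Suc p" by (intro power_mono) auto
      also have "\<dots> \<le> 10 ^ m" using p by (intro power_increasing) auto
      finally have 1: "(6::real) ^ Suc p \<le> 10 ^ m" .
      have 2: "(10::real) ^ i \<le> 10 ^ m" using p by (intro power_increasing) auto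
      have "(6::real) ^ Suc p * 10 ^ i \<le> 10 ^ m * 10 ^ m" using 1 2 by (intro mult_mono) auto
      from mult_right_mono[OF this \<gamma>] show ?thesis by (simp only: mult.assoc)
    qed
    moreover have "10 ^ m * 10 ^ m * \<gamma> = 100 ^ m * \<gamma>" by (simp flip: power_mult_distrib)
    ultimately have "cmod (jdet c z m * u i) \<le> (\<Prod>j<i. \<bar>c j\<bar>) * cmod (jdet (\<lambda>j. c (i + j)) z (Suc p)) * cmod (u 0)
        + P * cmod (jdet c z (i - 1)) * cmod (u (Suc m)) + 3 * (100 ^ m * \<gamma>)"
      by linarith
    then show ?thesis using p by (simp add: norm_mult P_def)
  qed
qed

subsection \<open>The chain along a rotation orbit\<close>

text \<open>The angle is \<open>pi\<close> times the phase, so a bond changes sign when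
  \<open>y\<close> grows by 1. Determinants contain only squares of bonds and are 1-periodic in
  \<open>y\<close>.\<close>

definition chain :: "real \<Rightarrow> real \<Rightarrow> nat \<Rightarrow> real" where
  "chain \<alpha> y j = 2 * cos (pi * (y + \<alpha> * real j))"

lemma abs_chain_le: "\<bar>chain \<alpha> y j\<bar> \<le> 2"
  by (simp add: chain_def abs_mult)

lemma chain_shift: "chain \<alpha> y (i + j) = chain \<alpha> (y + \<alpha> * real i) j"
  by (simp add: chain_def algebra_simps)

section \<open>Roots of unity and rational approximation of the frequency\<close>

lemma cmod_cis_plus_1: "cmod (cis (2 * pi * t) + 1) = \<bar>2 * cos (pi * t)\<bar>"
proof -
  have "cis (2 * pi * t) + 1 = cis (pi * t) * (2 * cos (pi * t))"
    using cos_double_cos[of "pi * t"] sin_double[of "pi * t"]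
    by (auto simp: complex_eq_iff power2_eq_square algebra_simps)
  then show ?thesis by (simp add: norm_mult)
qed

lemma cmod_cis_diff_le: "cmod (cis a - cis b) \<le> \<bar>a - b\<bar>"
proof -
  have "cis a - cis b = cis b * (cis (a - b) - 1)" by (simp add: algebra_simps cis_mult)
  then have "cmod (cis a - cis b) = cmod (exp (\<i> * of_real (a - b)) - 1)"
    by (simp add: norm_mult cis_conv_exp)
  also have "\<dots> = 2 * \<bar>sin ((a - b) / 2)\<bar>" by (rule dist_exp_i_1)
  also have "\<dots> \<le> 2 * \<bar>(a - b) / 2\<bar>" by (intro mult_left_mono abs_sin_x_le_abs_x) auto
  finally show ?thesis by simp
qed

lemma dvd_small_eq_0:
  fixes d m :: int
  assumes "m dvd d" "\<bar>d\<bar> < m"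
  shows "d = 0"
  using dvd_imp_le_int[of d m] assms by auto

lemma prod_lessThan_add:
  fixes f :: "nat \<Rightarrow> 'a::comm_monoid_mult"
  shows "(\<Prod>j<m + n. f j) = (\<Prod>j<m. f j) * (\<Prod>j<n. f (m + j))"
  by (induction n) (auto simp: mult_ac)

text \<open>For nonzero \<open>b\<close> both sides are, as polynomials in \<open>a\<close>, monic
  of degree \<open>n\<close> with the same \<open>n\<close> distinct roots.\<close>

lemma prod_roots_unity:
  fixes a b :: complex
  assumes "n > 0"
  shows "(\<Prod>j<n. a - b * cis (2 * pi * real j / real n)) = a ^ n - b ^ n"
proof (cases "b = 0")
  case False
  define p where "p = Polynomial.monom 1 n - [:b ^ n:]"
  define R where "R = (\<lambda>j. b * cis (2 * pi * real j / real n)) ` {..<n}"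
  define r where "r = (\<Prod>x\<in>R. [:-x, 1:])"
  have inj: "inj_on (\<lambda>j. b * cis (2 * pi * real j / real n)) {..<n}"
    using bij_betw_imp_inj_on[OF Complex.bij_betw_roots_unity[OF assms]] False by (auto simp: inj_on_def)
  have card: "card R = n" using card_image[OF inj] by (simp add: R_def)
  have degp: "degree p = n" "lead_coeff p = 1"
  proof -
    have "degree [:b ^ n:] < degree (Polynomial.monom (1::complex) n)" using assms by (simp add: degree_monom_eq)
    then have "degree (Polynomial.monom 1 n + - [:b ^ n:]) = n" using degree_add_eq_left[of "- [:b^n:]" "Polynomial.monom 1 n"]
      by (simp add: degree_monom_eq)
    then show "degree p = n" unfolding p_def diff_conv_add_uminus .
    then show "lead_coeff p = 1" using assms by (simp add: p_def) (cases n; simp)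
  qed
  have degr: "degree r = n"
    unfolding r_def by (simp add: degree_prod_eq_sum_degree card)
  have lcr: "lead_coeff r = 1"
    unfolding r_def lead_coeff_prod by simp
  have "poly (p - r) x = 0" if "x \<in> R" for x
  proof -
    have "poly r x = 0" unfolding r_def poly_prod using that
      by (intro prod_zero) (auto simp: R_def)
    moreover from that obtain j where "j < n" "x = b * cis (2 * pi * real j / real n)" by (auto simp: R_def)
    then have "x ^ n = b ^ n"
      using bij_betw_imp_surj_on[OF Complex.bij_betw_roots_unity[OF assms]] by (auto simp: power_mult_distrib)
    then have "poly p x = 0" by (simp add: p_def poly_monom)
    ultimately show ?thesis by simp
  qed
  then have sub: "R \<subseteq> {x. poly (p - r) x = 0}" by auto
  have "p - r = 0"
  proof (rule ccontr)
    assume nz: "p - r \<noteq> 0"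
    have "degree (p - r) < n"
    proof -
      have "Polynomial.coeff (p - r) n = 0" using degp degr lcr by simp
      then show ?thesis using degp degr nz
        by (metis degree_diff_le le_neq_implies_less leading_coeff_0_iff order_refl)
    qed
    moreover have "card R \<le> card {x. poly (p - r) x = 0}"
      using sub by (intro card_mono poly_roots_finite[OF nz])
    moreover have "\<dots> \<le> degree (p - r)" using nz by (rule card_poly_roots_bound)
    ultimately show False using card by simp
  qed
  then have "poly p a = poly r a" by simp
  then show ?thesis using inj
    by (simp add: p_def r_def R_def poly_monom poly_prod prod.reindex)
qed (use assms in \<open>simp add: zero_power\<close>)

lemma irrational_mult_int:
  fixes \<alpha> :: real
  assumes "\<alpha> \<notin> \<rat>" "k \<noteq> 0"
  shows "of_int k * \<alpha> \<noteq> of_int p"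
proof
  assume "of_int k * \<alpha> = of_int p"
  then have "\<alpha> = of_int p / of_int k" using assms by (simp add: field_simps)
  then show False using assms by auto
qed

lemma min_int_dist:
  fixes \<alpha> :: real
  assumes "\<alpha> \<notin> \<rat>" "Q > 0"
  obtains \<delta> q p where "\<delta> > 0" "0 < q" "q \<le> Q" "\<bar>of_int (int q) * \<alpha> - of_int p\<bar> = \<delta>"
    "\<And>j p. 0 < j \<Longrightarrow> j \<le> Q \<Longrightarrow> \<bar>of_int (int j) * \<alpha> - of_int p\<bar> \<ge> \<delta>"
proof -
  define f where "f = (\<lambda>j. \<bar>of_int (int j) * \<alpha> - of_int (round (of_int (int j) * \<alpha>))\<bar>)"
  define \<delta> where "\<delta> = Min (f ` {1..Q})"
  have "\<delta> \<in> f ` {1..Q}" unfolding \<delta>_def using assms by (intro Min_in) auto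
  then obtain q where q: "1 \<le> q" "q \<le> Q" "\<delta> = f q" by auto
  have "f q > 0" using irrational_mult_int[OF assms(1), of "int q" "round (of_int (int q) * \<alpha>)"] q
    by (simp add: f_def)
  moreover have "\<bar>of_int (int j) * \<alpha> - of_int p\<bar> \<ge> \<delta>" if "0 < j" "j \<le> Q" for j p
  proof -
    have "\<delta> \<le> f j" unfolding \<delta>_def using that by (intro Min_le) auto
    also have "f j \<le> \<bar>of_int (int j) * \<alpha> - of_int p\<bar>"
      using round_diff_minimal[of "of_int (int j) * \<alpha>" p] by (simp add: f_def abs_minus_commute)
    finally show ?thesis .
  qed
  ultimately show ?thesis using that[of \<delta> q "round (of_int (int q) * \<alpha>)"] q by (auto simp: f_def)
qed

text \<open>For denominators up to \<open>Suc Q0\<close> the multiples of \<alpha> stay at distance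
  \<delta> from the integers. Asking Dirichlet's theorem for an error below \<delta> forces the
  denominator past that bound.\<close>

lemma Dirichlet_large:
  fixes \<alpha> :: real
  assumes "\<alpha> \<notin> \<rat>"
  obtains q :: nat and r :: int where "q \<ge> Q0" "q > 0" "coprime r (int q)" "\<bar>\<alpha> - of_int r / real q\<bar> \<le> 1 / (real q)\<^sup>2"
proof -
  obtain \<delta> where \<delta>: "\<delta> > 0" "\<And>j p. 0 < j \<Longrightarrow> j \<le> Suc Q0 \<Longrightarrow> \<bar>of_int (int j) * \<alpha> - of_int p\<bar> \<ge> \<delta>"
    using min_int_dist[OF assms, of "Suc Q0"] by (metis zero_less_Suc)
  obtain N :: nat where N: "real N > 1 / \<delta>" using reals_Archimedean2 by blast
  then have N0: "N > 0" using \<delta>(1) by (cases "N = 0") (auto simp: not_less[symmetric])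
  obtain h k where hk: "coprime h k" "0 < k" "k \<le> int N" "\<bar>of_int k * \<alpha> - of_int h\<bar> < 1/N"
    by (rule Dirichlet_approx_coprime[OF N0])
  define q where "q = nat k"
  have q: "int q = k" "q > 0" using hk by (auto simp: q_def)
  have "1 / real N < \<delta>" using N \<delta>(1) N0 by (simp add: field_simps)
  then have "\<bar>of_int (int q) * \<alpha> - of_int h\<bar> < \<delta>" using hk q by simp
  then have "\<not> q \<le> Suc Q0" using \<delta>(2)[of q h] q by fastforce
  moreover have "\<bar>\<alpha> - of_int h / real q\<bar> \<le> 1 / (real q)\<^sup>2"
  proof -
    have "real q \<le> real N" using hk q by (metis of_nat_le_iff)
    then have "1 / real N \<le> 1 / real q" using q by (simp add: frac_le)
    then have "\<bar>real q * \<alpha> - of_int h\<bar> \<le> 1 / real q" using hk q(1) by (metis less_eq_real_def of_int_of_nat_eq order_trans)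
    moreover have "\<alpha> - of_int h / real q = (real q * \<alpha> - of_int h) / real q" using q by (simp add: field_simps)
    ultimately have "\<bar>\<alpha> - of_int h / real q\<bar> \<le> 1 / real q / real q"
      using q divide_right_mono[of "\<bar>real q * \<alpha> - of_int h\<bar>" "1 / real q" "real q"] by (simp add: abs_divide)
    then show ?thesis by (simp add: power2_eq_square)
  qed
  ultimately show ?thesis using that[of q h] hk q by simp
qed

text \<open>Here \<open>q\<close> is the first denominator that beats the record \<delta> set by
  \<open>q'\<close>, so all smaller ones stay at distance \<delta>. What remains is that \<delta> is
  at least \<open>1 / (2 * q)\<close>, the usual relation between consecutive best
  approximations.\<close>

lemma separated_denominators:
  fixes \<alpha> :: real
  assumes "\<alpha> \<notin> \<rat>"
  obtains q :: nat where "q \<ge> Q0" "\<And>j p. 0 < j \<Longrightarrow> j < q \<Longrightarrow> \<bar>of_int (int j) * \<alpha> - of_int p\<bar> \<ge> 1 / (2 * real q)"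
proof -
  obtain \<delta> q' p' where \<delta>: "\<delta> > 0" "0 < q'" "q' \<le> Suc Q0" "\<bar>of_int (int q') * \<alpha> - of_int p'\<bar> = \<delta>"
    "\<And>j p. 0 < j \<Longrightarrow> j \<le> Suc Q0 \<Longrightarrow> \<bar>of_int (int j) * \<alpha> - of_int p\<bar> \<ge> \<delta>"
    using min_int_dist[OF assms, of "Suc Q0"] by (metis zero_less_Suc)
  define P where "P = (\<lambda>q::nat. q > 0 \<and> (\<exists>p::int. \<bar>of_int (int q) * \<alpha> - of_int p\<bar> < \<delta>))"
  have "\<exists>q. P q"
  proof -
    obtain N :: nat where N: "real N > 1 / \<delta>" using reals_Archimedean2 by blast
    then have N0: "N > 0" using \<delta>(1) by (cases "N = 0") (auto simp: not_less[symmetric])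
    obtain h k where hk: "coprime h k" "0 < k" "k \<le> int N" "\<bar>of_int k * \<alpha> - of_int h\<bar> < 1/N"
      by (rule Dirichlet_approx_coprime[OF N0])
    have "1 / real N < \<delta>" using N \<delta>(1) N0 by (simp add: field_simps)
    then have "\<bar>of_int (int (nat k)) * \<alpha> - of_int h\<bar> < \<delta>" using hk by simp
    then have "P (nat k)" unfolding P_def using hk(2) by auto
    then show ?thesis by blast
  qed
  define q where "q = (LEAST q. P q)"
  have Pq: "P q" unfolding q_def using \<open>\<exists>q. P q\<close> by (rule LeastI_ex)
  have least: "\<not> P j" if "j < q" for j using that not_less_Least unfolding q_def by blast
  obtain p where p: "\<bar>of_int (int q) * \<alpha> - of_int p\<bar> < \<delta>" and q0: "q > 0" using Pq by (auto simp: P_def)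
  have qQ: "q > Suc Q0" using \<delta>(5)[of q p] p q0 by fastforce
  have "1 \<le> 2 * real q * \<delta>"
  proof -
    \<comment> \<open>The determinant of the two approximations is a nonzero integer; written
      through the two errors, its absolute value is at most \<open>2 * q * \<delta>\<close>.\<close>
    define d where "d = int q * p' - int q' * p"
    have deq: "of_int d = real q' * (real q * \<alpha> - of_int p) - real q * (real q' * \<alpha> - of_int p')"
      by (simp add: d_def algebra_simps)
    have "d \<noteq> 0"
    proof
      assume "d = 0"
      then have "real q' * (real q * \<alpha> - of_int p) = real q * (real q' * \<alpha> - of_int p')" using deq by simp
      then have "real q' * \<bar>real q * \<alpha> - of_int p\<bar> = real q * \<bar>real q' * \<alpha> - of_int p'\<bar>"
        by (metis abs_mult abs_of_nat)
      then have "real q' * \<bar>real q * \<alpha> - of_int p\<bar> = real q * \<delta>" using \<delta>(4) by simp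
      moreover have "real q' * \<bar>real q * \<alpha> - of_int p\<bar> < real q' * \<delta>" using p \<delta>(2) by simp
      moreover have "real q' * \<delta> \<le> real q * \<delta>" using \<delta> qQ by (intro mult_right_mono) auto
      ultimately show False by linarith
    qed
    then have "1 \<le> \<bar>of_int d :: real\<bar>" by (metis abs_ge_zero int_one_le_iff_zero_less of_int_1_le_iff of_int_abs zero_less_abs_iff)
    also have "\<dots> \<le> real q' * \<bar>real q * \<alpha> - of_int p\<bar> + real q * \<bar>real q' * \<alpha> - of_int p'\<bar>"
      unfolding deq using abs_triangle_ineq4[of "real q' * (real q * \<alpha> - of_int p)" "real q * (real q' * \<alpha> - of_int p')"]
      by (simp add: abs_mult)
    also have "\<dots> \<le> real q * \<delta> + real q * \<delta>"
      using p \<delta> qQ by (intro add_mono mult_mono) auto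
    finally show ?thesis by (simp add: mult_ac)
  qed
  then have d: "1 / (2 * real q) \<le> \<delta>" using q0 by (simp add: field_simps)
  have "\<bar>of_int (int j) * \<alpha> - of_int r\<bar> \<ge> 1 / (2 * real q)" if "0 < j" "j < q" for j r
    using least[OF that(2)] that(1) d unfolding P_def by (meson le_less_linear less_le_trans order_trans)
  then show ?thesis using that[of q] qQ by simp
qed

lemma coprime_mult_residue:
  fixes r :: int and q :: nat
  assumes "coprime r (int q)" "q > 0"
  obtains j where "j < q" "(int j * r) mod int q = l mod int q"
proof -
  obtain x v where x: "x * r + v * int q = 1"
    using assms(1) bezout_int[of r "int q"] by (auto simp: coprime_iff_gcd_eq_1)
  define j where "j = nat ((x * l) mod int q)"
  have j: "int j = (x * l) mod int q" using assms(2) by (simp add: j_def)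
  have "(int j * r) mod int q = l mod int q"
  proof -
    have "(int j * r) mod int q = (x * l * r) mod int q" unfolding j by (rule mod_mult_left_eq)
    also have "x * l * r = l * (x * r)" by simp
    also have "x * r = 1 - v * int q" using x by simp
    also have "l * (1 - v * int q) = l + int q * (- (l * v))" by (simp add: algebra_simps)
    finally show ?thesis by (simp only: mod_mult_self2)
  qed
  moreover have "j < q" using j assms(2) by (metis of_nat_0_less_iff of_nat_less_iff pos_mod_bound)
  ultimately show ?thesis using that by blast
qed

lemma bij_residue:
  fixes r :: int and q :: nat
  assumes "coprime r (int q)" "q > 0"
  shows "bij_betw (\<lambda>j. nat ((int j * r) mod int q)) {..<q} {..<q}"
proof -
  let ?f = "\<lambda>j. nat ((int j * r) mod int q)"
  have sub: "?f ` {..<q} \<subseteq> {..<q}" using assms(2) by (auto simp: nat_less_iff)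
  moreover have "{..<q} \<subseteq> ?f ` {..<q}"
  proof
    fix l assume l: "l \<in> {..<q}"
    obtain j where "j < q" "(int j * r) mod int q = int l mod int q" using coprime_mult_residue[OF assms] by metis
    then have "?f j = l" using l by simp
    then show "l \<in> ?f ` {..<q}" using \<open>j < q\<close> by blast
  qed
  ultimately have eq: "?f ` {..<q} = {..<q}" by blast
  then show ?thesis unfolding bij_betw_def by (auto intro!: eq_card_imp_inj_on)
qed

text \<open>The window products are compared with those of the nearby periodic orbit, after moving the
  zero off the unit circle to radius \<open>\<rho>\<close>.\<close>

lemma chain_prod_upper:
  assumes "\<alpha> \<notin> \<rat>" "\<epsilon> > 0"
  obtains C where "C > 0" "\<And>y m. (\<Prod>j<m. \<bar>chain \<alpha> y j\<bar>) \<le> C * exp (\<epsilon> * real m)"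
proof -
  \<comment> \<open>Half of the rate \<epsilon> pays for the radius \<rho>. The choice of
    \<open>Q0\<close> makes the other half pay for the factor 2 and the error
    \<open>2 * pi / \<tau>\<close> of a block.\<close>
  define \<rho> where "\<rho> = exp (\<epsilon> / 2)"
  define \<tau> where "\<tau> = \<rho> - 1"
  have \<tau>: "\<tau> > 0" using assms by (simp add: \<tau>_def \<rho>_def)
  obtain Q0 :: nat where Q0: "real Q0 \<ge> (ln 2 + 2 * pi / \<tau>) / (\<epsilon> / 2)" using real_arch_simple by blast
  obtain q r where q: "q \<ge> Q0" "q > 0" "coprime r (int q)" and ar: "\<bar>\<alpha> - of_int r / real q\<bar> \<le> 1 / (real q)\<^sup>2"
    using Dirichlet_large[OF assms(1)] by metis
  have q': "ln 2 + 2 * pi / \<tau> \<le> \<epsilon> / 2 * real q"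
  proof -
    have "(ln 2 + 2 * pi / \<tau>) / (\<epsilon> / 2) \<le> real q" using Q0 q(1) by linarith
    then show ?thesis using assms(2) by (simp add: field_simps)
  qed
  have block: "(\<Prod>j<q. \<bar>chain \<alpha> y j\<bar>) \<le> exp (\<epsilon> * real q)" for y
  proof -
    define v where "v = (\<lambda>j. cis (2 * pi * (y + real j * of_int r / real q)))"
    have "\<bar>chain \<alpha> y j\<bar> \<le> cmod (v j + \<rho>) * (1 + 2 * pi / (real q * \<tau>))" if "j < q" for j
    proof -
      define t where "t = y + \<alpha> * real j"
      define s where "s = y + real j * of_int r / real q"
      have "\<bar>t - s\<bar> = \<bar>\<alpha> - of_int r / real q\<bar> * real j" 
      proof -
        have "t - s = (\<alpha> - of_int r / real q) * real j" by (simp add: t_def s_def algebra_simps)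
        then show ?thesis by (simp add: abs_mult)
      qed
      also have "\<dots> \<le> 1 / (real q)\<^sup>2 * real q" using ar that by (intro mult_mono) auto
      also have "\<dots> = 1 / real q" using q by (simp add: power2_eq_square)
      finally have ts: "\<bar>t - s\<bar> \<le> 1 / real q" .
      have "\<bar>chain \<alpha> y j\<bar> = cmod (cis (2 * pi * t) + 1)" by (simp add: cmod_cis_plus_1 chain_def t_def)
      also have "\<dots> \<le> cmod (v j + 1) + cmod (cis (2 * pi * t) - v j)"
        using norm_triangle_ineq[of "v j + 1" "cis (2 * pi * t) - v j"] by (simp add: add.commute)
      also have "cmod (cis (2 * pi * t) - v j) \<le> 2 * pi / real q"
      proof -
        have "cmod (cis (2 * pi * t) - v j) \<le> \<bar>2 * pi * t - 2 * pi * s\<bar>"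
          unfolding v_def s_def[symmetric]
          by (rule cmod_cis_diff_le)
        also have "\<dots> = 2 * pi * \<bar>t - s\<bar>" by (simp add: abs_mult flip: right_diff_distrib)
        also have "\<dots> \<le> 2 * pi * (1 / real q)" using ts by (intro mult_left_mono) auto
        finally show ?thesis by simp
      qed
      also have "cmod (v j + 1) \<le> cmod (v j + \<rho>)"
      proof -
        have c1: "-1 \<le> Re (v j)" "Re (v j) \<le> 1" by (auto simp: v_def)
        have c2: "(Re (v j))\<^sup>2 + (Im (v j))\<^sup>2 = 1" by (simp add: v_def)
        have "(cmod (v j + \<rho>))\<^sup>2 - (cmod (v j + 1))\<^sup>2 = (\<rho> - 1) * (\<rho> + 1 + 2 * Re (v j))"
        proof -
          have "(cmod (v j + \<rho>))\<^sup>2 = (Re (v j) + \<rho>)\<^sup>2 + (Im (v j))\<^sup>2" by (simp add: cmod_power2)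
          moreover have "(cmod (v j + 1))\<^sup>2 = (Re (v j) + 1)\<^sup>2 + (Im (v j))\<^sup>2" by (simp add: cmod_power2)
          ultimately show ?thesis by (simp add: power2_eq_square algebra_simps)
        qed
        moreover have "(\<rho> - 1) * (\<rho> + 1 + 2 * Re (v j)) \<ge> 0" using c1 \<tau> by (intro mult_nonneg_nonneg) (auto simp: \<tau>_def)
        ultimately have "(cmod (v j + 1))\<^sup>2 \<le> (cmod (v j + \<rho>))\<^sup>2" by linarith
        then show ?thesis by (rule power2_le_imp_le) simp
      qed
      \<comment> \<open>Since the shifted zero keeps distance \<tau> from the circle, the additive
        error becomes a relative one, and the \<open>q\<close>-th power of the factor is at most
        \<open>exp (2 * pi / \<tau>)\<close>, whatever \<open>q\<close> is.\<close>
      also have "cmod (v j + \<rho>) + 2 * pi / real q \<le> cmod (v j + \<rho>) * (1 + 2 * pi / (real q * \<tau>))"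
      proof -
        have "\<tau> \<le> cmod (v j + \<rho>)"
        proof -
          have "cmod (complex_of_real \<rho>) - cmod (v j) \<le> cmod (v j + \<rho>)"
            by (metis add.commute norm_diff_ineq)
          then show ?thesis using \<tau> by (simp add: \<tau>_def v_def \<rho>_def)
        qed
        then have "2 * pi / real q * \<tau> \<le> 2 * pi / real q * cmod (v j + \<rho>)" by (intro mult_left_mono) auto
        then have "2 * pi / real q \<le> cmod (v j + \<rho>) * (2 * pi / (real q * \<tau>))" using \<tau> q(2)
          by (simp add: field_simps)
        then show ?thesis by (simp add: algebra_simps)
      qed
      finally show ?thesis by simp
    qed
    then have "(\<Prod>j<q. \<bar>chain \<alpha> y j\<bar>) \<le> (\<Prod>j<q. cmod (v j + \<rho>) * (1 + 2 * pi / (real q * \<tau>)))"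
      by (intro prod_mono) auto
    also have "\<dots> = cmod (\<Prod>j<q. v j + \<rho>) * (1 + 2 * pi / (real q * \<tau>)) ^ q"
      by (simp add: prod.distrib prod_norm)
    also have "(\<Prod>j<q. v j + \<rho>) = (\<Prod>l<q. cis (2 * pi * y) * cis (2 * pi * real l / real q) + \<rho>)"
    proof -
      have "v j = cis (2 * pi * y) * cis (2 * pi * real (nat ((int j * r) mod int q)) / real q)" for j
      proof -
        define m where "m = (int j * r) div int q"
        have "int j * r = int q * m + (int j * r) mod int q" by (simp add: m_def)
        then have "real j * of_int r = real q * of_int m + of_int ((int j * r) mod int q)"
          by (metis of_int_add of_int_mult of_int_of_nat_eq)
        then have "2 * pi * (y + real j * of_int r / real q)
          = 2 * pi * y + 2 * pi * of_int ((int j * r) mod int q) / real q + 2 * pi * of_int m"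
          using q(2) by (simp add: field_simps)
        moreover have "of_int ((int j * r) mod int q) = real (nat ((int j * r) mod int q))"
          using q(2) by simp
        ultimately have "v j = cis (2 * pi * y) * cis (2 * pi * real (nat ((int j * r) mod int q)) / real q) * cis (2 * pi * of_int m)"
          unfolding v_def by (simp only: cis_mult)
        then show ?thesis by (simp only: cis_multiple_2pi[OF Ints_of_int] mult_1_right)
      qed
      then show ?thesis
        using prod.reindex_bij_betw[OF bij_residue[OF q(3,2)], of "\<lambda>l. cis (2 * pi * y) * cis (2 * pi * real l / real q) + \<rho>"]
        by simp
    qed
    also have "\<dots> = complex_of_real \<rho> ^ q - (- cis (2 * pi * y)) ^ q"
      using prod_roots_unity[OF q(2), of "complex_of_real \<rho>" "- cis (2 * pi * y)"] by (simp add: add.commute)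
    also have "cmod (complex_of_real \<rho> ^ q - (- cis (2 * pi * y)) ^ q) * (1 + 2 * pi / (real q * \<tau>)) ^ q \<le> 2 * \<rho> ^ q * exp (2 * pi / \<tau>)"
    proof (rule mult_mono)
      have "cmod (complex_of_real \<rho> ^ q) = \<rho> ^ q" using \<tau> by (simp add: norm_power \<tau>_def)
      moreover have "cmod ((- cis (2 * pi * y)) ^ q) = 1" by (simp add: norm_power)
      ultimately have "cmod (complex_of_real \<rho> ^ q - (- cis (2 * pi * y)) ^ q) \<le> \<rho> ^ q + 1"
        by (metis norm_triangle_ineq4)
      also have "\<rho> ^ q + 1 \<le> 2 * \<rho> ^ q" using \<tau> one_le_power[of \<rho> q] by (simp add: \<tau>_def)
      finally show "cmod (complex_of_real \<rho> ^ q - (- cis (2 * pi * y)) ^ q) \<le> 2 * \<rho> ^ q" .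
      have "(1 + 2 * pi / (real q * \<tau>)) ^ q \<le> exp (2 * pi / (real q * \<tau>)) ^ q"
        using \<tau> by (intro power_mono exp_ge_add_one_self) auto
      also have "exp (2 * pi / (real q * \<tau>)) ^ q = exp (2 * pi / \<tau>)"
        using q(2) by (simp flip: exp_of_nat_mult)
      finally show "(1 + 2 * pi / (real q * \<tau>)) ^ q \<le> exp (2 * pi / \<tau>)" .
    qed (use \<tau> in \<open>auto simp: \<rho>_def\<close>)
    also have "2 * \<rho> ^ q * exp (2 * pi / \<tau>) = exp (ln 2 + 2 * pi / \<tau> + \<epsilon> / 2 * real q)"
      by (simp add: \<rho>_def exp_add mult.commute flip: exp_of_nat_mult)
    also have "\<dots> \<le> exp (\<epsilon> * real q)" using q' by simp
    finally show ?thesis .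
  qed
  \<comment> \<open>Blocks of length \<open>q\<close> are peeled off from the left;
    \<open>2 ^ q\<close> covers a remainder shorter than \<open>q\<close>.\<close>
  have "(\<Prod>j<m. \<bar>chain \<alpha> y j\<bar>) \<le> 2 ^ q * exp (\<epsilon> * real m)" for y m
  proof (induction m arbitrary: y rule: less_induct)
    case (less m)
    show ?case
    proof (cases "m < q")
      case True
      have "(\<Prod>j<m. \<bar>chain \<alpha> y j\<bar>) \<le> (\<Prod>j<m. 2)" using abs_chain_le by (intro prod_mono) auto
      also have "\<dots> = 2 ^ m" by simp
      also have "\<dots> \<le> 2 ^ q * 1" using True by simp
      also have "\<dots> \<le> 2 ^ q * exp (\<epsilon> * real m)" using assms by (intro mult_left_mono) auto
      finally show ?thesis .
    next
      case False
      define m' where "m' = m - q"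
      have m: "m = q + m'" "m' < m" using False q(2) by (auto simp: m'_def)
      have "(\<Prod>j<m. \<bar>chain \<alpha> y j\<bar>) = (\<Prod>j<q. \<bar>chain \<alpha> y j\<bar>) * (\<Prod>j<m'. \<bar>chain \<alpha> (y + \<alpha> * real q) j\<bar>)"
        unfolding m(1) by (simp add: prod_lessThan_add chain_shift)
      also have "\<dots> \<le> exp (\<epsilon> * real q) * (2 ^ q * exp (\<epsilon> * real m'))"
        by (intro mult_mono block less.IH m) (auto intro: prod_nonneg)
      also have "\<dots> = 2 ^ q * exp (\<epsilon> * real m)" using m(1) by (simp add: exp_add algebra_simps)
      finally show ?thesis .
    qed
  qed
  then show ?thesis using that[of "2 ^ q"] by simp
qed

section \<open>Truncated logarithmic means over grids and orbits\<close>

lemma inv_grid_chain: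
  fixes N :: nat
  assumes "N > 0"
  shows "(\<Prod>i<N. \<bar>2 * cos (pi * (y + real i / real N))\<bar>) = cmod (1 - (- cis (2 * pi * y)) ^ N)"
proof -
  have "\<bar>2 * cos (pi * (y + real i / real N))\<bar> = cmod (1 - (- cis (2 * pi * y)) * cis (2 * pi * real i / real N))" for i
    unfolding cmod_cis_plus_1[symmetric] by (simp add: cis_mult distrib_left add.commute)
  then show ?thesis using prod_roots_unity[OF assms, of 1 "- cis (2 * pi * y)"] by (simp add: prod_norm)
qed

lemma ln_max_lipschitz:
  fixes a b h :: real
  assumes "h > 0"
  shows "ln (max a h) \<ge> ln (max b h) - \<bar>a - b\<bar> / h"
proof -
  have "max b h \<le> max a h + \<bar>a - b\<bar>" by linarith
  also have "\<dots> \<le> max a h + \<bar>a - b\<bar> / h * max a h"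
  proof -
    have "\<bar>a - b\<bar> * h \<le> \<bar>a - b\<bar> * max a h" by (intro mult_left_mono) auto
    then show ?thesis using assms by (simp add: field_simps)
  qed
  also have "\<dots> = max a h * (1 + \<bar>a - b\<bar> / h)" by (simp add: algebra_simps)
  also have "\<dots> \<le> max a h * exp (\<bar>a - b\<bar> / h)" using assms by (intro mult_left_mono exp_ge_add_one_self) auto
  finally have "ln (max b h) \<le> ln (max a h * exp (\<bar>a - b\<bar> / h))" using assms by (subst ln_le_cancel_iff) auto
  also have "\<dots> = ln (max a h) + \<bar>a - b\<bar> / h" using assms by (subst ln_mult) auto
  finally show ?thesis by simp
qed

lemma abs_cos_pi_lipschitz: "\<bar>\<bar>2 * cos (pi * s)\<bar> - \<bar>2 * cos (pi * t)\<bar>\<bar> \<le> 2 * pi * \<bar>s - t\<bar>"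
proof -
  have "\<bar>cmod (cis (2 * pi * s) + 1) - cmod (cis (2 * pi * t) + 1)\<bar> \<le> cmod (cis (2 * pi * s) - cis (2 * pi * t))"
    using norm_triangle_ineq3[of "cis (2 * pi * s) + 1" "cis (2 * pi * t) + 1"] by simp
  also have "\<dots> \<le> \<bar>2 * pi * s - 2 * pi * t\<bar>" by (rule cmod_cis_diff_le)
  also have "\<dots> = 2 * pi * \<bar>s - t\<bar>" by (simp add: abs_mult flip: right_diff_distrib)
  finally show ?thesis by (simp add: cmod_cis_plus_1)
qed

text \<open>Jensen's formula gives mean \<open>0\<close> for \<open>ln \<bar>2 cos\<bar>\<close>; truncating below at \<open>h\<close> gains
  \<open>1\<close> on the set \<open>\<bar>2 cos\<bar> \<le> h / e\<close>, whose density is of order \<open>h\<close>.\<close>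

lemma grid_mean_lower:
  assumes h: "0 < h" "h \<le> 1"
  obtains N0 :: nat where "N0 > 0" "\<And>N y. N \<ge> N0 \<Longrightarrow>
     (\<Sum>i<N. ln (max \<bar>2 * cos (pi * (y + real i / real N))\<bar> h)) \<ge> h / 20 * real N"
proof -
  \<comment> \<open>The gain found below is \<open>h / 10\<close> per point, less 1 for rounding and
    \<open>2 * pi / h\<close> for moving the phase; half of the gain is given up to absorb
    both.\<close>
  obtain N0 :: nat where N0: "real N0 \<ge> (1 + 2 * pi / h) / (h / 20)" using real_arch_simple by blast
  define N1 where "N1 = Suc N0"
  have "(\<Sum>i<N. ln (max \<bar>2 * cos (pi * (y + real i / real N))\<bar> h)) \<ge> h / 20 * real N" if N: "N \<ge> N1" for N y
  proof -
    have Npos: "N > 0" using N by (simp add: N1_def)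
    have Nh: "1 + 2 * pi / h \<le> h / 20 * real N"
    proof -
      have "(1 + 2 * pi / h) / (h / 20) \<le> real N" using N0 N by (simp add: N1_def)
      then show ?thesis using h by (simp add: field_simps)
    qed
    \<comment> \<open>At the nearby phase \<open>y'\<close> the \<open>N\<close>-th power of
      \<open>- cis (2 * pi * y')\<close> is -1, so the grid product takes its largest value
      2.\<close>
    define t0 where "t0 = (real N + 1) / 2"
    define y' where "y' = (t0 + of_int \<lfloor>real N * y - t0\<rfloor>) / real N"
    have y': "\<bar>y - y'\<bar> \<le> 1 / real N"
    proof -
      have "\<bar>real N * y - real N * y'\<bar> \<le> 1" using Npos unfolding y'_def by simp linarith
      then have "real N * \<bar>y - y'\<bar> \<le> 1" by (simp add: abs_mult flip: right_diff_distrib)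
      then show ?thesis using Npos by (simp add: field_simps)
    qed
    have prod2: "(\<Prod>i<N. \<bar>2 * cos (pi * (y' + real i / real N))\<bar>) = 2"
    proof -
      have "(- cis (2 * pi * y')) ^ N = cis (real N * (pi + 2 * pi * y'))"
      proof -
        have "- cis (2 * pi * y') = cis pi * cis (2 * pi * y')" by simp
        also have "\<dots> = cis (pi + 2 * pi * y')" by (rule cis_mult)
        finally show ?thesis by (simp only: Complex.DeMoivre)
      qed
      also have "real N * (pi + 2 * pi * y') = pi * real N + 2 * pi * (real N * y')" by (simp add: algebra_simps)
      also have "real N * y' = t0 + of_int \<lfloor>real N * y - t0\<rfloor>" using Npos by (simp add: y'_def)
      also have "pi * real N + 2 * pi * (t0 + of_int \<lfloor>real N * y - t0\<rfloor>) = 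
         2 * pi * of_int (int N + \<lfloor>real N * y - t0\<rfloor>) + pi"
        by (simp add: t0_def field_simps)
      also have "cis \<dots> = - 1"
        unfolding cis_mult[symmetric] by (simp only: cis_multiple_2pi[OF Ints_of_int] mult_1_left cis_pi)
      finally have "(- cis (2 * pi * y')) ^ N = - 1" .
      then show ?thesis using inv_grid_chain[OF Npos, of y'] by simp
    qed
    define a where "a = (\<lambda>i. \<bar>2 * cos (pi * (y' + real i / real N))\<bar>)"
    have apos: "a i > 0" if "i < N" for i
    proof (rule ccontr)
      assume "\<not> a i > 0"
      then have "a i = 0" by (simp add: a_def)
      then have "prod a {..<N} = 0" using that by (intro prod_zero) auto
      then show False using prod2 by (simp add: a_def)
    qed
    have suma: "(\<Sum>i<N. ln (a i)) = ln 2"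
      using prod2 apos by (subst ln_prod[symmetric]) (auto simp: a_def)
    define B where "B = {i. i < N \<and> a i \<le> h / exp 1}"
    have gain: "ln (max (a i) h) \<ge> ln (a i) + (if i \<in> B then 1 else 0)" if "i < N" for i
    proof (cases "i \<in> B")
      case True
      then have "ln (a i) \<le> ln (h / exp 1)" using apos[OF that] h by (subst ln_le_cancel_iff) (auto simp: B_def)
      also have "\<dots> = ln h - 1" using h by (simp add: ln_div)
      finally have "ln (a i) + 1 \<le> ln h" by simp
      also have "\<dots> \<le> ln (max (a i) h)" using h by (subst ln_le_cancel_iff) auto
      finally show ?thesis using True by simp
    next
      case False
      then show ?thesis using apos[OF that] h by simp
    qed
    have cardB: "real (card B) \<ge> real N * (h / 10) - 1"
    proof -
      \<comment> \<open>In grid steps, \<open>c\<close> is the position of the zero of the cosine,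
        and \<open>w\<close> a half width within which the bond is at most
        \<open>2 * pi * w / N = pi * h / 10\<close>, which is below
        \<open>h / exp 1\<close>.\<close>
      define c where "c = (1/2 - y') * real N"
      define w where "w = real N * h / 20"
      define f where "f = (\<lambda>l::int. nat (l mod int N))"
      have "f ` {\<lceil>c - w\<rceil>..\<lfloor>c + w\<rfloor>} \<subseteq> B"
      proof
        fix i assume "i \<in> f ` {\<lceil>c - w\<rceil>..\<lfloor>c + w\<rfloor>}"
        then obtain l where l: "\<lceil>c - w\<rceil> \<le> l" "l \<le> \<lfloor>c + w\<rfloor>" "i = f l" by auto
        then have lc: "\<bar>of_int l - c\<bar> \<le> w" by linarith
        have iN: "i < N" using Npos l(3) by (simp add: f_def nat_less_iff)
        define m where "m = l div int N"
        have "l = int N * m + int i" using l(3) Npos by (simp add: f_def m_def)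
        then have leq: "of_int l = real N * of_int m + real i" by simp
        have "a i = \<bar>2 * cos (pi * (y' + of_int l / real N))\<bar>"
        proof -
          have "y' + of_int l / real N = y' + real i / real N + of_int m" using leq Npos by (simp add: field_simps)
          then have "pi * (y' + of_int l / real N) = pi * (y' + real i / real N) + of_int m * pi" by (simp add: algebra_simps)
          then have "\<bar>cos (pi * (y' + of_int l / real N))\<bar> = \<bar>cos (pi * (y' + real i / real N))\<bar>"
          proof -
            have "sin (of_int m * pi) = 0" using sin_npi_int[of m] by (simp add: mult.commute)
            then have "\<bar>cos (of_int m * pi)\<bar> = 1" by (rule sin_zero_abs_cos_one)
            then show ?thesis using \<open>sin (of_int m * pi) = 0\<close>
              \<open>pi * (y' + of_int l / real N) = pi * (y' + real i / real N) + of_int m * pi\<close>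
              by (simp add: cos_add abs_mult)
          qed
          then show ?thesis by (simp add: a_def abs_mult)
        qed
        also have "\<dots> \<le> 2 * pi * \<bar>(y' + of_int l / real N) - 1/2\<bar>"
          using abs_cos_pi_lipschitz[of "y' + of_int l / real N" "1/2"] by simp
        also have "(y' + of_int l / real N) - 1/2 = (of_int l - c) / real N" using Npos by (simp add: c_def field_simps)
        also have "2 * pi * \<bar>(of_int l - c) / real N\<bar> \<le> 2 * pi * (w / real N)"
          using lc by (intro mult_left_mono) (auto simp: abs_divide divide_right_mono)
        also have "\<dots> = pi * h / 10" using Npos by (simp add: w_def)
        also have "\<dots> \<le> h / exp 1"
        proof -
          have "pi * exp 1 \<le> 3.2 * (3::real)" using pi_approx exp_le by (intro mult_mono) auto
          then have "pi * exp 1 \<le> 10" by simp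
          then show ?thesis using h by (simp add: field_simps)
        qed
        finally show "i \<in> B" using iN by (simp add: B_def)
      qed
      moreover have "inj_on f {\<lceil>c - w\<rceil>..\<lfloor>c + w\<rfloor>}"
      proof (rule inj_onI)
        fix l l' assume l: "l \<in> {\<lceil>c - w\<rceil>..\<lfloor>c + w\<rfloor>}" "l' \<in> {\<lceil>c - w\<rceil>..\<lfloor>c + w\<rfloor>}" and "f l = f l'"
        then have "l mod int N = l' mod int N" using Npos by (simp add: f_def nat_eq_iff)
        then have "int N dvd l - l'" by (simp add: mod_eq_dvd_iff)
        moreover have "\<bar>l - l'\<bar> < int N"
        proof -
          have "\<bar>of_int l - of_int l'\<bar> \<le> 2 * w" using l by auto linarith+
          also have "\<dots> < real N" using h Npos by (simp add: w_def)
          finally show ?thesis by linarith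
        qed
        ultimately have "l - l' = 0" by (rule dvd_small_eq_0)
        then show "l = l'" by simp
      qed
      moreover have "finite B" by (simp add: B_def)
      ultimately have "real (card {\<lceil>c - w\<rceil>..\<lfloor>c + w\<rfloor>}) \<le> real (card B)"
        by (metis card_image card_mono of_nat_le_iff)
      moreover have "real (card {\<lceil>c - w\<rceil>..\<lfloor>c + w\<rfloor>}) \<ge> 2 * w - 1" by simp linarith
      ultimately have "real (card B) \<ge> 2 * w - 1" by linarith
      then show ?thesis by (simp add: w_def mult.commute)
    qed
    have "(\<Sum>i<N. ln (max (a i) h)) \<ge> (\<Sum>i<N. ln (a i) + (if i \<in> B then 1 else 0))"
      using gain by (intro sum_mono) auto
    moreover have "(\<Sum>i<N. ln (a i) + (if i \<in> B then 1 else 0)) = ln 2 + real (card B)"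
    proof -
      have "B \<inter> {..<N} = B" "{..<N} \<inter> B = B" by (auto simp: B_def)
      then show ?thesis by (simp add: sum.distrib suma sum.If_cases)
    qed
    ultimately have 1: "(\<Sum>i<N. ln (max (a i) h)) \<ge> real N * (h / 10) - 1" using cardB ln_gt_zero[of "2::real"] by linarith
    have "(\<Sum>i<N. ln (max \<bar>2 * cos (pi * (y + real i / real N))\<bar> h)) \<ge> (\<Sum>i<N. ln (max (a i) h) - 2 * pi / (real N * h))"
    proof (intro sum_mono)
      fix i assume "i \<in> {..<N}"
      have "\<bar>\<bar>2 * cos (pi * (y + real i / real N))\<bar> - a i\<bar> / h \<le> 2 * pi * (1 / real N) / h"
        unfolding a_def using y' h abs_cos_pi_lipschitz[of "y + real i / real N" "y' + real i / real N"]
        by (intro divide_right_mono order_trans[OF abs_cos_pi_lipschitz] mult_left_mono) auto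
      then show "ln (max (a i) h) - 2 * pi / (real N * h) \<le> ln (max \<bar>2 * cos (pi * (y + real i / real N))\<bar> h)"
        using ln_max_lipschitz[OF h(1), of "a i" "\<bar>2 * cos (pi * (y + real i / real N))\<bar>"] by simp
    qed
    moreover have "(\<Sum>i<N. ln (max (a i) h) - 2 * pi / (real N * h)) = (\<Sum>i<N. ln (max (a i) h)) - 2 * pi / h"
      using Npos by (simp add: sum_subtractf)
    ultimately have "(\<Sum>i<N. ln (max \<bar>2 * cos (pi * (y + real i / real N))\<bar> h)) \<ge> real N * (h / 10) - 1 - 2 * pi / h"
      using 1 by linarith
    moreover have "real N * (h / 10) = 2 * (h / 20 * real N)" by simp
    ultimately show ?thesis using Nh by linarith
  qed
  then show ?thesis using that[of N1] by (simp add: N1_def)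
qed

text \<open>The grid mean is bounded below for each site, hence also for the sum over
  \<open>K\<close>, and some grid point attains the mean. The offset \<open>y0\<close> avoids a
  countable set, so that no bond vanishes and the spectral theory of Jacobi matrices
  applies.\<close>

lemma good_phase:
  assumes h: "0 < h" "h \<le> 1" and K: "finite K"
  obtains y where "\<And>j. chain \<alpha> y j \<noteq> 0" "(\<Sum>k\<in>K. ln (max \<bar>chain \<alpha> y k\<bar> h)) \<ge> h / 20 * real (card K)"
proof -
  obtain N where N: "N > 0" "\<And>y. (\<Sum>i<N. ln (max \<bar>2 * cos (pi * (y + real i / real N))\<bar> h)) \<ge> h / 20 * real N"
    using grid_mean_lower[OF h] by (metis order_refl)
  define Z where "Z = (\<Union>m::int. \<Union>j::nat. \<Union>i::nat. {of_int m / 2 - \<alpha> * real j - real i / real N})"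
  have "countable Z" unfolding Z_def by auto
  then obtain y0 where y0: "y0 \<notin> Z" using uncountable_UNIV_real by (metis UNIV_I countable_subset subsetI)
  have nz: "chain \<alpha> (y0 + real i / real N) j \<noteq> 0" for i j
  proof
    assume "chain \<alpha> (y0 + real i / real N) j = 0"
    then have "cos (pi * (y0 + real i / real N + \<alpha> * real j)) = 0" by (simp add: chain_def)
    then obtain m :: int where "pi * (y0 + real i / real N + \<alpha> * real j) = of_int m * (pi / 2)"
      using cos_zero_iff_int by auto
    then have "pi * (y0 + real i / real N + \<alpha> * real j - of_int m / 2) = 0" by (simp add: algebra_simps)
    then have "y0 = of_int m / 2 - \<alpha> * real j - real i / real N" by simp
    then show False using y0 by (auto simp: Z_def)
  qed
  have "(\<Sum>i<N. \<Sum>k\<in>K. ln (max \<bar>chain \<alpha> (y0 + real i / real N) k\<bar> h)) \<ge> real N * (h / 20 * real (card K))"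
  proof -
    have "(\<Sum>i<N. ln (max \<bar>chain \<alpha> (y0 + real i / real N) k\<bar> h)) \<ge> h / 20 * real N" for k
      using N(2)[of "y0 + \<alpha> * real k"] by (simp add: chain_def add_ac)
    then have "(\<Sum>k\<in>K. \<Sum>i<N. ln (max \<bar>chain \<alpha> (y0 + real i / real N) k\<bar> h)) \<ge> (\<Sum>k\<in>K. h / 20 * real N)"
      by (intro sum_mono) auto
    then show ?thesis by (subst sum.swap) (simp add: mult_ac)
  qed
  then have "\<exists>i<N. (\<Sum>k\<in>K. ln (max \<bar>chain \<alpha> (y0 + real i / real N) k\<bar> h)) \<ge> h / 20 * real (card K)"
  proof (rule contrapos_pp)
    assume "\<not> (\<exists>i<N. (\<Sum>k\<in>K. ln (max \<bar>chain \<alpha> (y0 + real i / real N) k\<bar> h)) \<ge> h / 20 * real (card K))"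
    then have "(\<Sum>i<N. \<Sum>k\<in>K. ln (max \<bar>chain \<alpha> (y0 + real i / real N) k\<bar> h)) < (\<Sum>i<N. h / 20 * real (card K))"
      using N(1) by (intro sum_strict_mono) auto
    then show "\<not> (\<Sum>i<N. \<Sum>k\<in>K. ln (max \<bar>chain \<alpha> (y0 + real i / real N) k\<bar> h)) \<ge> real N * (h / 20 * real (card K))"
      by simp
  qed
  then show ?thesis using that nz by blast
qed

text \<open>Over \<open>q\<close> steps the rotation by \<open>r / q\<close> visits each residue
  once, and the rotation by \<alpha> stays within \<open>1 / q\<close> of it. A cell of length
  \<open>1 / M\<close> thus receives at least \<open>q / M - 3\<close> visits, and
  \<open>q \<ge> 6 * M\<close> turns this into half of the expected number.\<close>

lemma cell_visits:
  fixes \<alpha> :: real and q M :: nat and r :: int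
  assumes q: "q > 0" "coprime r (int q)" "\<bar>\<alpha> - of_int r / real q\<bar> \<le> 1 / (real q)\<^sup>2"
    and M: "M > 0" "q \<ge> 6 * M" and i: "i < M"
  shows "real (card {j. j < q \<and> (\<exists>s::int. real i / real M \<le> y + \<alpha> * real j - of_int s \<and> y + \<alpha> * real j - of_int s < (real i + 1) / real M)})
     \<ge> real q / (2 * real M)"
proof -
  define V where "V = {j. j < q \<and> (\<exists>s::int. real i / real M \<le> y + \<alpha> * real j - of_int s \<and> y + \<alpha> * real j - of_int s < (real i + 1) / real M)}"
  \<comment> \<open>In units of \<open>1 / q\<close>, the cell is shrunk by one unit at both ends to
    allow for the deviation of \<alpha> from \<open>r / q\<close>.\<close>
  define A where "A = real q * (real i / real M - y) + 1"
  define B where "B = real q * ((real i + 1) / real M - y) - 1"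
  define L where "L = {\<lceil>A\<rceil>..<\<lceil>B\<rceil>}"
  define J where "J = (\<lambda>l. SOME j. j < q \<and> (int j * r) mod int q = l mod int q)"
  have J: "J l < q \<and> (int (J l) * r) mod int q = l mod int q" for l
    unfolding J_def by (rule someI_ex) (rule coprime_mult_residue[OF q(2,1), of l], blast)
  have "J ` L \<subseteq> V"
  proof
    fix j assume "j \<in> J ` L"
    then obtain l where l: "l \<in> L" "j = J l" by auto
    have lAB: "A \<le> of_int l" "of_int l < B" using l(1) by (auto simp: L_def) linarith+
    have j: "j < q" "(int j * r) mod int q = l mod int q" using J l(2) by auto
    then obtain s where s: "int j * r = l + int q * s" by (metis mod_eqE mult.commute)
    have jr: "real j * of_int r = of_int l + real q * of_int s"
      using arg_cong[OF s, of real_of_int] by simp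
    have "\<bar>(\<alpha> - of_int r / real q) * real j\<bar> \<le> 1 / (real q)\<^sup>2 * real q"
      unfolding abs_mult using q(3) j(1) by (intro mult_mono) auto
    then have d: "\<bar>(\<alpha> - of_int r / real q) * real j\<bar> \<le> 1 / real q" using q(1) by (simp add: power2_eq_square)
    have eq: "y + \<alpha> * real j - of_int s = y + of_int l / real q + (\<alpha> - of_int r / real q) * real j"
    proof -
      have "of_int r / real q * real j = of_int l / real q + of_int s"
        using jr q(1) by (simp add: field_simps)
      then show ?thesis by (simp add: algebra_simps)
    qed
    have "real i / real M + 1 / real q \<le> y + of_int l / real q"
    proof -
      have "A / real q \<le> of_int l / real q" using lAB(1) q(1) by (simp add: divide_right_mono)
      moreover have "A / real q = real i / real M - y + 1 / real q" using q(1) by (simp add: A_def add_divide_distrib)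
      ultimately show ?thesis by linarith
    qed
    moreover have "y + of_int l / real q < (real i + 1) / real M - 1 / real q"
    proof -
      have "of_int l / real q < B / real q" using lAB(2) q(1) by (simp add: divide_strict_right_mono)
      also have "B / real q = (real i + 1) / real M - y - 1 / real q" using q(1) by (simp add: B_def diff_divide_distrib)
      finally show ?thesis by linarith
    qed
    ultimately have "real i / real M \<le> y + \<alpha> * real j - of_int s" "y + \<alpha> * real j - of_int s < (real i + 1) / real M"
      using d unfolding eq by linarith+
    then show "j \<in> V" using j(1) by (auto simp: V_def)
  qed
  moreover have "inj_on J L"
  proof (rule inj_onI)
    fix l l' assume l: "l \<in> L" "l' \<in> L" "J l = J l'"
    then have "l mod int q = l' mod int q" using J by metis
    then have "int q dvd l - l'" by (simp add: mod_eq_dvd_iff)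
    moreover have "\<bar>l - l'\<bar> < int q"
    proof -
      have "A \<le> of_int l" "of_int l < B" "A \<le> of_int l'" "of_int l' < B" using l by (auto simp: L_def) linarith+
      then have "\<bar>of_int l - of_int l'\<bar> < B - A" by linarith
      also have "B - A = real q / real M - 2" by (simp add: A_def B_def field_simps add_divide_distrib)
      also have "\<dots> \<le> real q"
      proof -
        have "real q / real M \<le> real q / 1" using M(1) by (intro divide_left_mono) auto
        then show ?thesis by simp
      qed
      finally show ?thesis by linarith
    qed
    ultimately have "l - l' = 0" by (rule dvd_small_eq_0)
        then show "l = l'" by simp
  qed
  moreover have "finite V" by (auto simp: V_def)
  ultimately have "real (card L) \<le> real (card V)" by (metis card_image card_mono of_nat_le_iff)
  moreover have "real (card L) \<ge> B - A - 1" unfolding L_def by simp linarith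
  moreover have "B - A = real q / real M - 2" by (simp add: A_def B_def field_simps add_divide_distrib)
  moreover have "real q / real M \<ge> 6" 
  proof -
    have "real q \<ge> 6 * real M" using M(2) by linarith
    then show ?thesis using M(1) by (simp add: field_simps)
  qed
  moreover define X where "X = real q / real M"
  ultimately have "real (card V) \<ge> X / 2" unfolding X_def[symmetric] by linarith
  then show ?thesis by (simp add: V_def X_def mult.commute)
qed

subsection \<open>Spectral representation of Jacobi matrices\<close>

text \<open>The polynomial form of \<open>jdet\<close> makes degrees, roots and derivatives
  available.\<close>

fun jpoly :: "(nat \<Rightarrow> real) \<Rightarrow> nat \<Rightarrow> complex poly" where
  "jpoly c 0 = 1"
| "jpoly c (Suc 0) = [:0, 1:]"
| "jpoly c (Suc (Suc n)) = [:0, 1:] * jpoly c (Suc n) - [:(complex_of_real (c (Suc n)))\<^sup>2:] * jpoly c n"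

lemma poly_jpoly: "poly (jpoly c n) z = jdet c z n"
  by (induction n rule: induct_nat_012) auto

lemma jpoly_monic: "degree (jpoly c n) = n \<and> Polynomial.coeff (jpoly c n) n = 1"
proof (induction n rule: induct_nat_012)
  case (ge2 n)
  have d: "degree ([:0, 1:] * jpoly c (Suc n)) = Suc (Suc n)"
    using ge2 by (subst degree_mult_eq) auto
  have lt: "degree (- [:(complex_of_real (c (Suc n)))\<^sup>2:] * jpoly c n) < degree ([:0, 1:] * jpoly c (Suc n))"
    unfolding d using ge2 by simp
  have "degree (jpoly c (Suc (Suc n))) = Suc (Suc n)"
    using degree_add_eq_left[OF lt] d by simp
  moreover have "Polynomial.coeff (jpoly c (Suc (Suc n))) (Suc (Suc n)) = 1"
    using ge2 by (simp add: coeff_eq_0)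
  ultimately show ?case by simp
qed auto

lemma jdet_real: "jdet c (complex_of_real x) n = complex_of_real (Re (jdet c (complex_of_real x) n))"
  using jdet_cnj[of c "complex_of_real x" n] by (simp add: complex_eq_iff)

text \<open>The expression obeys W' = d^2 + c^2 W and starts at 1; up to factors it is the
  Christoffel-Darboux sum on the diagonal. Its positivity makes the roots simple.\<close>

lemma jpoly_wronskian:
  assumes "\<And>j. 1 \<le> j \<Longrightarrow> j \<le> n \<Longrightarrow> c j \<noteq> 0"
  shows "\<exists>w>0. poly (pderiv (jpoly c (Suc n))) (complex_of_real x) * jdet c x n
           - jdet c x (Suc n) * poly (pderiv (jpoly c n)) (complex_of_real x) = complex_of_real w"
  using assms
proof (induction n)
  case 0
  then show ?case by (intro exI[of _ 1]) (simp add: pderiv_pCons)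
next
  case (Suc n)
  then obtain w where w: "w > 0" "poly (pderiv (jpoly c (Suc n))) (complex_of_real x) * jdet c x n
           - jdet c x (Suc n) * poly (pderiv (jpoly c n)) (complex_of_real x) = complex_of_real w"
    by auto
  define d where "d = Re (jdet c (complex_of_real x) (Suc n))"
  have d: "jdet c (complex_of_real x) (Suc n) = complex_of_real d" unfolding d_def by (rule jdet_real)
  have "poly (pderiv (jpoly c (Suc (Suc n)))) (complex_of_real x) * jdet c x (Suc n)
           - jdet c x (Suc (Suc n)) * poly (pderiv (jpoly c (Suc n))) (complex_of_real x)
     = (jdet c x (Suc n))\<^sup>2 + (complex_of_real (c (Suc n)))\<^sup>2 * (poly (pderiv (jpoly c (Suc n))) (complex_of_real x) * jdet c x n
           - jdet c x (Suc n) * poly (pderiv (jpoly c n)) (complex_of_real x))"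
    unfolding jpoly.simps(3) pderiv_diff pderiv_mult jdet.simps(3)
    by (simp add: poly_jpoly pderiv_pCons algebra_simps power2_eq_square)
  also have "\<dots> = complex_of_real (d\<^sup>2 + (c (Suc n))\<^sup>2 * w)" unfolding w(2) unfolding d by simp
  finally have "poly (pderiv (jpoly c (Suc (Suc n)))) (complex_of_real x) * jdet c x (Suc n)
           - jdet c x (Suc (Suc n)) * poly (pderiv (jpoly c (Suc n))) (complex_of_real x) = complex_of_real (d\<^sup>2 + (c (Suc n))\<^sup>2 * w)" .
  moreover have "d\<^sup>2 + (c (Suc n))\<^sup>2 * w > 0"
    using w(1) Suc.prems[of "Suc n"] by (intro add_nonneg_pos mult_pos_pos) auto
  ultimately show ?case by blast
qed

text \<open>Roots are real because the determinant does not vanish off the real axis, and simple by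
  the Wronskian.\<close>

lemma jdet_roots:
  assumes c: "\<And>j. 1 \<le> j \<Longrightarrow> j < n \<Longrightarrow> c j \<noteq> 0"
  defines "\<Lambda> \<equiv> {x::real. jdet c (complex_of_real x) n = 0}"
  shows "finite \<Lambda>" "card \<Lambda> = n" "jdet c z n = (\<Prod>x\<in>\<Lambda>. z - complex_of_real x)"
proof -
  let ?p = "jpoly c n"
  have p0: "?p \<noteq> 0" using jpoly_monic[of c n] by auto
  have real_root: "w \<in> complex_of_real ` \<Lambda>" if "poly ?p w = 0" for w
  proof -
    have "Im w = 0" using jdet_nonzero'[of w c n] that by (auto simp: poly_jpoly)
    then have "w = complex_of_real (Re w)" by (simp add: complex_eq_iff)
    then show ?thesis using that by (auto simp: \<Lambda>_def poly_jpoly)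
  qed
  have roots: "{w. poly ?p w = 0} = complex_of_real ` \<Lambda>"
    using real_root by (auto simp: \<Lambda>_def poly_jpoly)
  have "rsquarefree ?p"
    unfolding rsquarefree_roots
  proof (intro allI notI)
    fix w assume w: "poly ?p w = 0 \<and> poly (pderiv ?p) w = 0"
    then obtain x where x: "w = complex_of_real x" using roots by auto
    show False
    proof (cases n)
      case 0
      then show ?thesis using w by simp
    next
      case (Suc m)
      then obtain v where "v > 0" "poly (pderiv (jpoly c (Suc m))) (complex_of_real x) * jdet c x m
           - jdet c x (Suc m) * poly (pderiv (jpoly c m)) (complex_of_real x) = complex_of_real v"
        using jpoly_wronskian[of m c x] c by auto
      then show ?thesis using w Suc x by (simp add: poly_jpoly)
    qed
  qed
  then have dec: "?p = (\<Prod>w\<in>complex_of_real ` \<Lambda>. [:-w, 1:])"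
    using complex_poly_decompose_rsquarefree[of ?p] jpoly_monic[of c n] by (simp add: roots)
  have "finite (complex_of_real ` \<Lambda>)" using poly_roots_finite[OF p0] by (simp add: roots)
  then show fin: "finite \<Lambda>" by (rule finite_imageD) (simp add: inj_on_def)
  have dec': "?p = (\<Prod>x\<in>\<Lambda>. [:- complex_of_real x, 1:])"
    by (subst dec, subst prod.reindex) (auto simp: inj_on_def)
  have "degree ?p = card \<Lambda>" by (subst dec') (simp add: degree_prod_eq_sum_degree)
  then show "card \<Lambda> = n" using jpoly_monic[of c n] by simp
  show "jdet c z n = (\<Prod>x\<in>\<Lambda>. z - complex_of_real x)"
    unfolding poly_jpoly[symmetric] by (subst dec') (simp add: poly_prod)
qed

text \<open>As functions of \<open>x\<close> these are the orthogonal polynomials of the matrix. At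
  an eigenvalue \<open>x\<close> they are the entries of the eigenvector that starts with 1, site
  \<open>k + 1\<close> having index \<open>k\<close>.\<close>

definition jvec :: "(nat \<Rightarrow> real) \<Rightarrow> real \<Rightarrow> nat \<Rightarrow> real" where
  "jvec c x k = Re (jdet c (complex_of_real x) k) / (\<Prod>j\<in>{1..k}. c j)"

text \<open>This is \<open>c (Suc k)\<close> times the next entry, written without that bond: at the
  last site the bond leads out of the matrix, and vanishing of \<open>jvec_next\<close> is the
  eigenvalue condition.\<close>

definition jvec_next :: "(nat \<Rightarrow> real) \<Rightarrow> real \<Rightarrow> nat \<Rightarrow> real" where
  "jvec_next c x k = Re (jdet c (complex_of_real x) (Suc k)) / (\<Prod>j\<in>{1..k}. c j)"

lemma jvec_0: "jvec c x 0 = 1" "jvec_next c x 0 = x"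
  by (simp_all add: jvec_def jvec_next_def)

lemma jvec_next_eq: "c (Suc k) \<noteq> 0 \<Longrightarrow> jvec_next c x k = c (Suc k) * jvec c x (Suc k)"
  by (simp add: jvec_def jvec_next_def)

lemma jvec_rec:
  assumes "c (Suc k) \<noteq> 0"
  shows "jvec_next c x (Suc k) = x * jvec c x (Suc k) - c (Suc k) * jvec c x k"
proof -
  have "Re ((complex_of_real (c (Suc k)))\<^sup>2 * jdet c (complex_of_real x) k) = (c (Suc k))\<^sup>2 * Re (jdet c (complex_of_real x) k)"
    unfolding of_real_power[symmetric] by simp
  then have "Re (jdet c (complex_of_real x) (Suc (Suc k))) =
     x * Re (jdet c (complex_of_real x) (Suc k)) - (c (Suc k))\<^sup>2 * Re (jdet c (complex_of_real x) k)"
    by simp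
  then show ?thesis using assms
    by (simp add: jvec_def jvec_next_def diff_divide_distrib power2_eq_square)
qed

lemma jvec_christoffel_darboux:
  assumes "\<And>j. 1 \<le> j \<Longrightarrow> j \<le> m \<Longrightarrow> c j \<noteq> 0"
  shows "(x - y) * (\<Sum>k<Suc m. jvec c x k * jvec c y k) = jvec_next c x m * jvec c y m - jvec c x m * jvec_next c y m"
  using assms
proof (induction m)
  case 0
  then show ?case by (simp add: jvec_0)
next
  case (Suc m)
  have cm: "c (Suc m) \<noteq> 0" using Suc.prems by simp
  have "(x - y) * (\<Sum>k<Suc (Suc m). jvec c x k * jvec c y k)
    = (x - y) * (\<Sum>k<Suc m. jvec c x k * jvec c y k) + (x - y) * (jvec c x (Suc m) * jvec c y (Suc m))"
    by (simp add: distrib_left)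
  also have "(x - y) * (\<Sum>k<Suc m. jvec c x k * jvec c y k) = jvec_next c x m * jvec c y m - jvec c x m * jvec_next c y m"
    using Suc by simp
  finally show ?case unfolding jvec_rec[where c=c, OF cm] jvec_next_eq[where c=c, OF cm]
    by (simp add: algebra_simps)
qed

text \<open>At eigenvalues the boundary term of the Christoffel-Darboux identity vanishes, so the
  normalised vectors form a square matrix \<open>U\<close> with orthonormal columns. Its rows are
  then orthonormal too, which is the completeness relation claimed; \<nu> collects the squared
  norms.\<close>

lemma jacobi_eigenbasis:
  assumes n: "n > 0" and c: "\<And>j. 1 \<le> j \<Longrightarrow> j < n \<Longrightarrow> c j \<noteq> 0"
  defines "\<Lambda> \<equiv> {x::real. jdet c (complex_of_real x) n = 0}"
  obtains \<nu> :: "real \<Rightarrow> real" where "\<And>x. x \<in> \<Lambda> \<Longrightarrow> \<nu> x > 0"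
    "\<And>i k. i < n \<Longrightarrow> k < n \<Longrightarrow> (\<Sum>x\<in>\<Lambda>. jvec c x i * jvec c x k / \<nu> x) = (if i = k then 1 else 0)"
proof -
  obtain m where m: "n = Suc m" using n by (cases n) auto
  note roots = jdet_roots[where c=c and n=n, OF c, folded \<Lambda>_def]
  define \<nu> where "\<nu> = (\<lambda>x. \<Sum>k<n. (jvec c x k)\<^sup>2)"
  have pos: "\<nu> x > 0" for x
  proof -
    have "(jvec c x 0)\<^sup>2 \<le> \<nu> x" unfolding \<nu>_def using n by (intro member_le_sum) auto
    then show ?thesis by (simp add: jvec_0)
  qed
  have orth: "(\<Sum>k<n. jvec c x k * jvec c y k) = 0" if "x \<in> \<Lambda>" "y \<in> \<Lambda>" "x \<noteq> y" for x y
  proof -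
    have "jvec_next c x m = 0" "jvec_next c y m = 0" using that by (auto simp: jvec_next_def \<Lambda>_def m)
    then have "(x - y) * (\<Sum>k<n. jvec c x k * jvec c y k) = 0"
      using jvec_christoffel_darboux[of m c x y] c by (simp add: m)
    then show ?thesis using that by simp
  qed
  define xs where "xs = sorted_list_of_set \<Lambda>"
  have xs: "set xs = \<Lambda>" "distinct xs" "length xs = n" using roots by (auto simp: xs_def)
  define U where "U = mat n n (\<lambda>(i,k). jvec c (xs ! k) i / sqrt (\<nu> (xs ! k)))"
  have U: "U \<in> carrier_mat n n" by (simp add: U_def)
  have "transpose_mat U * U = 1\<^sub>m n"
  proof (rule eq_matI)
    fix i j assume ij: "i < dim_row (1\<^sub>m n)" "j < dim_col (1\<^sub>m n)"
    then have ij': "i < n" "j < n" by auto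
    have mem: "xs ! i \<in> \<Lambda>" "xs ! j \<in> \<Lambda>" using xs ij' nth_mem by metis+
    have "(transpose_mat U * U) $$ (i,j) = (\<Sum>k<n. jvec c (xs ! i) k * jvec c (xs ! j) k) / (sqrt (\<nu> (xs ! i)) * sqrt (\<nu> (xs ! j)))"
      using ij' by (simp add: U_def scalar_prod_def lessThan_atLeast0 sum_divide_distrib)
    also have "\<dots> = (if i = j then 1 else 0)"
    proof (cases "i = j")
      case True
      then show ?thesis using pos[of "xs ! j"] by (simp add: \<nu>_def power2_eq_square)
    next
      case False
      then have "xs ! i \<noteq> xs ! j" using xs ij' by (simp add: nth_eq_iff_index_eq)
      then show ?thesis using orth[OF mem] False by simp
    qed
    finally show "(transpose_mat U * U) $$ (i,j) = 1\<^sub>m n $$ (i,j)" using ij' by simp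
  qed (auto simp: U_def)
  then have UU: "U * transpose_mat U = 1\<^sub>m n"
    using mat_mult_left_right_inverse[of "transpose_mat U" n U] U by auto
  have "(\<Sum>x\<in>\<Lambda>. jvec c x i * jvec c x k / \<nu> x) = (if i = k then 1 else 0)" if "i < n" "k < n" for i k
  proof -
    have "(\<Sum>x\<in>\<Lambda>. jvec c x i * jvec c x k / \<nu> x) = (\<Sum>l<n. jvec c (xs ! l) i * jvec c (xs ! l) k / \<nu> (xs ! l))"
      using bij_betw_nth[OF xs(2) _ xs(1)[symmetric], of "{..<n}"] xs(3)
      by (intro sum.reindex_bij_betw[symmetric]) auto
    also have "\<dots> = (U * transpose_mat U) $$ (i,k)"
    proof -
      have "\<nu> x = sqrt (\<nu> x) * sqrt (\<nu> x)" for x using pos[of x] by simp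
      then show ?thesis using that
        by (simp add: U_def scalar_prod_def lessThan_atLeast0)
    qed
    also have "\<dots> = (if i = k then 1 else 0)" unfolding UU using that by simp
    finally show ?thesis .
  qed
  then show ?thesis using that[of \<nu>] pos by blast
qed

lemma jdet_cong:
  assumes "\<And>j. 0 < j \<Longrightarrow> c' j = c j"
  shows "jdet c' z k = jdet c z k"
proof (induction k rule: induct_nat_012)
  case (ge2 n)
  then show ?case using assms[of "Suc n"] by simp
qed auto

text \<open>By Cramer's rule the left side is the modulus of the Green function between the sites 1
  and \<open>b\<close>. In the eigenbasis it is a sum over eigenvalues, whose weights have total
  mass at most 1 by the arithmetic-geometric mean inequality and completeness. The weights do not
  depend on \<open>z\<close>.\<close>

lemma jdet_green_bound:
  assumes b: "1 \<le> b" "b \<le> n" and c: "\<And>j. 1 \<le> j \<Longrightarrow> j < n \<Longrightarrow> c j \<noteq> 0" and c2: "\<And>j. \<bar>c j\<bar> \<le> 2"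
  defines "\<Lambda> \<equiv> {x::real. jdet c (complex_of_real x) n = 0}"
  obtains w :: "real \<Rightarrow> real" where "\<And>x. w x \<ge> 0" "(\<Sum>x\<in>\<Lambda>. w x) \<le> 1"
    "\<And>z. Im z > 0 \<Longrightarrow> cmod z \<le> 5 \<Longrightarrow>
       (\<Prod>j\<in>{1..<b}. \<bar>c j\<bar>) * cmod (jdet (\<lambda>j. c (b + j)) z (n - b)) / cmod (jdet c z n) \<le> (\<Sum>x\<in>\<Lambda>. w x / cmod (z - x))"
proof -
  have n: "n > 0" using b by simp
  obtain \<nu> where \<nu>: "\<And>x. x \<in> \<Lambda> \<Longrightarrow> \<nu> x > 0"
    "\<And>i k. i < n \<Longrightarrow> k < n \<Longrightarrow> (\<Sum>x\<in>\<Lambda>. jvec c x i * jvec c x k / \<nu> x) = (if i = k then 1 else 0)"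
    using jacobi_eigenbasis[where c=c, OF n c] unfolding \<Lambda>_def by blast
  note fin = jdet_roots(1)[where c=c and n=n, OF c, folded \<Lambda>_def]
  define w where "w = (\<lambda>x. \<bar>jvec c x 0 * jvec c x (b - 1)\<bar> / \<bar>\<nu> x\<bar>)"
  have w1: "(\<Sum>x\<in>\<Lambda>. w x) \<le> 1"
  proof -
    have "w x \<le> (jvec c x 0 * jvec c x 0 / \<nu> x + jvec c x (b - 1) * jvec c x (b - 1) / \<nu> x) / 2" if "x \<in> \<Lambda>" for x
    proof -
      have "0 \<le> (\<bar>jvec c x 0\<bar> - \<bar>jvec c x (b - 1)\<bar>)\<^sup>2" by simp
      then have "\<bar>jvec c x 0\<bar> * \<bar>jvec c x (b - 1)\<bar> \<le> (jvec c x 0 * jvec c x 0 + jvec c x (b - 1) * jvec c x (b - 1)) / 2"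
        by (simp add: power2_diff) (simp add: power2_eq_square)
      then have "\<bar>jvec c x 0\<bar> * \<bar>jvec c x (b - 1)\<bar> / \<nu> x \<le> (jvec c x 0 * jvec c x 0 + jvec c x (b - 1) * jvec c x (b - 1)) / 2 / \<nu> x"
        using \<nu>(1)[OF that] by (intro divide_right_mono) auto
      then show ?thesis using \<nu>(1)[OF that] by (simp add: w_def abs_mult add_divide_distrib mult.commute)
    qed
    then have "(\<Sum>x\<in>\<Lambda>. w x) \<le> (\<Sum>x\<in>\<Lambda>. (jvec c x 0 * jvec c x 0 / \<nu> x + jvec c x (b - 1) * jvec c x (b - 1) / \<nu> x) / 2)"
      by (intro sum_mono)
    also have "\<dots> = 1" using \<nu>(2)[of 0 0] \<nu>(2)[of "b - 1" "b - 1"] b n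
      by (simp add: sum.distrib flip: sum_divide_distrib)
    finally show ?thesis .
  qed
  have "(\<Prod>j\<in>{1..<b}. \<bar>c j\<bar>) * cmod (jdet (\<lambda>j. c (b + j)) z (n - b)) / cmod (jdet c z n) \<le> (\<Sum>x\<in>\<Lambda>. w x / cmod (z - x))"
    if z: "Im z > 0" "cmod z \<le> 5" for z
  proof -
    have zx: "z - complex_of_real x \<noteq> 0" for x using z(1) by (auto simp: complex_eq_iff)
    \<comment> \<open>The first column of the resolvent, taken from the eigenbasis and extended by 0
      at the site 0 and beyond \<open>n\<close>; \<open>c'\<close> removes the bond at 0, which lies
      outside the matrix.\<close>
    define s where "s = (\<lambda>i. if i = 0 \<or> i > n then 0 else (\<Sum>x\<in>\<Lambda>. complex_of_real (jvec c x 0 * jvec c x (i - 1) / \<nu> x) / (z - x)))"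
    define c' where "c' = (\<lambda>j. if j = 0 then 0 else c j)"
    have eq: "z * s i - c' i * s (Suc i) - c' (i - 1) * s (i - 1) = (if i = 1 then 1 else 0)" if i: "1 \<le> i" "i \<le> n" for i
    proof -
      obtain k where k: "i = Suc k" using i by (cases i) auto
      have xrec: "x * jvec c x k = (if Suc i \<le> n then c i * jvec c x i else 0) + (if k = 0 then 0 else c k * jvec c x (k - 1))"
        if x: "x \<in> \<Lambda>" for x
      proof -
        have "x * jvec c x k = jvec_next c x k + (if k = 0 then 0 else c k * jvec c x (k - 1))"
        proof (cases k)
          case 0
          then show ?thesis by (simp add: jvec_0)
        next
          case (Suc k')
          then have "c (Suc k') \<noteq> 0" using c[of "Suc k'"] i k by simp
          from jvec_rec[where c=c, OF this] show ?thesis by (simp add: Suc)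
        qed
        moreover have "jvec_next c x k = (if Suc i \<le> n then c i * jvec c x i else 0)"
        proof (cases "Suc i \<le> n")
          case True
          then show ?thesis using c[of i] i k jvec_next_eq[of c k x] by simp
        next
          case False
          then have "n = Suc k" using i k by simp
          then show ?thesis using x False by (simp add: jvec_next_def \<Lambda>_def)
        qed
        ultimately show ?thesis by simp
      qed
      have "c' i * s (Suc i) = (\<Sum>x\<in>\<Lambda>. complex_of_real (jvec c x 0 * (if Suc i \<le> n then c i * jvec c x i else 0) / \<nu> x) / (z - x))"
        using i by (simp add: s_def c'_def sum_distrib_left mult_ac)
      moreover have "c' (i - 1) * s (i - 1) = (\<Sum>x\<in>\<Lambda>. complex_of_real (jvec c x 0 * (if k = 0 then 0 else c k * jvec c x (k - 1)) / \<nu> x) / (z - x))"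
        using i k by (simp add: s_def c'_def sum_distrib_left mult_ac)
      moreover have "z * s i = (\<Sum>x\<in>\<Lambda>. z * complex_of_real (jvec c x 0 * jvec c x k / \<nu> x) / (z - x))"
        using i k by (simp add: s_def sum_distrib_left mult_ac)
      ultimately have "z * s i - c' i * s (Suc i) - c' (i - 1) * s (i - 1) =
          (\<Sum>x\<in>\<Lambda>. z * complex_of_real (jvec c x 0 * jvec c x k / \<nu> x) / (z - x)
            - complex_of_real (jvec c x 0 * (if Suc i \<le> n then c i * jvec c x i else 0) / \<nu> x) / (z - x)
            - complex_of_real (jvec c x 0 * (if k = 0 then 0 else c k * jvec c x (k - 1)) / \<nu> x) / (z - x))"
        by (simp only: sum_subtractf)
      also have "\<dots> = (\<Sum>x\<in>\<Lambda>. complex_of_real (jvec c x 0 * jvec c x k / \<nu> x))"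
      proof (intro sum.cong refl)
        fix x assume x: "x \<in> \<Lambda>"
        have "complex_of_real (jvec c x 0 * (if Suc i \<le> n then c i * jvec c x i else 0) / \<nu> x) / (z - x)
            + complex_of_real (jvec c x 0 * (if k = 0 then 0 else c k * jvec c x (k - 1)) / \<nu> x) / (z - x)
            = complex_of_real (jvec c x 0 * (x * jvec c x k) / \<nu> x) / (z - x)"
          unfolding xrec[OF x] by (simp add: add_divide_distrib distrib_left)
        moreover have "z * complex_of_real (jvec c x 0 * jvec c x k / \<nu> x) / (z - x) - complex_of_real (jvec c x 0 * (x * jvec c x k) / \<nu> x) / (z - x)
            = (z - x) * complex_of_real (jvec c x 0 * jvec c x k / \<nu> x) / (z - x)"
          by (simp add: algebra_simps diff_divide_distrib)
        ultimately show "z * complex_of_real (jvec c x 0 * jvec c x k / \<nu> x) / (z - x)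
            - complex_of_real (jvec c x 0 * (if Suc i \<le> n then c i * jvec c x i else 0) / \<nu> x) / (z - x)
            - complex_of_real (jvec c x 0 * (if k = 0 then 0 else c k * jvec c x (k - 1)) / \<nu> x) / (z - x)
            = complex_of_real (jvec c x 0 * jvec c x k / \<nu> x)" using zx[of x] by (simp add: diff_diff_eq)
      qed
      also have "\<dots> = complex_of_real (\<Sum>x\<in>\<Lambda>. jvec c x 0 * jvec c x k / \<nu> x)" by simp
      also have "\<dots> = (if i = 1 then 1 else 0)" using \<nu>(2)[of 0 k] i k n by simp
      finally show ?thesis .
    qed
    define d where "d = (\<lambda>i. jdet (\<lambda>j. c' (i + j)) z (n - i))"
    have dnz: "d i \<noteq> 0" for i unfolding d_def using jdet_nonzero[OF z(1)] by blast
    have c'2: "\<bar>c' j\<bar> \<le> 2" for j using c2[of j] by (simp add: c'_def)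
    \<comment> \<open>All sites to the right of \<open>i\<close> are eliminated; \<open>s\<close>
      solves the homogeneous equation there and vanishes beyond \<open>n\<close>. For
      \<open>i = 0\<close> the source at site 1 contributes the extra
      \<open>d (Suc i)\<close>.\<close>
    have step: "d i * s (Suc i) = c' i * d (Suc i) * s i + (if i = 0 then d (Suc i) else 0)" if i: "Suc i \<le> n" for i
    proof -
      define m where "m = n - Suc i"
      have m: "n = i + Suc m" using i by (simp add: m_def)
      show ?thesis
      proof (cases "i = 0")
        case False
        have g: "cmod (z * s (i + j) - c' (i + j) * s (i + Suc j) - c' (i + (j - 1)) * s (i + (j - 1))) \<le> 0"
          if "1 \<le> j" "j \<le> Suc m" for j
        proof -
          have ij: "i + (j - 1) = i + j - 1" using that by simp
          show ?thesis unfolding ij using eq[of "i + j"] that m False by simp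
        qed
        have "cmod (jdet (\<lambda>j. c' (i + j)) z (Suc m) * s (i + 1) - c' (i + 0) * jdet (\<lambda>j. c' (i + Suc j)) z m * s (i + 0)
           - complex_of_real (\<Prod>j\<in>{1..Suc m}. c' (i + j)) * s (i + Suc (Suc m))) \<le> 10 ^ Suc m * 0"
          by (rule jdet_elim_right[where u="\<lambda>j. s (i + j)" and c="\<lambda>j. c' (i + j)", OF z(2) c'2 g]) auto
        moreover have "s (i + Suc (Suc m)) = 0" by (simp add: s_def m)
        ultimately show ?thesis using False by (simp add: d_def m)
      next
        case True
        show ?thesis
        proof (cases m)
          case 0
          then show ?thesis using eq[of 1] True m by (simp add: d_def c'_def s_def)
        next
          case (Suc m')
          have g: "cmod (z * s (1 + j) - c' (1 + j) * s (1 + Suc j) - c' (1 + (j - 1)) * s (1 + (j - 1))) \<le> 0"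
            if "1 \<le> j" "j \<le> m" for j using eq[of "1 + j"] that m True by simp
          have "cmod (jdet (\<lambda>j. c' (1 + j)) z (Suc m') * s (1 + 1) - c' (1 + 0) * jdet (\<lambda>j. c' (1 + Suc j)) z m' * s (1 + 0)
             - complex_of_real (\<Prod>j\<in>{1..Suc m'}. c' (1 + j)) * s (1 + Suc (Suc m'))) \<le> 10 ^ Suc m' * 0"
            by (rule jdet_elim_right[where u="\<lambda>j. s (1 + j)" and c="\<lambda>j. c' (1 + j)", OF z(2) c'2 g]) (auto simp: Suc)
          moreover have "s (Suc (Suc (Suc m'))) = 0" using m True Suc by (simp add: s_def)
          ultimately have s2: "d 1 * s 2 = c' 1 * d 2 * s 1" using m True Suc by (simp add: d_def numeral_2_eq_2)
          have d0: "d 0 = z * d 1 - (complex_of_real (c' 1))\<^sup>2 * d 2"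
            using jdet_left[of c' z m'] m True Suc by (simp add: d_def numeral_2_eq_2)
          have "d 0 * s 1 = d 1 * (z * s 1) - c' 1 * (c' 1 * d 2 * s 1)" unfolding d0 by (simp add: algebra_simps power2_eq_square)
          also have "\<dots> = d 1 * (z * s 1 - c' 1 * s 2)" unfolding s2[symmetric] by (simp add: algebra_simps)
          also have "z * s 1 - c' 1 * s 2 = 1" using eq[of 1] n by (simp add: c'_def numeral_2_eq_2)
          finally show ?thesis using True by (simp add: c'_def)
        qed
      qed
    qed
    have sol: "d 0 * s (Suc i) = complex_of_real (\<Prod>j\<in>{1..<Suc i}. c' j) * d (Suc i)" if "Suc i \<le> n" for i
      using that
    proof (induction i)
      case 0
      then show ?case using step[of 0] by (simp add: c'_def)
    next
      case (Suc i)
      have "d (Suc i) * (d 0 * s (Suc (Suc i))) = d 0 * (d (Suc i) * s (Suc (Suc i)))" by (simp add: mult_ac)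
      also have "\<dots> = c' (Suc i) * d (Suc (Suc i)) * (d 0 * s (Suc i))" using step[of "Suc i"] Suc by (simp add: mult_ac)
      also have "\<dots> = d (Suc i) * (complex_of_real (\<Prod>j\<in>{1..<Suc (Suc i)}. c' j) * d (Suc (Suc i)))"
        using Suc by (simp add: mult_ac)
      finally show ?case using dnz[of "Suc i"] by simp
    qed
    obtain b' where b': "b = Suc b'" using b by (cases b) auto
    have d0: "d 0 = jdet c z n"
    proof -
      have "d 0 = jdet c' z n" by (simp add: d_def)
      also have "\<dots> = jdet c z n" by (rule jdet_cong) (simp add: c'_def)
      finally show ?thesis .
    qed
    have db: "d b = jdet (\<lambda>j. c (b + j)) z (n - b)" using b' by (simp add: d_def c'_def)
    have pr: "(\<Prod>j\<in>{1..<b}. c' j) = (\<Prod>j\<in>{1..<b}. c j)" by (intro prod.cong) (auto simp: c'_def)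
    have "s b = complex_of_real (\<Prod>j\<in>{1..<b}. c j) * jdet (\<lambda>j. c (b + j)) z (n - b) / jdet c z n"
      using sol[of b'] b b' dnz[of 0] unfolding b'[symmetric] d0 db pr by (simp add: field_simps)
    then have "cmod (s b) = (\<Prod>j\<in>{1..<b}. \<bar>c j\<bar>) * cmod (jdet (\<lambda>j. c (b + j)) z (n - b)) / cmod (jdet c z n)"
      by (simp add: norm_mult norm_divide abs_prod del: of_real_prod)
    moreover have "cmod (s b) \<le> (\<Sum>x\<in>\<Lambda>. w x / cmod (z - x))"
    proof -
      have "cmod (s b) \<le> (\<Sum>x\<in>\<Lambda>. cmod (complex_of_real (jvec c x 0 * jvec c x (b - 1) / \<nu> x) / (z - x)))"
        using b by (simp add: s_def norm_sum del: of_real_mult of_real_divide)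
      also have "\<dots> = (\<Sum>x\<in>\<Lambda>. w x / cmod (z - x))"
        by (intro sum.cong) (auto simp: norm_divide w_def simp del: of_real_mult of_real_divide)
      finally show ?thesis .
    qed
    ultimately show ?thesis by simp
  qed
  moreover have "w x \<ge> 0" for x by (simp add: w_def)
  ultimately show ?thesis using that[of w] w1 by blast
qed

subsection \<open>Approximate eigenvectors on the spectrum\<close>

text \<open>One operator covers both models: unit bonds with cosine potential for the original
  operator, cosine bonds with zero potential for the chains.\<close>

definition jop :: "(int \<Rightarrow> real) \<Rightarrow> (int \<Rightarrow> real) \<Rightarrow> (int \<Rightarrow> complex) \<Rightarrow> int \<Rightarrow> complex" where
  "jop c v f n = c n * f (n + 1) + c (n - 1) * f (n - 1) + v n * f n"

lemma sum_shift_symmetric: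
  fixes f :: "int \<Rightarrow> 'a::comm_monoid_add"
  assumes "\<And>n. \<bar>n\<bar> > L \<Longrightarrow> f n = 0" "\<bar>a\<bar> \<le> K" "L + K \<le> R"
  shows "(\<Sum>n\<in>{-R..R}. f (n + a)) = (\<Sum>n\<in>{-L..L}. f n)"
proof -
  have "(\<Sum>n\<in>{-R..R}. f (n + a)) = (\<Sum>n\<in>{-R+a..R+a}. f n)"
    by (intro sum.reindex_bij_witness[of _ "\<lambda>n. n - a" "\<lambda>n. n + a"]) auto
  also have "\<dots> = (\<Sum>n\<in>{-L..L}. f n)"
    using assms by (intro sum.mono_neutral_right) auto
  finally show ?thesis .
qed

lemma sum_extend_symmetric:
  fixes f :: "int \<Rightarrow> 'a::comm_monoid_add"
  assumes "\<And>n. \<bar>n\<bar> > L \<Longrightarrow> f n = 0" "L \<le> R"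
  shows "(\<Sum>n\<in>{-R..R}. f n) = (\<Sum>n\<in>{-L..L}. f n)"
  using sum_shift_symmetric[of L f 0 0 R] assms by simp

definition fsupp :: "int \<Rightarrow> (int \<Rightarrow> complex) \<Rightarrow> bool" where
  "fsupp L f \<longleftrightarrow> (\<forall>n. \<bar>n\<bar> > L \<longrightarrow> f n = 0)"

text \<open>Windows turn every identity for finitely supported sequences into one between finite
  sums, once the window is wide enough.\<close>

definition sqn :: "int \<Rightarrow> (int \<Rightarrow> complex) \<Rightarrow> real" where
  "sqn L f = (\<Sum>n\<in>{-L..L}. (cmod (f n))\<^sup>2)"

lemma sqn_nonneg: "sqn L f \<ge> 0"
  by (simp add: sqn_def sum_nonneg)

lemma sqn_extend: "fsupp L f \<Longrightarrow> L \<le> R \<Longrightarrow> sqn R f = sqn L f"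
  unfolding sqn_def by (rule sum_extend_symmetric) (auto simp: fsupp_def)

lemma sqn_mono: "L \<le> R \<Longrightarrow> sqn L f \<le> sqn R f"
  unfolding sqn_def by (intro sum_mono2) auto

lemma jop_fsupp: "fsupp L f \<Longrightarrow> fsupp (L + 1) (jop c v f)"
  unfolding fsupp_def jop_def by auto

lemma sum3_sq_le: "((a::real) + b + d)\<^sup>2 \<le> 3 * (a\<^sup>2 + b\<^sup>2 + d\<^sup>2)"
proof -
  have "0 \<le> (a - b)\<^sup>2 + (b - d)\<^sup>2 + (a - d)\<^sup>2" by simp
  then show ?thesis by (simp add: power2_eq_square algebra_simps)
qed

text \<open>Below \<open>A = J - z\<close> with \<open>J\<close> symmetric, and the adjoint of \<open>A\<close> is \<open>J - cnj z\<close>.\<close>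

lemma jop_shift_bound:
  assumes f: "fsupp L f" and c: "\<And>n. \<bar>c n\<bar> \<le> 2" "\<And>n. \<bar>v n\<bar> \<le> 2"
  shows "sqn (L + 1) (\<lambda>n. jop c v f n - z * f n) \<le> 3 * (8 + (2 + cmod z)\<^sup>2) * sqn L f"
proof -
  have "(cmod (jop c v f n - z * f n))\<^sup>2 \<le> 12 * (cmod (f (n + 1)))\<^sup>2 + 12 * (cmod (f (n + (- 1))))\<^sup>2 + 3 * (2 + cmod z)\<^sup>2 * (cmod (f n))\<^sup>2" for n
  proof -
    have vz: "cmod (v n - z) \<le> 2 + cmod z"
      using norm_triangle_ineq4[of "complex_of_real (v n)" z] c(2)[of n] by simp
    have "cmod (jop c v f n - z * f n) = cmod (c n * f (n + 1) + c (n - 1) * f (n - 1) + (v n - z) * f n)"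
      by (simp add: jop_def algebra_simps)
    also have "\<dots> \<le> \<bar>c n\<bar> * cmod (f (n + 1)) + \<bar>c (n - 1)\<bar> * cmod (f (n - 1)) + cmod (v n - z) * cmod (f n)"
      by (intro norm_triangle_le add_mono) (auto simp: norm_mult)
    also have "\<dots> \<le> 2 * cmod (f (n + 1)) + 2 * cmod (f (n - 1)) + (2 + cmod z) * cmod (f n)"
      using c vz by (intro add_mono mult_right_mono) auto
    finally have "(cmod (jop c v f n - z * f n))\<^sup>2 \<le> (2 * cmod (f (n + 1)) + 2 * cmod (f (n - 1)) + (2 + cmod z) * cmod (f n))\<^sup>2"
      by (intro power_mono) auto
    also have "\<dots> \<le> 3 * ((2 * cmod (f (n + 1)))\<^sup>2 + (2 * cmod (f (n - 1)))\<^sup>2 + ((2 + cmod z) * cmod (f n))\<^sup>2)"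
      by (rule sum3_sq_le)
    finally show ?thesis by (simp add: power_mult_distrib)
  qed
  then have "sqn (L + 1) (\<lambda>n. jop c v f n - z * f n) \<le>
     (\<Sum>n\<in>{-(L+1)..L+1}. 12 * (cmod (f (n + 1)))\<^sup>2 + 12 * (cmod (f (n + (- 1))))\<^sup>2 + 3 * (2 + cmod z)\<^sup>2 * (cmod (f n))\<^sup>2)"
    unfolding sqn_def by (intro sum_mono)
  also have "\<dots> = 12 * (\<Sum>n\<in>{-(L+1)..L+1}. (cmod (f (n + 1)))\<^sup>2) + 12 * (\<Sum>n\<in>{-(L+1)..L+1}. (cmod (f (n + (- 1))))\<^sup>2)
     + 3 * (2 + cmod z)\<^sup>2 * (\<Sum>n\<in>{-(L+1)..L+1}. (cmod (f n))\<^sup>2)"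
    by (simp add: sum.distrib sum_distrib_left)
  also have "(\<Sum>n\<in>{-(L+1)..L+1}. (cmod (f (n + 1)))\<^sup>2) = sqn L f"
    unfolding sqn_def by (rule sum_shift_symmetric[where K=1]) (use f in \<open>auto simp: fsupp_def\<close>)
  also have "(\<Sum>n\<in>{-(L+1)..L+1}. (cmod (f (n + (- 1))))\<^sup>2) = sqn L f"
    unfolding sqn_def by (rule sum_shift_symmetric[where K=1]) (use f in \<open>auto simp: fsupp_def\<close>)
  also have "(\<Sum>n\<in>{-(L+1)..L+1}. (cmod (f n))\<^sup>2) = sqn L f"
    using sqn_extend[OF f, of "L + 1"] by (simp add: sqn_def)
  finally show ?thesis by (simp add: algebra_simps)
qed

lemma jop_symmetric:
  assumes f: "fsupp L f" and g: "fsupp L' g" and R: "L + 1 \<le> R" "L' + 1 \<le> R"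
  shows "(\<Sum>n\<in>{-R..R}. jop c v f n * cnj (g n)) = (\<Sum>n\<in>{-R..R}. f n * cnj (jop c v g n))"
proof -
  have 1: "(\<Sum>n\<in>{-R..R}. c n * f (n + 1) * cnj (g n)) = (\<Sum>n\<in>{-R..R}. c (n - 1) * f n * cnj (g (n - 1)))"
  proof -
    define h where "h = (\<lambda>n. c (n - 1) * f n * cnj (g (n - 1)))"
    have h: "\<And>n. \<bar>n\<bar> > L \<Longrightarrow> h n = 0" using f by (simp add: h_def fsupp_def)
    have "(\<Sum>n\<in>{-R..R}. h (n + 1)) = (\<Sum>n\<in>{-R..R}. h n)"
      using sum_shift_symmetric[of L h 1 1 R] sum_extend_symmetric[of L h R] h R by simp
    then show ?thesis by (simp add: h_def)
  qed
  have 2: "(\<Sum>n\<in>{-R..R}. c (n - 1) * f (n - 1) * cnj (g n)) = (\<Sum>n\<in>{-R..R}. c n * f n * cnj (g (n + 1)))"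
  proof -
    define h where "h = (\<lambda>n. c n * f n * cnj (g (n + 1)))"
    have h: "\<And>n. \<bar>n\<bar> > L \<Longrightarrow> h n = 0" using f by (simp add: h_def fsupp_def)
    have "(\<Sum>n\<in>{-R..R}. h (n + (-1))) = (\<Sum>n\<in>{-R..R}. h n)"
      using sum_shift_symmetric[of L h "-1" 1 R] sum_extend_symmetric[of L h R] h R by simp
    then show ?thesis by (simp add: h_def)
  qed
  have "(\<Sum>n\<in>{-R..R}. jop c v f n * cnj (g n)) = (\<Sum>n\<in>{-R..R}. c n * f (n + 1) * cnj (g n))
     + (\<Sum>n\<in>{-R..R}. c (n - 1) * f (n - 1) * cnj (g n)) + (\<Sum>n\<in>{-R..R}. v n * f n * cnj (g n))"
    by (simp add: jop_def algebra_simps sum.distrib)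
  also have "\<dots> = (\<Sum>n\<in>{-R..R}. f n * cnj (jop c v g n))"
    unfolding 1 2 by (simp add: jop_def algebra_simps sum.distrib)
  finally show ?thesis .
qed

lemma sqn_inner: "complex_of_real (sqn R f) = (\<Sum>n\<in>{-R..R}. f n * cnj (f n))"
  unfolding sqn_def of_real_sum complex_norm_square ..

lemma cauchy_schwarz_fs:
  "(cmod (\<Sum>n\<in>{-R..R}. f n * cnj (g n)))\<^sup>2 \<le> sqn R f * sqn R g"
proof -
  have "cmod (\<Sum>n\<in>{-R..R}. f n * cnj (g n)) \<le> (\<Sum>n\<in>{-R..R}. \<bar>cmod (f n)\<bar> * \<bar>cmod (g n)\<bar>)"
    by (rule order_trans[OF norm_sum]) (simp add: norm_mult)
  also have "\<dots> \<le> L2_set (\<lambda>n. cmod (f n)) {-R..R} * L2_set (\<lambda>n. cmod (g n)) {-R..R}"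
    by (rule L2_set_mult_ineq)
  finally have "(cmod (\<Sum>n\<in>{-R..R}. f n * cnj (g n)))\<^sup>2 \<le> (L2_set (\<lambda>n. cmod (f n)) {-R..R} * L2_set (\<lambda>n. cmod (g n)) {-R..R})\<^sup>2"
    by (intro power_mono) auto
  also have "\<dots> = sqn R f * sqn R g"
    by (simp add: power_mult_distrib L2_set_def sqn_def sum_nonneg)
  finally show ?thesis .
qed

text \<open>The inner product of \<open>jop c v f\<close> with \<open>f\<close> is real, so that of
  \<open>jop c v f - z f\<close> has imaginary part \<open>- Im z\<close> times the squared norm. By
  Cauchy-Schwarz the relative error cannot be below \<open>|Im z|\<close>.\<close>

lemma weyl_imp_real:
  assumes ap: "\<And>\<epsilon>. \<epsilon> > 0 \<Longrightarrow> \<exists>L f. fsupp L f \<and> sqn L f > 0 \<and> sqn (L + 1) (\<lambda>n. jop c v f n - z * f n) \<le> \<epsilon>\<^sup>2 * sqn L f"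
  shows "Im z = 0"
proof (rule ccontr)
  assume "Im z \<noteq> 0"
  then obtain L f where f: "fsupp L f" "sqn L f > 0" "sqn (L + 1) (\<lambda>n. jop c v f n - z * f n) \<le> (\<bar>Im z\<bar> / 2)\<^sup>2 * sqn L f"
    using ap[of "\<bar>Im z\<bar> / 2"] by auto
  define R where "R = L + 1"
  define I where "I = (\<Sum>n\<in>{-R..R}. (jop c v f n - z * f n) * cnj (f n))"
  have sf: "sqn R f = sqn L f" unfolding R_def by (rule sqn_extend[OF f(1)]) simp
  define Q where "Q = (\<Sum>n\<in>{-R..R}. jop c v f n * cnj (f n))"
  have "cnj Q = Q"
    using jop_symmetric[OF f(1) f(1), of R c v] by (simp add: Q_def R_def mult.commute)
  then have "Im Q = 0" by (simp add: complex_eq_iff)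
  moreover have "I = Q - z * complex_of_real (sqn R f)"
    by (simp add: I_def Q_def sqn_inner sum_subtractf left_diff_distrib sum_distrib_left mult.assoc)
  ultimately have "\<bar>Im I\<bar> = \<bar>Im z\<bar> * sqn L f" using f(2) by (simp add: sf abs_mult)
  then have "(\<bar>Im z\<bar> * sqn L f)\<^sup>2 \<le> (cmod I)\<^sup>2" using abs_Im_le_cmod[of I] f(2) by (intro power_mono) auto
  also have "\<dots> \<le> sqn R (\<lambda>n. jop c v f n - z * f n) * sqn R f" unfolding I_def by (rule cauchy_schwarz_fs)
  also have "\<dots> \<le> (\<bar>Im z\<bar> / 2)\<^sup>2 * sqn L f * sqn L f" unfolding sf using f(2,3) by (intro mult_right_mono) (auto simp: R_def)
  also have "(\<bar>Im z\<bar> / 2)\<^sup>2 * sqn L f * sqn L f = (Im z)\<^sup>2 * (sqn L f)\<^sup>2 / 4"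
    by (simp add: power_divide power2_eq_square)
  finally have "(Im z)\<^sup>2 * (sqn L f)\<^sup>2 \<le> (Im z)\<^sup>2 * (sqn L f)\<^sup>2 / 4"
    unfolding power_mult_distrib by simp
  moreover have "(Im z)\<^sup>2 * (sqn L f)\<^sup>2 > 0" using f(2) \<open>Im z \<noteq> 0\<close> by simp
  ultimately show False by linarith
qed

section \<open>Weyl's criterion by way of a Neumann series\<close>

lemma L2_sqn: "L2_set (\<lambda>n. cmod (f n)) {-L..L} = sqrt (sqn L f)"
  by (simp add: L2_set_def sqn_def)

definition l2bd :: "real \<Rightarrow> (int \<Rightarrow> complex) \<Rightarrow> bool" where
  "l2bd b f \<longleftrightarrow> (\<forall>L. sqn L f \<le> b\<^sup>2)"

lemma finite_int_subset:
  assumes "finite (F :: int set)"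
  obtains L where "F \<subseteq> {-L..L}"
proof -
  have "\<bar>n\<bar> \<le> Max (insert 0 (abs ` F))" if "n \<in> F" for n
    using assms that by (intro Max_ge) auto
  then have "F \<subseteq> {- Max (insert 0 (abs ` F))..Max (insert 0 (abs ` F))}" by (force simp: abs_le_iff)
  then show ?thesis by (rule that)
qed

lemma l2bd_imp_ell2:
  assumes "l2bd b f" "b \<ge> 0"
  shows "f \<in> ell2" "ell2_norm f \<le> b"
proof -
  have bd: "(\<Sum>n\<in>F. (cmod (f n))\<^sup>2) \<le> b\<^sup>2" if "finite F" for F
  proof -
    obtain L where "F \<subseteq> {-L..L}" using finite_int_subset \<open>finite F\<close> by blast
    then have "(\<Sum>n\<in>F. (cmod (f n))\<^sup>2) \<le> sqn L f" unfolding sqn_def by (intro sum_mono2) auto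
    also have "\<dots> \<le> b\<^sup>2" using assms by (simp add: l2bd_def)
    finally show ?thesis .
  qed
  have s: "(\<lambda>n. (cmod (f n))\<^sup>2) summable_on UNIV"
    by (rule nonneg_bdd_above_summable_on) (auto intro!: bdd_aboveI[of _ "b\<^sup>2"] bd)
  then show "f \<in> ell2" by (simp add: ell2_def)
  have "(\<Sum>\<^sub>\<infinity>n. (cmod (f n))\<^sup>2) \<le> b\<^sup>2" using s bd by (intro infsum_le_finite_sums) auto
  then show "ell2_norm f \<le> b" using assms(2) unfolding ell2_norm_def by (simp add: real_le_lsqrt infsum_nonneg)
qed

lemma ell2_imp_l2bd:
  assumes "f \<in> ell2"
  shows "l2bd (ell2_norm f) f"
  unfolding l2bd_def
proof
  fix L
  have "sqn L f \<le> (\<Sum>\<^sub>\<infinity>n. (cmod (f n))\<^sup>2)" unfolding sqn_def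
    using assms by (intro finite_sum_le_infsum) (auto simp: ell2_def)
  then show "sqn L f \<le> (ell2_norm f)\<^sup>2" by (simp add: ell2_norm_def infsum_nonneg)
qed

lemma ell2_norm_nonneg: "ell2_norm f \<ge> 0"
  by (simp add: ell2_norm_def infsum_nonneg)

definition trunc :: "int \<Rightarrow> (int \<Rightarrow> complex) \<Rightarrow> int \<Rightarrow> complex" where
  "trunc L f n = (if \<bar>n\<bar> \<le> L then f n else 0)"

lemma trunc_fsupp: "fsupp L (trunc L f)"
  by (simp add: fsupp_def trunc_def)

lemma sqn_trunc: "sqn L (trunc L f) = sqn L f"
  unfolding sqn_def by (intro sum.cong) (auto simp: trunc_def)

text \<open>A lower bound for A = J - z on finitely supported sequences yields a bounded inverse.
  The adjoint A' inherits the bound because \<open>c\<close> and \<open>v\<close> are real, so A A'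
  is at least \<epsilon>^2 and \<open>1 - tt A A'\<close> is a contraction. Its Neumann series
  inverts \<open>tt A A'\<close>, and \<open>tt A'\<close> applied to the result is the
  resolvent.\<close>

context
  fixes c v :: "int \<Rightarrow> real" and z :: complex and \<epsilon> :: real
  assumes c: "\<And>n. \<bar>c n\<bar> \<le> 2" and v: "\<And>n. \<bar>v n\<bar> \<le> 2" and \<epsilon>: "\<epsilon> > 0"
    and lower: "\<And>L f. fsupp L f \<Longrightarrow> sqn (L + 1) (\<lambda>n. jop c v f n - z * f n) \<ge> \<epsilon>\<^sup>2 * sqn L f"
begin

definition "opA f = (\<lambda>n. jop c v f n - z * f n)"
definition "opA' f = (\<lambda>n. jop c v f n - cnj z * f n)"
text \<open>\<open>KK\<close> bounds the squared norms of A and A'. The squared norm of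
  \<open>1 - t A A'\<close> is at most \<open>1 - 2 t \<epsilon>^2 + t^2 KK^2\<close>, which is
  smallest at \<open>t = tt\<close>, with value \<open>qq^2\<close>.\<close>

definition "KK = 3 * (8 + (2 + cmod z)\<^sup>2)"
definition "tt = \<epsilon>\<^sup>2 / KK\<^sup>2"
definition "opS f = (\<lambda>n. f n - complex_of_real tt * opA (opA' f) n)"
definition "qq = sqrt (1 - \<epsilon>^4 / KK\<^sup>2)"

lemma KK_pos: "KK > 0" by (simp add: KK_def add_pos_nonneg)

lemma opA_fs: "fsupp L f \<Longrightarrow> fsupp (L + 1) (opA f)" "fsupp L f \<Longrightarrow> fsupp (L + 1) (opA' f)"
  using jop_fsupp[of L f c v] by (auto simp: opA_def opA'_def fsupp_def)

lemma opA_bound: "fsupp L f \<Longrightarrow> sqn (L + 1) (opA f) \<le> KK * sqn L f"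
  "fsupp L f \<Longrightarrow> sqn (L + 1) (opA' f) \<le> KK * sqn L f"
  using jop_shift_bound[of L f c v z] jop_shift_bound[of L f c v "cnj z"] c v
  by (auto simp: opA_def opA'_def KK_def)

text \<open>Complex conjugation of the sequence exchanges A and A', the coefficients being
  real.\<close>

lemma opA'_lower: "fsupp L f \<Longrightarrow> sqn (L + 1) (opA' f) \<ge> \<epsilon>\<^sup>2 * sqn L f"
proof -
  assume f: "fsupp L f"
  have "fsupp L (\<lambda>n. cnj (f n))" using f by (simp add: fsupp_def)
  from lower[OF this] have "\<epsilon>\<^sup>2 * sqn L (\<lambda>n. cnj (f n)) \<le> sqn (L + 1) (\<lambda>n. jop c v (\<lambda>n. cnj (f n)) n - z * cnj (f n))" .
  moreover have "jop c v (\<lambda>n. cnj (f n)) n - z * cnj (f n) = cnj (opA' f n)" for n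
    by (simp add: jop_def opA'_def)
  ultimately show ?thesis by (simp add: sqn_def)
qed

text \<open>Expanding the square, the cross term is the squared norm of \<open>opA' f\<close>, which
  the lower bound controls. The second claim comes from the same estimate and makes the radicand of
  \<open>qq\<close> nonnegative.\<close>

lemma opS_contract_fs:
  assumes f: "fsupp L f"
  shows "sqn (L + 2) (opS f) \<le> qq\<^sup>2 * sqn L f" "0 \<le> 1 - \<epsilon>^4 / KK\<^sup>2 \<or> sqn L f = 0"
proof -
  define R where "R = L + 2"
  have A'f: "fsupp (L + 1) (opA' f)" using opA_fs(2)[OF f] .
  have Bf: "fsupp R (opA (opA' f))" using opA_fs(1)[OF A'f] by (simp add: R_def add.assoc)
  have bB: "sqn R (opA (opA' f)) \<le> KK\<^sup>2 * sqn L f"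
  proof -
    have "sqn R (opA (opA' f)) \<le> KK * sqn (L + 1) (opA' f)" using opA_bound(1)[OF A'f] by (simp add: R_def add.assoc)
    also have "\<dots> \<le> KK * (KK * sqn L f)" using opA_bound(2)[OF f] KK_pos by (intro mult_left_mono) auto
    finally show ?thesis by (simp add: power2_eq_square)
  qed
  have inner: "(\<Sum>n\<in>{-R..R}. opA (opA' f) n * cnj (f n)) = complex_of_real (sqn (L + 1) (opA' f))"
  proof -
    have "(\<Sum>n\<in>{-R..R}. opA (opA' f) n * cnj (f n)) = (\<Sum>n\<in>{-R..R}. jop c v (opA' f) n * cnj (f n)) - (\<Sum>n\<in>{-R..R}. z * opA' f n * cnj (f n))"
      by (simp add: opA_def left_diff_distrib sum_subtractf)
    also have "(\<Sum>n\<in>{-R..R}. jop c v (opA' f) n * cnj (f n)) = (\<Sum>n\<in>{-R..R}. opA' f n * cnj (jop c v f n))"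
      by (rule jop_symmetric[OF A'f f]) (auto simp: R_def)
    also have "(\<Sum>n\<in>{-R..R}. opA' f n * cnj (jop c v f n)) - (\<Sum>n\<in>{-R..R}. z * opA' f n * cnj (f n)) = (\<Sum>n\<in>{-R..R}. opA' f n * cnj (opA' f n))"
      unfolding sum_subtractf[symmetric] by (intro sum.cong) (auto simp: opA'_def algebra_simps)
    also have "\<dots> = complex_of_real (sqn R (opA' f))" by (rule sqn_inner[symmetric])
    also have "sqn R (opA' f) = sqn (L + 1) (opA' f)" by (rule sqn_extend[OF A'f]) (simp add: R_def)
    finally show ?thesis .
  qed
  have "complex_of_real (sqn R (opS f)) = (\<Sum>n\<in>{-R..R}. f n * cnj (f n))
      - tt * (\<Sum>n\<in>{-R..R}. opA (opA' f) n * cnj (f n)) - tt * cnj (\<Sum>n\<in>{-R..R}. opA (opA' f) n * cnj (f n))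
      + tt\<^sup>2 * (\<Sum>n\<in>{-R..R}. opA (opA' f) n * cnj (opA (opA' f) n))"
    unfolding sqn_inner by (simp add: opS_def algebra_simps sum.distrib sum_subtractf sum_distrib_left power2_eq_square)
  also have "\<dots> = complex_of_real (sqn L f - 2 * tt * sqn (L + 1) (opA' f) + tt\<^sup>2 * sqn R (opA (opA' f)))"
    unfolding inner sqn_inner[symmetric] using sqn_extend[OF f, of R] by (simp add: R_def)
  finally have eq: "sqn R (opS f) = sqn L f - 2 * tt * sqn (L + 1) (opA' f) + tt\<^sup>2 * sqn R (opA (opA' f))"
    by (simp only: of_real_eq_iff)
  also have "\<dots> \<le> sqn L f - 2 * tt * (\<epsilon>\<^sup>2 * sqn L f) + tt\<^sup>2 * (KK\<^sup>2 * sqn L f)"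
    using bB opA'_lower[OF f] by (intro add_mono diff_mono mult_left_mono) (auto simp: tt_def)
  also have "\<dots> = (1 - \<epsilon>^4 / KK\<^sup>2) * sqn L f"
    using KK_pos by (simp add: tt_def field_simps power2_eq_square power4_eq_xxxx)
  finally have main: "sqn R (opS f) \<le> (1 - \<epsilon>^4 / KK\<^sup>2) * sqn L f" .
  then have "0 \<le> (1 - \<epsilon>^4 / KK\<^sup>2) * sqn L f" using sqn_nonneg order_trans by blast
  then have d: "0 \<le> 1 - \<epsilon>^4 / KK\<^sup>2 \<or> sqn L f = 0"
    using sqn_nonneg[of L f] by (auto simp: zero_le_mult_iff)
  show "0 \<le> 1 - \<epsilon>^4 / KK\<^sup>2 \<or> sqn L f = 0" by (rule d)
  show "sqn (L + 2) (opS f) \<le> qq\<^sup>2 * sqn L f"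
    using main d by (auto simp: qq_def R_def)
qed

lemma qq: "0 \<le> qq" "qq < 1"
proof -
  have "fsupp 0 (\<lambda>n. if n = 0 then 1 else 0)" "sqn 0 (\<lambda>n. if n = 0 then 1 else 0) = 1"
    by (auto simp: fsupp_def sqn_def)
  then have "0 \<le> 1 - \<epsilon>^4 / KK\<^sup>2" using opS_contract_fs(2) by fastforce
  then show "0 \<le> qq" "qq < 1" using \<epsilon> KK_pos by (auto simp: qq_def)
qed

text \<open>\<open>opS\<close> reaches two sites in each direction, so on a window it agrees with
  its value on a truncation, to which the estimate for finite supports applies.\<close>

lemma opS_contract:
  assumes "l2bd b f" "b \<ge> 0"
  shows "l2bd (qq * b) (opS f)"
  unfolding l2bd_def
proof
  fix L
  have "opS f n = opS (trunc (L + 2) f) n" if n: "\<bar>n\<bar> \<le> L" for n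
  proof -
    have t: "trunc (L + 2) f k = f k" if "n - 2 \<le> k" "k \<le> n + 2" for k
      using n that by (simp add: trunc_def)
    show ?thesis by (simp add: opS_def opA_def opA'_def jop_def t)
  qed
  then have "sqn L (opS f) = sqn L (opS (trunc (L + 2) f))" unfolding sqn_def by (intro sum.cong) auto
  also have "\<dots> \<le> sqn (L + 2 + 2) (opS (trunc (L + 2) f))" by (rule sqn_mono) simp
  also have "\<dots> \<le> qq\<^sup>2 * sqn (L + 2) (trunc (L + 2) f)" by (rule opS_contract_fs[OF trunc_fsupp])
  also have "\<dots> \<le> qq\<^sup>2 * b\<^sup>2" using assms by (intro mult_left_mono) (auto simp: sqn_trunc l2bd_def)
  finally show "sqn L (opS f) \<le> (qq * b)\<^sup>2" by (simp add: power_mult_distrib)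
qed

lemma opA'_l2bd:
  assumes "l2bd b f" "b \<ge> 0"
  shows "l2bd (sqrt KK * b) (opA' f)"
  unfolding l2bd_def
proof
  fix L
  have "opA' f n = opA' (trunc (L + 1) f) n" if n: "\<bar>n\<bar> \<le> L" for n
  proof -
    have t: "trunc (L + 1) f k = f k" if "n - 1 \<le> k" "k \<le> n + 1" for k
      using n that by (simp add: trunc_def)
    show ?thesis by (simp add: opA'_def jop_def t)
  qed
  then have "sqn L (opA' f) = sqn L (opA' (trunc (L + 1) f))" unfolding sqn_def by (intro sum.cong) auto
  also have "\<dots> \<le> sqn (L + 1 + 1) (opA' (trunc (L + 1) f))" by (rule sqn_mono) simp
  also have "\<dots> \<le> KK * sqn (L + 1) (trunc (L + 1) f)" by (rule opA_bound[OF trunc_fsupp])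
  also have "\<dots> \<le> KK * b\<^sup>2" using assms KK_pos by (intro mult_left_mono) (auto simp: sqn_trunc l2bd_def)
  finally show "sqn L (opA' f) \<le> (sqrt KK * b)\<^sup>2" using KK_pos by (simp add: power_mult_distrib)
qed

lemma opS_pow_bd:
  assumes "l2bd b f" "b \<ge> 0"
  shows "l2bd (qq ^ k * b) ((opS ^^ k) f)"
proof (induction k)
  case (Suc k)
  then show ?case using opS_contract[OF Suc] qq assms by (simp add: mult.assoc)
qed (use assms in simp)

lemma l2bd_pointwise: "l2bd b f \<Longrightarrow> b \<ge> 0 \<Longrightarrow> cmod (f n) \<le> b"
proof -
  assume a: "l2bd b f" "b \<ge> 0"
  have "(cmod (f n))\<^sup>2 \<le> sqn \<bar>n\<bar> f" unfolding sqn_def by (rule member_le_sum) auto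
  also have "\<dots> \<le> b\<^sup>2" using a by (simp add: l2bd_def)
  finally show ?thesis using a(2) by (rule power2_le_imp_le)
qed

definition "neu f = (\<lambda>n. \<Sum>k. (opS ^^ k) f n)"

lemma neu_summable:
  assumes "l2bd b f" "b \<ge> 0"
  shows "summable (\<lambda>k. (opS ^^ k) f n)"
proof (rule summable_comparison_test')
  show "summable (\<lambda>k. qq ^ k * b)" using qq by (intro summable_mult2 summable_geometric) auto
  show "norm ((opS ^^ k) f n) \<le> qq ^ k * b" if "k \<ge> 0" for k
    using l2bd_pointwise[OF opS_pow_bd[OF assms, of k]] qq assms by simp
qed

lemma neu_l2bd:
  assumes "l2bd b f" "b \<ge> 0"
  shows "l2bd (b / (1 - qq)) (neu f)"
  unfolding l2bd_def
proof
  fix L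
  have fin: "sqn L (\<lambda>n. \<Sum>k<m. (opS ^^ k) f n) \<le> (b / (1 - qq))\<^sup>2" for m
  proof -
    have "sqrt (sqn L (\<lambda>n. \<Sum>k<m. (opS ^^ k) f n)) \<le> (\<Sum>k<m. qq ^ k * b)"
    proof (induction m)
      case 0
      then show ?case by (simp add: sqn_def)
    next
      case (Suc m)
      have "sqrt (sqn L (\<lambda>n. \<Sum>k<Suc m. (opS ^^ k) f n)) = L2_set (\<lambda>n. cmod ((\<Sum>k<m. (opS ^^ k) f n) + (opS ^^ m) f n)) {-L..L}"
        by (simp add: L2_sqn)
      also have "\<dots> \<le> L2_set (\<lambda>n. cmod (\<Sum>k<m. (opS ^^ k) f n) + cmod ((opS ^^ m) f n)) {-L..L}"
        by (rule L2_set_mono) (auto intro: norm_triangle_ineq)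
      also have "\<dots> \<le> L2_set (\<lambda>n. cmod (\<Sum>k<m. (opS ^^ k) f n)) {-L..L} + L2_set (\<lambda>n. cmod ((opS ^^ m) f n)) {-L..L}"
        by (rule L2_set_triangle_ineq)
      also have "\<dots> \<le> (\<Sum>k<m. qq ^ k * b) + qq ^ m * b"
      proof (rule add_mono)
        show "L2_set (\<lambda>n. cmod (\<Sum>k<m. (opS ^^ k) f n)) {-L..L} \<le> (\<Sum>k<m. qq ^ k * b)"
          unfolding L2_sqn by (rule Suc)
        have "sqn L ((opS ^^ m) f) \<le> (qq ^ m * b)\<^sup>2" using opS_pow_bd[OF assms, of m] by (simp add: l2bd_def)
        then show "L2_set (\<lambda>n. cmod ((opS ^^ m) f n)) {-L..L} \<le> qq ^ m * b"
          unfolding L2_sqn using qq assms by (intro real_le_lsqrt) auto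
      qed
      finally show ?case by simp
    qed
    also have "\<dots> \<le> (\<Sum>k. qq ^ k * b)" using qq assms
      by (intro sum_le_suminf summable_mult2 summable_geometric) auto
    also have "\<dots> = b / (1 - qq)" using qq by (simp add: suminf_mult2[symmetric] summable_geometric suminf_geometric)
    finally show ?thesis by (rule sqrt_le_D)
  qed
  have "(\<lambda>m. sqn L (\<lambda>n. \<Sum>k<m. (opS ^^ k) f n)) \<longlonglongrightarrow> sqn L (neu f)"
    unfolding sqn_def neu_def
    by (intro tendsto_intros summable_LIMSEQ neu_summable[OF assms])
  then show "sqn L (neu f) \<le> (b / (1 - qq))\<^sup>2"
    by (rule LIMSEQ_le_const2) (use fin in blast)
qed

lemma opS_tendsto:
  assumes "\<And>n. (\<lambda>m. g m n) \<longlonglongrightarrow> h n"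
  shows "(\<lambda>m. opS (g m) n) \<longlonglongrightarrow> opS h n"
  unfolding opS_def opA_def opA'_def jop_def
  by (intro tendsto_diff tendsto_add tendsto_mult tendsto_const assms)

lemma neu_eq:
  assumes "l2bd b f" "b \<ge> 0"
  shows "tt * opA (opA' (neu f)) n = f n"
proof -
  have sm: "summable (\<lambda>k. (opS ^^ k) f n)" for n by (rule neu_summable[OF assms])
  have "opS (neu f) n = (\<Sum>k. opS ((opS ^^ k) f) n)"
  proof -
    have lim: "(\<lambda>m. \<Sum>k<m. (opS ^^ k) f n) \<longlonglongrightarrow> neu f n" for n unfolding neu_def by (rule summable_LIMSEQ[OF sm])
    have lin: "opS (\<lambda>n. \<Sum>k<m. (opS ^^ k) f n) n = (\<Sum>k<m. opS ((opS ^^ k) f) n)" for m n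
    proof (induction m)
      case 0
      then show ?case by (simp add: opS_def opA_def opA'_def jop_def)
    next
      case (Suc m)
      have "opS (\<lambda>n. g n + h n) n = opS g n + opS h n" for g h
        by (simp add: opS_def opA_def opA'_def jop_def algebra_simps)
      then show ?case using Suc by simp
    qed
    have "(\<lambda>m. opS (\<lambda>n. \<Sum>k<m. (opS ^^ k) f n) n) \<longlonglongrightarrow> opS (neu f) n"
      using lim by (rule opS_tendsto)
    then have "(\<lambda>m. \<Sum>k<m. opS ((opS ^^ k) f) n) \<longlonglongrightarrow> opS (neu f) n" unfolding lin .
    then have "(\<lambda>k. opS ((opS ^^ k) f) n) sums opS (neu f) n" by (simp add: sums_def)
    then show ?thesis by (rule sums_unique)
  qed
  also have "\<dots> = (\<Sum>k. (opS ^^ Suc k) f n)" by simp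
  also have "\<dots> = neu f n - f n" unfolding neu_def using suminf_split_head[OF sm, of n] by simp
  finally show ?thesis by (simp add: opS_def)
qed

definition "resolv f = (\<lambda>n. tt * opA' (neu f) n)"

lemma resolv_right: "f \<in> ell2 \<Longrightarrow> opA (resolv f) n = f n"
proof -
  assume "f \<in> ell2"
  from neu_eq[OF ell2_imp_l2bd[OF this] ell2_norm_nonneg]
  show ?thesis by (simp add: resolv_def opA_def jop_def algebra_simps)
qed

lemma tt_pos: "tt > 0" using \<epsilon> KK_pos by (simp add: tt_def)

lemma resolv_bound: "f \<in> ell2 \<Longrightarrow> resolv f \<in> ell2 \<and> ell2_norm (resolv f) \<le> tt * (sqrt KK * (1 / (1 - qq))) * ell2_norm f"
proof -
  assume f: "f \<in> ell2"
  have "l2bd (ell2_norm f / (1 - qq)) (neu f)" by (rule neu_l2bd[OF ell2_imp_l2bd[OF f] ell2_norm_nonneg])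
  then have 1: "l2bd (sqrt KK * (ell2_norm f / (1 - qq))) (opA' (neu f))"
    by (rule opA'_l2bd) (use qq ell2_norm_nonneg[of f] in simp)
  have "l2bd (tt * (sqrt KK * (ell2_norm f / (1 - qq)))) (resolv f)"
    unfolding l2bd_def
  proof
    fix L
    have "sqn L (resolv f) = tt\<^sup>2 * sqn L (opA' (neu f))"
      by (simp add: sqn_def resolv_def norm_mult power_mult_distrib sum_distrib_left)
    also have "\<dots> \<le> tt\<^sup>2 * (sqrt KK * (ell2_norm f / (1 - qq)))\<^sup>2"
      using 1 by (intro mult_left_mono) (auto simp: l2bd_def)
    finally show "sqn L (resolv f) \<le> (tt * (sqrt KK * (ell2_norm f / (1 - qq))))\<^sup>2"
      by (simp only: power_mult_distrib)
  qed
  from l2bd_imp_ell2[OF this] show ?thesis using tt_pos qq KK_pos ell2_norm_nonneg[of f] by simp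
qed

text \<open>The lower bound is given for finite supports only. Truncating a null vector at
  \<open>L\<close> leaves errors at the four sites next to the cuts, so the squared entries there
  have a positive lower bound for all large \<open>L\<close>; summed over \<open>L\<close> this
  contradicts square summability.\<close>

lemma opA_inj:
  assumes f: "f \<in> ell2" and Af: "\<And>n. opA f n = 0"
  shows "f n = 0"
proof (rule ccontr)
  assume "f n \<noteq> 0"
  define a where "a = \<epsilon>\<^sup>2 * (cmod (f n))\<^sup>2"
  have a: "a > 0" using \<epsilon> \<open>f n \<noteq> 0\<close> by (simp add: a_def)
  define g where "g = (\<lambda>L. 4 * ((cmod (f L))\<^sup>2 + (cmod (f (-L)))\<^sup>2 + (cmod (f (L+1)))\<^sup>2 + (cmod (f (-L-1)))\<^sup>2))"
  have gl: "a \<le> g L" if L: "L \<ge> \<bar>n\<bar>" "L \<ge> 1" for L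
  proof -
    have "a \<le> \<epsilon>\<^sup>2 * sqn L f" unfolding a_def sqn_def using L
      by (intro mult_left_mono member_le_sum) auto
    also have "\<dots> = \<epsilon>\<^sup>2 * sqn L (trunc L f)" by (simp add: sqn_trunc)
    also have "\<dots> \<le> sqn (L + 1) (opA (trunc L f))" using lower[OF trunc_fsupp] by (simp add: opA_def)
    also have "\<dots> = (\<Sum>k\<in>{L, -L, L+1, -L-1}. (cmod (opA (trunc L f) k))\<^sup>2)"
    proof -
      have "opA (trunc L f) k = 0" if "k \<in> {-(L+1)..L+1} - {L, -L, L+1, -L-1}" for k
        using that Af[of k] by (auto simp: opA_def jop_def trunc_def)
      then show ?thesis unfolding sqn_def using L by (intro sum.mono_neutral_right) auto
    qed
    also have "\<dots> \<le> g L"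
    proof -
      have e1: "opA (trunc L f) L = - c L * f (L + 1)" using Af[of L] L by (simp add: opA_def jop_def trunc_def algebra_simps)
      have e2: "opA (trunc L f) (-L) = - c (-L - 1) * f (-L - 1)" using Af[of "-L"] L by (simp add: opA_def jop_def trunc_def algebra_simps)
      have e3: "opA (trunc L f) (L+1) = c L * f L" using L by (simp add: opA_def jop_def trunc_def)
      have e4: "opA (trunc L f) (-L-1) = c (-L-1) * f (-L)" using L by (simp add: opA_def jop_def trunc_def)
      have sq: "(cmod (complex_of_real (c k) * w))\<^sup>2 \<le> 4 * (cmod w)\<^sup>2" for k w
      proof -
        have "(c k)\<^sup>2 \<le> 4" using c[of k] by (simp add: abs_le_square_iff[of _ 2, simplified])
        then show ?thesis by (simp add: norm_mult power_mult_distrib mult_right_mono)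
      qed
      have "(\<Sum>k\<in>{L, -L, L+1, -L-1}. (cmod (opA (trunc L f) k))\<^sup>2) =
         (cmod (opA (trunc L f) L))\<^sup>2 + (cmod (opA (trunc L f) (-L)))\<^sup>2 + (cmod (opA (trunc L f) (L+1)))\<^sup>2 + (cmod (opA (trunc L f) (-L-1)))\<^sup>2"
        using L by simp
      also have "\<dots> \<le> g L" unfolding e1 e2 e3 e4 g_def
        using sq[of L "f (L+1)"] sq[of "-L-1" "f (-L-1)"] sq[of L "f L"] sq[of "-L-1" "f (-L)"]
        by (simp add: norm_mult power_mult_distrib)
      finally show ?thesis .
    qed
    finally show ?thesis .
  qed
  define b where "b = (ell2_norm f)\<^sup>2"
  have tot: "sqn R f \<le> b" for R using ell2_imp_l2bd[OF f] by (simp add: l2bd_def b_def)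
  define N where "N = max \<bar>n\<bar> 1"
  have "real m * a \<le> 8 * b" for m :: nat
  proof -
    define R where "R = N + int m"
    have "(\<Sum>L\<in>{N..<N + int m}. a) \<le> (\<Sum>L\<in>{N..<N + int m}. g L)"
      using gl by (intro sum_mono) (auto simp: N_def)
    also have "\<dots> = 4 * (\<Sum>L\<in>{N..<N + int m}. (cmod (f L))\<^sup>2 + (cmod (f (-L)))\<^sup>2) + 4 * (\<Sum>L\<in>{N..<N + int m}. (cmod (f (L+1)))\<^sup>2 + (cmod (f (-L-1)))\<^sup>2)"
      by (simp add: g_def sum.distrib sum_distrib_left)
    also have "(\<Sum>L\<in>{N..<N + int m}. (cmod (f L))\<^sup>2 + (cmod (f (-L)))\<^sup>2) \<le> sqn R f"
    proof -
      have "(\<Sum>L\<in>{N..<N + int m}. (cmod (f (-L)))\<^sup>2) = (\<Sum>L\<in>uminus ` {N..<N + int m}. (cmod (f L))\<^sup>2)"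
        by (subst sum.reindex) (auto simp: inj_on_def)
      moreover have "(\<Sum>L\<in>{N..<N + int m} \<union> uminus ` {N..<N + int m}. (cmod (f L))\<^sup>2)
          = (\<Sum>L\<in>{N..<N + int m}. (cmod (f L))\<^sup>2) + (\<Sum>L\<in>uminus ` {N..<N + int m}. (cmod (f L))\<^sup>2)"
        by (rule sum.union_disjoint) (auto simp: N_def)
      ultimately have "(\<Sum>L\<in>{N..<N + int m}. (cmod (f L))\<^sup>2 + (cmod (f (-L)))\<^sup>2) = (\<Sum>L\<in>{N..<N + int m} \<union> uminus ` {N..<N + int m}. (cmod (f L))\<^sup>2)"
        by (simp only: sum.distrib)
      also have "\<dots> \<le> sqn R f" unfolding sqn_def by (intro sum_mono2) (auto simp: R_def N_def)
      finally show ?thesis .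
    qed
    also have "(\<Sum>L\<in>{N..<N + int m}. (cmod (f (L+1)))\<^sup>2 + (cmod (f (-L-1)))\<^sup>2) \<le> sqn R f"
    proof -
      have "(\<Sum>L\<in>{N..<N + int m}. (cmod (f (L+1)))\<^sup>2) = (\<Sum>L\<in>(\<lambda>L. L + 1) ` {N..<N + int m}. (cmod (f L))\<^sup>2)"
        by (subst sum.reindex) (auto simp: inj_on_def)
      moreover have "(\<Sum>L\<in>{N..<N + int m}. (cmod (f (-L-1)))\<^sup>2) = (\<Sum>L\<in>(\<lambda>L. -L-1) ` {N..<N + int m}. (cmod (f L))\<^sup>2)"
        by (subst sum.reindex) (auto simp: inj_on_def)
      moreover have "(\<Sum>L\<in>(\<lambda>L. L + 1) ` {N..<N + int m} \<union> (\<lambda>L. -L-1) ` {N..<N + int m}. (cmod (f L))\<^sup>2)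
          = (\<Sum>L\<in>(\<lambda>L. L + 1) ` {N..<N + int m}. (cmod (f L))\<^sup>2) + (\<Sum>L\<in>(\<lambda>L. -L-1) ` {N..<N + int m}. (cmod (f L))\<^sup>2)"
        by (rule sum.union_disjoint) (auto simp: N_def)
      ultimately have "(\<Sum>L\<in>{N..<N + int m}. (cmod (f (L+1)))\<^sup>2 + (cmod (f (-L-1)))\<^sup>2) = (\<Sum>L\<in>(\<lambda>L. L + 1) ` {N..<N + int m} \<union> (\<lambda>L. -L-1) ` {N..<N + int m}. (cmod (f L))\<^sup>2)"
        by (simp only: sum.distrib)
      also have "\<dots> \<le> sqn R f" unfolding sqn_def by (intro sum_mono2) (auto simp: R_def N_def)
      finally show ?thesis .
    qed
    finally show ?thesis using tot[of R] by simp
  qed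
  then show False using a reals_Archimedean3[OF a] by (meson not_less)
qed

text \<open>\<open>resolv\<close> is a right inverse; injectivity of \<open>opA\<close> on
  \<open>ell2\<close> makes preimages unique, which gives both linearity and the left
  inverse.\<close>

lemma z_resolvent:
  assumes T: "\<And>f. T f = jop c v f"
  shows "z \<in> ell2_resolvent_set T"
proof -
  have uniq: "resolv f = g" if "f \<in> ell2" "g \<in> ell2" "\<And>n. opA g n = f n" for f g
  proof
    fix n
    have bd: "resolv f \<in> ell2" using resolv_bound[OF that(1)] by simp
    have "l2bd (ell2_norm (resolv f) + ell2_norm g) (\<lambda>n. resolv f n - g n)"
      unfolding l2bd_def
    proof
      fix L
      have "sqrt (sqn L (\<lambda>n. resolv f n - g n)) \<le> L2_set (\<lambda>n. cmod (resolv f n) + cmod (g n)) {-L..L}"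
        unfolding L2_sqn[symmetric] by (rule L2_set_mono) (auto intro: norm_triangle_ineq4)
      also have "\<dots> \<le> L2_set (\<lambda>n. cmod (resolv f n)) {-L..L} + L2_set (\<lambda>n. cmod (g n)) {-L..L}" by (rule L2_set_triangle_ineq)
      also have "\<dots> \<le> ell2_norm (resolv f) + ell2_norm g"
        unfolding L2_sqn using ell2_imp_l2bd[OF bd] ell2_imp_l2bd[OF that(2)] ell2_norm_nonneg
        by (intro add_mono real_le_lsqrt) (auto simp: l2bd_def)
      finally have "sqrt (sqn L (\<lambda>n. resolv f n - g n)) \<le> ell2_norm (resolv f) + ell2_norm g" .
      then show "sqn L (\<lambda>n. resolv f n - g n) \<le> (ell2_norm (resolv f) + ell2_norm g)\<^sup>2"
        by (rule sqrt_le_D)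
    qed
    then have "(\<lambda>n. resolv f n - g n) \<in> ell2" using l2bd_imp_ell2(1) ell2_norm_nonneg by (meson add_nonneg_nonneg)
    moreover have "opA (\<lambda>n. resolv f n - g n) n = 0" for n
      using resolv_right[OF that(1), of n] that(3)[of n] by (simp add: opA_def jop_def algebra_simps)
    ultimately have "resolv f n - g n = 0" by (rule opA_inj)
    then show "resolv f n = g n" by simp
  qed
  have lin: "(\<lambda>n. a * f n + b * g n) \<in> ell2" if "f \<in> ell2" "g \<in> ell2" for f g a b
  proof -
    have "l2bd (cmod a * ell2_norm f + cmod b * ell2_norm g) (\<lambda>n. a * f n + b * g n)"
      unfolding l2bd_def
    proof
      fix L
      have "sqrt (sqn L (\<lambda>n. a * f n + b * g n)) \<le> L2_set (\<lambda>n. cmod a * cmod (f n) + cmod b * cmod (g n)) {-L..L}"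
        unfolding L2_sqn[symmetric] by (rule L2_set_mono) (auto intro!: norm_triangle_le simp: norm_mult)
      also have "\<dots> \<le> L2_set (\<lambda>n. cmod a * cmod (f n)) {-L..L} + L2_set (\<lambda>n. cmod b * cmod (g n)) {-L..L}" by (rule L2_set_triangle_ineq)
      also have "\<dots> = cmod a * L2_set (\<lambda>n. cmod (f n)) {-L..L} + cmod b * L2_set (\<lambda>n. cmod (g n)) {-L..L}"
        by (simp add: L2_set_right_distrib)
      also have "\<dots> \<le> cmod a * ell2_norm f + cmod b * ell2_norm g"
        unfolding L2_sqn using ell2_imp_l2bd[OF that(1)] ell2_imp_l2bd[OF that(2)] ell2_norm_nonneg
        by (intro add_mono mult_left_mono real_le_lsqrt) (auto simp: l2bd_def)
      finally have "sqrt (sqn L (\<lambda>n. a * f n + b * g n)) \<le> cmod a * ell2_norm f + cmod b * ell2_norm g" .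
      then show "sqn L (\<lambda>n. a * f n + b * g n) \<le> (cmod a * ell2_norm f + cmod b * ell2_norm g)\<^sup>2"
        by (rule sqrt_le_D)
    qed
    then show ?thesis by (rule l2bd_imp_ell2) (auto intro!: add_nonneg_nonneg mult_nonneg_nonneg ell2_norm_nonneg)
  qed
  have Aell: "opA f \<in> ell2" if "f \<in> ell2" for f
  proof -
    have "l2bd (sqrt KK * ell2_norm f) (opA f)"
      unfolding l2bd_def
    proof
      fix L
      have "opA f n = opA (trunc (L + 1) f) n" if n: "\<bar>n\<bar> \<le> L" for n
      proof -
    have t: "trunc (L + 1) f k = f k" if "n - 1 \<le> k" "k \<le> n + 1" for k
      using n that by (simp add: trunc_def)
    show ?thesis by (simp add: opA_def jop_def t)
  qed
      then have "sqn L (opA f) = sqn L (opA (trunc (L + 1) f))" unfolding sqn_def by (intro sum.cong) auto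
      also have "\<dots> \<le> sqn (L + 1 + 1) (opA (trunc (L + 1) f))" by (rule sqn_mono) simp
      also have "\<dots> \<le> KK * sqn (L + 1) (trunc (L + 1) f)" by (rule opA_bound[OF trunc_fsupp])
      also have "\<dots> \<le> KK * (ell2_norm f)\<^sup>2" using ell2_imp_l2bd[OF that] KK_pos by (intro mult_left_mono) (auto simp: sqn_trunc l2bd_def)
      finally show "sqn L (opA f) \<le> (sqrt KK * ell2_norm f)\<^sup>2" using KK_pos by (simp add: power_mult_distrib)
    qed
    then show ?thesis by (rule l2bd_imp_ell2) (use KK_pos ell2_norm_nonneg in auto)
  qed
  have "ell2_bounded_op resolv"
    unfolding ell2_bounded_op_def
  proof (intro conjI ballI allI)
    show "resolv f \<in> ell2" if "f \<in> ell2" for f using resolv_bound[OF that] by simp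
    show "\<exists>K. \<forall>f\<in>ell2. ell2_norm (resolv f) \<le> K * ell2_norm f" using resolv_bound by blast
    fix f g a b assume fg: "f \<in> ell2" "g \<in> ell2"
    show "resolv (\<lambda>n. a * f n + b * g n) = (\<lambda>n. a * resolv f n + b * resolv g n)"
    proof (rule uniq)
      show "(\<lambda>n. a * f n + b * g n) \<in> ell2" by (rule lin[OF fg])
      show "(\<lambda>n. a * resolv f n + b * resolv g n) \<in> ell2" using resolv_bound fg by (intro lin) auto
      fix n
      have "opA (\<lambda>n. a * resolv f n + b * resolv g n) n = a * opA (resolv f) n + b * opA (resolv g) n"
        by (simp add: opA_def jop_def algebra_simps)
      then show "opA (\<lambda>n. a * resolv f n + b * resolv g n) n = a * f n + b * g n"
        using resolv_right fg by simp
    qed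
  qed
  moreover have "resolv (\<lambda>n. T f n - z * f n) = f" if "f \<in> ell2" for f
    by (rule uniq) (use that Aell[OF that] in \<open>auto simp: T opA_def\<close>)
  moreover have "(\<lambda>n. T (resolv f) n - z * resolv f n) = f" if "f \<in> ell2" for f
    using resolv_right[OF that] by (auto simp: T opA_def)
  ultimately show ?thesis unfolding ell2_resolvent_set_def by blast
qed

end

section \<open>Approximate eigenvectors and size of the spectrum\<close>

definition amo_pot :: "real \<Rightarrow> real \<Rightarrow> int \<Rightarrow> real" where
  "amo_pot \<alpha> \<theta> n = 2 * cos (2 * pi * (\<alpha> * real_of_int n + \<theta>))"

lemma critical_amo_jop: "critical_amo \<alpha> \<theta> f = jop (\<lambda>_. 1) (amo_pot \<alpha> \<theta>) f"
  by (auto simp: critical_amo_def jop_def amo_pot_def)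

lemma spectrum_weyl:
  assumes "z \<in> ell2_spectrum (critical_amo \<alpha> \<theta>)" "\<epsilon> > 0"
  shows "\<exists>L f. fsupp L f \<and> sqn L f > 0 \<and>
    sqn (L + 1) (\<lambda>n. jop (\<lambda>_. 1) (amo_pot \<alpha> \<theta>) f n - z * f n) \<le> \<epsilon>\<^sup>2 * sqn L f"
proof (rule ccontr)
  assume neg: "\<not> ?thesis"
  have "z \<in> ell2_resolvent_set (critical_amo \<alpha> \<theta>)"
  proof (rule z_resolvent[where c="\<lambda>_. 1" and v="amo_pot \<alpha> \<theta>" and \<epsilon>=\<epsilon>])
    show "\<bar>amo_pot \<alpha> \<theta> n\<bar> \<le> 2" for n by (simp add: amo_pot_def abs_mult)
    show "\<epsilon>\<^sup>2 * sqn L f \<le> sqn (L + 1) (\<lambda>n. jop (\<lambda>_. 1) (amo_pot \<alpha> \<theta>) f n - z * f n)" if "fsupp L f" for L f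
    proof (cases "sqn L f > 0")
      case True
      then show ?thesis using neg that by force
    next
      case False
      then have "sqn L f = 0" using sqn_nonneg[of L f] by simp
      then show ?thesis using sqn_nonneg by simp
    qed
  qed (use assms critical_amo_jop in auto)
  then show False using assms by (simp add: ell2_spectrum_def)
qed

lemma spectrum_bounded:
  assumes z: "z \<in> ell2_spectrum (critical_amo \<alpha> \<theta>)"
  shows "cmod z \<le> 9 / 2"
proof -
  let ?J = "jop (\<lambda>_. 1) (amo_pot \<alpha> \<theta>)"
  \<comment> \<open>The operator norm is at most 4, so an approximate eigenvector with error 1/2
    gives the bound 9/2. The distance to 5 later leaves room for an imaginary part.\<close>
  obtain L f where f: "fsupp L f" "sqn L f > 0" "sqn (L + 1) (\<lambda>n. ?J f n - z * f n) \<le> (1 / 2)\<^sup>2 * sqn L f"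
    using spectrum_weyl[OF z, of "1 / 2"] by auto
  have pt: "(cmod (?J f n))\<^sup>2 \<le> 4 * (cmod (f (n + 1)))\<^sup>2 + 4 * (cmod (f (n + (- 1))))\<^sup>2 + 8 * (cmod (f n))\<^sup>2" for n
  proof -
    let ?a = "cmod (f (n + 1))" and ?b = "cmod (f (n - 1))" and ?c = "cmod (f n)"
    have v: "\<bar>amo_pot \<alpha> \<theta> n\<bar> \<le> 2" by (simp add: amo_pot_def abs_mult)
    have "cmod (?J f n) \<le> ?a + ?b + 2 * ?c"
      unfolding jop_def using v by (intro norm_triangle_le add_mono) (auto simp: norm_mult mult_right_mono)
    then have "(cmod (?J f n))\<^sup>2 \<le> (?a + ?b + 2 * ?c)\<^sup>2" by (intro power_mono) auto
    also have "\<dots> \<le> 4 * ?a\<^sup>2 + 4 * ?b\<^sup>2 + 8 * ?c\<^sup>2"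
    proof -
      have "0 \<le> (?a - ?b)\<^sup>2 + 2 * (?a - ?c)\<^sup>2 + 2 * (?b - ?c)\<^sup>2" by simp
      then show ?thesis by (simp add: power2_eq_square algebra_simps)
    qed
    finally show ?thesis by simp
  qed
  have "sqn (L + 1) (?J f) \<le> (\<Sum>n\<in>{-(L+1)..L+1}. 4 * (cmod (f (n + 1)))\<^sup>2 + 4 * (cmod (f (n + (- 1))))\<^sup>2 + 8 * (cmod (f n))\<^sup>2)"
    unfolding sqn_def by (intro sum_mono pt)
  also have "\<dots> = 4 * (\<Sum>n\<in>{-(L+1)..L+1}. (cmod (f (n + 1)))\<^sup>2) + 4 * (\<Sum>n\<in>{-(L+1)..L+1}. (cmod (f (n + (- 1))))\<^sup>2)
     + 8 * (\<Sum>n\<in>{-(L+1)..L+1}. (cmod (f n))\<^sup>2)"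
    by (simp add: sum.distrib sum_distrib_left)
  also have "(\<Sum>n\<in>{-(L+1)..L+1}. (cmod (f (n + 1)))\<^sup>2) = sqn L f"
    unfolding sqn_def by (rule sum_shift_symmetric[where K=1]) (use f in \<open>auto simp: fsupp_def\<close>)
  also have "(\<Sum>n\<in>{-(L+1)..L+1}. (cmod (f (n + (- 1))))\<^sup>2) = sqn L f"
    unfolding sqn_def by (rule sum_shift_symmetric[where K=1]) (use f in \<open>auto simp: fsupp_def\<close>)
  also have sL: "(\<Sum>n\<in>{-(L+1)..L+1}. (cmod (f n))\<^sup>2) = sqn L f"
    using sqn_extend[OF f(1), of "L + 1"] by (simp add: sqn_def)
  finally have J: "sqn (L + 1) (?J f) \<le> 4\<^sup>2 * sqn L f" by simp
  have "cmod z * sqrt (sqn L f) = sqrt (sqn (L + 1) (\<lambda>n. z * f n))"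
    using sL by (simp add: sqn_def norm_mult power_mult_distrib sum_distrib_left[symmetric] real_sqrt_mult)
  also have "\<dots> \<le> L2_set (\<lambda>n. cmod (?J f n) + cmod (?J f n - z * f n)) {-(L+1)..L+1}"
    unfolding L2_sqn[symmetric] by (rule L2_set_mono) (auto intro: order_trans[OF norm_triangle_sub] simp: norm_minus_commute)
  also have "\<dots> \<le> sqrt (sqn (L + 1) (?J f)) + sqrt (sqn (L + 1) (\<lambda>n. ?J f n - z * f n))"
    unfolding L2_sqn[symmetric] by (rule L2_set_triangle_ineq)
  also have "\<dots> \<le> sqrt (4\<^sup>2 * sqn L f) + sqrt ((1 / 2)\<^sup>2 * sqn L f)"
    using J f(3) by (intro add_mono) auto
  also have "\<dots> = 9 / 2 * sqrt (sqn L f)" by (simp add: real_sqrt_mult real_sqrt_divide)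
  finally show ?thesis using f(2) by simp
qed

subsection \<open>The gauge transformation\<close>

text \<open>Discrete Parseval: frequencies whose differences stay below \<open>R\<close> remain
  distinct modulo \<open>R\<close>, so their characters are orthogonal on the grid.\<close>

lemma sum_grid_cis_sq:
  fixes b :: "int \<Rightarrow> complex" and R :: nat
  assumes R: "R > 0" "2 * L < int R"
  shows "(\<Sum>j<R. (cmod (\<Sum>n\<in>{-L..L}. b n * cis (2 * pi * real j * real_of_int n / real R)))\<^sup>2)
     = real R * (\<Sum>n\<in>{-L..L}. (cmod (b n))\<^sup>2)"
proof -
  define e where "e = (\<lambda>j n. cis (2 * pi * real j * real_of_int n / real R))"
  have orth: "(\<Sum>j<R. e j n * cnj (e j m)) = (if n = m then of_nat R else 0)" if nm: "n \<in> {-L..L}" "m \<in> {-L..L}" for n m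
  proof (cases "n = m")
    case True
    moreover have "e j m * cnj (e j m) = 1" for j
      using complex_norm_square[of "e j m"] by (simp add: e_def)
    ultimately show ?thesis by simp
  next
    case False
    define \<omega> where "\<omega> = cis (2 * pi * real_of_int (n - m) / real R)"
    have "e j n * cnj (e j m) = \<omega> ^ j" for j
    proof -
      have "e j n * cnj (e j m) = cis (2 * pi * real j * real_of_int n / real R + - (2 * pi * real j * real_of_int m / real R))"
        unfolding e_def cis_cnj by (rule cis_mult)
      also have "\<dots> = \<omega> ^ j" unfolding \<omega>_def Complex.DeMoivre
        by (rule arg_cong[of _ _ cis]) (simp add: algebra_simps diff_divide_distrib)
      finally show ?thesis .
    qed
    moreover have "\<omega> \<noteq> 1"
    proof
      assume "\<omega> = 1"
      then have "cos (2 * pi * real_of_int (n - m) / real R) = 1" by (simp add: \<omega>_def complex_eq_iff)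
      then obtain k :: int where "2 * pi * real_of_int (n - m) / real R = real_of_int k * 2 * pi"
        by (auto simp: cos_one_2pi_int)
      have "real_of_int (n - m) / real R = (2 * pi * real_of_int (n - m) / real R) / (2 * pi)" by simp
      also have "\<dots> = real_of_int k" unfolding \<open>2 * pi * real_of_int (n - m) / real R = real_of_int k * 2 * pi\<close> by simp
      finally have "real_of_int (n - m) / real R = real_of_int k" .
      then have "real_of_int (n - m) = real_of_int (k * int R)" using R by (simp add: field_simps)
      then have nmk: "n - m = k * int R" by (simp only: of_int_eq_iff)
      then have "k \<noteq> 0" using False by auto
      then have "1 * int R \<le> \<bar>k\<bar> * int R" by (intro mult_right_mono) auto
      then have "int R \<le> \<bar>k * int R\<bar>" by (simp add: abs_mult)
      then show False using nm nmk R by auto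
    qed
    moreover have "\<omega> ^ R = 1"
    proof -
      have "\<omega> ^ R = cis (2 * pi * of_int (n - m))" unfolding \<omega>_def Complex.DeMoivre using R by simp
      then show ?thesis by (simp only: cis_multiple_2pi[OF Ints_of_int])
    qed
    ultimately show ?thesis using False by (simp add: geometric_sum)
  qed
  have "complex_of_real (\<Sum>j<R. (cmod (\<Sum>n\<in>{-L..L}. b n * e j n))\<^sup>2)
     = (\<Sum>j<R. (\<Sum>n\<in>{-L..L}. b n * e j n) * cnj (\<Sum>m\<in>{-L..L}. b m * e j m))"
    unfolding of_real_sum complex_norm_square ..
  also have "\<dots> = (\<Sum>j<R. \<Sum>n\<in>{-L..L}. \<Sum>m\<in>{-L..L}. b n * cnj (b m) * (e j n * cnj (e j m)))"
    by (simp add: sum_product mult_ac)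
  also have "\<dots> = (\<Sum>n\<in>{-L..L}. \<Sum>m\<in>{-L..L}. \<Sum>j<R. b n * cnj (b m) * (e j n * cnj (e j m)))"
    by (subst sum.swap, intro sum.cong refl, subst sum.swap) simp
  also have "\<dots> = (\<Sum>n\<in>{-L..L}. \<Sum>m\<in>{-L..L}. b n * cnj (b m) * (if n = m then of_nat R else 0))"
    unfolding sum_distrib_left[symmetric] by (intro sum.cong refl) (simp add: orth)
  also have "\<dots> = (\<Sum>n\<in>{-L..L}. b n * cnj (b n) * of_nat R)"
    by (simp add: if_distrib[of "\<lambda>x. _ * x"] cong: if_cong)
  also have "\<dots> = complex_of_real (real R * (\<Sum>n\<in>{-L..L}. (cmod (b n))\<^sup>2))"
    unfolding of_real_mult of_real_sum complex_norm_square by (simp add: sum_distrib_left mult_ac)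
  finally show ?thesis unfolding e_def by (simp only: of_real_eq_iff)
qed

definition chain_int :: "real \<Rightarrow> real \<Rightarrow> int \<Rightarrow> real" where
  "chain_int \<alpha> y k = 2 * cos (pi * (y + \<alpha> * real_of_int k))"

text \<open>The gauge transformation: \<open>\<phi> n\<close>, read as a plane wave on the lattice of pairs \<open>(n, k - n)\<close>, is multiplied
  by a quadratic phase that turns the Landau gauge into one depending only on \<open>n + m = k\<close>; the
  remaining direction \<open>n - m = 2 n - k\<close> is Fourier transformed with quasi-momentum \<open>x\<close>.\<close>

definition gauge :: "real \<Rightarrow> real \<Rightarrow> real \<Rightarrow> int \<Rightarrow> int \<Rightarrow> complex" where
  "gauge \<alpha> \<theta> x n k = cis (2 * pi * (- \<alpha> / 4 * (real_of_int n)\<^sup>2 - \<alpha> / 2 * real_of_int n * real_of_int (k - n)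
      + \<alpha> / 4 * (real_of_int (k - n))\<^sup>2 - \<theta> * real_of_int (k - n) + x * real_of_int (2 * n - k)))"

text \<open>Equals \<open>pi * (y + \<alpha> * k)\<close> with
  \<open>y = \<alpha> / 2 - 2 * x\<close>, the angle of the chain bond \<open>k\<close>: the
  quasi-momentum becomes the phase of the chain.\<close>

definition gphase :: "real \<Rightarrow> real \<Rightarrow> real \<Rightarrow> int \<Rightarrow> real" where
  "gphase \<alpha> \<theta> x k = 2 * pi * (\<alpha> / 2 * (real_of_int k + 1 / 2) - x)"

text \<open>Each bond of the chain collects two hops of the lattice: one in \<open>n\<close>, which
  is the shift of the original operator, and one in \<open>k - n\<close>, whose phase is one of the
  two exponentials of the cosine potential. Their phases are conjugate and add up to
  \<open>2 * cos\<close>.\<close>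

lemma gauge_shift:
  "cis (gphase \<alpha> \<theta> x k) * gauge \<alpha> \<theta> x (n + 1) (k + 1) = gauge \<alpha> \<theta> x n k"
  "cis (- gphase \<alpha> \<theta> x k) * gauge \<alpha> \<theta> x n (k + 1) = gauge \<alpha> \<theta> x n k * cis (- (2 * pi * (\<alpha> * real_of_int n + \<theta>)))"
  "cis (- gphase \<alpha> \<theta> x (k - 1)) * gauge \<alpha> \<theta> x (n - 1) (k - 1) = gauge \<alpha> \<theta> x n k"
  "cis (gphase \<alpha> \<theta> x (k - 1)) * gauge \<alpha> \<theta> x n (k - 1) = gauge \<alpha> \<theta> x n k * cis (2 * pi * (\<alpha> * real_of_int n + \<theta>))"
  unfolding gauge_def gphase_def cis_mult
  by (rule arg_cong[of _ _ cis], simp add: field_simps power2_eq_square)+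

lemma cis_add_cis_minus: "cis a + cis (- a) = complex_of_real (2 * cos a)"
  by (simp add: complex_eq_iff)

text \<open>The weight \<open>g\<close> cuts off the second lattice direction, along which the plane
  wave has constant modulus and is not summable. Besides the error of \<phi> only differences of
  \<open>g\<close> remain, and these vanish where \<open>g\<close> is locally constant.\<close>

lemma gauge_intertwine:
  fixes \<phi> \<xi> :: "int \<Rightarrow> complex" and g :: "int \<Rightarrow> real" and \<alpha> \<theta> x :: real
  assumes \<phi>: "fsupp L \<phi>"
  defines "\<xi> \<equiv> \<lambda>k. \<Sum>n\<in>{-(L+1)..L+1}. gauge \<alpha> \<theta> x n k * \<phi> n * g (k - n)"
  shows "2 * cos (gphase \<alpha> \<theta> x k) * \<xi> (k + 1) + 2 * cos (gphase \<alpha> \<theta> x (k - 1)) * \<xi> (k - 1) - z * \<xi> k =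
    (\<Sum>n\<in>{-(L+1)..L+1}. gauge \<alpha> \<theta> x n k * (g (k - n) * (jop (\<lambda>_. 1) (amo_pot \<alpha> \<theta>) \<phi> n - z * \<phi> n)
       + \<phi> n * (cis (2 * pi * (\<alpha> * real_of_int n + \<theta>)) * (g (k - n - 1) - g (k - n))
               + cis (- (2 * pi * (\<alpha> * real_of_int n + \<theta>))) * (g (k - n + 1) - g (k - n)))))"
proof -
  let ?I = "{-(L+1)..L+1}"
  let ?G = "gauge \<alpha> \<theta> x"
  let ?w = "\<lambda>n. 2 * pi * (\<alpha> * real_of_int n + \<theta>)"
  have out: "\<phi> n = 0" if "\<bar>n\<bar> > L" for n using \<phi> that by (simp add: fsupp_def)
  have p1: "cis (gphase \<alpha> \<theta> x k) * \<xi> (k + 1) = (\<Sum>n\<in>?I. ?G n k * \<phi> (n + 1) * g (k - n))"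
  proof -
    have "cis (gphase \<alpha> \<theta> x k) * \<xi> (k + 1) = (\<Sum>n\<in>?I. cis (gphase \<alpha> \<theta> x k) * ?G n (k + 1) * \<phi> n * g (k + 1 - n))"
      by (simp add: \<xi>_def sum_distrib_left mult.assoc)
    also have "\<dots> = (\<Sum>n\<in>{-L..L}. cis (gphase \<alpha> \<theta> x k) * ?G n (k + 1) * \<phi> n * g (k + 1 - n))"
      by (rule sum_extend_symmetric) (auto simp: out)
    also have "\<dots> = (\<Sum>n\<in>?I. cis (gphase \<alpha> \<theta> x k) * ?G (n + 1) (k + 1) * \<phi> (n + 1) * g (k + 1 - (n + 1)))"
      by (rule sum_shift_symmetric[where K=1, symmetric]) (auto simp: out)
    finally show ?thesis unfolding gauge_shift(1) by simp
  qed
  have p3: "cis (- gphase \<alpha> \<theta> x (k - 1)) * \<xi> (k - 1) = (\<Sum>n\<in>?I. ?G n k * \<phi> (n - 1) * g (k - n))"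
  proof -
    have "cis (- gphase \<alpha> \<theta> x (k - 1)) * \<xi> (k - 1) = (\<Sum>n\<in>?I. cis (- gphase \<alpha> \<theta> x (k - 1)) * ?G n (k - 1) * \<phi> n * g (k - 1 - n))"
      by (simp add: \<xi>_def sum_distrib_left mult.assoc)
    also have "\<dots> = (\<Sum>n\<in>{-L..L}. cis (- gphase \<alpha> \<theta> x (k - 1)) * ?G n (k - 1) * \<phi> n * g (k - 1 - n))"
      by (rule sum_extend_symmetric) (auto simp: out)
    also have "\<dots> = (\<Sum>n\<in>?I. cis (- gphase \<alpha> \<theta> x (k - 1)) * ?G (n + -1) (k - 1) * \<phi> (n + -1) * g (k - 1 - (n + -1)))"
      by (rule sum_shift_symmetric[where K=1, symmetric]) (auto simp: out)
    finally show ?thesis using gauge_shift(3)[of \<alpha> \<theta> x k] by simp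
  qed
  have p2: "cis (- gphase \<alpha> \<theta> x k) * \<xi> (k + 1) = (\<Sum>n\<in>?I. ?G n k * cis (- ?w n) * \<phi> n * g (k - n + 1))"
  proof -
    have "cis (- gphase \<alpha> \<theta> x k) * \<xi> (k + 1) = (\<Sum>n\<in>?I. cis (- gphase \<alpha> \<theta> x k) * ?G n (k + 1) * \<phi> n * g (k + 1 - n))"
      by (simp add: \<xi>_def sum_distrib_left mult.assoc)
    then show ?thesis unfolding gauge_shift(2) by (simp add: algebra_simps)
  qed
  have p4: "cis (gphase \<alpha> \<theta> x (k - 1)) * \<xi> (k - 1) = (\<Sum>n\<in>?I. ?G n k * cis (?w n) * \<phi> n * g (k - n - 1))"
  proof -
    have "cis (gphase \<alpha> \<theta> x (k - 1)) * \<xi> (k - 1) = (\<Sum>n\<in>?I. cis (gphase \<alpha> \<theta> x (k - 1)) * ?G n (k - 1) * \<phi> n * g (k - 1 - n))"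
      by (simp add: \<xi>_def sum_distrib_left mult.assoc)
    then show ?thesis unfolding gauge_shift(4) by (simp add: algebra_simps)
  qed
  have "2 * cos (gphase \<alpha> \<theta> x k) * \<xi> (k + 1) + 2 * cos (gphase \<alpha> \<theta> x (k - 1)) * \<xi> (k - 1) - z * \<xi> k
     = (cis (gphase \<alpha> \<theta> x k) * \<xi> (k + 1) + cis (- gphase \<alpha> \<theta> x k) * \<xi> (k + 1))
       + (cis (gphase \<alpha> \<theta> x (k - 1)) * \<xi> (k - 1) + cis (- gphase \<alpha> \<theta> x (k - 1)) * \<xi> (k - 1)) - z * \<xi> k"
    unfolding distrib_right[symmetric] cis_add_cis_minus by simp
  also have "\<dots> = (\<Sum>n\<in>?I. ?G n k * \<phi> (n + 1) * g (k - n) + ?G n k * cis (- ?w n) * \<phi> n * g (k - n + 1)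
       + (?G n k * cis (?w n) * \<phi> n * g (k - n - 1) + ?G n k * \<phi> (n - 1) * g (k - n)) - z * (?G n k * \<phi> n * g (k - n)))"
    unfolding p1 p2 p3 p4 by (simp add: \<xi>_def sum.distrib sum_subtractf sum_distrib_left)
  also have "\<dots> = (\<Sum>n\<in>?I. ?G n k * (g (k - n) * (jop (\<lambda>_. 1) (amo_pot \<alpha> \<theta>) \<phi> n - z * \<phi> n)
       + \<phi> n * (cis (?w n) * (g (k - n - 1) - g (k - n)) + cis (- ?w n) * (g (k - n + 1) - g (k - n)))))"
  proof (intro sum.cong refl)
    fix n
    have pot: "complex_of_real (amo_pot \<alpha> \<theta> n) = cis (?w n) + cis (- ?w n)"
      by (simp only: cis_add_cis_minus amo_pot_def)
    show "?G n k * \<phi> (n + 1) * g (k - n) + ?G n k * cis (- ?w n) * \<phi> n * g (k - n + 1)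
       + (?G n k * cis (?w n) * \<phi> n * g (k - n - 1) + ?G n k * \<phi> (n - 1) * g (k - n)) - z * (?G n k * \<phi> n * g (k - n))
      = ?G n k * (g (k - n) * (jop (\<lambda>_. 1) (amo_pot \<alpha> \<theta>) \<phi> n - z * \<phi> n)
       + \<phi> n * (cis (?w n) * (g (k - n - 1) - g (k - n)) + cis (- ?w n) * (g (k - n + 1) - g (k - n))))"
      unfolding jop_def pot by (simp add: algebra_simps)
  qed
  finally show ?thesis .
qed

lemma gauge_split: "gauge \<alpha> \<theta> x n k = gauge \<alpha> \<theta> 0 n k * cis (- (2 * pi * x * real_of_int k)) * cis (2 * pi * x * real_of_int (2 * n))"
  unfolding gauge_def cis_mult by (rule arg_cong[of _ _ cis]) (simp add: algebra_simps)

text \<open>Averaging over the quasi-momenta \<open>x = j / (2 R)\<close> and over \<open>k\<close> is Parseval on the plane.\<close>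

lemma gauge_parseval:
  fixes b :: "int \<Rightarrow> int \<Rightarrow> complex" and R :: nat
  assumes R: "R > 0" "2 * L < int R"
  shows "(\<Sum>j<R. \<Sum>k\<in>K. (cmod (\<Sum>n\<in>{-L..L}. gauge \<alpha> \<theta> (real j / (2 * real R)) n k * b n k))\<^sup>2)
    = real R * (\<Sum>n\<in>{-L..L}. \<Sum>k\<in>K. (cmod (b n k))\<^sup>2)"
proof -
  have "(\<Sum>j<R. (cmod (\<Sum>n\<in>{-L..L}. gauge \<alpha> \<theta> (real j / (2 * real R)) n k * b n k))\<^sup>2)
     = real R * (\<Sum>n\<in>{-L..L}. (cmod (b n k))\<^sup>2)" for k
  proof -
    have "cmod (\<Sum>n\<in>{-L..L}. gauge \<alpha> \<theta> (real j / (2 * real R)) n k * b n k)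
       = cmod (\<Sum>n\<in>{-L..L}. (gauge \<alpha> \<theta> 0 n k * b n k) * cis (2 * pi * real j * real_of_int n / real R))" for j
    proof -
      let ?c = "cis (- (2 * pi * (real j / (2 * real R)) * real_of_int k))"
      have "(\<Sum>n\<in>{-L..L}. gauge \<alpha> \<theta> (real j / (2 * real R)) n k * b n k)
        = ?c * (\<Sum>n\<in>{-L..L}. (gauge \<alpha> \<theta> 0 n k * b n k) * cis (2 * pi * real j * real_of_int n / real R))"
        unfolding sum_distrib_left
      proof (intro sum.cong refl)
        fix n
        have "2 * pi * (real j / (2 * real R)) * real_of_int (2 * n) = 2 * pi * real j * real_of_int n / real R" by simp
        then show "gauge \<alpha> \<theta> (real j / (2 * real R)) n k * b n k
           = ?c * ((gauge \<alpha> \<theta> 0 n k * b n k) * cis (2 * pi * real j * real_of_int n / real R))"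
          by (subst gauge_split) (simp add: mult_ac)
      qed
      then show ?thesis by (simp add: norm_mult)
    qed
    then have "(\<Sum>j<R. (cmod (\<Sum>n\<in>{-L..L}. gauge \<alpha> \<theta> (real j / (2 * real R)) n k * b n k))\<^sup>2)
      = (\<Sum>j<R. (cmod (\<Sum>n\<in>{-L..L}. (gauge \<alpha> \<theta> 0 n k * b n k) * cis (2 * pi * real j * real_of_int n / real R)))\<^sup>2)"
      by simp
    also have "\<dots> = real R * (\<Sum>n\<in>{-L..L}. (cmod (gauge \<alpha> \<theta> 0 n k * b n k))\<^sup>2)" by (rule sum_grid_cis_sq[OF R])
    also have "\<dots> = real R * (\<Sum>n\<in>{-L..L}. (cmod (b n k))\<^sup>2)" by (simp add: norm_mult gauge_def)
    finally show ?thesis .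
  qed
  then have "(\<Sum>k\<in>K. \<Sum>j<R. (cmod (\<Sum>n\<in>{-L..L}. gauge \<alpha> \<theta> (real j / (2 * real R)) n k * b n k))\<^sup>2)
    = (\<Sum>k\<in>K. real R * (\<Sum>n\<in>{-L..L}. (cmod (b n k))\<^sup>2))" by simp
  then show ?thesis
    by (subst sum.swap) (simp add: sum_distrib_left[symmetric] sum.swap[of _ _ K])
qed

text \<open>By Parseval the squared norms and the squared errors, each summed over the
  quasi-momenta, are in the ratio wanted; hence some quasi-momentum does at least as well as the
  average.\<close>

lemma chain_weyl:
  assumes z: "z \<in> ell2_spectrum (critical_amo \<alpha> \<theta>)" and \<epsilon>: "\<epsilon> > 0"
  shows "\<exists>y L f. fsupp L f \<and> sqn L f > 0 \<and>
    sqn (L + 1) (\<lambda>n. jop (chain_int \<alpha> y) (\<lambda>_. 0) f n - z * f n) \<le> \<epsilon>\<^sup>2 * sqn L f"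
proof -
  obtain L \<phi> where \<phi>: "fsupp L \<phi>" "sqn L \<phi> > 0"
    "sqn (L + 1) (\<lambda>n. jop (\<lambda>_. 1) (amo_pot \<alpha> \<theta>) \<phi> n - z * \<phi> n) \<le> (\<epsilon> / 2)\<^sup>2 * sqn L \<phi>"
    using spectrum_weyl[OF z, of "\<epsilon> / 2"] \<epsilon> by auto
  have L0: "L \<ge> 0" using \<phi>(2) by (auto simp: sqn_def intro: ccontr)
  \<comment> \<open>For each \<open>n\<close> the cutoff carries mass \<open>M\<close> and has at
    most four boundary sites, which contribute at most 8 to the squared error; \<open>M\<close>
    makes this at most half of \<open>\<epsilon>^2 M\<close>.\<close>
  obtain M :: nat where M: "real M \<ge> max 2 (16 / \<epsilon>\<^sup>2)" using real_arch_simple by blast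
  then have M2: "M \<ge> 2" by simp
  then have M0: "M > 0" by simp
  have M8: "8 \<le> (\<epsilon>\<^sup>2 / 2) * real M" using M \<epsilon> by (simp add: field_simps)
  define g where "g = (\<lambda>m::int. if 0 \<le> m \<and> m < int M then 1 else 0 :: real)"
  define e where "e = (\<lambda>n. jop (\<lambda>_. 1) (amo_pot \<alpha> \<theta>) \<phi> n - z * \<phi> n)"
  define w where "w = (\<lambda>n. 2 * pi * (\<alpha> * real_of_int n + \<theta>))"
  define b where "b = (\<lambda>n k. g (k - n) * e n + \<phi> n * (cis (w n) * (g (k - n - 1) - g (k - n)) + cis (- w n) * (g (k - n + 1) - g (k - n))))"
  define N where "N = L + 1 + int M"
  define K where "K = {-(N + 1)..N + 1}"
  define R where "R = nat (2 * L + 3)"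
  have R: "R > 0" "2 * (L + 1) < int R" using L0 by (auto simp: R_def)
  define \<xi> where "\<xi> = (\<lambda>x k. \<Sum>n\<in>{-(L+1)..L+1}. gauge \<alpha> \<theta> x n k * (\<phi> n * g (k - n)))"
  define Y where "Y = (\<lambda>x. \<alpha> / 2 - 2 * x)"
  have err: "jop (chain_int \<alpha> (Y x)) (\<lambda>_. 0) (\<xi> x) k - z * \<xi> x k = (\<Sum>n\<in>{-(L+1)..L+1}. gauge \<alpha> \<theta> x n k * b n k)" for x k
  proof -
    have c: "chain_int \<alpha> (Y x) k = 2 * cos (gphase \<alpha> \<theta> x k)" for k
      unfolding chain_int_def gphase_def Y_def by (rule arg_cong[of _ _ "\<lambda>t. 2 * cos t"]) (simp add: algebra_simps)
    show ?thesis
      using gauge_intertwine[OF \<phi>(1), of \<alpha> \<theta> x k g z]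
      unfolding jop_def c \<xi>_def b_def e_def w_def by (simp add: mult.assoc)
  qed
  have \<xi>supp: "fsupp N (\<xi> x)" for x
    unfolding fsupp_def
  proof (intro allI impI)
    fix k assume k: "\<bar>k\<bar> > N"
    have "g (k - n) = 0" if "n \<in> {-(L+1)..L+1}" for n using k that by (auto simp: g_def N_def)
    then show "\<xi> x k = 0" unfolding \<xi>_def by (intro sum.neutral) auto
  qed
  have tot1: "(\<Sum>j<R. sqn (N + 1) (\<xi> (real j / (2 * real R)))) = real R * (real M * sqn L \<phi>)"
  proof -
    have "(\<Sum>j<R. sqn (N + 1) (\<xi> (real j / (2 * real R)))) = real R * (\<Sum>n\<in>{-(L+1)..L+1}. \<Sum>k\<in>K. (cmod (\<phi> n * g (k - n)))\<^sup>2)"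
      unfolding sqn_def \<xi>_def K_def by (rule gauge_parseval[OF R])
    also have "(\<Sum>n\<in>{-(L+1)..L+1}. \<Sum>k\<in>K. (cmod (\<phi> n * g (k - n)))\<^sup>2) = (\<Sum>n\<in>{-(L+1)..L+1}. (cmod (\<phi> n))\<^sup>2 * real M)"
    proof (intro sum.cong refl)
      fix n assume n: "n \<in> {-(L+1)..L+1}"
      have "(\<Sum>k\<in>K. (cmod (\<phi> n * g (k - n)))\<^sup>2) = (\<Sum>k\<in>{n..<n + int M}. (cmod (\<phi> n))\<^sup>2)"
        by (rule sum.mono_neutral_cong_right) (use n in \<open>auto simp: K_def N_def g_def norm_mult\<close>)
      then show "(\<Sum>k\<in>K. (cmod (\<phi> n * g (k - n)))\<^sup>2) = (cmod (\<phi> n))\<^sup>2 * real M" by simp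
    qed
    also have "\<dots> = sqn (L + 1) \<phi> * real M" by (simp add: sqn_def sum_distrib_right)
    also have "sqn (L + 1) \<phi> = sqn L \<phi>" by (rule sqn_extend[OF \<phi>(1)]) simp
    finally show ?thesis by (simp add: mult_ac)
  qed
  have tot2: "(\<Sum>j<R. sqn (N + 1) (\<lambda>k. jop (chain_int \<alpha> (Y (real j / (2 * real R)))) (\<lambda>_. 0) (\<xi> (real j / (2 * real R))) k - z * \<xi> (real j / (2 * real R)) k))
     \<le> real R * (\<epsilon>\<^sup>2 * (real M * sqn L \<phi>))"
  proof -
    have "(\<Sum>j<R. sqn (N + 1) (\<lambda>k. jop (chain_int \<alpha> (Y (real j / (2 * real R)))) (\<lambda>_. 0) (\<xi> (real j / (2 * real R))) k - z * \<xi> (real j / (2 * real R)) k))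
      = real R * (\<Sum>n\<in>{-(L+1)..L+1}. \<Sum>k\<in>K. (cmod (b n k))\<^sup>2)"
      unfolding err sqn_def K_def by (rule gauge_parseval[OF R])
    also have "\<dots> \<le> real R * (\<Sum>n\<in>{-(L+1)..L+1}. 2 * real M * (cmod (e n))\<^sup>2 + 8 * (cmod (\<phi> n))\<^sup>2)"
    proof (intro mult_left_mono sum_mono)
      fix n assume n: "n \<in> {-(L+1)..L+1}"
      define B where "B = {n - 1, n, n + int M - 1, n + int M}"
      have bd: "(cmod (b n k))\<^sup>2 \<le> 2 * (if k \<in> {n..<n + int M} then (cmod (e n))\<^sup>2 else 0) + 2 * (if k \<in> B then (cmod (\<phi> n))\<^sup>2 else 0)" for k
      proof -
        define q where "q = cis (w n) * (g (k - n - 1) - g (k - n)) + cis (- w n) * (g (k - n + 1) - g (k - n))"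
        have "cmod q \<le> \<bar>g (k - n - 1) - g (k - n)\<bar> + \<bar>g (k - n + 1) - g (k - n)\<bar>"
          unfolding q_def by (rule norm_triangle_le) (simp add: norm_mult flip: of_real_diff)
        also have "\<dots> \<le> (if k \<in> B then 1 else 0)"
          using M2 by (auto simp: g_def B_def)
        finally have q: "cmod q \<le> (if k \<in> B then 1 else 0)" .
        have "cmod (b n k) \<le> (if k \<in> {n..<n + int M} then cmod (e n) else 0) + (if k \<in> B then cmod (\<phi> n) else 0)"
        proof -
          have "cmod (b n k) \<le> cmod (g (k - n) * e n) + cmod (\<phi> n * q)"
            unfolding b_def q_def by (rule norm_triangle_ineq)
          moreover have "cmod (g (k - n) * e n) = (if k \<in> {n..<n + int M} then cmod (e n) else 0)"
            by (auto simp: g_def)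
          moreover have "cmod (\<phi> n * q) \<le> (if k \<in> B then cmod (\<phi> n) else 0)"
            using q mult_left_mono[OF q, of "cmod (\<phi> n)"] by (auto simp: norm_mult split: if_splits)
          ultimately show ?thesis by linarith
        qed
        then have "(cmod (b n k))\<^sup>2 \<le> ((if k \<in> {n..<n + int M} then cmod (e n) else 0) + (if k \<in> B then cmod (\<phi> n) else 0))\<^sup>2"
          by (intro power_mono) auto
        also have "\<dots> \<le> 2 * (if k \<in> {n..<n + int M} then cmod (e n) else 0)\<^sup>2 + 2 * (if k \<in> B then cmod (\<phi> n) else 0)\<^sup>2"
          using sum_squares_bound[of "if k \<in> {n..<n + int M} then cmod (e n) else 0" "if k \<in> B then cmod (\<phi> n) else 0"]
          by (simp only: power2_sum)
        finally show ?thesis by (auto split: if_splits)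
      qed
      have "(\<Sum>k\<in>K. (cmod (b n k))\<^sup>2) \<le> (\<Sum>k\<in>K. 2 * (if k \<in> {n..<n + int M} then (cmod (e n))\<^sup>2 else 0) + 2 * (if k \<in> B then (cmod (\<phi> n))\<^sup>2 else 0))"
        by (intro sum_mono bd)
      also have "\<dots> = 2 * (real (card (K \<inter> {n..<n + int M})) * (cmod (e n))\<^sup>2) + 2 * (real (card (K \<inter> B)) * (cmod (\<phi> n))\<^sup>2)"
      proof -
        have "(\<Sum>k\<in>K. if k \<in> A then x else 0) = real (card (K \<inter> A)) * x" for A x
          using sum.inter_restrict[of K "\<lambda>_. x" A] by (simp add: K_def)
        then show ?thesis by (simp only: sum.distrib sum_distrib_left[symmetric])
      qed
      also have "\<dots> \<le> 2 * (real M * (cmod (e n))\<^sup>2) + 2 * (4 * (cmod (\<phi> n))\<^sup>2)"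
      proof (intro add_mono mult_left_mono mult_right_mono)
        have "card (K \<inter> {n..<n + int M}) \<le> card {n..<n + int M}" by (intro card_mono) auto
        then show "real (card (K \<inter> {n..<n + int M})) \<le> real M" by simp
        have "card (K \<inter> B) \<le> card B" by (intro card_mono) (auto simp: B_def)
        also have "card B \<le> 4" using card_length[of "[n - 1, n, n + int M - 1, n + int M]"] by (simp add: B_def)
        finally show "real (card (K \<inter> B)) \<le> 4" by simp
      qed auto
      finally show "(\<Sum>k\<in>K. (cmod (b n k))\<^sup>2) \<le> 2 * real M * (cmod (e n))\<^sup>2 + 8 * (cmod (\<phi> n))\<^sup>2" by simp
    qed auto
    also have "(\<Sum>n\<in>{-(L+1)..L+1}. 2 * real M * (cmod (e n))\<^sup>2 + 8 * (cmod (\<phi> n))\<^sup>2) = 2 * real M * sqn (L + 1) e + 8 * sqn (L + 1) \<phi>"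
      by (simp add: sqn_def sum.distrib sum_distrib_left)
    also have "sqn (L + 1) \<phi> = sqn L \<phi>" by (rule sqn_extend[OF \<phi>(1)]) simp
    finally have "(\<Sum>j<R. sqn (N + 1) (\<lambda>k. jop (chain_int \<alpha> (Y (real j / (2 * real R)))) (\<lambda>_. 0) (\<xi> (real j / (2 * real R))) k - z * \<xi> (real j / (2 * real R)) k))
       \<le> real R * (2 * real M * sqn (L + 1) e + 8 * sqn L \<phi>)" .
    also have "2 * real M * sqn (L + 1) e + 8 * sqn L \<phi> \<le> 2 * real M * ((\<epsilon> / 2)\<^sup>2 * sqn L \<phi>) + \<epsilon>\<^sup>2 / 2 * real M * sqn L \<phi>"
      using \<phi>(3) M8 sqn_nonneg[of L \<phi>] unfolding e_def by (intro add_mono mult_left_mono mult_right_mono) auto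
    also have "\<dots> = \<epsilon>\<^sup>2 * (real M * sqn L \<phi>)" by (simp add: power_divide field_simps)
    finally show ?thesis by (simp add: mult_left_mono)
  qed
  have "\<exists>j<R. sqn (N + 1) (\<xi> (real j / (2 * real R))) > 0 \<and>
     sqn (N + 1) (\<lambda>k. jop (chain_int \<alpha> (Y (real j / (2 * real R)))) (\<lambda>_. 0) (\<xi> (real j / (2 * real R))) k - z * \<xi> (real j / (2 * real R)) k)
       \<le> \<epsilon>\<^sup>2 * sqn (N + 1) (\<xi> (real j / (2 * real R)))"
  proof (rule ccontr)
    assume neg: "\<not> ?thesis"
    let ?x = "\<lambda>j. real j / (2 * real R)"
    let ?E = "\<lambda>j. sqn (N + 1) (\<lambda>k. jop (chain_int \<alpha> (Y (?x j))) (\<lambda>_. 0) (\<xi> (?x j)) k - z * \<xi> (?x j) k)"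
    have ge: "\<epsilon>\<^sup>2 * sqn (N + 1) (\<xi> (?x j)) \<le> ?E j" "sqn (N + 1) (\<xi> (?x j)) > 0 \<Longrightarrow> \<epsilon>\<^sup>2 * sqn (N + 1) (\<xi> (?x j)) < ?E j" if "j < R" for j
    proof -
      show "sqn (N + 1) (\<xi> (?x j)) > 0 \<Longrightarrow> \<epsilon>\<^sup>2 * sqn (N + 1) (\<xi> (?x j)) < ?E j" using neg that by force
      then show "\<epsilon>\<^sup>2 * sqn (N + 1) (\<xi> (?x j)) \<le> ?E j"
      proof (cases "sqn (N + 1) (\<xi> (?x j)) > 0")
        case False
        then have "sqn (N + 1) (\<xi> (?x j)) = 0" using sqn_nonneg[of "N + 1" "\<xi> (?x j)"] by linarith
        then show ?thesis using sqn_nonneg by simp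
      qed simp
    qed
    have pos: "real R * (real M * sqn L \<phi>) > 0" using R(1) M0 \<phi>(2) by simp
    then have "\<exists>j<R. sqn (N + 1) (\<xi> (?x j)) > 0"
      using tot1 by (metis (mono_tags, lifting) lessThan_iff linorder_not_less sum_nonpos)
    then obtain j where j: "j < R" "sqn (N + 1) (\<xi> (?x j)) > 0" by blast
    have "(\<Sum>j<R. \<epsilon>\<^sup>2 * sqn (N + 1) (\<xi> (?x j))) < (\<Sum>j<R. ?E j)"
      by (rule sum_strict_mono_ex1) (use ge j in auto)
    then show False using tot2 tot1 by (simp add: sum_distrib_left[symmetric] mult.left_commute)
  qed
  then obtain x where x: "sqn (N + 1) (\<xi> x) > 0"
    "sqn (N + 1) (\<lambda>k. jop (chain_int \<alpha> (Y x)) (\<lambda>_. 0) (\<xi> x) k - z * \<xi> x k) \<le> \<epsilon>\<^sup>2 * sqn (N + 1) (\<xi> x)" by blast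
  have "sqn (N + 1) (\<xi> x) = sqn N (\<xi> x)" by (rule sqn_extend[OF \<xi>supp]) simp
  then show ?thesis using x \<xi>supp[of x] by auto
qed

text \<open>Passing to a site where \<open>f\<close> is not much smaller than on the surrounding window.\<close>

lemma chain_local_solution:
  assumes z: "z \<in> ell2_spectrum (critical_amo \<alpha> \<theta>)" and \<epsilon>: "\<epsilon> > 0"
  obtains y u where "u 0 = 1" "\<And>i. \<bar>i\<bar> \<le> int T \<Longrightarrow> cmod (u i) \<le> 4 * (real T + 1)"
    "\<And>i. \<bar>i\<bar> \<le> int T \<Longrightarrow> cmod (jop (chain_int \<alpha> y) (\<lambda>_. 0) u i - z * u i) \<le> \<epsilon>"
proof -
  \<comment> \<open>Summed over all centres, the windows \<open>S n\<close> give at most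
    \<open>2 * (2 * T + 1)\<close> times the squared norm of \<open>f\<close>, so they cannot all
    reach \<open>W\<close> times the squared value at the centre. The weight
    \<open>1 / \<delta>^2\<close> makes the error count like the solution.\<close>
  define W where "W = 4 * (2 * real T + 1)"
  have W: "W > 0" by (simp add: W_def)
  define \<delta> where "\<delta> = \<epsilon> / sqrt W"
  have \<delta>: "\<delta> > 0" using \<epsilon> W by (simp add: \<delta>_def)
  obtain y L f where f: "fsupp L f" "sqn L f > 0"
    "sqn (L + 1) (\<lambda>n. jop (chain_int \<alpha> y) (\<lambda>_. 0) f n - z * f n) \<le> \<delta>\<^sup>2 * sqn L f"
    using chain_weyl[OF z \<delta>] by blast
  define e where "e = (\<lambda>n. jop (chain_int \<alpha> y) (\<lambda>_. 0) f n - z * f n)"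
  have esupp: "fsupp (L + 1) e" using jop_fsupp[OF f(1)] f(1) by (auto simp: e_def fsupp_def)
  define S where "S = (\<lambda>n. \<Sum>i\<in>{-int T..int T}. (cmod (f (n + i)))\<^sup>2 + (cmod (e (n + i)))\<^sup>2 / \<delta>\<^sup>2)"
  define Q where "Q = L + 1 + int T"
  have "\<exists>n. f n \<noteq> 0 \<and> S n \<le> W * (cmod (f n))\<^sup>2"
  proof (rule ccontr)
    assume neg: "\<not> ?thesis"
    have S0: "S n \<ge> 0" for n unfolding S_def by (intro sum_nonneg add_nonneg_nonneg) auto
    have le: "W * (cmod (f n))\<^sup>2 \<le> S n" for n using neg S0[of n] by (cases "f n = 0") force+
    have "W * sqn Q f \<le> (\<Sum>n\<in>{-Q..Q}. S n)"
      unfolding sqn_def sum_distrib_left by (intro sum_mono le)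
    also have "\<dots> = (\<Sum>i\<in>{-int T..int T}. (\<Sum>n\<in>{-Q..Q}. (cmod (f (n + i)))\<^sup>2) + (\<Sum>n\<in>{-Q..Q}. (cmod (e (n + i)))\<^sup>2) / \<delta>\<^sup>2)"
      unfolding S_def by (subst sum.swap) (simp add: sum.distrib sum_divide_distrib)
    also have "\<dots> = (\<Sum>i\<in>{-int T..int T}. sqn L f + sqn (L + 1) e / \<delta>\<^sup>2)"
    proof (intro sum.cong refl)
      fix i assume i: "i \<in> {-int T..int T}"
      have "(\<Sum>n\<in>{-Q..Q}. (cmod (f (n + i)))\<^sup>2) = sqn L f"
        unfolding sqn_def by (rule sum_shift_symmetric[where K="int T"]) (use i f(1) in \<open>auto simp: fsupp_def Q_def\<close>)
      moreover have "(\<Sum>n\<in>{-Q..Q}. (cmod (e (n + i)))\<^sup>2) = sqn (L + 1) e"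
        unfolding sqn_def by (rule sum_shift_symmetric[where K="int T"]) (use i esupp in \<open>auto simp: fsupp_def Q_def\<close>)
      ultimately show "(\<Sum>n\<in>{-Q..Q}. (cmod (f (n + i)))\<^sup>2) + (\<Sum>n\<in>{-Q..Q}. (cmod (e (n + i)))\<^sup>2) / \<delta>\<^sup>2 = sqn L f + sqn (L + 1) e / \<delta>\<^sup>2"
        by simp
    qed
    also have "\<dots> = (2 * real T + 1) * (sqn L f + sqn (L + 1) e / \<delta>\<^sup>2)" by simp
    also have "\<dots> \<le> (2 * real T + 1) * (sqn L f + sqn L f)"
      using f(3) \<delta> by (intro mult_left_mono add_left_mono) (auto simp: e_def field_simps)
    also have "sqn Q f = sqn L f" by (rule sqn_extend[OF f(1)]) (simp add: Q_def)
    finally show False using f(2) by (simp add: W_def)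
  qed
  then obtain n where n: "f n \<noteq> 0" "S n \<le> W * (cmod (f n))\<^sup>2" by blast
  define u where "u = (\<lambda>i. f (n + i) / f n)"
  have "u 0 = 1" using n by (simp add: u_def)
  moreover have bd: "cmod (f (n + i)) \<le> sqrt W * cmod (f n)" "cmod (e (n + i)) \<le> \<epsilon> * cmod (f n)" if "\<bar>i\<bar> \<le> int T" for i
  proof -
    have "(cmod (f (n + i)))\<^sup>2 + (cmod (e (n + i)))\<^sup>2 / \<delta>\<^sup>2 \<le> S n"
      unfolding S_def using that by (intro member_le_sum[of i _ "\<lambda>i. (cmod (f (n + i)))\<^sup>2 + (cmod (e (n + i)))\<^sup>2 / \<delta>\<^sup>2"] add_nonneg_nonneg) auto
    then have 1: "(cmod (f (n + i)))\<^sup>2 + (cmod (e (n + i)))\<^sup>2 / \<delta>\<^sup>2 \<le> W * (cmod (f n))\<^sup>2" using n(2) by linarith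
    moreover have nn: "0 \<le> (cmod (e (n + i)))\<^sup>2 / \<delta>\<^sup>2" by simp
    moreover have "(sqrt W * cmod (f n))\<^sup>2 = W * (cmod (f n))\<^sup>2" using W by (simp add: power_mult_distrib)
    ultimately have "(cmod (f (n + i)))\<^sup>2 \<le> (sqrt W * cmod (f n))\<^sup>2" by linarith
    then show "cmod (f (n + i)) \<le> sqrt W * cmod (f n)" by (rule power2_le_imp_le) (use W in simp)
    have "0 \<le> (cmod (f (n + i)))\<^sup>2" by simp
    then have "(cmod (e (n + i)))\<^sup>2 / \<delta>\<^sup>2 \<le> W * (cmod (f n))\<^sup>2" using 1 by linarith
    then have "(cmod (e (n + i)))\<^sup>2 \<le> W * (cmod (f n))\<^sup>2 * \<delta>\<^sup>2" using \<delta> by (simp add: divide_le_eq)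
    also have "\<dots> = (\<epsilon> * cmod (f n))\<^sup>2" using W by (simp add: \<delta>_def power_mult_distrib power_divide)
    finally show "cmod (e (n + i)) \<le> \<epsilon> * cmod (f n)" by (rule power2_le_imp_le) (use \<epsilon> in simp)
  qed
  moreover have "cmod (u i) \<le> 4 * (real T + 1)" if "\<bar>i\<bar> \<le> int T" for i
  proof -
    have "cmod (u i) \<le> sqrt W" using bd(1)[OF that] n(1) by (simp add: u_def norm_divide field_simps)
    also have "\<dots> \<le> 4 * (real T + 1)"
    proof (rule real_le_lsqrt)
      show "W \<le> (4 * (real T + 1))\<^sup>2" by (simp add: W_def power2_eq_square algebra_simps)
    qed auto
    finally show ?thesis .
  qed
  moreover have "cmod (jop (chain_int \<alpha> (y + \<alpha> * of_int n)) (\<lambda>_. 0) u i - z * u i) \<le> \<epsilon>" if "\<bar>i\<bar> \<le> int T" for i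
  proof -
    have c: "chain_int \<alpha> (y + \<alpha> * of_int n) k = chain_int \<alpha> y (n + k)" for k
      by (simp add: chain_int_def algebra_simps)
    have "jop (chain_int \<alpha> (y + \<alpha> * of_int n)) (\<lambda>_. 0) u i - z * u i = e (n + i) / f n"
      unfolding jop_def c e_def u_def by (simp add: add_divide_distrib diff_divide_distrib algebra_simps)
    then show ?thesis unfolding norm_divide using bd(2)[OF that] n(1) by (simp add: norm_divide divide_le_eq)
  qed
  ultimately show ?thesis using that[of u "y + \<alpha> * of_int n"] by blast
qed

lemma spectrum_real:
  assumes z: "z \<in> ell2_spectrum (critical_amo \<alpha> \<theta>)"
  shows "z = complex_of_real (Re z)"
proof -
  have "Im z = 0" by (rule weyl_imp_real[where c="\<lambda>_. 1" and v="amo_pot \<alpha> \<theta>"]) (rule spectrum_weyl[OF z])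
  then show ?thesis by (simp add: complex_eq_iff)
qed

subsection \<open>Growth of the determinants\<close>

definition cdet :: "real \<Rightarrow> complex \<Rightarrow> real \<Rightarrow> nat \<Rightarrow> complex" where
  "cdet \<alpha> z y m = jdet (chain \<alpha> y) z m"

lemma chain_shift_fun: "(\<lambda>j. chain \<alpha> y (i + j)) = chain \<alpha> (y + \<alpha> * real i)"
  by (rule ext) (rule chain_shift)

lemma chain_sq_le: "(chain \<alpha> y j)\<^sup>2 \<le> 4"
  using abs_chain_le[of \<alpha> y j] by (simp add: abs_le_square_iff[of _ 2, simplified])

lemma cdet_split_le:
  assumes "a \<ge> 1" "b \<ge> 1"
  shows "cmod (cdet \<alpha> z y (a + b)) \<le> cmod (cdet \<alpha> z y a) * cmod (cdet \<alpha> z (y + \<alpha> * real a) b)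
     + 4 * (cmod (cdet \<alpha> z y (a - 1)) * cmod (cdet \<alpha> z (y + \<alpha> + \<alpha> * real a) (b - 1)))"
proof -
  obtain a' b' where ab: "a = Suc a'" "b = Suc b'" using assms by (metis One_nat_def Suc_le_D)
  have sh: "y + \<alpha> * real (Suc (Suc a')) = y + \<alpha> + \<alpha> * real a" by (simp add: ab algebra_simps)
  have "cdet \<alpha> z y (a + b) = cdet \<alpha> z y a * cdet \<alpha> z (y + \<alpha> * real a) b
     - (complex_of_real (chain \<alpha> y a))\<^sup>2 * (cdet \<alpha> z y (a - 1) * cdet \<alpha> z (y + \<alpha> + \<alpha> * real a) (b - 1))"
    unfolding cdet_def sh[symmetric]
    using jdet_split[of "chain \<alpha> y" z a' b'] unfolding chain_shift_fun by (simp only: ab diff_Suc_1 mult.assoc)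
  then have "cmod (cdet \<alpha> z y (a + b)) \<le> cmod (cdet \<alpha> z y a * cdet \<alpha> z (y + \<alpha> * real a) b)
     + cmod ((complex_of_real (chain \<alpha> y a))\<^sup>2 * (cdet \<alpha> z y (a - 1) * cdet \<alpha> z (y + \<alpha> + \<alpha> * real a) (b - 1)))"
    by (simp add: norm_triangle_ineq4)
  also have "\<dots> \<le> cmod (cdet \<alpha> z y a) * cmod (cdet \<alpha> z (y + \<alpha> * real a) b)
     + 4 * (cmod (cdet \<alpha> z y (a - 1)) * cmod (cdet \<alpha> z (y + \<alpha> + \<alpha> * real a) (b - 1)))"
    using chain_sq_le[of \<alpha> y a] by (intro add_mono) (auto simp: norm_mult norm_power intro!: mult_right_mono)
  finally show ?thesis .
qed

text \<open>Up to bounded factors the norm of the transfer matrix over \<open>m\<close> sites.\<close>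

definition dnorm :: "real \<Rightarrow> complex \<Rightarrow> real \<Rightarrow> nat \<Rightarrow> real" where
  "dnorm \<alpha> z y m = Max {cmod (cdet \<alpha> z y m), cmod (cdet \<alpha> z y (m - 1)),
     cmod (cdet \<alpha> z (y + \<alpha>) (m - 1)), cmod (cdet \<alpha> z (y + \<alpha>) (m - 2))}"

lemma dnorm_ge:
  "cmod (cdet \<alpha> z y m) \<le> dnorm \<alpha> z y m" "cmod (cdet \<alpha> z y (m - 1)) \<le> dnorm \<alpha> z y m"
  "cmod (cdet \<alpha> z (y + \<alpha>) (m - 1)) \<le> dnorm \<alpha> z y m" "cmod (cdet \<alpha> z (y + \<alpha>) (m - 2)) \<le> dnorm \<alpha> z y m"
  unfolding dnorm_def by (intro Max_ge; simp)+

lemma dnorm_le: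
  assumes "cmod (cdet \<alpha> z y m) \<le> b" "cmod (cdet \<alpha> z y (m - 1)) \<le> b"
    "cmod (cdet \<alpha> z (y + \<alpha>) (m - 1)) \<le> b" "cmod (cdet \<alpha> z (y + \<alpha>) (m - 2)) \<le> b"
  shows "dnorm \<alpha> z y m \<le> b"
  using assms unfolding dnorm_def by (subst Max_le_iff) auto

lemma dnorm_nonneg: "dnorm \<alpha> z y m \<ge> 0"
  using dnorm_ge(1)[of \<alpha> z y m] norm_ge_zero order_trans by blast

text \<open>Each of the four long determinants is cut between the two pieces, and all factors that
  arise are among the four short determinants of either piece. The constant is 1 + 4, with 4
  bounding the squared bond at the cut.\<close>

lemma dnorm_submult:
  assumes "m \<ge> 2" "p \<ge> 2"
  shows "dnorm \<alpha> z y (m + p) \<le> 5 * dnorm \<alpha> z y m * dnorm \<alpha> z (y + \<alpha> * real m) p"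
proof -
  let ?y = "y + \<alpha> * real m"
  let ?a = "dnorm \<alpha> z y m" and ?b = "dnorm \<alpha> z ?y p"
  have key: "u1 * u2 + 4 * (u3 * u4) \<le> 5 * ?a * ?b" if "0 \<le> u1" "u1 \<le> ?a" "0 \<le> u2" "u2 \<le> ?b" "0 \<le> u3" "u3 \<le> ?a" "0 \<le> u4" "u4 \<le> ?b" for u1 u2 u3 u4
  proof -
    have "u1 * u2 \<le> ?a * ?b" "u3 * u4 \<le> ?a * ?b" using that by (auto intro: mult_mono)
    then show ?thesis by simp
  qed
  have split: "cmod (cdet \<alpha> z y0 (a + b)) \<le> 5 * ?a * ?b"
    if ab: "a \<ge> 1" "b \<ge> 1" and y0: "y0 + \<alpha> * real a = ?y"
      and le: "cmod (cdet \<alpha> z y0 a) \<le> ?a" "cmod (cdet \<alpha> z y0 (a - 1)) \<le> ?a"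
        "cmod (cdet \<alpha> z ?y b) \<le> ?b" "cmod (cdet \<alpha> z (?y + \<alpha>) (b - 1)) \<le> ?b" for a b y0
  proof -
    have y1: "y0 + \<alpha> + \<alpha> * real a = ?y + \<alpha>" using y0 by linarith
    show ?thesis using cdet_split_le[OF ab, of \<alpha> z y0] key[OF norm_ge_zero le(1) norm_ge_zero le(3) norm_ge_zero le(2) norm_ge_zero le(4)]
      unfolding y0 y1 by linarith
  qed
  have ym: "y + \<alpha> + \<alpha> * real (m - 1) = ?y" using assms by (simp add: of_nat_diff algebra_simps)
  have e: "m - 1 - 1 = m - 2" "p - 1 - 1 = p - 2" "m + p - 1 = m + (p - 1)" "m + (p - 1) = (m - 1) + p" "m + p - 2 = (m - 1) + (p - 1)"
    using assms by auto
  have m1: "m \<ge> 1" "p \<ge> 1" "m - 1 \<ge> 1" "p - 1 \<ge> 1" using assms by auto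
  note A = dnorm_ge[of \<alpha> z y m] and B = dnorm_ge[of \<alpha> z ?y p]
  show ?thesis
  proof (rule dnorm_le)
    show "cmod (cdet \<alpha> z y (m + p)) \<le> 5 * ?a * ?b"
      by (rule split[OF m1(1,2) refl A(1,2) B(1,3)])
    show "cmod (cdet \<alpha> z y (m + p - 1)) \<le> 5 * ?a * ?b"
      unfolding e(3) by (rule split[OF m1(1,4) refl A(1,2) B(2)]) (use B(4) in \<open>simp only: e(2)\<close>)
    show "cmod (cdet \<alpha> z (y + \<alpha>) (m + p - 1)) \<le> 5 * ?a * ?b"
      unfolding e(3,4) by (rule split[OF m1(3,2) ym A(3) _ B(1,3)]) (use A(4) in \<open>simp only: e(1)\<close>)
    show "cmod (cdet \<alpha> z (y + \<alpha>) (m + p - 2)) \<le> 5 * ?a * ?b"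
      unfolding e(5) by (rule split[OF m1(3,4) ym A(3) _ B(2)]) (use A(4) B(4) in \<open>simp_all only: e(1,2)\<close>)
  qed
qed

lemma dnorm_iterate:
  assumes "k \<ge> 2"
  shows "5 * dnorm \<alpha> z y (k * Suc t) \<le> (\<Prod>i<Suc t. 5 * dnorm \<alpha> z (y + (real k * \<alpha>) * real i) k)"
proof (induction t)
  case 0
  then show ?case by simp
next
  case (Suc t)
  have "dnorm \<alpha> z y (k * Suc t + k) \<le> 5 * dnorm \<alpha> z y (k * Suc t) * dnorm \<alpha> z (y + \<alpha> * real (k * Suc t)) k"
    using assms by (intro dnorm_submult) (auto simp: trans_le_add1)
  then have "5 * dnorm \<alpha> z y (k * Suc (Suc t)) \<le> (5 * dnorm \<alpha> z y (k * Suc t)) * (5 * dnorm \<alpha> z (y + \<alpha> * real (k * Suc t)) k)"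
    by (simp add: add.commute)
  also have "\<dots> \<le> (\<Prod>i<Suc t. 5 * dnorm \<alpha> z (y + (real k * \<alpha>) * real i) k) * (5 * dnorm \<alpha> z (y + \<alpha> * real (k * Suc t)) k)"
    using Suc dnorm_nonneg by (intro mult_right_mono) auto
  also have "y + \<alpha> * real (k * Suc t) = y + (real k * \<alpha>) * real (Suc t)" unfolding of_nat_mult by (simp only: mult_ac)
  finally show ?case by (simp only: prod.lessThan_Suc)
qed

lemma cmod_cdet_le: "cmod z \<le> 5 \<Longrightarrow> cmod (cdet \<alpha> z y m) \<le> 6 ^ m"
  unfolding cdet_def by (rule cmod_jdet_le) (auto simp: abs_chain_le)

lemma dnorm_upper:
  assumes "cmod z \<le> 5"
  shows "dnorm \<alpha> z y m \<le> 6 ^ m"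
proof -
  have "cmod (cdet \<alpha> z y' i) \<le> 6 ^ m" if "i \<le> m" for y' i
  proof -
    have "cmod (cdet \<alpha> z y' i) \<le> 6 ^ i" by (rule cmod_cdet_le[OF assms])
    also have "(6::real) ^ i \<le> 6 ^ m" using that by (intro power_increasing) auto
    finally show ?thesis .
  qed
  then show ?thesis by (intro dnorm_le) auto
qed

lemma chain_add_int_sq: "(chain \<alpha> (y + of_int s) j)\<^sup>2 = (chain \<alpha> y j)\<^sup>2"
proof -
  have "pi * (y + of_int s + \<alpha> * real j) = pi * (y + \<alpha> * real j) + of_int s * pi" by (simp add: algebra_simps)
  moreover have s0: "sin (of_int s * pi) = 0" using sin_npi_int[of s] by (simp add: mult.commute)
  moreover have "(cos (of_int s * pi))\<^sup>2 = 1" using sin_cos_squared_add[of "of_int s * pi"] s0 by simp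
  ultimately show ?thesis by (simp add: chain_def cos_add power_mult_distrib)
qed

lemma jdet_cong_sq:
  assumes "\<And>j. (c' j)\<^sup>2 = (c j)\<^sup>2"
  shows "jdet c' z k = jdet c z k"
proof (induction k rule: induct_nat_012)
  case (ge2 n)
  have "(complex_of_real (c' (Suc n)))\<^sup>2 = (complex_of_real (c (Suc n)))\<^sup>2"
    using assms[of "Suc n"] by (metis of_real_power)
  then show ?case using ge2 by simp
qed auto

lemma cdet_add_int: "cdet \<alpha> z (y + of_int s) m = cdet \<alpha> z y m"
  unfolding cdet_def by (rule jdet_cong_sq) (rule chain_add_int_sq)

lemma dnorm_add_int: "dnorm \<alpha> z (y + of_int s) m = dnorm \<alpha> z y m"
proof -
  have "y + of_int s + \<alpha> = y + \<alpha> + of_int s" by simp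
  then show ?thesis unfolding dnorm_def by (simp only: cdet_add_int)
qed

subsection \<open>Trigonometric polynomials\<close>

text \<open>Multiplying a trigonometric polynomial of degree \<open>D\<close> by the
  \<open>D\<close>-th power of the character gives an ordinary polynomial; level sets of a
  nonconstant one then have at most \<open>2 * D\<close> points per period.\<close>

definition tpoly :: "nat \<Rightarrow> (real \<Rightarrow> complex) \<Rightarrow> bool" where
  "tpoly D f \<longleftrightarrow> (\<exists>p::complex poly. degree p \<le> 2 * D \<and> (\<forall>y. f y * cis (2 * pi * y) ^ D = poly p (cis (2 * pi * y))))"

lemma tpoly_mono: "tpoly D f \<Longrightarrow> D \<le> D' \<Longrightarrow> tpoly D' f"
  unfolding tpoly_def
proof (elim exE conjE)
  fix p assume p: "degree p \<le> 2 * D" "\<forall>y. f y * cis (2 * pi * y) ^ D = poly p (cis (2 * pi * y))" and D: "D \<le> D'"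
  show "\<exists>p. degree p \<le> 2 * D' \<and> (\<forall>y. f y * cis (2 * pi * y) ^ D' = poly p (cis (2 * pi * y)))"
  proof (intro exI[of _ "p * [:0, 1:] ^ (D' - D)"] conjI allI)
    have "degree (p * [:0, 1:] ^ (D' - D)) \<le> degree p + (D' - D)"
      by (rule order_trans[OF degree_mult_le]) (simp add: degree_linear_power)
    then show "degree (p * [:0, 1:] ^ (D' - D)) \<le> 2 * D'" using p(1) D by linarith
    fix y
    have "cis (2 * pi * y) ^ D' = cis (2 * pi * y) ^ D * cis (2 * pi * y) ^ (D' - D)"
      using D by (simp flip: power_add)
    then show "f y * cis (2 * pi * y) ^ D' = poly (p * [:0, 1:] ^ (D' - D)) (cis (2 * pi * y))"
      using p(2) by (simp add: mult.assoc[symmetric])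
  qed
qed

lemma tpoly_mult: "tpoly D f \<Longrightarrow> tpoly D' g \<Longrightarrow> tpoly (D + D') (\<lambda>y. f y * g y)"
  unfolding tpoly_def
proof (elim exE conjE)
  fix p q assume p: "degree p \<le> 2 * D" "\<forall>y. f y * cis (2 * pi * y) ^ D = poly p (cis (2 * pi * y))"
    and q: "degree q \<le> 2 * D'" "\<forall>y. g y * cis (2 * pi * y) ^ D' = poly q (cis (2 * pi * y))"
  show "\<exists>p. degree p \<le> 2 * (D + D') \<and> (\<forall>y. f y * g y * cis (2 * pi * y) ^ (D + D') = poly p (cis (2 * pi * y)))"
  proof (intro exI[of _ "p * q"] conjI allI)
    show "degree (p * q) \<le> 2 * (D + D')" using order_trans[OF degree_mult_le add_mono[OF p(1) q(1)]] by (simp add: distrib_left)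
    fix y
    show "f y * g y * cis (2 * pi * y) ^ (D + D') = poly (p * q) (cis (2 * pi * y))"
      using p(2)[rule_format, of y, symmetric] q(2)[rule_format, of y, symmetric] by (simp add: power_add mult_ac)
  qed
qed

lemma tpoly_add: "tpoly D f \<Longrightarrow> tpoly D g \<Longrightarrow> tpoly D (\<lambda>y. f y + g y)"
  unfolding tpoly_def
proof (elim exE conjE)
  fix p q assume p: "degree p \<le> 2 * D" "\<forall>y. f y * cis (2 * pi * y) ^ D = poly p (cis (2 * pi * y))"
    and q: "degree q \<le> 2 * D" "\<forall>y. g y * cis (2 * pi * y) ^ D = poly q (cis (2 * pi * y))"
  show "\<exists>p. degree p \<le> 2 * D \<and> (\<forall>y. (f y + g y) * cis (2 * pi * y) ^ D = poly p (cis (2 * pi * y)))"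
    using p q by (intro exI[of _ "p + q"]) (auto simp: distrib_right degree_add_le)
qed

lemma tpoly_const: "tpoly D (\<lambda>_. c)"
proof -
  have "tpoly 0 (\<lambda>_. c)" unfolding tpoly_def by (intro exI[of _ "[:c:]"]) simp
  then show ?thesis by (rule tpoly_mono) simp
qed

lemma tpoly_chain_sq: "tpoly 1 (\<lambda>y. (complex_of_real (chain \<alpha> (y + a) j))\<^sup>2)"
  unfolding tpoly_def
proof (intro exI[of _ "[:cis (- (2 * pi * (a + \<alpha> * real j))), 2, cis (2 * pi * (a + \<alpha> * real j)):]"] conjI allI)
  fix y
  define t where "t = a + \<alpha> * real j"
  define w where "w = cis (pi * (y + t))"
  have "complex_of_real (chain \<alpha> (y + a) j) = w + cis (- (pi * (y + t)))"
    by (simp only: w_def cis_add_cis_minus chain_def t_def add.assoc)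
  also have "cis (- (pi * (y + t))) = cnj w" by (simp add: w_def cis_cnj)
  finally have c: "complex_of_real (chain \<alpha> (y + a) j) = w + cnj w" .
  have ww: "w * cnj w = 1" using complex_norm_square[of w] by (simp add: w_def)
  have "(complex_of_real (chain \<alpha> (y + a) j))\<^sup>2 = w * w + 2 * (w * cnj w) + cnj w * cnj w"
    unfolding c by (simp add: power2_eq_square algebra_simps)
  also have "\<dots> = cis (2 * pi * t) * cis (2 * pi * y) + 2 + cis (- (2 * pi * t)) * cis (- (2 * pi * y))"
  proof -
    have "w * w = cis (2 * pi * t) * cis (2 * pi * y)" unfolding w_def cis_mult by (rule arg_cong[of _ _ cis]) (simp add: algebra_simps)
    moreover have "cnj w * cnj w = cis (- (2 * pi * t)) * cis (- (2 * pi * y))"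
      unfolding w_def cis_cnj cis_mult by (rule arg_cong[of _ _ cis]) (simp add: algebra_simps)
    ultimately show ?thesis using ww by simp
  qed
  finally have sq: "(complex_of_real (chain \<alpha> (y + a) j))\<^sup>2 = cis (2 * pi * t) * cis (2 * pi * y) + 2 + cis (- (2 * pi * t)) * cis (- (2 * pi * y))" .
  have inv: "cis (- (2 * pi * y)) * cis (2 * pi * y) = 1" by (simp add: cis_mult)
  show "(complex_of_real (chain \<alpha> (y + a) j))\<^sup>2 * cis (2 * pi * y) ^ 1 =
     poly [:cis (- (2 * pi * (a + \<alpha> * real j))), 2, cis (2 * pi * (a + \<alpha> * real j)):] (cis (2 * pi * y))"
    unfolding sq t_def[symmetric] using inv by (simp add: algebra_simps)
qed simp

text \<open>Every bond enters squared and occupies two sites, so at most \<open>m div 2\<close>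
  bonds occur in one term.\<close>

lemma tpoly_cdet: "tpoly (m div 2) (\<lambda>y. cdet \<alpha> z (y + a) m)"
  unfolding cdet_def
proof (induction m rule: induct_nat_012)
  case 0
  then show ?case by (simp add: tpoly_const)
next
  case 1
  then show ?case by (simp add: tpoly_const)
next
  case (ge2 n)
  have "tpoly (0 + Suc n div 2) (\<lambda>y. z * jdet (chain \<alpha> (y + a)) z (Suc n))"
    by (rule tpoly_mult[OF tpoly_const ge2(2)])
  then have 1: "tpoly (Suc (Suc n) div 2) (\<lambda>y. z * jdet (chain \<alpha> (y + a)) z (Suc n))"
    by (rule tpoly_mono) simp
  have "tpoly (0 + (1 + n div 2)) (\<lambda>y. (-1) * ((complex_of_real (chain \<alpha> (y + a) (Suc n)))\<^sup>2 * jdet (chain \<alpha> (y + a)) z n))"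
    by (rule tpoly_mult[OF tpoly_const tpoly_mult[OF tpoly_chain_sq ge2(1)]])
  then have 2: "tpoly (Suc (Suc n) div 2) (\<lambda>y. (-1) * ((complex_of_real (chain \<alpha> (y + a) (Suc n)))\<^sup>2 * jdet (chain \<alpha> (y + a)) z n))"
    by (rule tpoly_mono) simp
  show ?case using tpoly_add[OF 1 2] by simp
qed

text \<open>A substitute for the square of \<open>dnorm\<close> at real energies, equivalent up to
  the factor 4: a sum of squares, unlike a maximum, is a trigonometric polynomial, here of degree at
  most \<open>k\<close>.\<close>

definition dsq :: "real \<Rightarrow> real \<Rightarrow> real \<Rightarrow> nat \<Rightarrow> real" where
  "dsq \<alpha> E y k = (Re (cdet \<alpha> E y k))\<^sup>2 + (Re (cdet \<alpha> E y (k - 1)))\<^sup>2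
     + (Re (cdet \<alpha> E (y + \<alpha>) (k - 1)))\<^sup>2 + (Re (cdet \<alpha> E (y + \<alpha>) (k - 2)))\<^sup>2"

lemma cdet_real: "cdet \<alpha> (complex_of_real E) y m = complex_of_real (Re (cdet \<alpha> (complex_of_real E) y m))"
  unfolding cdet_def by (rule jdet_real)

lemma cdet_Re_sq: "(Re (cdet \<alpha> (complex_of_real E) y m))\<^sup>2 = (cmod (cdet \<alpha> (complex_of_real E) y m))\<^sup>2"
proof -
  have "cmod (cdet \<alpha> (complex_of_real E) y m) = \<bar>Re (cdet \<alpha> (complex_of_real E) y m)\<bar>"
    by (metis cdet_real norm_of_real)
  then show ?thesis by simp
qed

lemma dsq_dnorm:
  "dsq \<alpha> E y k \<le> 4 * (dnorm \<alpha> E y k)\<^sup>2" "(dnorm \<alpha> E y k)\<^sup>2 \<le> dsq \<alpha> E y k"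
proof -
  have sq: "(cmod w)\<^sup>2 \<le> (dnorm \<alpha> E y k)\<^sup>2" if "cmod w \<le> dnorm \<alpha> E y k" for w
    using that by (intro power_mono) auto
  show "dsq \<alpha> E y k \<le> 4 * (dnorm \<alpha> E y k)\<^sup>2"
    unfolding dsq_def cdet_Re_sq
    using sq[OF dnorm_ge(1)] sq[OF dnorm_ge(2)] sq[OF dnorm_ge(3)] sq[OF dnorm_ge(4)] by linarith
  have "dnorm \<alpha> E y k \<in> {cmod (cdet \<alpha> E y k), cmod (cdet \<alpha> E y (k - 1)), cmod (cdet \<alpha> E (y + \<alpha>) (k - 1)), cmod (cdet \<alpha> E (y + \<alpha>) (k - 2))}"
    unfolding dnorm_def by (rule Max_in) auto
  then show "(dnorm \<alpha> E y k)\<^sup>2 \<le> dsq \<alpha> E y k"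
    unfolding dsq_def cdet_Re_sq by auto
qed

lemma dsq_add_int: "dsq \<alpha> E (y + of_int s) k = dsq \<alpha> E y k"
proof -
  have "y + of_int s + \<alpha> = y + \<alpha> + of_int s" by simp
  then show ?thesis unfolding dsq_def by (simp only: cdet_add_int)
qed

lemma tpoly_dsq: "tpoly k (\<lambda>y. complex_of_real (dsq \<alpha> E y k))"
proof -
  have sq: "tpoly k (\<lambda>y. cdet \<alpha> E (y + a) m * cdet \<alpha> E (y + a) m)" if "m \<le> k" for a m
    by (rule tpoly_mono[OF tpoly_mult[OF tpoly_cdet tpoly_cdet]]) (use that in auto)
  have eq: "complex_of_real (dsq \<alpha> E y k) = cdet \<alpha> E (y + 0) k * cdet \<alpha> E (y + 0) k + cdet \<alpha> E (y + 0) (k - 1) * cdet \<alpha> E (y + 0) (k - 1)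
     + cdet \<alpha> E (y + \<alpha>) (k - 1) * cdet \<alpha> E (y + \<alpha>) (k - 1) + cdet \<alpha> E (y + \<alpha>) (k - 2) * cdet \<alpha> E (y + \<alpha>) (k - 2)" for y
    unfolding dsq_def of_real_add of_real_power cdet_real[symmetric] by (simp add: power2_eq_square)
  show ?thesis unfolding eq by (intro tpoly_add sq) auto
qed

lemma continuous_jdet: "continuous_on UNIV (\<lambda>y. cdet \<alpha> z (y + a) m)"
  unfolding cdet_def
proof (induction m rule: induct_nat_012)
  case (ge2 n)
  have "continuous_on UNIV (\<lambda>y. complex_of_real (chain \<alpha> (y + a) (Suc n)))"
    unfolding chain_def by (intro continuous_intros)
  then show ?case using ge2 by (simp, intro continuous_intros)
qed (auto intro: continuous_intros)

lemma continuous_dsq: "continuous_on UNIV (\<lambda>y. dsq \<alpha> E y k)"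
  using continuous_jdet[of \<alpha> E 0] continuous_jdet[of \<alpha> E \<alpha>] unfolding dsq_def
  by (intro continuous_intros) auto

text \<open>Each point with \<open>f < t1\<close> has two adjacent half arcs; a half arc on which \<open>f < t2\<close> fails contains
  a zero of \<open>f - \<tau>\<close>, and there are at most \<open>2 D\<close> of these.\<close>

lemma half_arcs:
  fixes f :: "real \<Rightarrow> real" and P :: "real set" and M :: nat
  assumes tp: "tpoly D (\<lambda>y. complex_of_real (f y))" and cont: "continuous_on UNIV f"
    and per: "\<And>y (s::int). f (y + of_int s) = f y"
    and t: "t1 < t2" and P: "finite P" "\<And>p. p \<in> P \<Longrightarrow> f p < t1"
    and lam: "0 < l" "2 * l \<le> 1" and sep: "\<And>p p' (s::int). p \<in> P \<Longrightarrow> p' \<in> P \<Longrightarrow> p \<noteq> p' \<Longrightarrow> \<bar>p - p' - of_int s\<bar> \<ge> 2 * l"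
    and M: "M > 0" "2 / real M \<le> l"
  obtains I where "I \<subseteq> {..<M}" "2 * card P \<le> 2 * D + card I"
    "\<And>i y. i \<in> I \<Longrightarrow> real i / real M \<le> y \<Longrightarrow> y < (real i + 1) / real M \<Longrightarrow> f y < t2"
proof -
  \<comment> \<open>The flag tells whether the half arc lies to the right or to the left of the
    point. By separation all half arcs are disjoint modulo 1, which \<open>uniq\<close>
    records.\<close>
  define arc where "arc = (\<lambda>(p, b). if b then {p<..<p + l} else {p - l<..<p})"
  define A where "A = P \<times> {True, False}"
  have finA: "finite A" using P by (simp add: A_def)
  have cardA: "card A = 2 * card P" by (simp add: A_def card_cartesian_product)
  have uniq: "a = a'" if a: "a \<in> A" "a' \<in> A" "x \<in> arc a" "x' \<in> arc a'" "x - x' = of_int s" for a a' x x' and s :: int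
  proof -
    obtain p b p' b' where pb: "a = (p, b)" "a' = (p', b')" by (cases a, cases a') auto
    have xp: "\<bar>x - p\<bar> < l" "\<bar>x' - p'\<bar> < l" using a lam(1) by (auto simp: pb arc_def split: if_splits)
    have "p = p'"
    proof (rule ccontr)
      assume "p \<noteq> p'"
      then have "\<bar>p - p' - of_int s\<bar> \<ge> 2 * l" using sep a by (auto simp: A_def pb)
      moreover have "p - p' - of_int s = (x' - p') - (x - p)" using a(5) by linarith
      ultimately show False using xp by linarith
    qed
    then have "\<bar>of_int s :: real\<bar> < 1" using a(5) xp lam by linarith
    then have "s = 0" by linarith
    then have "x = x'" using a(5) by simp
    then have "b = b'" using a \<open>p = p'\<close> by (auto simp: pb arc_def split: if_splits)
    then show ?thesis using \<open>p = p'\<close> pb by simp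
  qed
  define G where "G = {a \<in> A. \<forall>y\<in>arc a. f y < t2}"
  define B where "B = A - G"
  \<comment> \<open>A level strictly between the thresholds: \<open>f\<close> crosses it inside each
    half arc on which it reaches \<open>t2\<close>.\<close>
  define \<tau> where "\<tau> = (t1 + t2) / 2"
  have "\<exists>\<zeta>\<in>arc a. f \<zeta> = \<tau>" if aB: "a \<in> B" for a
  proof -
    obtain p b where pb: "a = (p, b)" by (cases a)
    obtain y where y: "y \<in> arc a" "f y \<ge> t2" using aB by (auto simp: B_def G_def not_less)
    have fp: "f p < t1" using aB P by (auto simp: B_def A_def pb)
    have c: "continuous_on {u..v} f" for u v using cont continuous_on_subset by blast
    show ?thesis
    proof (cases b)
      case True
      then have py: "p < y" "y < p + l" using y by (auto simp: pb arc_def)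
      obtain \<zeta> where \<zeta>: "p \<le> \<zeta>" "\<zeta> \<le> y" "f \<zeta> = \<tau>"
        using IVT'[of f p \<tau> y] py fp y(2) t c by (auto simp: \<tau>_def)
      then have "\<zeta> \<noteq> p" using fp t by (auto simp: \<tau>_def)
      then show ?thesis using \<zeta> py True by (auto simp: pb arc_def intro!: bexI[of _ \<zeta>])
    next
      case False
      then have py: "p - l < y" "y < p" using y by (auto simp: pb arc_def)
      obtain \<zeta> where \<zeta>: "y \<le> \<zeta>" "\<zeta> \<le> p" "f \<zeta> = \<tau>"
        using IVT2'[of f p \<tau> y] py fp y(2) t c by (auto simp: \<tau>_def)
      then have "\<zeta> \<noteq> p" using fp t by (auto simp: \<tau>_def)
      then show ?thesis using \<zeta> py False by (auto simp: pb arc_def intro!: bexI[of _ \<zeta>])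
    qed
  qed
  then obtain Z where Z: "\<And>a. a \<in> B \<Longrightarrow> Z a \<in> arc a \<and> f (Z a) = \<tau>" by metis
  have cisint: "\<exists>s::int. x - x' = of_int s" if "cis (2 * pi * x) = cis (2 * pi * x')" for x x'
  proof -
    have "cis (2 * pi * x - 2 * pi * x') = 1" using that by (simp flip: cis_divide)
    then have "cos (2 * pi * x - 2 * pi * x') = 1" by (simp add: complex_eq_iff)
    then obtain s :: int where s: "2 * pi * x - 2 * pi * x' = of_int s * 2 * pi" by (auto simp: cos_one_2pi_int)
    have "x - x' = (2 * pi * x - 2 * pi * x') / (2 * pi)" by (simp add: diff_divide_distrib)
    also have "\<dots> = of_int s" unfolding s by simp
    finally show ?thesis by blast
  qed
  have cardB: "card B \<le> 2 * D"
  proof (cases "B = {}")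
    case False
    then obtain a0 where a0: "a0 \<in> B" by blast
    obtain p where p: "degree p \<le> 2 * D" "\<And>y. complex_of_real (f y) * cis (2 * pi * y) ^ D = poly p (cis (2 * pi * y))"
      using tp by (auto simp: tpoly_def)
    define q where "q = p - [:complex_of_real \<tau>:] * [:0, 1:] ^ D"
    have q: "poly q (cis (2 * pi * y)) = (complex_of_real (f y) - complex_of_real \<tau>) * cis (2 * pi * y) ^ D" for y
      by (simp add: q_def p(2)[symmetric] left_diff_distrib)
    have q0: "q \<noteq> 0"
    proof
      assume "q = 0"
      then have "complex_of_real (f (fst a0)) = complex_of_real \<tau>" using q[of "fst a0"] by simp
      then have "f (fst a0) = \<tau>" by (simp only: of_real_eq_iff)
      then show False using P(2)[of "fst a0"] a0 t by (auto simp: B_def A_def \<tau>_def)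
    qed
    have degq: "degree q \<le> 2 * D"
      unfolding q_def using p(1) by (intro degree_diff_le order_trans[OF degree_mult_le]) (auto simp: degree_linear_power)
    have inj: "inj_on (\<lambda>a. cis (2 * pi * Z a)) B"
    proof (rule inj_onI)
      fix a a' assume a: "a \<in> B" "a' \<in> B" "cis (2 * pi * Z a) = cis (2 * pi * Z a')"
      then obtain s :: int where "Z a - Z a' = of_int s" using cisint by blast
      then show "a = a'" using uniq[of a a' "Z a" "Z a'" s] Z a by (auto simp: B_def)
    qed
    have "card B = card ((\<lambda>a. cis (2 * pi * Z a)) ` B)" using card_image[OF inj] by simp
    also have "\<dots> \<le> card {w. poly q w = 0}"
      using Z q by (intro card_mono poly_roots_finite[OF q0]) auto
    also have "\<dots> \<le> degree q" by (rule card_poly_roots_bound[OF q0])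
    finally show ?thesis using degq by simp
  qed simp
  \<comment> \<open>The first grid cell starting strictly inside the half arc;
    \<open>2 / real M \<le> l\<close> lets the whole cell fit.\<close>
  define cell where "cell = (\<lambda>a. \<lfloor>(if snd a then fst a else fst a - l) * real M\<rfloor> + 1)"
  have cell: "{of_int (cell a) / real M..<(of_int (cell a) + 1) / real M} \<subseteq> arc a" for a
  proof -
    define left where "left = (if snd a then fst a else fst a - l)"
    have arc: "arc a = {left<..<left + l}" by (cases a) (auto simp: arc_def left_def)
    have "left * real M < of_int (cell a)" "of_int (cell a) \<le> left * real M + 1" unfolding cell_def left_def[symmetric] by linarith+
    then have "left < of_int (cell a) / real M" using M(1) by (simp add: field_simps)
    moreover have "(of_int (cell a) + 1) / real M \<le> left + 2 / real M"
    proof -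
      have "(of_int (cell a) + 1) / real M \<le> (left * real M + 2) / real M"
        using \<open>of_int (cell a) \<le> left * real M + 1\<close> M(1) by (intro divide_right_mono) auto
      then show ?thesis using M(1) by (simp add: add_divide_distrib)
    qed
    ultimately have "left < of_int (cell a) / real M" "(of_int (cell a) + 1) / real M \<le> left + 2 / real M" by auto
    then show ?thesis unfolding arc using M(2) by auto
  qed
  have cell0: "of_int (cell a) / real M \<in> arc a" for a
    using cell[of a] M(1) by (auto simp: divide_strict_right_mono)
  define idx where "idx = (\<lambda>a. nat (cell a mod int M))"
  have injG: "inj_on idx G"
  proof (rule inj_onI)
    fix a a' assume a: "a \<in> G" "a' \<in> G" "idx a = idx a'"
    then have "cell a mod int M = cell a' mod int M" using M(1) by (simp add: idx_def nat_eq_iff)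
    then have "int M dvd cell a - cell a'" by (simp add: mod_eq_dvd_iff)
    then obtain s where s: "cell a - cell a' = int M * s" by (auto simp: dvd_def)
    have "of_int (cell a) / real M - of_int (cell a') / real M = of_int (cell a - cell a') / real M"
      by (simp add: diff_divide_distrib)
    also have "\<dots> = of_int s" unfolding s using M(1) by simp
    finally show "a = a'" using uniq[of a a' "of_int (cell a) / real M" "of_int (cell a') / real M" s] cell0 a by (auto simp: G_def)
  qed
  show ?thesis
  proof (rule that)
    show "idx ` G \<subseteq> {..<M}" using M(1) by (auto simp: idx_def nat_less_iff)
    have "card A = card B + card G" unfolding B_def using finA by (subst card_Diff_subset) (auto simp: G_def card_mono)
    then show "2 * card P \<le> 2 * D + card (idx ` G)" using cardA cardB card_image[OF injG] by simp
    fix i y assume i: "i \<in> idx ` G" and y: "real i / real M \<le> y" "y < (real i + 1) / real M"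
    then obtain a where a: "a \<in> G" "i = idx a" by blast
    define s where "s = cell a div int M"
    have "cell a = int M * s + int i" using M(1) by (simp add: a(2) idx_def s_def)
    then have ca: "of_int (cell a) = real M * of_int s + real i" by simp
    have e1: "of_int (cell a) / real M = real i / real M + of_int s" "(of_int (cell a) + 1) / real M = (real i + 1) / real M + of_int s"
      unfolding ca using M(1) by (simp_all add: field_simps)
    have "y + of_int s \<in> {of_int (cell a) / real M..<(of_int (cell a) + 1) / real M}"
      unfolding e1 using y by simp
    then have "y + of_int s \<in> arc a" using cell by blast
    then have "f (y + of_int s) < t2" using a by (auto simp: G_def)
    then show "f y < t2" by (simp only: per)
  qed
qed

subsection \<open>Maximal growth rate and decay of solutions\<close>

lemma card_blocks:
  fixes b :: real and q R :: nat
  assumes "\<And>r. r < R \<Longrightarrow> b \<le> real (card {j. j < q \<and> P (q * r + j)})"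
  shows "real R * b \<le> real (card {j. j < q * R \<and> P j})"
  using assms
proof (induction R)
  case (Suc R)
  have eq: "{j. j < q * Suc R \<and> P j} = {j. j < q * R \<and> P j} \<union> (\<lambda>j. q * R + j) ` {j. j < q \<and> P (q * R + j)}"
  proof (rule Set.set_eqI, rule iffI)
    fix j assume "j \<in> {j. j < q * Suc R \<and> P j}"
    then have j: "j < q + q * R" "P j" by simp_all
    show "j \<in> {j. j < q * R \<and> P j} \<union> (\<lambda>j. q * R + j) ` {j. j < q \<and> P (q * R + j)}"
    proof (cases "j < q * R")
      case False
      then have "j = q * R + (j - q * R)" "j - q * R < q" using j by simp_all
      then show ?thesis using j by (intro UnI2 image_eqI[of _ _ "j - q * R"]) auto
    qed (use j in auto)
  qed auto
  have "card {j. j < q * Suc R \<and> P j} = card {j. j < q * R \<and> P j} + card ((\<lambda>j. q * R + j) ` {j. j < q \<and> P (q * R + j)})"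
    unfolding eq by (rule card_Un_disjoint) auto
  moreover have "card ((\<lambda>j. q * R + j) ` {j. j < q \<and> P (q * R + j)}) = card {j. j < q \<and> P (q * R + j)}"
    by (rule card_image) (auto simp: inj_on_def)
  ultimately have "real (card {j. j < q * Suc R \<and> P j}) = real (card {j. j < q * R \<and> P j}) + real (card {j. j < q \<and> P (q * R + j)})"
    by simp
  moreover have "real R * b \<le> real (card {j. j < q * R \<and> P j})" using Suc by simp
  ultimately show ?case using Suc.prems[of R] by (simp add: algebra_simps)
qed simp

text \<open>\<open>5 * dnorm\<close> is submultiplicative, so a bound at one length, uniform in the
  phase, propagates to all lengths. Submultiplicativity asks for pieces of length at least 2, hence
  remainders up to \<open>m + 2\<close>.\<close>

lemma dnorm_subexponential:
  assumes m: "m \<ge> 2" and z: "cmod z \<le> 5" and \<epsilon>: "\<epsilon> > 0" and le: "\<And>y. 5 * dnorm \<alpha> z y m \<le> exp (\<epsilon> * real m)"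
  shows "5 * dnorm \<alpha> z y n \<le> 5 * 6 ^ (m + 2) * exp (\<epsilon> * real n)"
proof (induction n arbitrary: y rule: less_induct)
  case (less n)
  show ?case
  proof (cases "n < m + 2")
    case True
    have "5 * dnorm \<alpha> z y n \<le> 5 * 6 ^ n" using dnorm_upper[OF z] by simp
    also have "\<dots> \<le> 5 * 6 ^ (m + 2) * 1" using True by (simp only: mult_1_right) (intro mult_left_mono power_increasing, auto)
    also have "\<dots> \<le> 5 * 6 ^ (m + 2) * exp (\<epsilon> * real n)" using \<epsilon> by (intro mult_left_mono) auto
    finally show ?thesis .
  next
    case False
    define n' where "n' = n - m"
    have n': "n = m + n'" "n' \<ge> 2" "n' < n" using False m by (auto simp: n'_def)
    have "dnorm \<alpha> z y n \<le> 5 * dnorm \<alpha> z y m * dnorm \<alpha> z (y + \<alpha> * real m) n'"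
      unfolding n'(1) by (rule dnorm_submult[OF m n'(2)])
    then have "5 * dnorm \<alpha> z y n \<le> (5 * dnorm \<alpha> z y m) * (5 * dnorm \<alpha> z (y + \<alpha> * real m) n')" by simp
    also have "\<dots> \<le> exp (\<epsilon> * real m) * (5 * 6 ^ (m + 2) * exp (\<epsilon> * real n'))"
      using dnorm_nonneg[of \<alpha> z y m] dnorm_nonneg[of \<alpha> z "y + \<alpha> * real m" n'] by (intro mult_mono le less[OF n'(3)]) auto
    also have "\<dots> = 5 * 6 ^ (m + 2) * exp (\<epsilon> * real n)" by (simp add: n'(1) exp_add algebra_simps)
    finally show ?thesis .
  qed
qed

lemma le_mult_exp_minus: "exp a * x \<le> b \<Longrightarrow> x \<le> b * exp (- a :: real)"
  by (simp add: exp_minus field_simps)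

lemma half_quotient_less: "x / 2 < a + 3 * x / 16 \<Longrightarrow> 5 * x < 16 * a" for a x :: real
  by simp

text \<open>The situation to be refuted for energies with local solutions. The constant 10 is twice
  the 5 of submultiplicativity and reserves a factor 2 for moving the energy later.\<close>

locale positive_growth =
  fixes \<alpha> E e0 :: real
  assumes irr: "\<alpha> \<notin> \<rat>" and E: "\<bar>E\<bar> \<le> 9 / 2" and e0: "e0 > 0"
    and growth: "\<And>m. m \<ge> 2 \<Longrightarrow> \<exists>y. exp (e0 * real m) < 10 * dnorm \<alpha> E y m"
begin

abbreviation N where "N y m \<equiv> dnorm \<alpha> (complex_of_real E) y m"

definition rate_ok :: "real \<Rightarrow> bool" where
  "rate_ok l \<longleftrightarrow> (\<exists>m\<ge>2. \<forall>y. 10 * N y m \<le> exp (l * real m))"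

text \<open>This takes the place of the Lyapunov exponent: by submultiplicativity it is an upper
  rate for all lengths up to any \<epsilon>, and by minimality some phase nearly attains it at each
  length.\<close>

definition L :: real where "L = Inf {l. rate_ok l}"

lemma E5: "cmod (complex_of_real E) \<le> 5" using E by simp

lemma rate_ok_5: "rate_ok 5"
  unfolding rate_ok_def
proof (intro exI[of _ 2] conjI allI)
  fix y
  have "10 * N y 2 \<le> 10 * 6 ^ 2" using dnorm_upper[OF E5, of \<alpha> y 2] by simp
  also have "\<dots> \<le> (2::real) ^ 10" by simp
  also have "\<dots> \<le> exp 1 ^ 10" using exp_ge_add_one_self[of 1] by (intro power_mono) auto
  also have "\<dots> = exp (5 * real 2)" by (simp flip: exp_of_nat_mult)
  finally show "10 * N y 2 \<le> exp (5 * real 2)" .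
qed simp

lemma rate_ok_gt: "rate_ok l \<Longrightarrow> e0 < l"
proof -
  assume "rate_ok l"
  then obtain m where m: "m \<ge> 2" "\<And>y. 10 * N y m \<le> exp (l * real m)" by (auto simp: rate_ok_def)
  obtain y where "exp (e0 * real m) < 10 * N y m" using growth[OF m(1)] by blast
  then have "exp (e0 * real m) < exp (l * real m)" using m(2)[of y] by linarith
  then show ?thesis using m(1) by simp
qed

lemma bdd_rate: "bdd_below {l. rate_ok l}"
  using rate_ok_gt by (auto intro!: bdd_belowI[of _ e0] simp: less_imp_le)

lemma L_pos: "0 < L"
proof -
  have "e0 \<le> L" unfolding L_def using rate_ok_5 rate_ok_gt by (intro cInf_greatest) (auto simp: less_imp_le)
  then show ?thesis using e0 by simp
qed

lemma rate_above: "L < l \<Longrightarrow> rate_ok l"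
proof -
  assume "L < l"
  then obtain l' where l': "rate_ok l'" "l' < l" unfolding L_def
    using cInf_lessD[of "{l. rate_ok l}" l] rate_ok_5 by auto
  then obtain m where m: "m \<ge> 2" "\<And>y. 10 * N y m \<le> exp (l' * real m)" by (auto simp: rate_ok_def)
  have "exp (l' * real m) \<le> exp (l * real m)" using l'(2) by (simp add: mult_right_mono)
  then have "10 * N y m \<le> exp (l * real m)" for y using m(2)[of y] by linarith
  then show ?thesis using m(1) by (auto simp: rate_ok_def)
qed

lemma rate_below:
  assumes "l < L" "m \<ge> 2"
  obtains y where "exp (l * real m) < 10 * N y m"
proof -
  have "\<not> rate_ok l"
  proof
    assume "rate_ok l"
    then have "L \<le> l" unfolding L_def using bdd_rate by (intro cInf_lower) auto
    then show False using assms by simp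
  qed
  then show ?thesis using that assms(2) unfolding rate_ok_def by (meson not_less)
qed

lemma upper_rate:
  assumes "\<epsilon> > 0"
  obtains C where "C \<ge> 1" "\<And>y m. N y m \<le> C * exp ((L + \<epsilon>) * real m)"
proof -
  have l: "L + \<epsilon> > 0" using L_pos assms by simp
  obtain M where M: "M \<ge> 2" "\<And>y. 10 * N y M \<le> exp ((L + \<epsilon>) * real M)"
    using rate_above[of "L + \<epsilon>"] assms by (auto simp: rate_ok_def)
  have "5 * N y M \<le> exp ((L + \<epsilon>) * real M)" for y
    using M(2)[of y] dnorm_nonneg[of \<alpha> "complex_of_real E" y M] by linarith
  then have 5: "5 * N y m \<le> 5 * 6 ^ (M + 2) * exp ((L + \<epsilon>) * real m)" for y m
    by (rule dnorm_subexponential[OF M(1) E5 l])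
  show ?thesis
  proof
    show "1 \<le> (6::real) ^ (M + 2)" by (rule one_le_power) simp
    show "N y m \<le> 6 ^ (M + 2) * exp ((L + \<epsilon>) * real m)" for y m using 5[of y m] by simp
  qed
qed

section \<open>Density of phases with deficient growth\<close>

definition bad :: "real \<Rightarrow> nat \<Rightarrow> real \<Rightarrow> bool" where
  "bad \<delta> k y \<longleftrightarrow> N y k < exp ((L - \<delta>) * real k)"

text \<open>Along an orbit realising the extremal growth rate, few blocks are bad; the orbit visits each cell in
  proportion to its length.\<close>

lemma bad_cells:
  assumes \<delta>: "\<delta> > 0" and \<mu>0: "\<mu> > 0"
  obtains k0 where "k0 \<ge> 2" "\<And>k M I. k \<ge> k0 \<Longrightarrow> M > 0 \<Longrightarrow> I \<subseteq> {..<M} \<Longrightarrow>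
     (\<And>i y. i \<in> I \<Longrightarrow> real i / real M \<le> y \<Longrightarrow> y < (real i + 1) / real M \<Longrightarrow> bad \<delta> k y) \<Longrightarrow> real (card I) \<le> \<mu> * real M"
proof -
  \<comment> \<open>Along a nearly extremal orbit each block may exceed the rate \<open>L\<close> by
    \<open>2 * \<epsilon>\<close>, and the total falls short of it by at most \<epsilon>. This
    admits, up to a constant, a share \<open>3 * \<epsilon> / \<delta> = 3 * \<mu> / 16\<close> of
    bad blocks, whereas too many bad cells force the share \<open>\<mu> / 2\<close>.\<close>
  define \<epsilon> where "\<epsilon> = \<delta> * \<mu> / 16"
  have \<epsilon>: "\<epsilon> > 0" using \<delta> \<mu>0 by (simp add: \<epsilon>_def)
  obtain C where C: "C \<ge> 1" "\<And>y m. N y m \<le> C * exp ((L + \<epsilon>) * real m)" using upper_rate[OF \<epsilon>] by blast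
  obtain k1 :: nat where k1: "real k1 \<ge> ln (5 * C) / \<epsilon>" using real_arch_simple by blast
  have "real (card I) \<le> \<mu> * real M"
    if k: "k \<ge> max 2 k1" and M: "M > 0" and I: "I \<subseteq> {..<M}"
      and bd: "\<And>i y. i \<in> I \<Longrightarrow> real i / real M \<le> y \<Longrightarrow> y < (real i + 1) / real M \<Longrightarrow> bad \<delta> k y" for k M I
  proof (rule ccontr)
    assume "\<not> real (card I) \<le> \<mu> * real M"
    then have cI: "real (card I) > \<mu> * real M" by simp
    have k2: "k \<ge> 2" "real k > 0" using k by auto
    have "ln (5 * C) / \<epsilon> \<le> real k" using k1 k by simp
    then have "ln (5 * C) \<le> \<epsilon> * real k" using \<epsilon> by (simp add: field_simps)
    have "0 < 5 * C" using C(1) by simp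
    then have "5 * C = exp (ln (5 * C))" by (rule exp_ln[symmetric])
    with \<open>ln (5 * C) \<le> \<epsilon> * real k\<close> have C5: "5 * C \<le> exp (\<epsilon> * real k)" by (metis exp_le_cancel_iff)
    \<comment> \<open>Blocks of length \<open>k\<close> advance the phase by
      \<open>k * \<alpha>\<close>, so visits are counted for this rotation.\<close>
    define \<beta> where "\<beta> = real k * \<alpha>"
    have \<beta>irr: "\<beta> \<notin> \<rat>"
    proof
      assume "\<beta> \<in> \<rat>"
      then have "\<beta> / real k \<in> \<rat>" by (intro Rats_divide) auto
      then show False using irr k2 by (simp add: \<beta>_def)
    qed
    obtain q r where q: "q \<ge> 6 * M" "q > 0" "coprime r (int q)" "\<bar>\<beta> - of_int r / real q\<bar> \<le> 1 / (real q)\<^sup>2"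
      using Dirichlet_large[OF \<beta>irr] by metis
    \<comment> \<open>The orbit runs through \<open>R\<close> stretches of \<open>q\<close> blocks,
      enough to make the constant \<open>ln 2 / \<delta>\<close> negligible.\<close>
    obtain R' :: nat where R': "real R' > 16 * (ln 2 / \<delta>) / (5 * \<mu>)" using reals_Archimedean2 by blast
    define R where "R = Suc R'"
    define t where "t = q * R"
    have "R \<le> t" using q(2) by (simp add: t_def)
    then have tR: "real t \<ge> real R" by simp
    obtain t' where t': "t = Suc t'" using q(2) by (cases t) (auto simp: t_def R_def)
    have kt: "k * t \<ge> 2" using k2 t' by (simp add: trans_le_add1)
    obtain y0 where y0: "exp ((L - \<epsilon>) * real (k * t)) < 10 * N y0 (k * t)"
      using rate_below[of "L - \<epsilon>" "k * t"] \<epsilon> kt by auto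
    define B where "B = {i. i < t \<and> bad \<delta> k (y0 + \<beta> * real i)}"
    have finB: "finite B" by (simp add: B_def)
    define ub where "ub = (\<lambda>i. (L + 2 * \<epsilon>) * real k - (if i \<in> B then \<delta> * real k else 0))"
    have fac: "0 \<le> 5 * N (y0 + \<beta> * real i) k \<and> 5 * N (y0 + \<beta> * real i) k \<le> exp (ub i)" if "i < t" for i
    proof (cases "i \<in> B")
      case True
      then have "5 * N (y0 + \<beta> * real i) k \<le> 5 * exp ((L - \<delta>) * real k)" by (simp add: B_def bad_def)
      also have "\<dots> \<le> exp (\<epsilon> * real k) * exp ((L - \<delta>) * real k)" using C5 C(1) by (intro mult_right_mono) auto
      also have "\<dots> = exp (\<epsilon> * real k + (L - \<delta>) * real k)" by (simp add: exp_add)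
      also have "\<dots> \<le> exp (ub i)" using True \<epsilon> k2 by (simp add: ub_def algebra_simps)
      finally show ?thesis using dnorm_nonneg by simp
    next
      case False
      have "5 * N (y0 + \<beta> * real i) k \<le> 5 * C * exp ((L + \<epsilon>) * real k)" using C(2)[of "y0 + \<beta> * real i" k] by simp
      also have "\<dots> \<le> exp (\<epsilon> * real k) * exp ((L + \<epsilon>) * real k)" using C5 by (intro mult_right_mono) auto
      also have "\<dots> = exp (ub i)" using False by (simp add: ub_def exp_add[symmetric] algebra_simps)
      finally show ?thesis using dnorm_nonneg by simp
    qed
    have "5 * N y0 (k * t) \<le> (\<Prod>i<t. 5 * N (y0 + \<beta> * real i) k)"
      using dnorm_iterate[OF k2(1), of \<alpha> "complex_of_real E" y0 t'] by (simp only: t' \<beta>_def)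
    also have "\<dots> \<le> (\<Prod>i<t. exp (ub i))" using fac by (intro prod_mono) auto
    also have "\<dots> = exp (\<Sum>i<t. ub i)" by (simp add: exp_sum)
    also have "(\<Sum>i<t. ub i) = (L + 2 * \<epsilon>) * real k * real t - \<delta> * real k * real (card B)"
    proof -
      have "{..<t} \<inter> B = B" by (auto simp: B_def)
      then have "(\<Sum>i<t. if i \<in> B then \<delta> * real k else 0) = (\<Sum>i\<in>B. \<delta> * real k)"
        using sum.inter_restrict[of "{..<t}" "\<lambda>_. \<delta> * real k" B] by simp
      then show ?thesis by (simp add: ub_def sum_subtractf)
    qed
    finally have "exp ((L - \<epsilon>) * real (k * t)) < 2 * exp ((L + 2 * \<epsilon>) * real k * real t - \<delta> * real k * real (card B))"
      using y0 by linarith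
    also have "\<dots> = exp (ln 2 + ((L + 2 * \<epsilon>) * real k * real t - \<delta> * real k * real (card B)))" by (simp add: exp_add)
    finally have "(L - \<epsilon>) * real (k * t) < ln 2 + ((L + 2 * \<epsilon>) * real k * real t - \<delta> * real k * real (card B))" by simp
    then have "real k * (\<delta> * real (card B)) < ln 2 + real k * (3 * \<epsilon> * real t)" by (simp add: algebra_simps)
    also have "\<dots> \<le> real k * ln 2 + real k * (3 * \<epsilon> * real t)" using k2 by (simp add: mult_le_cancel_right1)
    also have "\<dots> = real k * (ln 2 + 3 * \<epsilon> * real t)" by (simp add: algebra_simps)
    finally have "\<delta> * real (card B) < ln 2 + 3 * \<epsilon> * real t" using k2 by simp
    then have upB: "real (card B) < ln 2 / \<delta> + 3 * \<mu> / 16 * real t" using \<delta> by (simp add: \<epsilon>_def field_simps)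
    define Q where "Q = (\<lambda>i j. \<exists>s::int. real i / real M \<le> y0 + \<beta> * real j - of_int s \<and> y0 + \<beta> * real j - of_int s < (real i + 1) / real M)"
    define W where "W = (\<lambda>i. {j. j < t \<and> Q i j})"
    have W: "real R * (real q / (2 * real M)) \<le> real (card (W i))" if i: "i \<in> I" for i
      unfolding W_def t_def
    proof (rule card_blocks)
      fix r'
      have "Q i (q * r' + j) = (\<exists>s::int. real i / real M \<le> (y0 + \<beta> * real (q * r')) + \<beta> * real j - of_int s \<and> (y0 + \<beta> * real (q * r')) + \<beta> * real j - of_int s < (real i + 1) / real M)" for j
        unfolding Q_def by (simp add: algebra_simps)
      then show "real q / (2 * real M) \<le> real (card {j. j < q \<and> Q i (q * r' + j)})"
        using cell_visits[OF q(2,3,4) M q(1), of i "y0 + \<beta> * real (q * r')"] i I by auto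
    qed
    have Wsub: "W i \<subseteq> B" if i: "i \<in> I" for i
    proof
      fix j assume "j \<in> W i"
      then obtain s :: int where s: "j < t" "real i / real M \<le> y0 + \<beta> * real j - of_int s" "y0 + \<beta> * real j - of_int s < (real i + 1) / real M"
        by (auto simp: W_def Q_def)
      have "bad \<delta> k (y0 + \<beta> * real j - of_int s)" by (rule bd[OF i s(2,3)])
      moreover have "N (y0 + \<beta> * real j - of_int s) k = N (y0 + \<beta> * real j) k"
        using dnorm_add_int[of \<alpha> "complex_of_real E" "y0 + \<beta> * real j" "- s" k] by simp
      ultimately show "j \<in> B" using s(1) by (simp add: B_def bad_def)
    qed
    have disj: "W i \<inter> W i' = {}" if ii: "i \<in> I" "i' \<in> I" "i \<noteq> i'" for i i'
    proof (rule ccontr)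
      assume "W i \<inter> W i' \<noteq> {}"
      then obtain j s s' where s: "real i / real M \<le> y0 + \<beta> * real j - of_int s" "y0 + \<beta> * real j - of_int s < (real i + 1) / real M"
        "real i' / real M \<le> y0 + \<beta> * real j - of_int s'" "y0 + \<beta> * real j - of_int s' < (real i' + 1) / real M"
        by (auto simp: W_def Q_def)
      have b: "0 \<le> real i / real M" "(real i + 1) / real M \<le> 1" "0 \<le> real i' / real M" "(real i' + 1) / real M \<le> 1"
        using ii I M by (auto simp: field_simps subset_iff)
      have "\<bar>of_int s - of_int s'\<bar> < (1::real)" using s b by linarith
      then have "s = s'" by linarith
      then have "real i / real M < (real i' + 1) / real M" "real i' / real M < (real i + 1) / real M" using s by linarith+
      then have "real i < real i' + 1" "real i' < real i + 1" using M by (auto simp: divide_less_cancel)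
      then show False using ii(3) by linarith
    qed
    have finI: "finite I" using I finite_subset by blast
    have "real (card I) * (real R * (real q / (2 * real M))) \<le> (\<Sum>i\<in>I. real (card (W i)))"
      using W sum_mono[of I "\<lambda>_. real R * (real q / (2 * real M))" "\<lambda>i. real (card (W i))"] by simp
    also have "\<dots> = real (card (\<Union>i\<in>I. W i))"
      using disj finI by (subst card_UN_disjoint) (auto simp: W_def)
    also have "\<dots> \<le> real (card B)" using Wsub finB by (auto intro!: card_mono)
    finally have "real (card I) * (real t / (2 * real M)) \<le> real (card B)" by (simp add: t_def mult_ac)
    moreover have "\<mu> * real M * (real t / (2 * real M)) \<le> real (card I) * (real t / (2 * real M))"
      using cI by (intro mult_right_mono) auto
    moreover have "\<mu> * real M * (real t / (2 * real M)) = \<mu> / 2 * real t" using M by simp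
    ultimately have "\<mu> / 2 * real t < ln 2 / \<delta> + 3 * \<mu> / 16 * real t" using upB by linarith
    then have "5 * \<mu> * real t < 16 * (ln 2 / \<delta>)"
      using half_quotient_less[of "\<mu> * real t" "ln 2 / \<delta>"] by simp
    moreover have "16 * (ln 2 / \<delta>) < 5 * \<mu> * real R"
    proof -
      have "16 * (ln 2 / \<delta>) / (5 * \<mu>) < real R" using R' by (simp add: R_def)
      moreover have "0 < 5 * \<mu>" using \<mu>0 by simp
      ultimately show ?thesis using pos_divide_less_eq[of "5 * \<mu>" "16 * (ln 2 / \<delta>)" "real R"] by (simp only: mult.commute)
    qed
    moreover have "5 * \<mu> * real R \<le> 5 * \<mu> * real t" using tR \<mu>0 by (intro mult_left_mono) auto
    ultimately show False by linarith
  qed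
  then show ?thesis by (intro that[of "max 2 k1"]) auto
qed

text \<open>The distance kept from the ends of a window of length \<open>k\<close>: an eighth of the
  length, plus 2 because the determinant realising \<open>dnorm\<close> may start or stop one site
  further inside.\<close>

definition wid :: "nat \<Rightarrow> nat" where "wid k = k div 8 + 2"

abbreviation "resid y u j \<equiv> cmod (jop (chain_int \<alpha> y) (\<lambda>_. 0) u j - complex_of_real E * u j)"

text \<open>On a block that is not bad one of the four determinants is nearly as large as growth
  allows. Cramer's rule divides by it, while the coefficient of either boundary value has bond
  products, of rate almost 0, in place of the growth over the distance from \<open>s\<close> to that
  end.\<close>

lemma regular_site:
  obtains k1 where "\<And>k y u (a::int) s U0 \<gamma>. k \<ge> k1 \<Longrightarrow> \<not> bad (L / 64) k (y + \<alpha> * of_int a) \<Longrightarrow>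
     a + int (wid k) \<le> s \<Longrightarrow> s \<le> a + int k - int (wid k) \<Longrightarrow>
     (\<And>j. a \<le> j \<Longrightarrow> j \<le> a + int k + 1 \<Longrightarrow> cmod (u j) \<le> U0) \<Longrightarrow>
     (\<And>j. a < j \<Longrightarrow> j \<le> a + int k \<Longrightarrow> resid y u j \<le> \<gamma>) \<Longrightarrow> 0 \<le> U0 \<Longrightarrow> 0 \<le> \<gamma> \<Longrightarrow>
     cmod (u s) \<le> exp (- L * real k / 16) * U0 + 3 * 100 ^ k * \<gamma>"
proof -
  \<comment> \<open>The exponent becomes \<open>2 * \<delta> - L / 8 = - 3 * L / 32\<close> per site
    of the block; \<open>k1\<close> lets \<open>L / 32\<close> absorb the constants, which leaves
    \<open>- L / 16\<close>.\<close>
  define \<delta> where "\<delta> = L / 64"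
  have \<delta>: "\<delta> > 0" using L_pos by (simp add: \<delta>_def)
  obtain C where C: "C \<ge> 1" "\<And>y m. N y m \<le> C * exp ((L + \<delta>) * real m)" using upper_rate[OF \<delta>] by blast
  have CD: "cmod (cdet \<alpha> E y m) \<le> C * exp ((L + \<delta>) * real m)" for y m
    using order_trans[OF dnorm_ge(1) C(2)] .
  obtain Cp where Cp: "Cp > 0" "\<And>y m. (\<Prod>j<m. \<bar>chain \<alpha> y j\<bar>) \<le> Cp * exp (\<delta> * real m)"
    using chain_prod_upper[OF irr \<delta>] by blast
  obtain k1 :: nat where k1: "real k1 \<ge> ln (2 * (Cp * C)) / (L / 32)" using real_arch_simple by blast
  have "cmod (u s) \<le> exp (- L * real k / 16) * U0 + 3 * 100 ^ k * \<gamma>"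
    if k: "k \<ge> k1" and good: "\<not> bad (L / 64) k (y + \<alpha> * of_int a)"
      and s: "a + int (wid k) \<le> s" "s \<le> a + int k - int (wid k)"
      and U: "\<And>j. a \<le> j \<Longrightarrow> j \<le> a + int k + 1 \<Longrightarrow> cmod (u j) \<le> U0"
      and g: "\<And>j. a < j \<Longrightarrow> j \<le> a + int k \<Longrightarrow> resid y u j \<le> \<gamma>" and U0: "0 \<le> U0" and \<gamma>: "0 \<le> \<gamma>"
    for k y u a s U0 \<gamma>
  proof -
    have w8: "real (wid k) - 1 \<ge> real k / 8"
    proof -
      have "k < 8 * (k div 8) + 8" by linarith
      then have "real k < 8 * real (k div 8) + 8" by linarith
      then show ?thesis by (simp add: wid_def)
    qed
    have k2: "2 * wid k \<le> k" using s by linarith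
    then have k4: "k \<ge> 4" by (simp add: wid_def)
    \<comment> \<open>The four determinants in \<open>dnorm\<close> differ only in the start
      \<open>b\<close> and the length \<open>m\<close> of their windows, so they are treated
      together.\<close>
    have core: "cmod (u s) \<le> exp (- L * real k / 16) * U0 + 3 * 100 ^ k * \<gamma>"
      if b: "a \<le> b" "b \<le> a + 1" "b + int m \<le> a + int k" "a + int k \<le> b + int m + 1" and big: "exp ((L - \<delta>) * real k) \<le> cmod (cdet \<alpha> E (y + \<alpha> * of_int b) m)"
      for b m
    proof -
      define Y where "Y = y + \<alpha> * of_int b"
      define i where "i = nat (s - b)"
      have "2 \<le> wid k" by (simp add: wid_def)
      then have i: "int i = s - b" using s b k4 by (simp add: i_def)
      have iw: "wid k \<le> i + 1" "wid k + i \<le> m + 1" "m \<le> k" "1 \<le> i" "i \<le> m" using i s b \<open>2 \<le> wid k\<close> by linarith+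
      have ch: "chain_int \<alpha> y (b + int j) = chain \<alpha> Y j" for j
        by (simp add: chain_int_def chain_def Y_def algebra_simps)
      have gg: "cmod (complex_of_real E * u (b + int j) - chain \<alpha> Y j * u (b + int (Suc j)) - chain \<alpha> Y (j - 1) * u (b + int (j - 1))) \<le> \<gamma>"
        if j: "1 \<le> j" "j \<le> m" for j
      proof -
        have "resid y u (b + int j) \<le> \<gamma>" using g b j by simp
        moreover have ix: "b + int j - 1 = b + int (j - 1)" "b + int j + 1 = b + int (Suc j)" using j by auto
        have "jop (chain_int \<alpha> y) (\<lambda>_. 0) u (b + int j) - complex_of_real E * u (b + int j)
          = chain \<alpha> Y j * u (b + int (Suc j)) + chain \<alpha> Y (j - 1) * u (b + int (j - 1)) + 0 - complex_of_real E * u (b + int j)"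
          unfolding jop_def ix ch by simp
        ultimately have "cmod (chain \<alpha> Y j * u (b + int (Suc j)) + chain \<alpha> Y (j - 1) * u (b + int (j - 1)) + 0 - complex_of_real E * u (b + int j)) \<le> \<gamma>"
          by simp
        moreover have "complex_of_real E * u (b + int j) - chain \<alpha> Y j * u (b + int (Suc j)) - chain \<alpha> Y (j - 1) * u (b + int (j - 1))
          = - (chain \<alpha> Y j * u (b + int (Suc j)) + chain \<alpha> Y (j - 1) * u (b + int (j - 1)) + 0 - complex_of_real E * u (b + int j))"
          by simp
        ultimately show ?thesis by (simp only: norm_minus_cancel)
      qed
      have main: "cmod (jdet (chain \<alpha> Y) E m) * cmod (u (b + int i)) \<le>
           (\<Prod>j<i. \<bar>chain \<alpha> Y j\<bar>) * cmod (jdet (\<lambda>j. chain \<alpha> Y (i + j)) E (m - i)) * cmod (u (b + int 0))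
         + (\<Prod>j\<in>{i..m}. \<bar>chain \<alpha> Y j\<bar>) * cmod (jdet (chain \<alpha> Y) E (i - 1)) * cmod (u (b + int (Suc m))) + 3 * 100 ^ m * \<gamma>"
        by (rule jdet_window[where u="\<lambda>j. u (b + int j)", OF E5 abs_chain_le gg \<gamma> iw(4,5)])
      define X where "X = Cp * C * U0 * exp ((L + \<delta>) * real k - L * real k / 8)"
      have CC: "0 \<le> Cp * C * U0" using Cp(1) C(1) U0 by simp
      have A1: "(\<Prod>j<i. \<bar>chain \<alpha> Y j\<bar>) * cmod (jdet (\<lambda>j. chain \<alpha> Y (i + j)) E (m - i)) * cmod (u (b + int 0)) \<le> X"
      proof -
        have "(\<Prod>j<i. \<bar>chain \<alpha> Y j\<bar>) * cmod (jdet (\<lambda>j. chain \<alpha> Y (i + j)) E (m - i)) * cmod (u (b + int 0))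
          \<le> (Cp * exp (\<delta> * real i)) * (C * exp ((L + \<delta>) * real (m - i))) * U0"
          using Cp(2)[of Y i] CD[of "Y + \<alpha> * real i" "m - i"] U[of b] b Cp(1) C(1) k4 unfolding chain_shift_fun
          by (intro mult_mono) (auto simp: cdet_def prod_nonneg)
        also have "\<dots> = Cp * C * U0 * exp ((L + \<delta>) * real m - L * real i)"
          using iw by (simp add: exp_add[symmetric] of_nat_diff algebra_simps)
        also have "\<dots> \<le> X" unfolding X_def
        proof (intro mult_left_mono CC, subst exp_le_cancel_iff, intro diff_mono)
          show "(L + \<delta>) * real m \<le> (L + \<delta>) * real k" using iw L_pos \<delta> by (intro mult_left_mono) auto
          have "real k / 8 \<le> real i" using w8 iw(1) by linarith
          then show "L * real k / 8 \<le> L * real i" using L_pos mult_left_mono[of "real k / 8" "real i" L] by simp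
        qed
        finally show ?thesis .
      qed
      have A2: "(\<Prod>j\<in>{i..m}. \<bar>chain \<alpha> Y j\<bar>) * cmod (jdet (chain \<alpha> Y) E (i - 1)) * cmod (u (b + int (Suc m))) \<le> X"
      proof -
        have "(\<Prod>j\<in>{i..m}. \<bar>chain \<alpha> Y j\<bar>) = (\<Prod>j<Suc m - i. \<bar>chain \<alpha> (Y + \<alpha> * real i) j\<bar>)"
          by (rule prod.reindex_bij_witness[of _ "\<lambda>j. i + j" "\<lambda>j. j - i"]) (auto simp: chain_shift[symmetric])
        then have "(\<Prod>j\<in>{i..m}. \<bar>chain \<alpha> Y j\<bar>) * cmod (jdet (chain \<alpha> Y) E (i - 1)) * cmod (u (b + int (Suc m)))
          \<le> (Cp * exp (\<delta> * real (Suc m - i))) * (C * exp ((L + \<delta>) * real (i - 1))) * U0"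
          using Cp(2)[of "Y + \<alpha> * real i" "Suc m - i"] CD[of Y "i - 1"] U[of "b + int (Suc m)"] b Cp(1) C(1)
          by (intro mult_mono) (auto simp: cdet_def prod_nonneg)
        also have "\<dots> = Cp * C * U0 * exp ((L + \<delta>) * real m - L * real (Suc m - i))"
          using iw by (simp add: exp_add[symmetric] of_nat_diff algebra_simps)
        also have "\<dots> \<le> X" unfolding X_def
        proof (intro mult_left_mono CC, subst exp_le_cancel_iff, intro diff_mono)
          show "(L + \<delta>) * real m \<le> (L + \<delta>) * real k" using iw L_pos \<delta> by (intro mult_left_mono) auto
          have "wid k \<le> Suc m - i" using iw by simp
          then have "real k / 8 \<le> real (Suc m - i)" using w8 by linarith
          then show "L * real k / 8 \<le> L * real (Suc m - i)" using L_pos mult_left_mono[of "real k / 8" "real (Suc m - i)" L] by simp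
        qed
        finally show ?thesis .
      qed
      have us: "b + int i = s" using i by simp
      have "exp ((L - \<delta>) * real k) * cmod (u s) \<le> cmod (jdet (chain \<alpha> Y) E m) * cmod (u s)"
        using big by (intro mult_right_mono) (auto simp: cdet_def Y_def)
      also have "\<dots> \<le> 2 * X + 3 * 100 ^ m * \<gamma>" using main A1 A2 unfolding us by linarith
      also have "\<dots> \<le> 2 * X + 3 * 100 ^ k * \<gamma>" using iw \<gamma> by (intro add_left_mono mult_right_mono mult_left_mono power_increasing) auto
      finally have "cmod (u s) \<le> (2 * X + 3 * 100 ^ k * \<gamma>) * exp (- ((L - \<delta>) * real k))"
        by (rule le_mult_exp_minus)
      also have "\<dots> = 2 * X * exp (- ((L - \<delta>) * real k)) + 3 * 100 ^ k * \<gamma> * exp (- ((L - \<delta>) * real k))" by (simp add: distrib_right)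
      also have "\<dots> \<le> exp (- L * real k / 16) * U0 + 3 * 100 ^ k * \<gamma> * 1"
      proof (rule add_mono)
        have "2 * X * exp (- ((L - \<delta>) * real k)) = 2 * (Cp * C) * U0 * exp (- 3 * L * real k / 32)"
          unfolding X_def by (simp add: exp_add[symmetric] \<delta>_def algebra_simps)
        also have "\<dots> \<le> exp (L * real k / 32) * U0 * exp (- 3 * L * real k / 32)"
        proof (intro mult_right_mono U0)
          have "ln (2 * (Cp * C)) / (L / 32) \<le> real k" using k1 k by linarith
          then have "ln (2 * (Cp * C)) \<le> L * real k / 32" using L_pos by (simp add: field_simps)
          moreover have "0 < 2 * (Cp * C)" using Cp(1) C(1) by simp
          ultimately show "2 * (Cp * C) \<le> exp (L * real k / 32)" by (metis exp_le_cancel_iff exp_ln)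
        qed auto
        also have "\<dots> = exp (- L * real k / 16) * U0" by (simp add: exp_add[symmetric] mult.commute mult.left_commute)
        finally show "2 * X * exp (- ((L - \<delta>) * real k)) \<le> exp (- L * real k / 16) * U0" .
        have "exp (- ((L - \<delta>) * real k)) \<le> 1" using L_pos by (simp add: \<delta>_def)
        then show "3 * 100 ^ k * \<gamma> * exp (- ((L - \<delta>) * real k)) \<le> 3 * 100 ^ k * \<gamma> * 1" using \<gamma> by (intro mult_left_mono) auto
      qed
      finally show ?thesis by simp
    qed
    have big: "exp ((L - \<delta>) * real k) \<le> N (y + \<alpha> * of_int a) k" using good by (simp add: bad_def \<delta>_def not_less)
    have "N (y + \<alpha> * of_int a) k \<in> {cmod (cdet \<alpha> E (y + \<alpha> * of_int a) k), cmod (cdet \<alpha> E (y + \<alpha> * of_int a) (k - 1)),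
        cmod (cdet \<alpha> E (y + \<alpha> * of_int a + \<alpha>) (k - 1)), cmod (cdet \<alpha> E (y + \<alpha> * of_int a + \<alpha>) (k - 2))}"
      unfolding dnorm_def by (rule Max_in) auto
    then consider "N (y + \<alpha> * of_int a) k = cmod (cdet \<alpha> E (y + \<alpha> * of_int a) k)"
      | "N (y + \<alpha> * of_int a) k = cmod (cdet \<alpha> E (y + \<alpha> * of_int a) (k - 1))"
      | "N (y + \<alpha> * of_int a) k = cmod (cdet \<alpha> E (y + \<alpha> * of_int (a + 1)) (k - 1))"
      | "N (y + \<alpha> * of_int a) k = cmod (cdet \<alpha> E (y + \<alpha> * of_int (a + 1)) (k - 2))"
      by (auto simp: algebra_simps)
    then show ?thesis
    proof cases
      case 1 then show ?thesis using core[of a k] big by simp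
    next
      case 2 then show ?thesis using core[of a "k - 1"] big k4 by (simp add: of_nat_diff)
    next
      case 3 then show ?thesis using core[of "a + 1" "k - 1"] big k4 by (simp add: of_nat_diff)
    next
      case 4 then show ?thesis using core[of "a + 1" "k - 2"] big k4 by (simp add: of_nat_diff)
    qed
  qed
  then show ?thesis using that[of k1] by blast
qed

end

text \<open>Two clusters of about \<open>3 * k / 4\<close> phases give about \<open>3 * k\<close>
  half arcs, more than \<open>2 * k\<close> crossings and \<open>k / 2\<close> cells can account
  for. The excess \<open>k / 2\<close> absorbs the rounding in \<open>wid\<close> from
  \<open>k = 25\<close> on.\<close>

lemma cluster_count_false:
  fixes a i w k :: int
  assumes "a = 2 * (k - 2 * w + 1)" "2 * i \<le> k" "2 * a \<le> 2 * k + i" "8 * w \<le> k + 16" "25 \<le> k"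
  shows False
  using assms by presburger

context positive_growth begin

text \<open>Two far apart clusters of bad phases would give more than \<open>2 k\<close> sign changes of a trigonometric
  polynomial of degree \<open>k\<close>, or else too many bad cells.\<close>

lemma one_cluster:
  fixes A' :: nat
  assumes A': "A' > 0"
  obtains k0 where "\<And>k q y s. k \<ge> k0 \<Longrightarrow> q \<le> 2 * A' * k \<Longrightarrow>
     (\<And>j p. 0 < j \<Longrightarrow> j < q \<Longrightarrow> \<bar>of_int (int j) * \<alpha> - of_int p\<bar> \<ge> 1 / (2 * real q)) \<Longrightarrow>
     int k < \<bar>s\<bar> \<Longrightarrow> \<bar>s\<bar> + int k < int q \<Longrightarrow>
     (\<And>a. - int k + int (wid k) \<le> a \<Longrightarrow> a \<le> - int (wid k) \<Longrightarrow> bad (L / 64) k (y + \<alpha> * of_int a)) \<Longrightarrow>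
     \<exists>a. s - int k + int (wid k) \<le> a \<and> a \<le> s - int (wid k) \<and> \<not> bad (L / 64) k (y + \<alpha> * of_int a)"
proof -
  define \<delta> where "\<delta> = L / 64"
  have \<delta>: "\<delta> > 0" using L_pos by (simp add: \<delta>_def)
  \<comment> \<open>With \<open>M = 8 * q\<close> and \<open>q \<le> 2 * A' * k\<close> this allows
    at most \<open>k / 2\<close> bad cells.\<close>
  define \<mu> where "\<mu> = 1 / (32 * real A')"
  have \<mu>: "\<mu> > 0" using A' by (simp add: \<mu>_def)
  have d2: "\<delta> / 2 > 0" using \<delta> by simp
  obtain k1 where k1: "k1 \<ge> 2" and cells: "\<And>k M I. k \<ge> k1 \<Longrightarrow> M > 0 \<Longrightarrow> I \<subseteq> {..<M} \<Longrightarrow>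
     (\<And>i y. i \<in> I \<Longrightarrow> real i / real M \<le> y \<Longrightarrow> y < (real i + 1) / real M \<Longrightarrow> bad (\<delta> / 2) k y) \<Longrightarrow> real (card I) \<le> \<mu> * real M"
    using bad_cells[OF d2 \<mu>] by blast
  obtain k2 :: nat where k2: "real k2 \<ge> 4 / \<delta>" using real_arch_simple by blast
  have "\<exists>a. s - int k + int (wid k) \<le> a \<and> a \<le> s - int (wid k) \<and> \<not> bad (L / 64) k (y + \<alpha> * of_int a)"
    if k: "k \<ge> max 25 (max k1 k2)" and q: "q \<le> 2 * A' * k"
      and sepq: "\<And>j p. 0 < j \<Longrightarrow> j < q \<Longrightarrow> \<bar>of_int (int j) * \<alpha> - of_int p\<bar> \<ge> 1 / (2 * real q)"
      and s: "int k < \<bar>s\<bar>" "\<bar>s\<bar> + int k < int q"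
      and bad0: "\<And>a. - int k + int (wid k) \<le> a \<Longrightarrow> a \<le> - int (wid k) \<Longrightarrow> bad (L / 64) k (y + \<alpha> * of_int a)"
    for k q y s
  proof (rule ccontr)
    assume neg: "\<not> ?thesis"
    have k25: "k \<ge> 25" "k \<ge> k1" "k \<ge> k2" using k by auto
    have w8: "8 * wid k \<le> k + 16" "2 \<le> wid k" by (auto simp: wid_def)
    have q0: "q > 0" using s by linarith
    define A where "A = {- int k + int (wid k)..- int (wid k)} \<union> {s - int k + int (wid k)..s - int (wid k)}"
    have cA: "int (card A) = 2 * (int k - 2 * int (wid k) + 1)"
    proof -
      have "card A = card {- int k + int (wid k)..- int (wid k)} + card {s - int k + int (wid k)..s - int (wid k)}"
        unfolding A_def using s w8 by (intro card_Un_disjoint) auto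
      then show ?thesis using w8 k25 by simp
    qed
    define P where "P = (\<lambda>a. y + \<alpha> * of_int a) ` A"
    have aA: "\<bar>a - a'\<bar> < int q" if "a \<in> A" "a' \<in> A" for a a'
      using that s w8 unfolding A_def by auto
    have sep: "1 / (2 * real q) \<le> \<bar>(y + \<alpha> * of_int a) - (y + \<alpha> * of_int a') - of_int p\<bar>" if a: "a \<in> A" "a' \<in> A" "a \<noteq> a'" for a a' p
    proof -
      define j where "j = nat \<bar>a - a'\<bar>"
      have j: "0 < j" "j < q" "int j = \<bar>a - a'\<bar>" using aA[OF a(1,2)] a(3) by (auto simp: j_def)
      consider "a - a' = int j" | "a - a' = - int j" using j(3) by linarith
      then show ?thesis
      proof cases
        case 1
        have "(y + \<alpha> * of_int a) - (y + \<alpha> * of_int a') - of_int p = of_int (a - a') * \<alpha> - of_int p" by (simp add: algebra_simps)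
        then show ?thesis using sepq[OF j(1,2), of p] unfolding 1 by simp
      next
        case 2
        have "(y + \<alpha> * of_int a) - (y + \<alpha> * of_int a') - of_int p = - (of_int (- (a - a')) * \<alpha> - of_int (- p))" by (simp add: algebra_simps)
        then show ?thesis using sepq[OF j(1,2), of "- p"] unfolding 2 by (simp only: abs_minus_cancel minus_minus)
      qed
    qed
    have inj: "inj_on (\<lambda>a. y + \<alpha> * of_int a) A"
    proof (rule inj_onI)
      fix a a' assume a: "a \<in> A" "a' \<in> A" "y + \<alpha> * real_of_int a = y + \<alpha> * real_of_int a'"
      show "a = a'"
      proof (rule ccontr)
        assume "a \<noteq> a'"
        then have "1 / (2 * real q) \<le> 0" using sep[OF a(1,2), of 0] a(3) by simp
        then show False using q0 by (simp add: divide_le_0_iff)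
      qed
    qed
    have cP: "card P = card A" unfolding P_def by (rule card_image[OF inj])
    define f where "f = (\<lambda>y. dsq \<alpha> E y k)"
    \<comment> \<open>A phase bad at level \<delta> has \<open>dsq\<close> below \<open>t1\<close>,
      the 4 being that of \<open>dsq_dnorm\<close>; a phase with \<open>dsq\<close> below
      \<open>t2\<close> is still bad at level \<open>\<delta> / 2\<close>.\<close>
    define t1 where "t1 = 4 * (exp ((L - \<delta>) * real k))\<^sup>2"
    define t2 where "t2 = (exp ((L - \<delta> / 2) * real k))\<^sup>2"
    \<comment> \<open>Phases are at least \<open>1 / (2 * q)\<close> apart modulo 1, half arcs have
      length \<open>1 / (4 * q)\<close>, and this is the length of two cells.\<close>
    define M where "M = 8 * q"
    have "4 / \<delta> \<le> real k" using k2 k25 by linarith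
    then have dk: "4 \<le> \<delta> * real k" using \<delta> by (simp add: field_simps)
    have t12: "t1 < t2"
    proof -
      have "2 < exp (\<delta> / 2 * real k)" using dk exp_ge_add_one_self[of "\<delta> / 2 * real k"] by linarith
      then have "2 * exp ((L - \<delta>) * real k) < exp (\<delta> / 2 * real k) * exp ((L - \<delta>) * real k)" by simp
      also have "\<dots> = exp ((L - \<delta> / 2) * real k)" by (simp add: exp_add[symmetric] algebra_simps)
      finally have "(2 * exp ((L - \<delta>) * real k))\<^sup>2 < (exp ((L - \<delta> / 2) * real k))\<^sup>2" by (intro power_strict_mono) auto
      then show ?thesis by (simp add: t1_def t2_def power_mult_distrib)
    qed
    have badP: "f p < t1" if p: "p \<in> P" for p
    proof -
      have "bad \<delta> k p" using p bad0 neg unfolding P_def A_def \<delta>_def by auto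
      then have "(N p k)\<^sup>2 < (exp ((L - \<delta>) * real k))\<^sup>2" unfolding bad_def by (intro power_strict_mono dnorm_nonneg) auto
      then show ?thesis using dsq_dnorm(1)[of \<alpha> E p k] by (simp add: f_def t1_def)
    qed
    obtain I where I: "I \<subseteq> {..<M}" "2 * card P \<le> 2 * k + card I"
      "\<And>i y. i \<in> I \<Longrightarrow> real i / real M \<le> y \<Longrightarrow> y < (real i + 1) / real M \<Longrightarrow> f y < t2"
    proof (rule half_arcs[of k f t1 t2 P "1 / (4 * real q)" M])
      show "tpoly k (\<lambda>y. complex_of_real (f y))" unfolding f_def by (rule tpoly_dsq)
      show "continuous_on UNIV f" unfolding f_def by (rule continuous_dsq)
      show "f (y + of_int s) = f y" for y s unfolding f_def by (rule dsq_add_int)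
      show "finite P" by (simp add: P_def A_def)
      show "2 * (1 / (4 * real q)) \<le> \<bar>p - p' - of_int s\<bar>" if "p \<in> P" "p' \<in> P" "p \<noteq> p'" for p p' s
      proof -
        obtain a a' where "a \<in> A" "a' \<in> A" "p = y + \<alpha> * of_int a" "p' = y + \<alpha> * of_int a'" using \<open>p \<in> P\<close> \<open>p' \<in> P\<close> by (auto simp: P_def)
        then show ?thesis using sep[of a a' s] \<open>p \<noteq> p'\<close> by auto
      qed
      show "M > 0" "0 < 1 / (4 * real q)" using q0 by (auto simp: M_def)
      show "2 * (1 / (4 * real q)) \<le> 1" using q0 by (simp add: divide_le_eq)
      show "2 / real M \<le> 1 / (4 * real q)" by (simp add: M_def)
    qed (use t12 badP in auto)
    have "real (card I) \<le> \<mu> * real M"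
    proof (rule cells[OF k25(2) _ I(1)])
      show "M > 0" using q0 by (simp add: M_def)
      fix i y assume i: "i \<in> I" "real i / real M \<le> y" "y < (real i + 1) / real M"
      have "(N y k)\<^sup>2 < (exp ((L - \<delta> / 2) * real k))\<^sup>2" using I(3)[OF i] dsq_dnorm(2)[of \<alpha> E y k] by (simp add: f_def t2_def)
      then show "bad (\<delta> / 2) k y" unfolding bad_def by (rule power_less_imp_less_base) simp
    qed
    also have "\<mu> * real M \<le> \<mu> * (8 * (2 * real A' * real k))"
      using q \<mu> by (intro mult_left_mono) (auto simp: M_def simp flip: of_nat_mult)
    also have "\<dots> = real k / 2" using A' by (simp add: \<mu>_def)
    finally have "2 * card I \<le> k" by simp
    then have "2 * int (card I) \<le> int k" by linarith
    moreover have "2 * int (card A) \<le> 2 * int k + int (card I)" using I(2) unfolding cP by linarith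
    moreover have "8 * int (wid k) \<le> int k + 16" "25 \<le> int k" using w8 k25 by linarith+
    ultimately show False using cluster_count_false[OF cA] by blast
  qed
  then show ?thesis using that[of "max 25 (max k1 k2)"] by blast
qed

text \<open>Since \<open>u 0 = 1\<close>, no window around 0 is regular, so all its phases are bad;
  by uniqueness of the cluster each window around a distant site has a good start. Iterating the
  estimate gains one factor per \<open>k + 1\<close> sites, as long as neither the origin nor the
  ends at \<open>T\<close> are reached. \<open>A'\<close> keeps all phases involved within
  \<open>q\<close> steps.\<close>

lemma decay:
  fixes J :: nat
  assumes J: "J > 0"
  defines "A' \<equiv> 4 * J + 8"
  obtains k0 where "\<And>k q y u U0 \<gamma> T. k \<ge> k0 \<Longrightarrow> A' * k \<le> q \<Longrightarrow> q \<le> 2 * A' * k \<Longrightarrow>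
     (\<And>j p. 0 < j \<Longrightarrow> j < q \<Longrightarrow> \<bar>of_int (int j) * \<alpha> - of_int p\<bar> \<ge> 1 / (2 * real q)) \<Longrightarrow>
     T = (2 * J + 2) * (k + 1) \<Longrightarrow>
     u 0 = 1 \<Longrightarrow> (\<And>j. \<bar>j\<bar> \<le> int T \<Longrightarrow> cmod (u j) \<le> U0) \<Longrightarrow> (\<And>j. \<bar>j\<bar> \<le> int T \<Longrightarrow> resid y u j \<le> \<gamma>) \<Longrightarrow>
     exp (- L * real k / 16) * U0 + 3 * 100 ^ k * \<gamma> < 1 \<Longrightarrow> exp (- L * real k / 16) \<le> 1 / 2 \<Longrightarrow>
     (\<And>s. int (J * (k + 1)) \<le> \<bar>s\<bar> \<Longrightarrow> \<bar>s\<bar> \<le> int ((J + 2) * (k + 1)) \<Longrightarrow>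
        cmod (u s) \<le> exp (- L * real k / 16) ^ J * U0 + 2 * (3 * 100 ^ k * \<gamma>))"
proof -
  have A': "A' > 0" by (simp add: A'_def)
  obtain k1 where one: "\<And>k q y s. k \<ge> k1 \<Longrightarrow> q \<le> 2 * A' * k \<Longrightarrow>
     (\<And>j p. 0 < j \<Longrightarrow> j < q \<Longrightarrow> \<bar>of_int (int j) * \<alpha> - of_int p\<bar> \<ge> 1 / (2 * real q)) \<Longrightarrow>
     int k < \<bar>s\<bar> \<Longrightarrow> \<bar>s\<bar> + int k < int q \<Longrightarrow>
     (\<And>a. - int k + int (wid k) \<le> a \<Longrightarrow> a \<le> - int (wid k) \<Longrightarrow> bad (L / 64) k (y + \<alpha> * of_int a)) \<Longrightarrow>
     \<exists>a. s - int k + int (wid k) \<le> a \<and> a \<le> s - int (wid k) \<and> \<not> bad (L / 64) k (y + \<alpha> * of_int a)"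
  proof (rule one_cluster[OF A'], goal_cases)
    case (1 k1)
    show ?case by (rule 1(1), rule 1(2))
  qed
  obtain k2 where reg: "\<And>k y u (a::int) s U0 \<gamma>. k \<ge> k2 \<Longrightarrow> \<not> bad (L / 64) k (y + \<alpha> * of_int a) \<Longrightarrow>
     a + int (wid k) \<le> s \<Longrightarrow> s \<le> a + int k - int (wid k) \<Longrightarrow>
     (\<And>j. a \<le> j \<Longrightarrow> j \<le> a + int k + 1 \<Longrightarrow> cmod (u j) \<le> U0) \<Longrightarrow>
     (\<And>j. a < j \<Longrightarrow> j \<le> a + int k \<Longrightarrow> resid y u j \<le> \<gamma>) \<Longrightarrow> 0 \<le> U0 \<Longrightarrow> 0 \<le> \<gamma> \<Longrightarrow>
     cmod (u s) \<le> exp (- L * real k / 16) * U0 + 3 * 100 ^ k * \<gamma>"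
  proof (rule regular_site, goal_cases)
    case (1 k1)
    show ?case by (rule 1(1), rule 1(2))
  qed
  show ?thesis
  proof (rule that[of "max 1 (max k1 k2)"])
    fix k q y u U0 \<gamma> T s
    assume k: "k \<ge> max 1 (max k1 k2)" and q: "A' * k \<le> q" "q \<le> 2 * A' * k"
      and sepq: "\<And>j p. 0 < j \<Longrightarrow> j < q \<Longrightarrow> \<bar>of_int (int j) * \<alpha> - of_int p\<bar> \<ge> 1 / (2 * real q)"
      and T: "T = (2 * J + 2) * (k + 1)" and u0: "u 0 = 1"
      and U: "\<And>j. \<bar>j\<bar> \<le> int T \<Longrightarrow> cmod (u j) \<le> U0" and g: "\<And>j. \<bar>j\<bar> \<le> int T \<Longrightarrow> resid y u j \<le> \<gamma>"
      and small: "exp (- L * real k / 16) * U0 + 3 * 100 ^ k * \<gamma> < 1" and half: "exp (- L * real k / 16) \<le> 1 / 2"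
      and s: "int (J * (k + 1)) \<le> \<bar>s\<bar>" "\<bar>s\<bar> \<le> int ((J + 2) * (k + 1))"
    define \<rho> where "\<rho> = exp (- L * real k / 16)"
    define G where "G = 3 * 100 ^ k * \<gamma>"
    have kk: "k \<ge> 1" "k \<ge> k1" "k \<ge> k2" using k by auto
    have w2: "2 \<le> wid k" by (simp add: wid_def)
    have U0: "0 \<le> U0" using order_trans[OF norm_ge_zero U[of 0]] by simp
    have \<gamma>: "0 \<le> \<gamma>" using order_trans[OF norm_ge_zero g[of 0]] by simp
    have G: "0 \<le> G" using \<gamma> by (simp add: G_def)
    have Tq: "int T + int k < int q"
    proof -
      have "T + k < (2 * J + 3) * (k + 1)" by (simp add: T algebra_simps)
      also have "\<dots> \<le> (2 * J + 3) * (2 * k)" using kk by (intro mult_left_mono) auto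
      also have "\<dots> \<le> A' * k" by (simp add: A'_def algebra_simps)
      finally show ?thesis using q by linarith
    qed
    have T2: "2 * (k + 1) \<le> T" unfolding T by (rule mult_right_mono) auto
    have bad0: "bad (L / 64) k (y + \<alpha> * of_int a)" if a: "- int k + int (wid k) \<le> a" "a \<le> - int (wid k)" for a
    proof (rule ccontr)
      assume nb: "\<not> bad (L / 64) k (y + \<alpha> * of_int a)"
      have "cmod (u 0) \<le> exp (- L * real k / 16) * U0 + 3 * 100 ^ k * \<gamma>"
      proof (rule reg[OF kk(3) nb])
        show "a + int (wid k) \<le> 0" "0 \<le> a + int k - int (wid k)" using a by auto
        show "cmod (u j) \<le> U0" if "a \<le> j" "j \<le> a + int k + 1" for j using that a T2 w2 by (intro U) auto
        show "resid y u j \<le> \<gamma>" if "a < j" "j \<le> a + int k" for j using that a T2 w2 by (intro g) auto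
      qed (use U0 \<gamma> in auto)
      then show False using small u0 by simp
    qed
    \<comment> \<open>The distance \<open>i * (k + 1)\<close> is required both from 0 and from the
      ends. The errors stay below \<open>2 * G\<close> because each step at least halves the earlier
      ones.\<close>
    have dec: "cmod (u s) \<le> \<rho> ^ i * U0 + 2 * G" if "int (i * (k + 1)) \<le> \<bar>s\<bar>" "\<bar>s\<bar> + int (i * (k + 1)) \<le> int T" for i s
      using that
    proof (induction i arbitrary: s)
      case 0
      then show ?case using U[of s] G by simp
    next
      case (Suc i)
      have r: "int (i * (k + 1)) + int k + 1 \<le> \<bar>s\<bar>" "\<bar>s\<bar> + int (i * (k + 1)) + int k + 1 \<le> int T" using Suc.prems by (auto simp: algebra_simps)
      have i0: "0 \<le> int (i * (k + 1))" by simp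
      obtain a where a: "s - int k + int (wid k) \<le> a" "a \<le> s - int (wid k)" "\<not> bad (L / 64) k (y + \<alpha> * of_int a)"
      proof -
        have "int k < \<bar>s\<bar>" "\<bar>s\<bar> + int k < int q" using r i0 Tq by linarith+
        then show ?thesis using one[OF kk(2) q(2) sepq _ _ bad0, of s] that by blast
      qed
      have "cmod (u s) \<le> \<rho> * (\<rho> ^ i * U0 + 2 * G) + G" unfolding \<rho>_def G_def
      proof (rule reg[OF kk(3) a(3)])
        show "a + int (wid k) \<le> s" "s \<le> a + int k - int (wid k)" using a by auto
        show "cmod (u j) \<le> exp (- L * real k / 16) ^ i * U0 + 2 * (3 * 100 ^ k * \<gamma>)" if "a \<le> j" "j \<le> a + int k + 1" for j
        proof -
          have "\<bar>j - s\<bar> \<le> int k + 1" using that a w2 by linarith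
          then have "int (i * (k + 1)) \<le> \<bar>j\<bar>" "\<bar>j\<bar> + int (i * (k + 1)) \<le> int T" using r by linarith+
          then show ?thesis using Suc.IH unfolding \<rho>_def G_def by blast
        qed
        show "resid y u j \<le> \<gamma>" if "a < j" "j \<le> a + int k" for j
        proof (rule g)
          have "\<bar>j - s\<bar> \<le> int k + 1" using that a w2 by linarith
          then show "\<bar>j\<bar> \<le> int T" using r i0 by linarith
        qed
      qed (use U0 \<gamma> in auto)
      also have "\<dots> = \<rho> ^ Suc i * U0 + (2 * (\<rho> * G) + G)" by (simp add: algebra_simps)
      also have "2 * (\<rho> * G) + G \<le> 2 * G" using half mult_right_mono[of \<rho> "1/2" G] G by (simp add: \<rho>_def)
      finally show ?case by simp
    qed
    have sT: "\<bar>s\<bar> + int (J * (k + 1)) \<le> int T" using s by (simp add: T algebra_simps)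
    show "cmod (u s) \<le> exp (- L * real k / 16) ^ J * U0 + 2 * (3 * 100 ^ k * \<gamma>)"
      using dec[OF s(1) sT] unfolding \<rho>_def G_def .
  qed
qed

end

subsection \<open>Interpolation\<close>

lemma power_le_fact_exp: "0 \<le> x \<Longrightarrow> x ^ n \<le> fact n * exp (x::real)"
proof -
  assume x: "0 \<le> x"
  have "(\<Sum>i\<in>{n}. x ^ i /\<^sub>R fact i) \<le> (\<Sum>i. x ^ i /\<^sub>R fact i)"
    using x summable_exp_generic[of x] by (intro sum_le_suminf) auto
  then have "x ^ n / fact n \<le> exp x" unfolding exp_def by (simp add: divide_inverse mult.commute)
  then show ?thesis by (simp add: field_simps)
qed

lemma prod_index_diff:
  assumes "e \<le> n"
  shows "(\<Prod>i\<in>{..n} - {e}. \<bar>real e - real i\<bar>) = fact e * fact (n - e)"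
proof -
  have eq: "{..n} - {e} = {..<e} \<union> {e<..n}" using assms by auto
  have "(\<Prod>i\<in>{..n} - {e}. \<bar>real e - real i\<bar>) = (\<Prod>i<e. \<bar>real e - real i\<bar>) * (\<Prod>i\<in>{e<..n}. \<bar>real e - real i\<bar>)"
    unfolding eq by (rule prod.union_disjoint) auto
  also have "(\<Prod>i<e. \<bar>real e - real i\<bar>) = fact e"
    unfolding fact_prod_rev of_nat_prod by (rule prod.cong) (auto simp: of_nat_diff)
  also have "(\<Prod>i\<in>{e<..n}. \<bar>real e - real i\<bar>) = fact (n - e)"
    unfolding fact_prod_Suc of_nat_prod
    by (rule prod.reindex_bij_witness[of _ "\<lambda>j. e + Suc j" "\<lambda>i. i - Suc e"]) auto
  finally show ?thesis .
qed

text \<open>The denominators of the Lagrange basis are at least \<open>e! (n - e)! h^n\<close>, so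
  the terms are controlled by binomial coefficients, which sum to \<open>2 ^ n\<close>.\<close>

lemma lagrange_bound:
  fixes p :: "complex poly" and x :: "nat \<Rightarrow> real"
  assumes deg: "degree p \<le> n" and h: "h > 0" and r: "r \<ge> 0"
    and sep: "\<And>e i. e \<le> n \<Longrightarrow> i \<le> n \<Longrightarrow> \<bar>real e - real i\<bar> * h \<le> \<bar>x e - x i\<bar>"
    and xr: "\<And>e. e \<le> n \<Longrightarrow> \<bar>x e\<bar> \<le> r"
    and B: "\<And>e. e \<le> n \<Longrightarrow> cmod (poly p (of_real (x e))) \<le> B"
  shows "cmod (poly p 0) \<le> B * ((2 * r / h) ^ n / fact n)"
proof -
  define X where "X = (\<lambda>e. complex_of_real (x e))"
  have ne: "X e \<noteq> X i" if "e \<le> n" "i \<le> n" "e \<noteq> i" for e i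
  proof -
    have "0 < \<bar>real e - real i\<bar> * h" using that h by simp
    then show ?thesis using sep[OF that(1,2)] by (auto simp: X_def)
  qed
  define D where "D = (\<lambda>e. \<Prod>i\<in>{..n} - {e}. X e - X i)"
  have D0: "D e \<noteq> 0" if "e \<le> n" for e using ne that by (auto simp: D_def)
  define lq where "lq = (\<lambda>e. [:poly p (X e) / D e:] * (\<Prod>i\<in>{..n} - {e}. [:- X i, 1:]))"
  define q where "q = (\<Sum>e\<le>n. lq e)"
  have dl: "degree (lq e) \<le> n" if "e \<le> n" for e
  proof -
    have "degree (\<Prod>i\<in>{..n} - {e}. [:- X i, 1:]) \<le> (\<Sum>i\<in>{..n} - {e}. degree [:- X i, 1:])"
      using degree_prod_sum_le[of "{..n} - {e}" "\<lambda>i. [:- X i, 1:]"] by (simp add: o_def)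
    also have "\<dots> = n" using that by simp
    finally show ?thesis unfolding lq_def by (intro order_trans[OF degree_mult_le]) simp
  qed
  have pl: "poly (lq e) z = poly p (X e) / D e * (\<Prod>i\<in>{..n} - {e}. z - X i)" for e z
    by (simp add: lq_def poly_prod)
  have qX: "poly q (X i) = poly p (X i)" if i: "i \<le> n" for i
  proof -
    have "poly q (X i) = (\<Sum>e\<le>n. poly (lq e) (X i))" by (simp add: q_def poly_sum)
    also have "\<dots> = (\<Sum>e\<le>n. if e = i then poly p (X i) else 0)"
    proof (rule sum.cong)
      fix e assume e: "e \<in> {..n}"
      show "poly (lq e) (X i) = (if e = i then poly p (X i) else 0)"
      proof (cases "e = i")
        case True
        then show ?thesis using D0[OF i] by (simp add: pl D_def)
      next
        case False
        then have "(\<Prod>j\<in>{..n} - {e}. X i - X j) = 0" using i by (intro prod_zero) auto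
        then show ?thesis using False by (simp add: pl)
      qed
    qed simp
    also have "\<dots> = poly p (X i)" using i by simp
    finally show ?thesis .
  qed
  have "p - q = 0"
  proof (rule ccontr)
    assume nz: "p - q \<noteq> 0"
    have "degree q \<le> n" unfolding q_def using dl by (intro degree_sum_le) auto
    then have "degree (p - q) \<le> n" using deg by (simp add: degree_diff_le)
    moreover have "card (X ` {..n}) \<le> card {z. poly (p - q) z = 0}"
      using qX by (intro card_mono poly_roots_finite[OF nz]) auto
    moreover have "card (X ` {..n}) = Suc n"
      using card_image[of X "{..n}"] ne by (auto simp: inj_on_def)
    ultimately show False using card_poly_roots_bound[OF nz] by linarith
  qed
  then have "poly p 0 = (\<Sum>e\<le>n. poly (lq e) 0)" by (simp add: q_def poly_sum)
  then have "cmod (poly p 0) \<le> (\<Sum>e\<le>n. cmod (poly (lq e) 0))" by (simp add: norm_sum)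
  also have "\<dots> \<le> (\<Sum>e\<le>n. B * ((r / h) ^ n / fact n * real (n choose e)))"
  proof (rule sum_mono)
    fix e assume "e \<in> {..n}"
    then have e: "e \<le> n" by simp
    have ce: "card ({..n} - {e}) = n" using e by simp
    have "cmod (\<Prod>i\<in>{..n} - {e}. 0 - X i) \<le> (\<Prod>i\<in>{..n} - {e}. r)"
      unfolding prod_norm[symmetric] using xr by (intro prod_mono) (auto simp: X_def)
    then have 1: "cmod (\<Prod>i\<in>{..n} - {e}. 0 - X i) \<le> r ^ n" using ce by simp
    have "(\<Prod>i\<in>{..n} - {e}. \<bar>real e - real i\<bar> * h) \<le> (\<Prod>i\<in>{..n} - {e}. cmod (X e - X i))"
      using sep[OF e] h by (intro prod_mono) (auto simp: X_def simp flip: of_real_diff)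
    then have 2: "fact e * fact (n - e) * h ^ n \<le> cmod (D e)"
      using ce by (simp add: D_def prod.distrib prod_index_diff[OF e] prod_norm)
    have 3: "0 < fact e * fact (n - e) * h ^ n" using h by simp
    have B0: "0 \<le> B" using order_trans[OF norm_ge_zero B[OF e]] .
    have "cmod (poly (lq e) 0) = cmod (poly p (X e)) * cmod (\<Prod>i\<in>{..n} - {e}. 0 - X i) / cmod (D e)"
      by (simp add: pl norm_mult norm_divide)
    also have "\<dots> \<le> B * r ^ n / (fact e * fact (n - e) * h ^ n)"
      using B[OF e] 1 2 3 B0 r by (intro frac_le mult_mono) (auto simp: X_def)
    also have "\<dots> = B * ((r / h) ^ n / fact n * real (n choose e))"
      using h by (simp add: binomial_fact[OF e] power_divide field_simps)
    finally show "cmod (poly (lq e) 0) \<le> B * ((r / h) ^ n / fact n * real (n choose e))" .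
  qed
  also have "\<dots> = B * ((r / h) ^ n / fact n * real (\<Sum>e\<le>n. n choose e))"
    by (simp add: sum_distrib_left)
  also have "(\<Sum>e\<le>n. n choose e) = 2 ^ n" by (rule choose_row_sum)
  also have "(r / h) ^ n / fact n * real (2 ^ n) = (2 * r / h) ^ n / fact n"
    by (simp add: power_divide power_mult_distrib)
  finally show ?thesis .
qed

text \<open>Near \<open>t0\<close> the sum is replaced by its Taylor polynomial of degree
  \<open>n\<close>, so \<open>n + 1\<close> nodes suffice although there are
  \<open>2 * R + 1\<close> frequencies. The bound is useful when \<open>R * r\<close> is small
  compared with \<open>n\<close>.\<close>

lemma exp_sum_interpolation:
  fixes \<phi> :: "int \<Rightarrow> complex" and x :: "nat \<Rightarrow> real" and R :: int
  defines "f \<equiv> \<lambda>t. \<Sum>s\<in>{-R..R}. \<phi> s * cis (pi * real_of_int s * t)"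
  assumes V: "(\<Sum>s\<in>{-R..R}. cmod (\<phi> s)) \<le> V" and h: "h > 0" and r: "r \<ge> 0" and R: "R \<ge> 0"
    and sep: "\<And>e i. e \<le> n \<Longrightarrow> i \<le> n \<Longrightarrow> \<bar>real e - real i\<bar> * h \<le> \<bar>x e - x i\<bar>"
    and xr: "\<And>e. e \<le> n \<Longrightarrow> \<bar>x e - t0\<bar> \<le> r"
    and B: "\<And>e. e \<le> n \<Longrightarrow> cmod (f (x e)) \<le> B"
  shows "cmod (f t0) \<le> (B + V * ((pi * real_of_int R * r) ^ Suc n / fact n)) * ((2 * r / h) ^ n / fact n)"
proof -
  define p where "p = (\<Sum>s\<in>{-R..R}. [:\<phi> s * cis (pi * real_of_int s * t0):] * (\<Sum>j\<le>n. Polynomial.monom ((\<i> * of_real (pi * real_of_int s)) ^ j / fact j) j))"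
  define Tay where "Tay = (\<lambda>s t. \<Sum>j\<le>n. (\<i> * of_real (pi * real_of_int s * (t - t0))) ^ j / (fact j :: complex))"
  have pp: "poly p (of_real (t - t0)) = (\<Sum>s\<in>{-R..R}. \<phi> s * cis (pi * real_of_int s * t0) * Tay s t)" for t
    by (simp add: p_def Tay_def poly_sum poly_monom power_mult_distrib mult_ac)
  have deg: "degree p \<le> n"
    unfolding p_def
  proof (intro degree_sum_le order_trans[OF degree_mult_le])
    fix s
    have "degree (\<Sum>j\<le>n. Polynomial.monom ((\<i> * of_real (pi * real_of_int s)) ^ j / (fact j :: complex)) j) \<le> n"
      by (intro degree_sum_le) (auto intro: order_trans[OF degree_monom_le])
    then show "degree [:\<phi> s * cis (pi * real_of_int s * t0):] + degree (\<Sum>j\<le>n. Polynomial.monom ((\<i> * of_real (pi * real_of_int s)) ^ j / (fact j :: complex)) j) \<le> n" by simp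
  qed simp
  have "poly p (of_real (t0 - t0)) = f t0"
    unfolding pp f_def
  proof (intro sum.cong refl)
    fix s
    have "Tay s t0 = (\<Sum>j\<le>n. if j = 0 then 1 else 0)" unfolding Tay_def by (intro sum.cong) auto
    then show "\<phi> s * cis (pi * real_of_int s * t0) * Tay s t0 = \<phi> s * cis (pi * real_of_int s * t0)" by simp
  qed
  then have p0: "poly p 0 = f t0" by simp
  have err: "cmod (f t - poly p (of_real (t - t0))) \<le> V * ((pi * real_of_int R * r) ^ Suc n / fact n)" if t: "\<bar>t - t0\<bar> \<le> r" for t
  proof -
    have "f t - poly p (of_real (t - t0)) = (\<Sum>s\<in>{-R..R}. \<phi> s * cis (pi * real_of_int s * t0) * (cis (pi * real_of_int s * (t - t0)) - Tay s t))"
      unfolding pp f_def by (simp add: sum_subtractf[symmetric] right_diff_distrib cis_mult[symmetric] mult.assoc) (simp add: cis_mult algebra_simps)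
    also have "cmod \<dots> \<le> (\<Sum>s\<in>{-R..R}. cmod (\<phi> s) * ((pi * real_of_int R * r) ^ Suc n / fact n))"
    proof (rule sum_norm_le)
      fix s assume s: "s \<in> {-R..R}"
      define a where "a = pi * real_of_int s * (t - t0)"
      have "cmod (cis a - Tay s t) \<le> \<bar>a\<bar> ^ Suc n / fact n"
        using Taylor_exp[of "\<i> * complex_of_real a" n] unfolding Tay_def a_def[symmetric] cis_conv_exp by (simp add: norm_mult)
      also have "\<dots> \<le> (pi * real_of_int R * r) ^ Suc n / fact n"
      proof (intro divide_right_mono power_mono)
        have "\<bar>a\<bar> = pi * real_of_int \<bar>s\<bar> * \<bar>t - t0\<bar>" by (simp add: a_def abs_mult)
        also have "\<dots> \<le> pi * real_of_int R * r" using s t R by (intro mult_mono) auto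
        finally show "\<bar>a\<bar> \<le> pi * real_of_int R * r" .
      qed auto
      finally show "cmod (\<phi> s * cis (pi * real_of_int s * t0) * (cis (pi * real_of_int s * (t - t0)) - Tay s t))
          \<le> cmod (\<phi> s) * ((pi * real_of_int R * r) ^ Suc n / fact n)"
        unfolding a_def norm_mult norm_cis mult_1_right by (rule mult_left_mono) simp
    qed
    also have "\<dots> = (\<Sum>s\<in>{-R..R}. cmod (\<phi> s)) * ((pi * real_of_int R * r) ^ Suc n / fact n)" by (rule sum_distrib_right[symmetric])
    also have "\<dots> \<le> V * ((pi * real_of_int R * r) ^ Suc n / fact n)" using V R r by (intro mult_right_mono) auto
    finally show ?thesis .
  qed
  have "cmod (poly p 0) \<le> (B + V * ((pi * real_of_int R * r) ^ Suc n / fact n)) * ((2 * r / h) ^ n / fact n)"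
  proof (rule lagrange_bound[OF deg h r, where x="\<lambda>e. x e - t0"])
    show "\<bar>real e - real i\<bar> * h \<le> \<bar>x e - t0 - (x i - t0)\<bar>" if "e \<le> n" "i \<le> n" for e i using sep[OF that] by simp
    show "\<bar>x e - t0\<bar> \<le> r" if "e \<le> n" for e by (rule xr[OF that])
    show "cmod (poly p (of_real (x e - t0))) \<le> B + V * ((pi * real_of_int R * r) ^ Suc n / fact n)" if e: "e \<le> n" for e
      using norm_triangle_ineq4[of "f (x e)" "f (x e) - poly p (of_real (x e - t0))"] B[OF e] err[OF xr[OF e]] by simp
  qed
  then show ?thesis unfolding p0 .
qed

subsection \<open>The dual chain\<close>

text \<open>Aubry duality: the Fourier transform of a solution solves a chain of the same kind.\<close>

lemma dual_intertwine:
  fixes \<phi> :: "int \<Rightarrow> complex" and R :: int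
  assumes supp: "\<And>s. \<bar>s\<bar> > R \<Longrightarrow> \<phi> s = 0" and R: "R \<ge> 0"
  defines "f \<equiv> \<lambda>t. \<Sum>s\<in>{-R..R}. \<phi> s * cis (pi * real_of_int s * t)"
  shows "jop (chain_int \<alpha> (t + \<alpha> / 2)) (\<lambda>_. 0) (\<lambda>l. cis (pi * (y - \<alpha> / 2) * real_of_int l) * f (t + \<alpha> * real_of_int l)) l
      - z * (cis (pi * (y - \<alpha> / 2) * real_of_int l) * f (t + \<alpha> * real_of_int l))
     = cis (pi * (y - \<alpha> / 2) * real_of_int l) * (\<Sum>s\<in>{-(R+1)..R+1}.
         (jop (chain_int \<alpha> y) (\<lambda>_. 0) \<phi> s - z * \<phi> s) * cis (pi * real_of_int s * (t + \<alpha> * real_of_int l)))"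
proof -
  define T where "T = t + \<alpha> * real_of_int l"
  \<comment> \<open>Bonds and shifts exchange roles: a cosine in \<open>s\<close> moves the argument
    \<open>T\<close> by \<alpha>, and a shift in \<open>s\<close> becomes a cosine in
    \<open>T\<close>. The leftover phases \<open>cis b\<close> and \<open>cis (- b)\<close> are
    gauged away by the factor \<open>cis (b * l)\<close>.\<close>
  define b where "b = pi * (y - \<alpha> / 2)"
  have ff: "(\<Sum>s\<in>{-(R+1)..R+1}. \<phi> s * cis (pi * real_of_int s * T)) = f T"
    using sum_shift_symmetric[of R "\<lambda>s. \<phi> s * cis (pi * real_of_int s * T)" 0 1 "R + 1"] supp by (simp add: f_def)
  have s1: "(\<Sum>s\<in>{-(R+1)..R+1}. chain_int \<alpha> y s * \<phi> (s + 1) * cis (pi * real_of_int s * T))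
      = (\<Sum>s\<in>{-R..R}. chain_int \<alpha> y (s - 1) * \<phi> s * cis (pi * real_of_int (s - 1) * T))"
    using sum_shift_symmetric[of R "\<lambda>s. chain_int \<alpha> y (s - 1) * \<phi> s * cis (pi * real_of_int (s - 1) * T)" 1 1 "R + 1"] supp by simp
  have s2: "(\<Sum>s\<in>{-(R+1)..R+1}. chain_int \<alpha> y (s - 1) * \<phi> (s - 1) * cis (pi * real_of_int s * T))
      = (\<Sum>s\<in>{-R..R}. chain_int \<alpha> y s * \<phi> s * cis (pi * real_of_int (s + 1) * T))"
    using sum_shift_symmetric[of R "\<lambda>s. chain_int \<alpha> y s * \<phi> s * cis (pi * real_of_int (s + 1) * T)" "- 1" 1 "R + 1"] supp by simp
  have key: "chain_int \<alpha> y (s - 1) * \<phi> s * cis (pi * real_of_int (s - 1) * T) + chain_int \<alpha> y s * \<phi> s * cis (pi * real_of_int (s + 1) * T)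
     = complex_of_real (2 * cos (pi * (T + \<alpha> / 2))) * cis b * (\<phi> s * cis (pi * real_of_int s * (T + \<alpha>)))
     + complex_of_real (2 * cos (pi * (T - \<alpha> / 2))) * cis (- b) * (\<phi> s * cis (pi * real_of_int s * (T - \<alpha>)))" for s
  proof -
    define S where "S = real_of_int s"
    have c1: "complex_of_real (chain_int \<alpha> y (s - 1)) = cis (pi * (y + \<alpha> * (S - 1))) + cis (- (pi * (y + \<alpha> * (S - 1))))"
      unfolding cis_add_cis_minus by (simp add: chain_int_def S_def)
    have c2: "complex_of_real (chain_int \<alpha> y s) = cis (pi * (y + \<alpha> * S)) + cis (- (pi * (y + \<alpha> * S)))"
      unfolding cis_add_cis_minus by (simp add: chain_int_def S_def)
    have S1: "real_of_int (s - 1) = S - 1" "real_of_int (s + 1) = S + 1" "real_of_int s = S" by (simp_all add: S_def)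
    have e: "cis (pi * (y + \<alpha> * (S - 1))) * cis (pi * (S - 1) * T) = cis (- (pi * (T + \<alpha> / 2))) * cis b * cis (pi * S * (T + \<alpha>))"
      "cis (- (pi * (y + \<alpha> * (S - 1)))) * cis (pi * (S - 1) * T) = cis (- (pi * (T - \<alpha> / 2))) * cis (- b) * cis (pi * S * (T - \<alpha>))"
      "cis (pi * (y + \<alpha> * S)) * cis (pi * (S + 1) * T) = cis (pi * (T + \<alpha> / 2)) * cis b * cis (pi * S * (T + \<alpha>))"
      "cis (- (pi * (y + \<alpha> * S))) * cis (pi * (S + 1) * T) = cis (pi * (T - \<alpha> / 2)) * cis (- b) * cis (pi * S * (T - \<alpha>))"
      by (simp_all only: cis_mult, rule_tac [!] arg_cong[where f=cis], simp_all add: b_def algebra_simps)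
    have "chain_int \<alpha> y (s - 1) * \<phi> s * cis (pi * (S - 1) * T) + chain_int \<alpha> y s * \<phi> s * cis (pi * (S + 1) * T)
      = \<phi> s * (cis (pi * (y + \<alpha> * (S - 1))) * cis (pi * (S - 1) * T) + cis (- (pi * (y + \<alpha> * (S - 1)))) * cis (pi * (S - 1) * T)
         + cis (pi * (y + \<alpha> * S)) * cis (pi * (S + 1) * T) + cis (- (pi * (y + \<alpha> * S))) * cis (pi * (S + 1) * T))"
      unfolding c1 c2 by (simp add: algebra_simps)
    also have "\<dots> = (cis (pi * (T + \<alpha> / 2)) + cis (- (pi * (T + \<alpha> / 2)))) * cis b * (\<phi> s * cis (pi * S * (T + \<alpha>)))
      + (cis (pi * (T - \<alpha> / 2)) + cis (- (pi * (T - \<alpha> / 2)))) * cis (- b) * (\<phi> s * cis (pi * S * (T - \<alpha>)))"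
      unfolding e by (simp add: algebra_simps)
    finally show ?thesis unfolding S1 cis_add_cis_minus .
  qed
  have "(\<Sum>s\<in>{-(R+1)..R+1}. (jop (chain_int \<alpha> y) (\<lambda>_. 0) \<phi> s - z * \<phi> s) * cis (pi * real_of_int s * T))
     = (\<Sum>s\<in>{-(R+1)..R+1}. chain_int \<alpha> y s * \<phi> (s + 1) * cis (pi * real_of_int s * T))
     + (\<Sum>s\<in>{-(R+1)..R+1}. chain_int \<alpha> y (s - 1) * \<phi> (s - 1) * cis (pi * real_of_int s * T))
     - z * (\<Sum>s\<in>{-(R+1)..R+1}. \<phi> s * cis (pi * real_of_int s * T))"
    by (simp add: jop_def sum_distrib_left sum.distrib[symmetric] sum_subtractf[symmetric] algebra_simps)
  also have "\<dots> = (\<Sum>s\<in>{-R..R}. chain_int \<alpha> y (s - 1) * \<phi> s * cis (pi * real_of_int (s - 1) * T) + chain_int \<alpha> y s * \<phi> s * cis (pi * real_of_int (s + 1) * T)) - z * f T"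
    unfolding s1 s2 ff by (simp only: sum.distrib)
  also have "\<dots> = complex_of_real (2 * cos (pi * (T + \<alpha> / 2))) * cis b * f (T + \<alpha>) + complex_of_real (2 * cos (pi * (T - \<alpha> / 2))) * cis (- b) * f (T - \<alpha>) - z * f T"
    unfolding key f_def by (simp only: sum.distrib sum_distrib_left)
  finally have main: "(\<Sum>s\<in>{-(R+1)..R+1}. (jop (chain_int \<alpha> y) (\<lambda>_. 0) \<phi> s - z * \<phi> s) * cis (pi * real_of_int s * T))
     = complex_of_real (2 * cos (pi * (T + \<alpha> / 2))) * cis b * f (T + \<alpha>) + complex_of_real (2 * cos (pi * (T - \<alpha> / 2))) * cis (- b) * f (T - \<alpha>) - z * f T" .
  have T1: "t + \<alpha> * real_of_int (l + 1) = T + \<alpha>" "t + \<alpha> * real_of_int (l - 1) = T - \<alpha>"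
    "t + \<alpha> / 2 + \<alpha> * real_of_int l = T + \<alpha> / 2" "t + \<alpha> / 2 + \<alpha> * real_of_int (l - 1) = T - \<alpha> / 2"
    by (simp_all add: T_def algebra_simps)
  have cb: "cis (b * real_of_int (l + 1)) = cis (b * real_of_int l) * cis b" "cis (b * real_of_int (l - 1)) = cis (b * real_of_int l) * cis (- b)"
    by (simp_all only: cis_mult, simp_all add: algebra_simps)
  show ?thesis
    unfolding T_def[symmetric] b_def[symmetric] main
    unfolding jop_def chain_int_def T1 cb by (simp add: algebra_simps)
qed

text \<open>The mean square over a grid of \<open>2 * R + 1\<close> points is the sum of the squared
  coefficients, hence at least 1.\<close>

lemma exp_sum_large:
  fixes \<phi> :: "int \<Rightarrow> complex" and R :: int
  assumes "\<phi> 0 = 1" "R \<ge> 0"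
  obtains t where "cmod (\<Sum>s\<in>{-R..R}. \<phi> s * cis (pi * real_of_int s * t)) \<ge> 1"
proof (rule ccontr)
  assume neg: "\<not> thesis"
  define G where "G = nat (2 * R + 1)"
  have G: "G > 0" "2 * R < int G" using assms by (auto simp: G_def)
  have "cmod (\<Sum>n\<in>{-R..R}. \<phi> n * cis (2 * pi * real j * real_of_int n / real G)) < 1" for j
  proof -
    have "(\<Sum>n\<in>{-R..R}. \<phi> n * cis (2 * pi * real j * real_of_int n / real G)) = (\<Sum>s\<in>{-R..R}. \<phi> s * cis (pi * real_of_int s * (2 * real j / real G)))"
      by (intro sum.cong refl arg_cong[where f="\<lambda>a. \<phi> _ * cis a"]) simp
    then show ?thesis using that neg by (metis not_less)
  qed
  then have "(\<Sum>j<G. (cmod (\<Sum>n\<in>{-R..R}. \<phi> n * cis (2 * pi * real j * real_of_int n / real G)))\<^sup>2) < (\<Sum>j<G. 1)"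
    using G(1) by (intro sum_strict_mono) (auto simp: power_less_one_iff abs_square_less_1)
  then have "real G * (\<Sum>n\<in>{-R..R}. (cmod (\<phi> n))\<^sup>2) < real G" unfolding sum_grid_cis_sq[OF G] by simp
  moreover have "(\<Sum>n\<in>{0}. (cmod (\<phi> n))\<^sup>2) \<le> (\<Sum>n\<in>{-R..R}. (cmod (\<phi> n))\<^sup>2)"
    using assms(2) by (intro sum_mono2) auto
  ultimately show False using assms(1) G(1) by simp
qed

lemma strict_mono_on_index_le:
  fixes g :: "nat \<Rightarrow> nat"
  assumes "strict_mono_on {..<m} g" "e \<le> i" "i < m"
  shows "g e + (i - e) \<le> g i"
  using assms(2,3)
proof (induction i rule: dec_induct)
  case (step i)
  have "g i < g (Suc i)" using assms(1) step by (auto simp: strict_mono_on_def)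
  then show ?case using step by linarith
qed simp

context positive_growth begin

text \<open>Every second cell of an interval of length \<open>r\<close> is a candidate,
  \<open>2 * (n + 1)\<close> in all. At most half of the candidates consist entirely of bad phases;
  the others supply the nodes, and the skipped cells keep these apart.\<close>

lemma nonbad_nodes:
  assumes r: "0 < r" "r \<le> 1"
  obtains k0 where "\<And>K n \<tau>. K \<ge> k0 \<Longrightarrow> \<exists>x::nat \<Rightarrow> real.
     (\<forall>e\<le>n. \<bar>x e - \<tau>\<bar> \<le> r \<and> \<not> bad (L / 64) K (x e)) \<and>
     (\<forall>e\<le>n. \<forall>i\<le>n. \<bar>real e - real i\<bar> * (r / (5 * real (Suc n))) \<le> \<bar>x e - x i\<bar>)"
proof -
  have \<delta>: "L / 64 > 0" using L_pos by simp
  have \<mu>: "r / 5 > 0" using r by simp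
  obtain k1 where k1: "k1 \<ge> 2" and cells: "\<And>k M I. k \<ge> k1 \<Longrightarrow> M > 0 \<Longrightarrow> I \<subseteq> {..<M} \<Longrightarrow>
     (\<And>i y. i \<in> I \<Longrightarrow> real i / real M \<le> y \<Longrightarrow> y < (real i + 1) / real M \<Longrightarrow> bad (L / 64) k y) \<Longrightarrow> real (card I) \<le> r / 5 * real M"
    using bad_cells[OF \<delta> \<mu>] by blast
  have "\<exists>x::nat \<Rightarrow> real. (\<forall>e\<le>n. \<bar>x e - \<tau>\<bar> \<le> r \<and> \<not> bad (L / 64) K (x e)) \<and>
     (\<forall>e\<le>n. \<forall>i\<le>n. \<bar>real e - real i\<bar> * (r / (5 * real (Suc n))) \<le> \<bar>x e - x i\<bar>)" if K: "K \<ge> k1" for K n \<tau>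
  proof -
    \<comment> \<open>Cell lengths lie between \<open>r / (5 * (n + 1))\<close> and
      \<open>r / (4 * (n + 1))\<close>: short enough for all candidates to fit, long enough for the
      separation and the count of bad cells.\<close>
    define M where "M = nat \<lceil>4 * real (Suc n) / r\<rceil>"
    define R where "R = 2 * Suc n"
    have Mr: "4 * real (Suc n) / r \<le> real M" by (simp add: M_def real_nat_ceiling_ge)
    have M0: "M > 0" using Mr r by (cases M) (auto simp: divide_le_0_iff)
    have rM: "2 * real R \<le> r * real M" using Mr r by (simp add: R_def field_simps)
    have Mu: "real M \<le> 5 * real (Suc n) / r"
    proof -
      have "0 < 4 * real (Suc n) / r" using r by simp
      then have "real M \<le> 4 * real (Suc n) / r + 1" unfolding M_def by (simp add: of_nat_nat ceiling_le_iff)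
      also have "1 \<le> real (Suc n) / r" using r by simp
      finally show ?thesis by (simp add: add_divide_distrib[symmetric])
    qed
    define \<phi> where "\<phi> = \<tau> - of_int \<lfloor>\<tau>\<rfloor>"
    have \<phi>: "0 \<le> \<phi>" "\<phi> < 1" unfolding \<phi>_def by linarith+
    \<comment> \<open>The interval from \<open>c\<close> to \<open>c + r\<close> contains the
      fractional part of the target and stays inside the unit interval, so no cell wraps
      around.\<close>
    define c where "c = min \<phi> (1 - r)"
    have c: "0 \<le> c" "c \<le> \<phi>" "\<phi> \<le> c + r" "c + r \<le> 1" using \<phi> r by (auto simp: c_def)
    define i0 where "i0 = nat \<lceil>c * real M\<rceil>"
    have i0: "c * real M \<le> real i0" "real i0 \<le> c * real M + 1"
    proof -
      show "c * real M \<le> real i0" by (simp add: i0_def real_nat_ceiling_ge)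
      have "0 \<le> c * real M" using c(1) by simp
      then have "0 \<le> \<lceil>c * real M\<rceil>" using ceiling_mono[of 0 "c * real M"] by simp
      then show "real i0 \<le> c * real M + 1" unfolding i0_def by (simp add: of_nat_nat)
    qed
    have cellr: "real (i0 + 2 * j) + 1 \<le> (c + r) * real M" if "j < R" for j
      using that i0(2) rM by (simp add: distrib_right)
    define cell where "cell = (\<lambda>j y. real (i0 + 2 * j) / real M \<le> y \<and> y < (real (i0 + 2 * j) + 1) / real M)"
    define Bd where "Bd = {j. j < R \<and> (\<forall>y. cell j y \<longrightarrow> bad (L / 64) K y)}"
    have "real (card ((\<lambda>j. i0 + 2 * j) ` Bd)) \<le> r / 5 * real M"
    proof (rule cells[OF K M0])
      show "(\<lambda>j. i0 + 2 * j) ` Bd \<subseteq> {..<M}"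
      proof
        fix i assume "i \<in> (\<lambda>j. i0 + 2 * j) ` Bd"
        then obtain j where j: "i = i0 + 2 * j" "j < R" by (auto simp: Bd_def)
        have "real i + 1 \<le> (c + r) * real M" using cellr[OF j(2)] j(1) by simp
        also have "\<dots> \<le> 1 * real M" using c by (intro mult_right_mono) auto
        finally show "i \<in> {..<M}" by simp
      qed
    qed (auto simp: Bd_def cell_def)
    also have "\<dots> \<le> r / 5 * (5 * real (Suc n) / r)" using Mu r by (intro mult_left_mono) auto
    also have "\<dots> = real (Suc n)" using r by simp
    finally have "card ((\<lambda>j. i0 + 2 * j) ` Bd) \<le> Suc n" by linarith
    moreover have "card ((\<lambda>j. i0 + 2 * j) ` Bd) = card Bd" by (rule card_image) (auto simp: inj_on_def)
    ultimately have cB: "card Bd \<le> Suc n" by simp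
    define Gd where "Gd = {..<R} - Bd"
    have fB: "finite Bd" "Bd \<subseteq> {..<R}" by (auto simp: Bd_def)
    have cG: "Suc n \<le> card Gd" using cB fB by (simp add: Gd_def card_Diff_subset R_def)
    obtain g where g: "bij_betw g {..<card Gd} Gd" "strict_mono_on {..<card Gd} g"
      using ex_bij_betw_strict_mono_card[of Gd] by (auto simp: Gd_def)
    have "\<exists>y. cell (g e) y \<and> \<not> bad (L / 64) K y \<and> g e < R" if "e \<le> n" for e
    proof -
      have "g e \<in> Gd" using that cG bij_betwE[OF g(1)] by auto
      then show ?thesis by (auto simp: Gd_def Bd_def)
    qed
    then obtain y where y: "\<And>e. e \<le> n \<Longrightarrow> cell (g e) (y e) \<and> \<not> bad (L / 64) K (y e) \<and> g e < R" by metis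
    have dist: "real (i - e) / real M \<le> y i - y e" if ei: "e < i" "i \<le> n" for e i
    proof -
      have "g e + (i - e) \<le> g i" using strict_mono_on_index_le[OF g(2), of e i] ei cG by simp
      then have "real (i - e) + real (i0 + 2 * g e) + 1 \<le> real (i0 + 2 * g i)" using ei by linarith
      then have "(real (i - e) + (real (i0 + 2 * g e) + 1)) / real M \<le> real (i0 + 2 * g i) / real M"
        by (intro divide_right_mono) auto
      moreover have "real (i0 + 2 * g i) / real M \<le> y i" "y e < (real (i0 + 2 * g e) + 1) / real M"
        using y[of i] y[of e] ei by (auto simp: cell_def)
      ultimately show ?thesis unfolding add_divide_distrib by linarith
    qed
    have h: "r / (5 * real (Suc n)) \<le> 1 / real M"
    proof -
      have "1 / (5 * real (Suc n) / r) \<le> 1 / real M" using Mu M0 by (intro divide_left_mono) (use r in auto)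
      then show ?thesis by simp
    qed
    show ?thesis
    proof (intro exI[of _ "\<lambda>e. of_int \<lfloor>\<tau>\<rfloor> + y e"] conjI allI impI)
      fix e assume e: "e \<le> n"
      have "c \<le> y e"
      proof -
        have "c \<le> real i0 / real M" using i0(1) M0 by (simp add: field_simps)
        also have "\<dots> \<le> real (i0 + 2 * g e) / real M" by (intro divide_right_mono) auto
        finally show ?thesis using y[OF e] by (simp add: cell_def)
      qed
      moreover have "y e \<le> c + r"
      proof -
        have "(real (i0 + 2 * g e) + 1) / real M \<le> c + r" using cellr[of "g e"] y[OF e] M0 by (simp add: divide_le_eq)
        then show ?thesis using y[OF e] by (simp add: cell_def)
      qed
      ultimately show "\<bar>of_int \<lfloor>\<tau>\<rfloor> + y e - \<tau>\<bar> \<le> r" using c unfolding \<phi>_def by linarith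
      show "\<not> bad (L / 64) K (of_int \<lfloor>\<tau>\<rfloor> + y e)" using y[OF e] by (simp add: bad_def add.commute[of "of_int _"] dnorm_add_int)
    next
      fix e i assume ei: "e \<le> n" "i \<le> n"
      have *: "\<bar>real e - real i\<bar> * (1 / real M) \<le> \<bar>y e - y i\<bar>"
      proof (cases rule: linorder_cases[of e i])
        case less then show ?thesis using dist[of e i] ei by (simp add: of_nat_diff)
      next
        case greater then show ?thesis using dist[of i e] ei by (simp add: of_nat_diff)
      qed simp
      have "\<bar>real e - real i\<bar> * (r / (5 * real (Suc n))) \<le> \<bar>real e - real i\<bar> * (1 / real M)"
        by (rule mult_left_mono[OF h]) simp
      with * show "\<bar>real e - real i\<bar> * (r / (5 * real (Suc n))) \<le> \<bar>of_int \<lfloor>\<tau>\<rfloor> + y e - (of_int \<lfloor>\<tau>\<rfloor> + y i)\<bar>" by simp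
    qed
  qed
  then show ?thesis using that by blast
qed

text \<open>Cutting disturbs the equation only at the two sites next to each cut, by one bond, at
  most 2, times a value of size at most \<open>b\<close>.\<close>

lemma truncation_error:
  fixes R :: int
  assumes R: "R \<ge> 1" and u: "\<And>s. R \<le> \<bar>s\<bar> \<Longrightarrow> \<bar>s\<bar> \<le> R + 1 \<Longrightarrow> cmod (u s) \<le> b" and g: "\<And>s. \<bar>s\<bar> \<le> R \<Longrightarrow> resid y u s \<le> \<gamma>"
  shows "resid y (\<lambda>s. if \<bar>s\<bar> \<le> R then u s else 0) s \<le> \<gamma> + 2 * b"
proof -
  let ?\<phi> = "\<lambda>s. if \<bar>s\<bar> \<le> R then u s else 0"
  have b: "0 \<le> b" using order_trans[OF norm_ge_zero u[of R]] R by simp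
  have \<gamma>: "0 \<le> \<gamma>" using order_trans[OF norm_ge_zero g[of 0]] R by simp
  have cu: "cmod (chain_int \<alpha> y k * u s) \<le> 2 * b" if "R \<le> \<bar>s\<bar>" "\<bar>s\<bar> \<le> R + 1" for k s
  proof -
    have "\<bar>chain_int \<alpha> y k\<bar> \<le> 2" by (simp add: chain_int_def abs_mult)
    then show ?thesis unfolding norm_mult norm_of_real by (rule mult_mono[OF _ u[OF that]]) auto
  qed
  consider "\<bar>s\<bar> < R" | "s = R" | "s = - R" | "s = R + 1" | "s = - R - 1" | "R + 1 < \<bar>s\<bar>" by linarith
  then show ?thesis
  proof cases
    case 1
    then have "\<bar>s + 1\<bar> \<le> R" "\<bar>s - 1\<bar> \<le> R" "\<bar>s\<bar> \<le> R" by linarith+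
    then show ?thesis using g[of s] b by (simp add: jop_def)
  next
    case 2
    have "\<not> \<bar>s + 1\<bar> \<le> R" "\<bar>s - 1\<bar> \<le> R" "\<bar>s\<bar> \<le> R" using 2 R by linarith+
    then have "jop (chain_int \<alpha> y) (\<lambda>_. 0) ?\<phi> s - complex_of_real E * ?\<phi> s
      = (jop (chain_int \<alpha> y) (\<lambda>_. 0) u s - complex_of_real E * u s) - chain_int \<alpha> y s * u (s + 1)" by (simp add: jop_def)
    also have "cmod \<dots> \<le> \<gamma> + 2 * b"
      using 2 R by (intro order_trans[OF norm_triangle_ineq4] add_mono g cu) auto
    finally show ?thesis .
  next
    case 3
    have "\<bar>s + 1\<bar> \<le> R" "\<not> \<bar>s - 1\<bar> \<le> R" "\<bar>s\<bar> \<le> R" using 3 R by linarith+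
    then have "jop (chain_int \<alpha> y) (\<lambda>_. 0) ?\<phi> s - complex_of_real E * ?\<phi> s
      = (jop (chain_int \<alpha> y) (\<lambda>_. 0) u s - complex_of_real E * u s) - chain_int \<alpha> y (s - 1) * u (s - 1)" by (simp add: jop_def)
    also have "cmod \<dots> \<le> \<gamma> + 2 * b"
      using 3 R by (intro order_trans[OF norm_triangle_ineq4] add_mono g cu) auto
    finally show ?thesis .
  next
    case 4
    have "\<not> \<bar>s + 1\<bar> \<le> R" "\<bar>s - 1\<bar> \<le> R" "\<not> \<bar>s\<bar> \<le> R" using 4 R by linarith+
    then have "jop (chain_int \<alpha> y) (\<lambda>_. 0) ?\<phi> s - complex_of_real E * ?\<phi> s = chain_int \<alpha> y (s - 1) * u (s - 1)" by (simp add: jop_def)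
    moreover have "cmod (chain_int \<alpha> y (s - 1) * u (s - 1)) \<le> 2 * b" using 4 R by (intro cu) auto
    ultimately show ?thesis using \<gamma> by simp
  next
    case 5
    have "\<bar>s + 1\<bar> \<le> R" "\<not> \<bar>s - 1\<bar> \<le> R" "\<not> \<bar>s\<bar> \<le> R" using 5 R by linarith+
    then have "jop (chain_int \<alpha> y) (\<lambda>_. 0) ?\<phi> s - complex_of_real E * ?\<phi> s = chain_int \<alpha> y s * u (s + 1)" by (simp add: jop_def)
    moreover have "cmod (chain_int \<alpha> y s * u (s + 1)) \<le> 2 * b" using 5 R by (intro cu) auto
    ultimately show ?thesis using \<gamma> by simp
  next
    case 6
    have "\<not> \<bar>s + 1\<bar> \<le> R" "\<not> \<bar>s - 1\<bar> \<le> R" "\<not> \<bar>s\<bar> \<le> R" using 6 R by linarith+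
    then show ?thesis using b \<gamma> by (simp add: jop_def)
  qed
qed

text \<open>A localised approximate solution is concentrated near the origin, so its dual is regular at most phases and
  hence tiny on a net; being an exponential sum of comparable degree, it would be small everywhere.\<close>

lemma localised_contradiction:
  assumes k0: "\<And>Y (a::int) v V \<gamma>. \<not> bad (L / 64) K (Y + \<alpha> * of_int a) \<Longrightarrow>
     a + int (wid K) \<le> 0 \<Longrightarrow> 0 \<le> a + int K - int (wid K) \<Longrightarrow>
     (\<And>j. cmod (v j) \<le> V) \<Longrightarrow> (\<And>j. resid Y v j \<le> \<gamma>) \<Longrightarrow> 0 \<le> V \<Longrightarrow> 0 \<le> \<gamma> \<Longrightarrow>
     cmod (v 0) \<le> exp (- L * real K / 16) * V + 3 * 100 ^ K * \<gamma>"
    and nodes: "\<And>\<tau>. \<exists>x::nat \<Rightarrow> real. (\<forall>e\<le>n. \<bar>x e - \<tau>\<bar> \<le> r \<and> \<not> bad (L / 64) K (x e)) \<and>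
     (\<forall>e\<le>n. \<forall>i\<le>n. \<bar>real e - real i\<bar> * h \<le> \<bar>x e - x i\<bar>)"
    and K: "16 \<le> K" and R: "R \<ge> 1" and u0: "u 0 = 1" and uU: "\<And>s. \<bar>s\<bar> \<le> R \<Longrightarrow> cmod (u s) \<le> U0"
    and u: "\<And>s. R \<le> \<bar>s\<bar> \<Longrightarrow> \<bar>s\<bar> \<le> R + 1 \<Longrightarrow> cmod (u s) \<le> b" and g: "\<And>s. \<bar>s\<bar> \<le> R \<Longrightarrow> resid y u s \<le> \<gamma>"
    and h: "h > 0" and r: "r \<ge> 0"
  defines "V \<equiv> (2 * real_of_int R + 1) * U0" and "\<gamma>' \<equiv> (2 * real_of_int R + 3) * (\<gamma> + 2 * b)"
  shows "1 \<le> (exp (- L * real K / 16) * V + 3 * 100 ^ K * \<gamma>' + V * ((pi * real_of_int R * r) ^ Suc n / fact n)) * ((2 * r / h) ^ n / fact n)"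
proof -
  define \<phi> where "\<phi> = (\<lambda>s. if \<bar>s\<bar> \<le> R then u s else 0)"
  define f where "f = (\<lambda>t. \<Sum>s\<in>{-R..R}. \<phi> s * cis (pi * real_of_int s * t))"
  have sV: "(\<Sum>s\<in>{-R..R}. cmod (\<phi> s)) \<le> V"
  proof -
    have "(\<Sum>s\<in>{-R..R}. cmod (\<phi> s)) \<le> of_nat (card {-R..R}) * U0" using uU by (intro sum_bounded_above) (auto simp: \<phi>_def)
    also have "real (card {-R..R}) = 2 * real_of_int R + 1" using R by simp
    finally show ?thesis by (simp add: V_def)
  qed
  have V0: "0 \<le> V" using order_trans[OF sum_nonneg sV] by simp
  have fV: "cmod (f t) \<le> V" for t
    unfolding f_def by (rule order_trans[OF norm_sum order_trans[OF _ sV]]) (simp add: norm_mult)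
  have \<phi>r: "resid y \<phi> s \<le> \<gamma> + 2 * b" for s unfolding \<phi>_def by (rule truncation_error[OF R u g])
  have gb: "0 \<le> \<gamma> + 2 * b" using order_trans[OF norm_ge_zero \<phi>r[of 0]] .
  have \<gamma>'0: "0 \<le> \<gamma>'" using gb R by (simp add: \<gamma>'_def)
  define B where "B = exp (- L * real K / 16) * V + 3 * 100 ^ K * \<gamma>'"
  \<comment> \<open>The window of length \<open>K\<close> is centred at the dual site 0, where the
    dual solution equals \<open>f t\<close>.\<close>
  have small: "cmod (f t) \<le> B" if nb: "\<not> bad (L / 64) K (t + \<alpha> / 2 + \<alpha> * of_int (- int (K div 2)))" for t
  proof -
    define v where "v = (\<lambda>l::int. cis (pi * (y - \<alpha> / 2) * real_of_int l) * f (t + \<alpha> * real_of_int l))"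
    have w: "8 * wid K \<le> K + 16" by (simp add: wid_def)
    have "cmod (v 0) \<le> exp (- L * real K / 16) * V + 3 * 100 ^ K * \<gamma>'"
    proof (rule k0[OF nb])
      have "2 * wid K \<le> K" "2 * (K div 2) \<le> K" "K \<le> 2 * (K div 2) + 1" using w K by linarith+
      have "wid K \<le> K div 2" unfolding wid_def using K by linarith
      then show "- int (K div 2) + int (wid K) \<le> 0" "0 \<le> - int (K div 2) + int K - int (wid K)" using \<open>2 * (K div 2) \<le> K\<close> by linarith+
      show "cmod (v j) \<le> V" for j using fV by (simp add: v_def norm_mult)
      show "resid (t + \<alpha> / 2) v l \<le> \<gamma>'" for l
      proof -
        have "jop (chain_int \<alpha> (t + \<alpha> / 2)) (\<lambda>_. 0) v l - complex_of_real E * v l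
          = cis (pi * (y - \<alpha> / 2) * real_of_int l) * (\<Sum>s\<in>{-(R+1)..R+1}.
             (jop (chain_int \<alpha> y) (\<lambda>_. 0) \<phi> s - complex_of_real E * \<phi> s) * cis (pi * real_of_int s * (t + \<alpha> * real_of_int l)))"
          unfolding v_def f_def by (rule dual_intertwine) (use R in \<open>auto simp: \<phi>_def\<close>)
        also have "cmod \<dots> \<le> (\<Sum>s\<in>{-(R+1)..R+1}. \<gamma> + 2 * b)"
          unfolding norm_mult norm_cis mult_1_left using \<phi>r by (intro sum_norm_le) (simp add: norm_mult)
        also have "\<dots> = \<gamma>'" using R by (simp add: \<gamma>'_def)
        finally show ?thesis .
      qed
    qed (use V0 \<gamma>'0 in auto)
    then show ?thesis by (simp add: v_def B_def)
  qed
  have "\<phi> 0 = 1" using u0 R by (simp add: \<phi>_def)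
  then obtain t0 where t0: "1 \<le> cmod (f t0)" unfolding f_def using exp_sum_large[of \<phi> R] R by auto
  define \<tau> where "\<tau> = \<alpha> / 2 + \<alpha> * of_int (- int (K div 2))"
  obtain x where x: "\<And>e. e \<le> n \<Longrightarrow> \<bar>x e - (t0 + \<tau>)\<bar> \<le> r" "\<And>e. e \<le> n \<Longrightarrow> \<not> bad (L / 64) K (x e)"
    "\<And>e i. e \<le> n \<Longrightarrow> i \<le> n \<Longrightarrow> \<bar>real e - real i\<bar> * h \<le> \<bar>x e - x i\<bar>"
    using nodes[of "t0 + \<tau>"] by blast
  have "cmod (f t0) \<le> (B + V * ((pi * real_of_int R * r) ^ Suc n / fact n)) * ((2 * r / h) ^ n / fact n)"
    unfolding f_def
  proof (rule exp_sum_interpolation[OF sV h r, where x="\<lambda>e. x e - \<tau>"])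
    show "\<bar>real e - real i\<bar> * h \<le> \<bar>x e - \<tau> - (x i - \<tau>)\<bar>" if "e \<le> n" "i \<le> n" for e i using x(3)[OF that] by simp
    show "\<bar>x e - \<tau> - t0\<bar> \<le> r" if "e \<le> n" for e using x(1)[OF that] by (simp add: algebra_simps)
    show "cmod (\<Sum>s\<in>{-R..R}. \<phi> s * cis (pi * real_of_int s * (x e - \<tau>))) \<le> B" if "e \<le> n" for e
      using small[of "x e - \<tau>"] x(2)[OF that] unfolding f_def \<tau>_def by simp
  qed (use R in auto)
  with t0 show ?thesis unfolding B_def by (rule order_trans)
qed

end

section \<open>Comparison of the exponential rates\<close>

lemma hundred_le_exp: "(100::real) \<le> exp 5"
proof -
  have "(13/8::real) \<le> exp (1/2)" using exp_lower_Taylor_quadratic[of "1/2::real"] by (simp add: power2_eq_square)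
  then have "(13/8::real) ^ 10 \<le> exp (1/2) ^ 10" by (intro power_mono) auto
  also have "\<dots> = exp 5" by (simp flip: exp_of_nat_mult)
  finally show ?thesis by (simp add: power_numeral_reduce)
qed

lemma exp_9_le: "exp 9 \<le> (10000::real)"
proof -
  have "exp (1::real) ^ 9 \<le> (272/100) ^ 9" using e_less_272 by (intro power_mono) auto
  moreover have "exp (1::real) ^ 9 = exp 9" by (simp flip: exp_of_nat_mult)
  ultimately show ?thesis by (simp add: power_numeral_reduce)
qed

text \<open>10000 exceeds \<open>exp 9\<close>, and the factors \<open>k \<le> exp k\<close> and
  \<open>k ^ k \<le> k! exp k\<close> use up two of the nine.\<close>

lemma taylor_remainder_bound:
  assumes X: "0 \<le> X" "X \<le> real k / 10000" and k: "k \<ge> 1"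
  shows "X ^ Suc k / fact k \<le> exp (- 7 * real k)"
proof -
  have "X ^ Suc k = X * X ^ k" by simp
  also have "\<dots> \<le> real k * (real k / 10000) ^ k" using X k by (intro mult_mono power_mono) auto
  also have "(real k / 10000) ^ k = real k ^ k * (1 / 10000) ^ k" by (simp add: power_divide)
  also have "\<dots> \<le> (fact k * exp (real k)) * exp (- 9) ^ k"
  proof (intro mult_mono power_mono)
    show "real k ^ k \<le> fact k * exp (real k)" by (rule power_le_fact_exp) simp
    show "1 / 10000 \<le> exp (- 9::real)" using exp_9_le by (simp add: exp_minus field_simps)
  qed auto
  also have "exp (- 9) ^ k = exp (- 9 * real k)" by (simp flip: exp_of_nat_mult add: mult.commute)
  finally have "X ^ Suc k \<le> real k * (fact k * exp (real k) * exp (- 9 * real k))" by (simp add: mult_left_mono)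
  also have "\<dots> \<le> exp (real k) * (fact k * exp (real k) * exp (- 9 * real k))"
    using exp_ge_add_one_self[of "real k"] by (intro mult_right_mono) (linarith, simp)
  also have "\<dots> = fact k * (exp (real k) * exp (real k) * exp (- 9 * real k))" by simp
  also have "exp (real k) * exp (real k) * exp (- 9 * real k) = exp (- 7 * real k)" by (simp flip: exp_add)
  finally show ?thesis by (simp add: divide_le_eq mult.commute)
qed

text \<open>The phase may change with \<open>T\<close> and \<epsilon>; the size bound is the one
  that \<open>chain_local_solution\<close> supplies.\<close>

definition local_solutions :: "real \<Rightarrow> real \<Rightarrow> bool" where
  "local_solutions \<alpha> E \<longleftrightarrow> (\<forall>T \<epsilon>. \<epsilon> > 0 \<longrightarrow> (\<exists>y u. u 0 = 1 \<and> (\<forall>i. \<bar>i\<bar> \<le> int T \<longrightarrow> cmod (u i) \<le> 4 * (real T + 1)) \<and>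
     (\<forall>i. \<bar>i\<bar> \<le> int T \<longrightarrow> cmod (jop (chain_int \<alpha> y) (\<lambda>_. 0) u i - complex_of_real E * u i) \<le> \<epsilon>)))"

context positive_growth begin

text \<open>Rates are compared per unit of \<open>k\<close>. Interpolation costs
  \<open>exp (4 * k + 1)\<close>, so every error has to be of order \<open>exp (- 7 * k)\<close> up
  to polynomial factors; the constants are chosen for this, and the product
  \<open>exp (1 - 3 * k)\<close> still beats those factors.\<close>

lemma no_local_solutions: "\<not> local_solutions \<alpha> E"
proof
  assume spec: "local_solutions \<alpha> E"
  \<comment> \<open>The dual is treated in blocks of length \<open>K1 * k\<close>, on which a
    regular site gains \<open>exp (- 7 * k)\<close>.\<close>
  define K1 where "K1 = nat \<lceil>112 / L\<rceil>"
  have "112 / L \<le> real K1" unfolding K1_def by (rule real_nat_ceiling_ge)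
  then have K1: "7 \<le> L * real K1 / 16" using L_pos by (simp add: field_simps)
  then have K10: "K1 \<ge> 1" by (cases K1) auto
  \<comment> \<open>Residuals of the dual are amplified by \<open>100 ^ (K1 * k)\<close>, at most
    \<open>exp (5 * K1 * k)\<close>; \<open>J\<close> steps of decay compensate this and leave
    \<open>exp (- 7 * k)\<close>.\<close>
  define J where "J = nat \<lceil>16 * (5 * real K1 + 7) / L\<rceil>"
  have "16 * (5 * real K1 + 7) / L \<le> real J" unfolding J_def by (rule real_nat_ceiling_ge)
  then have J: "5 * real K1 + 7 \<le> L * real J / 16" using L_pos by (simp add: field_simps)
  then have J0: "J > 0" by (cases J) auto
  define A' where "A' = 4 * J + 8"
  \<comment> \<open>The 5 beyond \<open>5 * K1 + 7\<close> pays for the factor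
    \<open>100 ^ k\<close> in the decay estimate.\<close>
  define B where "B = 5 * real K1 + 12"
  \<comment> \<open>This gives \<open>pi * R * r = (k + 1) / 20000\<close>, within the range of
    \<open>taylor_remainder_bound\<close>.\<close>
  define r where "r = 1 / (20000 * pi * (real J + 1))"
  have r: "0 < r" "r \<le> 1"
  proof -
    show "0 < r" using pi_gt_zero by (simp add: r_def)
    have "1 * 1 \<le> pi * (real J + 1)" using pi_gt3 by (intro mult_mono) auto
    then have "1 \<le> 20000 * pi * (real J + 1)" by simp
    then show "r \<le> 1" unfolding r_def by (simp add: divide_le_eq)
  qed
  obtain k1 where k1: "\<And>k q y u U0 \<gamma> T s. k \<ge> k1 \<Longrightarrow> A' * k \<le> q \<Longrightarrow> q \<le> 2 * A' * k \<Longrightarrow>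
     (\<And>j p. 0 < j \<Longrightarrow> j < q \<Longrightarrow> \<bar>of_int (int j) * \<alpha> - of_int p\<bar> \<ge> 1 / (2 * real q)) \<Longrightarrow>
     T = (2 * J + 2) * (k + 1) \<Longrightarrow>
     u 0 = 1 \<Longrightarrow> (\<And>j. \<bar>j\<bar> \<le> int T \<Longrightarrow> cmod (u j) \<le> U0) \<Longrightarrow> (\<And>j. \<bar>j\<bar> \<le> int T \<Longrightarrow> resid y u j \<le> \<gamma>) \<Longrightarrow>
     exp (- L * real k / 16) * U0 + 3 * 100 ^ k * \<gamma> < 1 \<Longrightarrow> exp (- L * real k / 16) \<le> 1 / 2 \<Longrightarrow>
     int (J * (k + 1)) \<le> \<bar>s\<bar> \<Longrightarrow> \<bar>s\<bar> \<le> int ((J + 2) * (k + 1)) \<Longrightarrow>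
        cmod (u s) \<le> exp (- L * real k / 16) ^ J * U0 + 2 * (3 * 100 ^ k * \<gamma>)"
  proof (rule decay[OF J0], goal_cases)
    case (1 k0)
    show ?case by (rule 1(1), rule 1(2)) (assumption | simp only: A'_def)+
  qed
  obtain k2 where k2: "\<And>k y u (a::int) s U0 \<gamma>. k \<ge> k2 \<Longrightarrow> \<not> bad (L / 64) k (y + \<alpha> * of_int a) \<Longrightarrow>
     a + int (wid k) \<le> s \<Longrightarrow> s \<le> a + int k - int (wid k) \<Longrightarrow>
     (\<And>j. a \<le> j \<Longrightarrow> j \<le> a + int k + 1 \<Longrightarrow> cmod (u j) \<le> U0) \<Longrightarrow>
     (\<And>j. a < j \<Longrightarrow> j \<le> a + int k \<Longrightarrow> resid y u j \<le> \<gamma>) \<Longrightarrow> 0 \<le> U0 \<Longrightarrow> 0 \<le> \<gamma> \<Longrightarrow>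
     cmod (u s) \<le> exp (- L * real k / 16) * U0 + 3 * 100 ^ k * \<gamma>"
  proof (rule regular_site, goal_cases)
    case (1 k1)
    show ?case by (rule 1(1), rule 1(2))
  qed
  obtain k3 where k3: "\<And>K n \<tau>. K \<ge> k3 \<Longrightarrow> \<exists>x::nat \<Rightarrow> real.
     (\<forall>e\<le>n. \<bar>x e - \<tau>\<bar> \<le> r \<and> \<not> bad (L / 64) K (x e)) \<and>
     (\<forall>e\<le>n. \<forall>i\<le>n. \<bar>real e - real i\<bar> * (r / (5 * real (Suc n))) \<le> \<bar>x e - x i\<bar>)"
    using nonbad_nodes[OF r] by blast
  define c where "c = real J + 1"
  have c: "c > 0" by (simp add: c_def)
  define U where "U = (\<lambda>k::nat. 4 * (2 * c * (real k + 1) + 1))"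
  define Rr where "Rr = (\<lambda>k::nat. c * (real k + 1))"
  have "(\<lambda>k::nat. exp (- L * real k / 16) * (4 * (2 * c * (real k + 1) + 1))) \<longlonglongrightarrow> 0" using L_pos c by real_asymp
  moreover have "(\<lambda>k::nat. 3 * exp (- 7 * real k)) \<longlonglongrightarrow> 0" by real_asymp
  ultimately have "(\<lambda>k::nat. exp (- L * real k / 16) * (4 * (2 * c * (real k + 1) + 1)) + 3 * exp (- 7 * real k)) \<longlonglongrightarrow> 0 + 0"
    by (rule tendsto_add)
  then have "eventually (\<lambda>k::nat. exp (- L * real k / 16) * (4 * (2 * c * (real k + 1) + 1)) + 3 * exp (- 7 * real k) < 1) at_top"
    by (rule order_tendstoD) simp
  moreover have "eventually (\<lambda>k::nat. exp (- L * real k / 16) \<le> 1 / 2) at_top" using L_pos by real_asymp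
  moreover have "eventually (\<lambda>k::nat. exp (1 - 3 * real k) * (2 * (2 * (c * (real k + 1)) + 1) * (4 * (2 * c * (real k + 1) + 1)) + 3 * (2 * (c * (real k + 1)) + 3) * (2 * (4 * (2 * c * (real k + 1) + 1)) + 13)) < 1) at_top"
    using c by real_asymp
  moreover have "eventually (\<lambda>k. k \<ge> max 16 (max k1 (max k2 k3))) at_top" by (rule eventually_ge_at_top)
  ultimately have "eventually (\<lambda>k. exp (- L * real k / 16) * U k + 3 * exp (- 7 * real k) < 1 \<and> exp (- L * real k / 16) \<le> 1 / 2 \<and>
      exp (1 - 3 * real k) * (2 * (2 * Rr k + 1) * U k + 3 * (2 * Rr k + 3) * (2 * U k + 13)) < 1 \<and> k \<ge> max 16 (max k1 (max k2 k3))) at_top"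
    unfolding U_def Rr_def by eventually_elim simp
  then obtain k0 where k0: "\<And>k. k \<ge> k0 \<Longrightarrow> exp (- L * real k / 16) * U k + 3 * exp (- 7 * real k) < 1 \<and> exp (- L * real k / 16) \<le> 1 / 2 \<and>
      exp (1 - 3 * real k) * (2 * (2 * Rr k + 1) * U k + 3 * (2 * Rr k + 3) * (2 * U k + 13)) < 1 \<and> k \<ge> max 16 (max k1 (max k2 k3))"
    unfolding eventually_at_top_linorder by blast
  obtain q where q: "q \<ge> A' * Suc k0" "\<And>j p. 0 < j \<Longrightarrow> j < q \<Longrightarrow> \<bar>of_int (int j) * \<alpha> - of_int p\<bar> \<ge> 1 / (2 * real q)"
    using separated_denominators[OF irr, of "A' * Suc k0"] by blast
  \<comment> \<open>Separation holds for special \<open>q\<close> only, so \<open>k\<close> is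
    adapted to \<open>q\<close>, which then lies between \<open>A' * k\<close> and
    \<open>2 * A' * k\<close>.\<close>
  define k where "k = q div A'"
  have A'0: "A' > 0" by (simp add: A'_def)
  have kk: "k \<ge> Suc k0" using q(1) A'0 by (simp add: k_def less_eq_div_iff_mult_less_eq mult.commute)
  have kq: "A' * k \<le> q" by (simp add: k_def)
  have "q < A' * k + A'" unfolding k_def using dividend_less_times_div[OF A'0, of q] by (simp only: add.commute)
  also have "\<dots> \<le> A' * k + A' * k" using kk by simp
  finally have kq2: "q \<le> 2 * A' * k" by simp
  have big: "exp (- L * real k / 16) * U k + 3 * exp (- 7 * real k) < 1" "exp (- L * real k / 16) \<le> 1 / 2"
      "exp (1 - 3 * real k) * (2 * (2 * Rr k + 1) * U k + 3 * (2 * Rr k + 3) * (2 * U k + 13)) < 1"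
      "16 \<le> k" "k1 \<le> k" "k2 \<le> k" "k3 \<le> k"
    using k0[of k] kk by auto
  define T where "T = (2 * J + 2) * (k + 1)"
  define \<gamma> where "\<gamma> = exp (- B * real k)"
  define W where "W = exp (- (5 * real K1 + 7) * real k)"
  have \<gamma>: "\<gamma> > 0" by (simp add: \<gamma>_def)
  have B0: "B \<ge> 12" by (simp add: B_def)
  obtain y u where u: "u 0 = 1" "\<And>i. \<bar>i\<bar> \<le> int T \<Longrightarrow> cmod (u i) \<le> 4 * (real T + 1)" "\<And>i. \<bar>i\<bar> \<le> int T \<Longrightarrow> resid y u i \<le> \<gamma>"
    using spec[unfolded local_solutions_def, rule_format, OF \<gamma>, of T] by blast
  have UT: "4 * (real T + 1) = U k" by (simp add: T_def U_def c_def algebra_simps)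
  have hund: "100 ^ k * \<gamma> \<le> W"
  proof -
    have "100 ^ k * \<gamma> \<le> exp 5 ^ k * \<gamma>" using hundred_le_exp \<gamma> by (intro mult_right_mono power_mono) auto
    also have "\<dots> = W" by (simp add: \<gamma>_def W_def B_def exp_add[symmetric] algebra_simps flip: exp_of_nat_mult)
    finally show ?thesis .
  qed
  have W1: "W \<le> exp (- 7 * real k)"
    unfolding W_def exp_le_cancel_iff by (intro mult_right_mono) auto
  have \<gamma>W: "\<gamma> \<le> W"
    unfolding \<gamma>_def W_def B_def exp_le_cancel_iff by (intro mult_right_mono) auto
  have U0: "0 \<le> U k" using c by (simp add: U_def)
  have dec: "cmod (u s) \<le> (U k + 6) * W" if s: "int (J * (k + 1)) \<le> \<bar>s\<bar>" "\<bar>s\<bar> \<le> int ((J + 2) * (k + 1))" for s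
  proof -
    have "exp (- L * real k / 16) * (4 * (real T + 1)) + 3 * 100 ^ k * \<gamma> < 1"
      using big(1) hund W1 unfolding UT by linarith
    from k1[OF big(5) kq kq2 q(2) T_def u this big(2) s]
    have "cmod (u s) \<le> exp (- L * real k / 16) ^ J * U k + 2 * (3 * 100 ^ k * \<gamma>)" unfolding UT .
    also have "exp (- L * real k / 16) ^ J = exp (- (L * real J / 16) * real k)" by (simp flip: exp_of_nat_mult)
    also have "\<dots> * U k \<le> W * U k"
      unfolding W_def using J by (intro mult_right_mono U0, subst exp_le_cancel_iff, intro mult_right_mono) auto
    also have "W * U k + 2 * (3 * 100 ^ k * \<gamma>) \<le> (U k + 6) * W" using hund by (simp add: algebra_simps)
    finally show ?thesis by simp
  qed
  define R where "R = int ((J + 1) * (k + 1))"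
  have RR: "real_of_int R = Rr k" by (simp add: R_def Rr_def c_def algebra_simps)
  define K where "K = K1 * k"
  have Kk: "k \<le> K" using K10 by (simp add: K_def)
  have "1 \<le> (exp (- L * real K / 16) * ((2 * real_of_int R + 1) * U k) + 3 * 100 ^ K * ((2 * real_of_int R + 3) * (\<gamma> + 2 * ((U k + 6) * W)))
      + ((2 * real_of_int R + 1) * U k) * ((pi * real_of_int R * r) ^ Suc k / fact k)) * ((2 * r / (r / (5 * real (Suc k)))) ^ k / fact k)"
  proof (rule localised_contradiction[where y=y and u=u])
    fix Y :: real and a :: int and v V \<gamma>
    assume *: "\<not> bad (L / 64) K (Y + \<alpha> * of_int a)" "a + int (wid K) \<le> 0" "0 \<le> a + int K - int (wid K)"
      "\<And>j. cmod (v j) \<le> V" "\<And>j. resid Y v j \<le> \<gamma>" "0 \<le> V" "0 \<le> \<gamma>"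
    show "cmod (v 0) \<le> exp (- L * real K / 16) * V + 3 * 100 ^ K * \<gamma>"
      by (rule k2[OF _ *(1-3) *(4,5) *(6,7)]) (use big Kk in auto)
  next
    fix \<tau>
    show "\<exists>x::nat \<Rightarrow> real. (\<forall>e\<le>k. \<bar>x e - \<tau>\<bar> \<le> r \<and> \<not> bad (L / 64) K (x e)) \<and>
      (\<forall>e\<le>k. \<forall>i\<le>k. \<bar>real e - real i\<bar> * (r / (5 * real (Suc k))) \<le> \<bar>x e - x i\<bar>)"
      by (rule k3) (use big Kk in auto)
  next
    show "16 \<le> K" using big Kk by simp
    show "1 \<le> R" by (simp add: R_def)
    have RT: "R \<le> int T" unfolding R_def T_def by (simp only: of_nat_le_iff) (rule mult_right_mono, auto)
    show "cmod (u s) \<le> U k" if "\<bar>s\<bar> \<le> R" for s using u(2)[of s] that RT UT by simp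
    show "resid y u s \<le> \<gamma>" if "\<bar>s\<bar> \<le> R" for s using u(3)[of s] that RT by simp
    show "cmod (u s) \<le> (U k + 6) * W" if "R \<le> \<bar>s\<bar>" "\<bar>s\<bar> \<le> R + 1" for s
    proof (rule dec)
      have "int (J * (k + 1)) \<le> R" unfolding R_def by simp
      then show "int (J * (k + 1)) \<le> \<bar>s\<bar>" using that by linarith
      have "R + 1 \<le> int ((J + 2) * (k + 1))" unfolding R_def by simp
      then show "\<bar>s\<bar> \<le> int ((J + 2) * (k + 1))" using that by linarith
    qed
    show "u 0 = 1" by (rule u(1))
    show "0 < r / (5 * real (Suc k))" "0 \<le> r" using r by auto
  qed
  also have "\<dots> \<le> (exp (- 7 * real k) * ((2 * Rr k + 1) * U k) + 3 * exp (- 7 * real k) * ((2 * Rr k + 3) * (2 * U k + 13))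
      + ((2 * Rr k + 1) * U k) * exp (- 7 * real k)) * exp (4 * real k + 1)"
    unfolding RR
  proof (rule mult_mono, intro add_mono)
    have Rr0: "0 \<le> Rr k" using c by (simp add: Rr_def)
    have "7 * real k \<le> L * real K1 / 16 * real k" using K1 by (intro mult_right_mono) auto
    then have e7: "exp (- L * real K / 16) \<le> exp (- 7 * real k)" by (simp add: K_def)
    have V0: "0 \<le> (2 * Rr k + 1) * U k" using Rr0 U0 by simp
    show "exp (- L * real K / 16) * ((2 * Rr k + 1) * U k) \<le> exp (- 7 * real k) * ((2 * Rr k + 1) * U k)"
      by (rule mult_right_mono[OF e7 V0])
    have "100 ^ K * ((2 * Rr k + 3) * (\<gamma> + 2 * ((U k + 6) * W))) \<le> exp (5 * real K) * ((2 * Rr k + 3) * ((2 * U k + 13) * W))"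
    proof (intro mult_mono)
      have "(100::real) ^ K \<le> exp 5 ^ K" using hundred_le_exp by (intro power_mono) auto
      then show "(100::real) ^ K \<le> exp (5 * real K)" by (simp flip: exp_of_nat_mult add: mult.commute)
      show "\<gamma> + 2 * ((U k + 6) * W) \<le> (2 * U k + 13) * W" using \<gamma>W by (simp add: algebra_simps)
    qed (use Rr0 U0 \<gamma> in \<open>auto simp: W_def\<close>)
    also have "\<dots> = exp (5 * real K) * W * ((2 * Rr k + 3) * (2 * U k + 13))" by simp
    also have "exp (5 * real K) * W = exp (- 7 * real k)" by (simp add: W_def K_def exp_add[symmetric] algebra_simps)
    finally have "100 ^ K * ((2 * Rr k + 3) * (\<gamma> + 2 * ((U k + 6) * W))) \<le> exp (- 7 * real k) * ((2 * Rr k + 3) * (2 * U k + 13))" .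
    then show "3 * 100 ^ K * ((2 * Rr k + 3) * (\<gamma> + 2 * ((U k + 6) * W))) \<le> 3 * exp (- 7 * real k) * ((2 * Rr k + 3) * (2 * U k + 13))"
      by (simp only: mult.assoc)
    have "(pi * Rr k * r) ^ Suc k / fact k \<le> exp (- 7 * real k)"
    proof (rule taylor_remainder_bound)
      show "0 \<le> pi * Rr k * r" using Rr0 r by simp
      have "pi * Rr k * r = (real k + 1) / 20000" using pi_gt_zero c unfolding Rr_def r_def c_def[symmetric] by simp
      also have "\<dots> \<le> real k / 10000" using big(4) by simp
      finally show "pi * Rr k * r \<le> real k / 10000" .
      show "1 \<le> k" using big by simp
    qed
    then show "(2 * Rr k + 1) * U k * ((pi * Rr k * r) ^ Suc k / fact k) \<le> (2 * Rr k + 1) * U k * exp (- 7 * real k)"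
      by (rule mult_left_mono[OF _ V0])
    show "(2 * r / (r / (5 * real (Suc k)))) ^ k / fact k \<le> exp (4 * real k + 1)"
    proof -
      have "2 * r / (r / (5 * real (Suc k))) = 10 * real (Suc k)" using r by simp
      then have "(2 * r / (r / (5 * real (Suc k)))) ^ k = 10 ^ k * real (Suc k) ^ k" by (simp only: power_mult_distrib)
      also have "\<dots> \<le> exp 3 ^ k * (fact k * exp (real (Suc k)))"
      proof (intro mult_mono power_mono)
        have "(13/8::real) \<le> exp (1/2)" using exp_lower_Taylor_quadratic[of "1/2::real"] by (simp add: power2_eq_square)
        then have "(13/8::real) ^ 6 \<le> exp (1/2) ^ 6" by (intro power_mono) auto
        also have "\<dots> = exp 3" by (simp flip: exp_of_nat_mult)
        finally show "(10::real) \<le> exp 3" by (simp add: power_numeral_reduce)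
        show "real (Suc k) ^ k \<le> fact k * exp (real (Suc k))" by (rule power_le_fact_exp) simp
      qed auto
      also have "\<dots> = fact k * exp (4 * real k + 1)" by (simp add: exp_add[symmetric] algebra_simps flip: exp_of_nat_mult)
      finally show ?thesis by (simp add: divide_le_eq mult.commute)
    qed
    show "0 \<le> exp (- 7 * real k) * ((2 * Rr k + 1) * U k) + 3 * exp (- 7 * real k) * ((2 * Rr k + 3) * (2 * U k + 13)) + (2 * Rr k + 1) * U k * exp (- 7 * real k)"
      using Rr0 U0 by simp
    show "0 \<le> (2 * r / (r / (5 * real (Suc k)))) ^ k / fact k" using r by simp
  qed
  also have "\<dots> = (exp (- 7 * real k) * exp (4 * real k + 1)) * (2 * (2 * Rr k + 1) * U k + 3 * (2 * Rr k + 3) * (2 * U k + 13))"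
    by (simp add: algebra_simps)
  also have "exp (- 7 * real k) * exp (4 * real k + 1) = exp (1 - 3 * real k)" by (simp add: exp_add[symmetric] algebra_simps)
  finally show False using big(3) by simp
qed

end

text \<open>Local solutions, unlike membership in the spectrum, visibly survive limits in \<open>E\<close>.\<close>

lemma local_solutions_closure:
  assumes E: "E \<in> closure {x. complex_of_real x \<in> ell2_spectrum (critical_amo \<alpha> \<theta>)}"
  shows "local_solutions \<alpha> E"
  unfolding local_solutions_def
proof (intro allI impI)
  fix T :: nat and \<epsilon> :: real assume \<epsilon>: "\<epsilon> > 0"
  define d where "d = \<epsilon> / (8 * (real T + 1))"
  have d: "d > 0" using \<epsilon> by (simp add: d_def)
  obtain x where x: "complex_of_real x \<in> ell2_spectrum (critical_amo \<alpha> \<theta>)" "dist x E < d"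
    using E d unfolding closure_approachable by auto
  have e2: "\<epsilon> / 2 > 0" using \<epsilon> by simp
  obtain y u where u: "u 0 = 1" "\<And>i. \<bar>i\<bar> \<le> int T \<Longrightarrow> cmod (u i) \<le> 4 * (real T + 1)"
    "\<And>i. \<bar>i\<bar> \<le> int T \<Longrightarrow> cmod (jop (chain_int \<alpha> y) (\<lambda>_. 0) u i - complex_of_real x * u i) \<le> \<epsilon> / 2"
    using chain_local_solution[OF x(1) e2, of T] by metis
  have "cmod (jop (chain_int \<alpha> y) (\<lambda>_. 0) u i - complex_of_real E * u i) \<le> \<epsilon>" if i: "\<bar>i\<bar> \<le> int T" for i
  proof -
    have "jop (chain_int \<alpha> y) (\<lambda>_. 0) u i - complex_of_real E * u i
      = (jop (chain_int \<alpha> y) (\<lambda>_. 0) u i - complex_of_real x * u i) + complex_of_real (x - E) * u i" by (simp add: algebra_simps)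
    also have "cmod \<dots> \<le> \<epsilon> / 2 + d * (4 * (real T + 1))"
    proof (intro order_trans[OF norm_triangle_ineq] add_mono u(3)[OF i])
      show "cmod (complex_of_real (x - E) * u i) \<le> d * (4 * (real T + 1))"
        unfolding norm_mult norm_of_real using x(2) u(2)[OF i] by (intro mult_mono) (auto simp: dist_real_def)
    qed
    also have "\<dots> = \<epsilon>" by (simp add: d_def field_simps)
    finally show ?thesis .
  qed
  then show "\<exists>y u. u 0 = 1 \<and> (\<forall>i. \<bar>i\<bar> \<le> int T \<longrightarrow> cmod (u i) \<le> 4 * (real T + 1)) \<and>
     (\<forall>i. \<bar>i\<bar> \<le> int T \<longrightarrow> cmod (jop (chain_int \<alpha> y) (\<lambda>_. 0) u i - complex_of_real E * u i) \<le> \<epsilon>)"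
    by (intro exI[of _ y] exI[of _ u] conjI allI impI u(1,2))
qed

lemma spectrum_subexponential:
  assumes "\<alpha> \<notin> \<rat>" "\<bar>E\<bar> \<le> 9 / 2" "local_solutions \<alpha> E" "\<epsilon> > 0"
  obtains m where "m \<ge> 2" "\<And>y. 10 * dnorm \<alpha> (complex_of_real E) y m \<le> exp (\<epsilon> * real m)"
proof (rule ccontr)
  assume neg: "\<not> thesis"
  note th = that
  have "positive_growth \<alpha> E \<epsilon>"
  proof
    show "\<exists>y. exp (\<epsilon> * real m) < 10 * dnorm \<alpha> (complex_of_real E) y m" if m: "m \<ge> 2" for m
    proof (rule ccontr)
      assume "\<not> ?thesis"
      then have "10 * dnorm \<alpha> (complex_of_real E) y m \<le> exp (\<epsilon> * real m)" for y by (simp add: not_less)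
      then show False using neg th[OF m] by blast
    qed
  qed (use assms in auto)
  then show False using positive_growth.no_local_solutions assms(3) by blast
qed

subsection \<open>Uniform subexponential growth near the spectrum\<close>

lemma dnorm_lipschitz:
  assumes "cmod z \<le> 5" "cmod z' \<le> 5"
  shows "dnorm \<alpha> z' y m \<le> dnorm \<alpha> z y m + cmod (z' - z) * 7 ^ m"
proof -
  have *: "cmod (cdet \<alpha> z' y' i) \<le> cmod (cdet \<alpha> z y' i) + cmod (z' - z) * 7 ^ m" if "i \<le> m" for y' i
  proof -
    have "cmod (cdet \<alpha> z' y' i - cdet \<alpha> z y' i) \<le> cmod (z' - z) * 7 ^ i"
      unfolding cdet_def by (rule jdet_lipschitz) (use assms abs_chain_le in auto)
    also have "\<dots> \<le> cmod (z' - z) * 7 ^ m" using that by (intro mult_left_mono power_increasing) auto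
    finally show ?thesis using norm_triangle_sub[of "cdet \<alpha> z' y' i" "cdet \<alpha> z y' i"] by linarith
  qed
  show ?thesis
    by (intro dnorm_le order_trans[OF *] add_right_mono dnorm_ge) auto
qed

definition amo_energies :: "real \<Rightarrow> real \<Rightarrow> real set" where
  "amo_energies \<alpha> \<theta> = {x. complex_of_real x \<in> ell2_spectrum (critical_amo \<alpha> \<theta>)}"

lemma amo_energies_bound: "E \<in> amo_energies \<alpha> \<theta> \<Longrightarrow> \<bar>E\<bar> \<le> 9 / 2"
  using spectrum_bounded unfolding amo_energies_def by fastforce

text \<open>At each energy of the closure some length has the bound with a factor 2 to spare, and by
  the Lipschitz estimate it persists on a complex disc. Compactness makes radius and constant
  uniform; half radii in the subcover leave the other half for \<open>z\<close>.\<close>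

lemma uniform_subexponential:
  assumes irr: "\<alpha> \<notin> \<rat>" and \<epsilon>: "\<epsilon> > 0"
  obtains C r where "C \<ge> 1" "r > 0"
    "\<And>E z y n. E \<in> amo_energies \<alpha> \<theta> \<Longrightarrow> cmod (z - complex_of_real E) \<le> r \<Longrightarrow> cmod z \<le> 5 \<Longrightarrow> cmod (cdet \<alpha> z y n) \<le> C * exp (\<epsilon> * real n)"
proof -
  let ?S = "closure (amo_energies \<alpha> \<theta>)"
  have cb: "?S \<subseteq> cball 0 (9/2)" using amo_energies_bound by (intro closure_minimal) auto
  then have comp: "compact ?S" using compact_eq_bounded_closed bounded_subset[OF bounded_cball] by blast
  have "\<exists>m\<ge>2. \<forall>y. 10 * dnorm \<alpha> (complex_of_real E) y m \<le> exp (\<epsilon> * real m)" if E: "E \<in> ?S" for E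
  proof -
    have "\<bar>E\<bar> \<le> 9/2" "local_solutions \<alpha> E"
      using E cb local_solutions_closure[of E \<alpha> \<theta>] by (auto simp: amo_energies_def)
    then show ?thesis using spectrum_subexponential[OF irr _ _ \<epsilon>, of E] by metis
  qed
  then obtain m where m: "\<And>E. E \<in> ?S \<Longrightarrow> m E \<ge> 2" "\<And>E y. E \<in> ?S \<Longrightarrow> 10 * dnorm \<alpha> (complex_of_real E) y (m E) \<le> exp (\<epsilon> * real (m E))"
    by metis
  \<comment> \<open>This radius makes the Lipschitz error at most 1/10, hence 1/2 after
    multiplication by 5, which the reserve in the factor 10 absorbs.\<close>
  define \<rho> where "\<rho> = (\<lambda>E. 1 / (10 * 7 ^ m E) :: real)"
  have \<rho>: "\<rho> E > 0" for E by (simp add: \<rho>_def)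
  have near: "cmod (cdet \<alpha> z y n) \<le> 5 * 6 ^ (m E + 2) * exp (\<epsilon> * real n)"
    if E: "E \<in> ?S" and z: "cmod (z - complex_of_real E) \<le> \<rho> E" "cmod z \<le> 5" for E z y n
  proof -
    have E5: "cmod (complex_of_real E) \<le> 5" using E cb by auto
    have "5 * dnorm \<alpha> z y' (m E) \<le> exp (\<epsilon> * real (m E))" for y'
    proof -
      have "cmod (z - complex_of_real E) * 7 ^ m E \<le> \<rho> E * 7 ^ m E" using z by (intro mult_right_mono) auto
      then have "cmod (z - complex_of_real E) * 7 ^ m E \<le> 1 / 10" by (simp add: \<rho>_def)
      moreover have "1 \<le> exp (\<epsilon> * real (m E))" using \<epsilon> by simp
      ultimately show ?thesis using dnorm_lipschitz[OF E5 z(2), of \<alpha> y' "m E"] m(2)[OF E, of y'] by linarith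
    qed
    then have "5 * dnorm \<alpha> z y n \<le> 5 * 6 ^ (m E + 2) * exp (\<epsilon> * real n)"
      by (rule dnorm_subexponential[OF m(1)[OF E] z(2) \<epsilon>])
    then show ?thesis using dnorm_ge(1)[of \<alpha> z y n] dnorm_nonneg[of \<alpha> z y n] by linarith
  qed
  obtain D where D: "D \<subseteq> ?S" "finite D" "?S \<subseteq> (\<Union>E\<in>D. ball E (\<rho> E / 2))"
    by (rule compactE_image[OF comp, of ?S "\<lambda>E. ball E (\<rho> E / 2)"]) (use \<rho> in auto)
  define r where "r = Min (insert 1 ((\<lambda>E. \<rho> E / 2) ` D))"
  define C where "C = Max (insert 1 ((\<lambda>E. 5 * 6 ^ (m E + 2)) ` D)) + (0::real)"
  have "r > 0" unfolding r_def using D(2) \<rho> by (subst Min_gr_iff) auto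
  moreover have "C \<ge> 1" unfolding C_def using D(2) by simp
  moreover have "cmod (cdet \<alpha> z y n) \<le> C * exp (\<epsilon> * real n)"
    if E: "E \<in> amo_energies \<alpha> \<theta>" "cmod (z - complex_of_real E) \<le> r" "cmod z \<le> 5" for E z y n
  proof -
    have "E \<in> ?S" using E(1) closure_subset by auto
    then obtain e where e: "e \<in> D" "dist e E < \<rho> e / 2" using D(3) by auto
    have "cmod (z - complex_of_real e) \<le> cmod (z - complex_of_real E) + cmod (complex_of_real (E - e))"
      using norm_triangle_ineq[of "z - complex_of_real E" "complex_of_real (E - e)"] by simp
    also have "cmod (complex_of_real (E - e)) = dist e E" unfolding norm_of_real by (simp add: dist_real_def abs_minus_commute)
    also have "r \<le> \<rho> e / 2" unfolding r_def using D(2) e(1) by (intro Min_le) auto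
    then have "cmod (z - complex_of_real E) + dist e E \<le> \<rho> e" using E(2) e(2) by linarith
    finally have "cmod (cdet \<alpha> z y n) \<le> 5 * 6 ^ (m e + 2) * exp (\<epsilon> * real n)"
      using near[OF _ _ E(3)] e(1) D(1) by blast
    also have "\<dots> \<le> C * exp (\<epsilon> * real n)"
      unfolding C_def using D(2) e(1) by (intro mult_right_mono) (auto intro!: Max_ge)
    finally show ?thesis .
  qed
  ultimately show ?thesis using that by blast
qed

subsection \<open>Green functions of the blocks between small bonds\<close>

text \<open>\<open>m\<close> counts the blocks and \<open>w\<close> adds up their spectral weights;
  neither depends on \<open>z\<close>, so one measure serves all energies. The term
  \<open>ln (1 / h)\<close> is the surplus of the last block, which has no closing bond.\<close>

definition block_measure :: "real \<Rightarrow> (nat \<Rightarrow> real) \<Rightarrow> nat \<Rightarrow> nat \<Rightarrow> real set \<Rightarrow> (real \<Rightarrow> real) \<Rightarrow> bool" where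
  "block_measure h c n m X w \<longleftrightarrow> m \<ge> 1 \<and> finite X \<and> (\<forall>x. w x \<ge> 0) \<and> (\<Sum>x\<in>X. w x) \<le> real m \<and>
    (\<forall>z. Im z > 0 \<longrightarrow> cmod z \<le> 5 \<longrightarrow>
      (\<Sum>k\<in>{1..<n}. ln (max \<bar>c k\<bar> h)) - ln (cmod (jdet c z n)) \<le> h * (\<Sum>x\<in>X. w x / cmod (z - complex_of_real x)) - real m + ln (1 / h))"

text \<open>\<open>ln G \<le> h G - 1 + ln (1/h)\<close>, summed over the blocks, is the arithmetic-geometric mean inequality in additive form;
  the product of the corner Green functions of the blocks telescopes.\<close>

lemma green_average:
  fixes c :: "nat \<Rightarrow> real"
  assumes h: "0 < h" and c: "\<And>j. c j \<noteq> 0" "\<And>j. \<bar>c j\<bar> \<le> 2" and n: "n \<ge> 1"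
  shows "\<exists>m X w. block_measure h c n m X w"
  using c n
proof (induction n arbitrary: c rule: less_induct)
  case (less n)
  note c = less.prems(1,2)
  have lnG: "ln G \<le> h * G - 1 + ln (1 / h)" if "G > 0" for G :: real
    using ln_le_minus_one[of "h * G"] that h by (simp add: ln_mult ln_div)
  have ll: "ln (p * d / e) = ln p + ln d - ln e" if "p > 0" "d > 0" "e > 0" for p d e :: real
    using that by (simp add: ln_div ln_mult)
  \<comment> \<open>The first block ends at the first bond of size at most \<open>h\<close>, or at
    \<open>n\<close> if there is none; truncation leaves its inner bonds unchanged.\<close>
  define b where "b = (if \<exists>k\<in>{1..<n}. \<bar>c k\<bar> \<le> h then (LEAST k. 1 \<le> k \<and> \<bar>c k\<bar> \<le> h) else n)"
  have b': "1 \<le> b \<and> b \<le> n \<and> (\<forall>k. 1 \<le> k \<longrightarrow> k < b \<longrightarrow> \<bar>c k\<bar> > h) \<and> (b < n \<longrightarrow> \<bar>c b\<bar> \<le> h)"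
  proof (cases "\<exists>k\<in>{1..<n}. \<bar>c k\<bar> \<le> h")
    case True
    then obtain k0 where k0: "1 \<le> k0" "k0 < n" "\<bar>c k0\<bar> \<le> h" by auto
    have bb: "b = (LEAST k. 1 \<le> k \<and> \<bar>c k\<bar> \<le> h)" using True by (simp only: b_def if_True)
    have 1: "1 \<le> b \<and> \<bar>c b\<bar> \<le> h" unfolding bb by (rule LeastI[of _ k0]) (use k0 in simp)
    have 2: "b \<le> k0" unfolding bb by (rule Least_le) (use k0 in simp)
    have 3: "\<not> (1 \<le> k \<and> \<bar>c k\<bar> \<le> h)" if "k < b" for k using that unfolding bb by (rule not_less_Least)
    show ?thesis using 1 2 3 k0 by (auto simp: not_le)
  next
    case False
    then have bb: "b = n" by (simp only: b_def if_False)
    show ?thesis using False less.prems(3) unfolding bb by force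
  qed
  then have b: "1 \<le> b" "b \<le> n" "\<And>k. 1 \<le> k \<Longrightarrow> k < b \<Longrightarrow> \<bar>c k\<bar> > h" "b < n \<Longrightarrow> \<bar>c b\<bar> \<le> h" by blast+
  define Lam where "Lam = {x::real. jdet c (complex_of_real x) n = 0}"
  have finL: "finite Lam" unfolding Lam_def by (rule jdet_roots(1)) (use c in auto)
  obtain w where w: "\<And>x. w x \<ge> 0" "(\<Sum>x\<in>Lam. w x) \<le> 1"
    "\<And>z. Im z > 0 \<Longrightarrow> cmod z \<le> 5 \<Longrightarrow>
       (\<Prod>j\<in>{1..<b}. \<bar>c j\<bar>) * cmod (jdet (\<lambda>j. c (b + j)) z (n - b)) / cmod (jdet c z n) \<le> (\<Sum>x\<in>Lam. w x / cmod (z - complex_of_real x))"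
  proof (rule jdet_green_bound[of b n c, OF b(1,2) _ c(2), folded Lam_def], goal_cases)
    case (2 w)
    show ?case by (rule 2(1)[OF 2(2,3)], rule 2(4))
  qed (use c in auto)
  have block: "(\<Sum>k\<in>{1..<b}. ln (max \<bar>c k\<bar> h)) + ln (cmod (jdet (\<lambda>j. c (b + j)) z (n - b))) - ln (cmod (jdet c z n))
     \<le> h * (\<Sum>x\<in>Lam. w x / cmod (z - complex_of_real x)) - 1 + ln (1 / h)" if z: "Im z > 0" "cmod z \<le> 5" for z
  proof -
    have P: "(\<Prod>j\<in>{1..<b}. \<bar>c j\<bar>) > 0" using c by (intro prod_pos) auto
    have D: "cmod (jdet (\<lambda>j. c (b + j)) z (n - b)) > 0" "cmod (jdet c z n) > 0" using jdet_nonzero[OF z(1)] by auto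
    have "ln (\<Prod>j\<in>{1..<b}. \<bar>c j\<bar>) = (\<Sum>j\<in>{1..<b}. ln \<bar>c j\<bar>)" using c by (intro ln_prod) auto
    also have "\<dots> = (\<Sum>k\<in>{1..<b}. ln (max \<bar>c k\<bar> h))" 
    proof (rule sum.cong)
      fix k assume "k \<in> {1..<b}"
      then have "h < \<bar>c k\<bar>" using b(3)[of k] by simp
      then show "ln \<bar>c k\<bar> = ln (max \<bar>c k\<bar> h)" by simp
    qed simp
    finally have S: "ln (\<Prod>j\<in>{1..<b}. \<bar>c j\<bar>) = (\<Sum>k\<in>{1..<b}. ln (max \<bar>c k\<bar> h))" .
    define G where "G = (\<Prod>j\<in>{1..<b}. \<bar>c j\<bar>) * cmod (jdet (\<lambda>j. c (b + j)) z (n - b)) / cmod (jdet c z n)"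
    have G0: "G > 0" unfolding G_def using P D by (intro divide_pos_pos mult_pos_pos)
    have "ln G = (\<Sum>k\<in>{1..<b}. ln (max \<bar>c k\<bar> h)) + ln (cmod (jdet (\<lambda>j. c (b + j)) z (n - b))) - ln (cmod (jdet c z n))"
      unfolding G_def S[symmetric] by (rule ll[OF P D])
    moreover have "h * G \<le> h * (\<Sum>x\<in>Lam. w x / cmod (z - complex_of_real x))" 
      using w(3)[OF z, folded G_def] h by (intro mult_left_mono) auto
    ultimately show ?thesis using lnG[OF G0] by linarith
  qed
  show ?case
  proof (cases "b < n")
    case False
    then have bn: "b = n" using b(2) by simp
    have "block_measure h c n 1 Lam w"
      unfolding block_measure_def
    proof (intro conjI allI impI)
      fix z assume "Im z > 0" "cmod z \<le> 5"
      from block[OF this] show "(\<Sum>k\<in>{1..<n}. ln (max \<bar>c k\<bar> h)) - ln (cmod (jdet c z n)) \<le> h * (\<Sum>x\<in>Lam. w x / cmod (z - complex_of_real x)) - real 1 + ln (1 / h)"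
        unfolding bn by simp
    qed (use w finL in auto)
    then show ?thesis by blast
  next
    case True
    define c' where "c' = (\<lambda>j. c (b + j))"
    have lt: "n - b < n" using b(1) True by simp
    have "\<exists>m X w. block_measure h c' (n - b) m X w"
      by (rule less.IH[OF lt]) (use c True in \<open>auto simp: c'_def\<close>)
    then obtain m X w' where IH0: "block_measure h c' (n - b) m X w'" by blast
    then have IH: "m \<ge> 1" "finite X" "\<And>x. w' x \<ge> 0" "(\<Sum>x\<in>X. w' x) \<le> real m"
      "\<And>z. Im z > 0 \<Longrightarrow> cmod z \<le> 5 \<Longrightarrow>
        (\<Sum>k\<in>{1..<n - b}. ln (max \<bar>c' k\<bar> h)) - ln (cmod (jdet c' z (n - b))) \<le> h * (\<Sum>x\<in>X. w' x / cmod (z - complex_of_real x)) - real m + ln (1 / h)"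
      unfolding block_measure_def by blast+
    define W where "W = (\<lambda>x. (if x \<in> Lam then w x else 0) + (if x \<in> X then w' x else 0))"
    have split: "(\<Sum>x\<in>Lam \<union> X. W x * f x) = (\<Sum>x\<in>Lam. w x * f x) + (\<Sum>x\<in>X. w' x * f x)" for f :: "real \<Rightarrow> real"
    proof -
      have "(\<Sum>x\<in>Lam \<union> X. W x * f x) = (\<Sum>x\<in>Lam \<union> X. if x \<in> Lam then w x * f x else 0) + (\<Sum>x\<in>Lam \<union> X. if x \<in> X then w' x * f x else 0)"
        unfolding sum.distrib[symmetric] by (rule sum.cong) (auto simp: W_def distrib_right)
      also have "(\<Sum>x\<in>Lam \<union> X. if x \<in> Lam then w x * f x else 0) = (\<Sum>x\<in>Lam. w x * f x)"
        using finL IH(2) by (intro sum.mono_neutral_cong_right) auto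
      also have "(\<Sum>x\<in>Lam \<union> X. if x \<in> X then w' x * f x else 0) = (\<Sum>x\<in>X. w' x * f x)"
        using finL IH(2) by (intro sum.mono_neutral_cong_right) auto
      finally show ?thesis .
    qed
    have "block_measure h c n (Suc m) (Lam \<union> X) W"
      unfolding block_measure_def
    proof (intro conjI allI impI)
      show "(\<Sum>x\<in>Lam \<union> X. W x) \<le> real (Suc m)" using split[of "\<lambda>_. 1"] w(2) IH(4) by simp
      show "W x \<ge> 0" for x using w(1) IH(3) by (simp add: W_def)
      fix z assume z: "Im z > 0" "cmod z \<le> 5"
      have eq: "{1..<n} = {1..<b} \<union> insert b ((\<lambda>k. b + k) ` {1..<n - b})"
      proof (rule Set.set_eqI, rule iffI)
        fix k assume k: "k \<in> {1..<n}"
        show "k \<in> {1..<b} \<union> insert b ((\<lambda>k. b + k) ` {1..<n - b})"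
        proof (cases "k \<le> b")
          case False
          then have "k = b + (k - b)" "k - b \<in> {1..<n - b}" using k by auto
          then show ?thesis by blast
        qed (use k in auto)
      qed (use b True in auto)
      have "(\<Sum>k\<in>{1..<n}. ln (max \<bar>c k\<bar> h)) = (\<Sum>k\<in>{1..<b}. ln (max \<bar>c k\<bar> h)) + (\<Sum>k\<in>insert b ((\<lambda>k. b + k) ` {1..<n - b}). ln (max \<bar>c k\<bar> h))"
        unfolding eq by (rule sum.union_disjoint) auto
      also have "(\<Sum>k\<in>insert b ((\<lambda>k. b + k) ` {1..<n - b}). ln (max \<bar>c k\<bar> h)) = ln (max \<bar>c b\<bar> h) + (\<Sum>k\<in>{1..<n - b}. ln (max \<bar>c' k\<bar> h))"
      proof -
        have "(\<Sum>k\<in>(\<lambda>k. b + k) ` {1..<n - b}. ln (max \<bar>c k\<bar> h)) = (\<Sum>k\<in>{1..<n - b}. ln (max \<bar>c' k\<bar> h))"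
          by (rule sum.reindex_cong[where l="\<lambda>k. b + k"]) (simp_all add: inj_on_def c'_def)
        moreover have "(\<Sum>k\<in>insert b ((\<lambda>k. b + k) ` {1..<n - b}). ln (max \<bar>c k\<bar> h)) = ln (max \<bar>c b\<bar> h) + (\<Sum>k\<in>(\<lambda>k. b + k) ` {1..<n - b}. ln (max \<bar>c k\<bar> h))"
          by (rule sum.insert) auto
        ultimately show ?thesis by simp
      qed
      also have "max \<bar>c b\<bar> h = h" using b(4)[OF True] by simp
      finally have sum: "(\<Sum>k\<in>{1..<n}. ln (max \<bar>c k\<bar> h)) = (\<Sum>k\<in>{1..<b}. ln (max \<bar>c k\<bar> h)) + (ln h + (\<Sum>k\<in>{1..<n - b}. ln (max \<bar>c' k\<bar> h)))" .
      \<comment> \<open>The closing bond enters the truncated sum as \<open>ln h\<close> and cancels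
        the \<open>ln (1 / h)\<close> of its block.\<close>
      have "ln (1 / h) = - ln h" using h by (simp add: ln_div)
      moreover have "(\<Sum>x\<in>Lam \<union> X. W x / cmod (z - complex_of_real x)) = (\<Sum>x\<in>Lam. w x / cmod (z - complex_of_real x)) + (\<Sum>x\<in>X. w' x / cmod (z - complex_of_real x))"
        using split[of "\<lambda>x. 1 / cmod (z - complex_of_real x)"] by simp
      ultimately show "(\<Sum>k\<in>{1..<n}. ln (max \<bar>c k\<bar> h)) - ln (cmod (jdet c z n)) \<le> h * (\<Sum>x\<in>Lam \<union> X. W x / cmod (z - complex_of_real x)) - real (Suc m) + ln (1 / h)"
        using block[OF z] IH(5)[OF z] unfolding sum c'_def[symmetric] by (simp add: distrib_left)
    qed (use finL IH(2) in auto)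
    then show ?thesis by blast
  qed
qed

subsection \<open>Counting grid cells\<close>

lemma sum_antimono_card:
  fixes f :: "nat \<Rightarrow> real"
  assumes f: "\<And>i j. i \<le> j \<Longrightarrow> f j \<le> f i" and D: "finite D"
  shows "sum f D \<le> sum f {..<card D}"
proof -
  obtain g where g: "bij_betw g {..<card D} D" "strict_mono_on {..<card D} g"
    using ex_bij_betw_strict_mono_card[OF D] by blast
  have "sum f D = (\<Sum>e<card D. f (g e))" by (rule sum.reindex_bij_betw[OF g(1), symmetric])
  also have "\<dots> \<le> (\<Sum>e<card D. f e)"
  proof (rule sum_mono)
    fix e assume e: "e \<in> {..<card D}"
    have "e \<le> g e" using strict_mono_on_index_le[OF g(2), of 0 e] e by simp
    then show "f (g e) \<le> f e" by (rule f)
  qed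
  finally show ?thesis .
qed

text \<open>On either side of \<open>j0\<close> the distances are distinct, so each half is largest
  for consecutive integers, where it is a harmonic sum.\<close>

lemma sum_inverse_dist:
  fixes J :: "int set"
  assumes J: "finite J" "J \<noteq> {}"
  shows "(\<Sum>j\<in>J. 1 / max 1 (real_of_int \<bar>j - j0\<bar> - 1)) \<le> 6 + 2 * ln (real (card J))"
proof -
  define f where "f = (\<lambda>d::nat. 1 / max 1 (real d - 1))"
  have f: "f j \<le> f i" if "i \<le> j" for i j using that unfolding f_def by (intro divide_left_mono) auto
  have f0: "f d \<ge> 0" for d by (simp add: f_def)
  have cJ: "card J \<ge> 1" using J by (simp add: Suc_le_eq card_gt_0_iff)
  have harm: "sum f {..<N} \<le> 3 + ln (real (card J))" if "N \<le> card J" for N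
  proof -
    have two: "(\<Sum>d<2. f d) = f 0 + f (Suc 0)" by (simp add: numeral_2_eq_2)
    have "sum f {..<N} \<le> sum f {..<card J + 2}" using that f0 by (intro sum_mono2) auto
    also have "\<dots> = (\<Sum>d<2. f d) + (\<Sum>d<card J. f (2 + d))"
      using sum.lessThan_Suc_shift[of f "Suc (card J)"] sum.lessThan_Suc_shift[of "\<lambda>d. f (Suc d)" "card J"]
      unfolding two by (simp del: sum.lessThan_Suc)
    also have "(\<Sum>d<2. f d) = 2" by (simp add: f_def numeral_2_eq_2)
    also have "(\<Sum>d<card J. f (2 + d)) = harm (card J)"
      unfolding harm_def by (rule sum.reindex_bij_witness[of _ "\<lambda>k. k - 1" Suc]) (auto simp: f_def inverse_eq_divide)
    also have "harm (card J) \<le> ln (real (card J)) + 1"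
      using decseqD[OF decseq_harm_diff_ln, of 0 "card J - 1"] cJ by (simp add: harm_expand)
    finally show ?thesis by simp
  qed
  have half: "(\<Sum>j\<in>J'. 1 / max 1 (real_of_int \<bar>j - j0\<bar> - 1)) \<le> 3 + ln (real (card J))"
    if J': "J' \<subseteq> J" "inj_on (\<lambda>j. nat \<bar>j - j0\<bar>) J'" for J'
  proof -
    have fin: "finite J'" using J' J finite_subset by blast
    have "(\<Sum>j\<in>J'. 1 / max 1 (real_of_int \<bar>j - j0\<bar> - 1)) = sum f ((\<lambda>j. nat \<bar>j - j0\<bar>) ` J')"
      unfolding sum.reindex[OF J'(2)] by (intro sum.cong) (auto simp: f_def)
    also have "\<dots> \<le> sum f {..<card ((\<lambda>j. nat \<bar>j - j0\<bar>) ` J')}" using f fin by (intro sum_antimono_card) auto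
    also have "\<dots> \<le> 3 + ln (real (card J))" using card_mono[OF J(1) J'(1)] by (intro harm) (simp add: card_image[OF J'(2)])
    finally show ?thesis .
  qed
  have "J = (J \<inter> {j0..}) \<union> (J \<inter> {..<j0})" by auto
  then have "(\<Sum>j\<in>J. 1 / max 1 (real_of_int \<bar>j - j0\<bar> - 1)) = (\<Sum>j\<in>J \<inter> {j0..}. 1 / max 1 (real_of_int \<bar>j - j0\<bar> - 1)) + (\<Sum>j\<in>J \<inter> {..<j0}. 1 / max 1 (real_of_int \<bar>j - j0\<bar> - 1))"
    using J(1) by (subst sum.union_disjoint[symmetric]) auto
  moreover have "(\<Sum>j\<in>J \<inter> {j0..}. 1 / max 1 (real_of_int \<bar>j - j0\<bar> - 1)) \<le> 3 + ln (real (card J))"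
    by (rule half) (auto simp: inj_on_def)
  moreover have "(\<Sum>j\<in>J \<inter> {..<j0}. 1 / max 1 (real_of_int \<bar>j - j0\<bar> - 1)) \<le> 3 + ln (real (card J))"
    by (rule half) (auto simp: inj_on_def)
  ultimately show ?thesis by linarith
qed

text \<open>One energy per occupied cell is selected and the lower bounds are added. For fixed
  \<open>x\<close> the resolvent kernels at the selected energies add up to a harmonic sum of order
  \<open>ln (card J) / \<eta>\<close>, and the mass \<open>m\<close> cancels.\<close>

lemma resolvent_cells:
  fixes A :: "real set" and w :: "real \<Rightarrow> real"
  assumes \<eta>: "\<eta> > 0" and h: "h > 0" and m: "m > 0" and w: "\<And>x. w x \<ge> 0" "(\<Sum>x\<in>X. w x) \<le> m" and X: "finite X"
    and A: "\<And>E. E \<in> A \<Longrightarrow> m / h \<le> (\<Sum>x\<in>X. w x / cmod (Complex E \<eta> - complex_of_real x))"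
    and J: "finite J" "J \<noteq> {}" "J = (\<lambda>E. \<lfloor>E / \<eta>\<rfloor>) ` A"
  shows "real (card J) \<le> h / \<eta> * (6 + 2 * ln (real (card J)))"
proof -
  have "\<exists>E. E \<in> A \<and> \<lfloor>E / \<eta>\<rfloor> = j" if "j \<in> J" for j using that J(3) by auto
  then obtain E where E: "\<And>j. j \<in> J \<Longrightarrow> E j \<in> A" "\<And>j. j \<in> J \<Longrightarrow> \<lfloor>E j / \<eta>\<rfloor> = j" by metis
  have pt: "(\<Sum>j\<in>J. 1 / cmod (Complex (E j) \<eta> - complex_of_real x)) \<le> (6 + 2 * ln (real (card J))) / \<eta>" for x
  proof -
    define j0 where "j0 = \<lfloor>x / \<eta>\<rfloor>"
    have "(\<Sum>j\<in>J. 1 / cmod (Complex (E j) \<eta> - complex_of_real x)) \<le> (\<Sum>j\<in>J. 1 / max 1 (real_of_int \<bar>j - j0\<bar> - 1) / \<eta>)"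
    proof (rule sum_mono)
      fix j assume j: "j \<in> J"
      have "\<eta> \<le> cmod (Complex (E j) \<eta> - complex_of_real x)"
        using abs_Im_le_cmod[of "Complex (E j) \<eta> - complex_of_real x"] \<eta> by simp
      moreover have "(real_of_int \<bar>j - j0\<bar> - 1) * \<eta> \<le> cmod (Complex (E j) \<eta> - complex_of_real x)"
      proof -
        have "real_of_int \<bar>j - j0\<bar> - 1 \<le> \<bar>E j / \<eta> - x / \<eta>\<bar>" using E(2)[OF j] unfolding j0_def by linarith
        then have "(real_of_int \<bar>j - j0\<bar> - 1) * \<eta> \<le> \<bar>E j / \<eta> - x / \<eta>\<bar> * \<eta>" using \<eta> by (intro mult_right_mono) auto
        also have "\<dots> = \<bar>E j - x\<bar>" using \<eta> by (simp add: diff_divide_distrib[symmetric])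
        also have "\<dots> \<le> cmod (Complex (E j) \<eta> - complex_of_real x)"
          using abs_Re_le_cmod[of "Complex (E j) \<eta> - complex_of_real x"] by simp
        finally show ?thesis .
      qed
      ultimately have le: "max 1 (real_of_int \<bar>j - j0\<bar> - 1) * \<eta> \<le> cmod (Complex (E j) \<eta> - complex_of_real x)"
        by (simp add: max_def)
      have P: "0 < max 1 (real_of_int \<bar>j - j0\<bar> - 1) * \<eta>" using \<eta> by (intro mult_pos_pos) auto
      then have Q: "0 < cmod (Complex (E j) \<eta> - complex_of_real x)" using le by linarith
      show "1 / cmod (Complex (E j) \<eta> - complex_of_real x) \<le> 1 / max 1 (real_of_int \<bar>j - j0\<bar> - 1) / \<eta>"
        unfolding divide_divide_eq_left by (rule divide_left_mono[OF le _ mult_pos_pos[OF Q P]]) simp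
    qed
    also have "\<dots> = (\<Sum>j\<in>J. 1 / max 1 (real_of_int \<bar>j - j0\<bar> - 1)) / \<eta>" by (simp only: sum_divide_distrib)
    also have "\<dots> \<le> (6 + 2 * ln (real (card J))) / \<eta>" using \<eta> by (intro divide_right_mono sum_inverse_dist J) auto
    finally show ?thesis .
  qed
  have "real (card J) * (m / h) = (\<Sum>j\<in>J. m / h)" by simp
  also have "\<dots> \<le> (\<Sum>j\<in>J. \<Sum>x\<in>X. w x / cmod (Complex (E j) \<eta> - complex_of_real x))" by (intro sum_mono A E(1))
  also have "\<dots> = (\<Sum>x\<in>X. w x * (\<Sum>j\<in>J. 1 / cmod (Complex (E j) \<eta> - complex_of_real x)))"
    by (subst sum.swap) (simp add: sum_distrib_left)
  also have "\<dots> \<le> (\<Sum>x\<in>X. w x * ((6 + 2 * ln (real (card J))) / \<eta>))" by (intro sum_mono mult_left_mono pt w)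
  also have "\<dots> = (\<Sum>x\<in>X. w x) * ((6 + 2 * ln (real (card J))) / \<eta>)" by (rule sum_distrib_right[symmetric])
  also have "\<dots> \<le> m * ((6 + 2 * ln (real (card J))) / \<eta>)"
  proof (rule mult_right_mono[OF w(2)])
    have "1 \<le> real (card J)" using J by (simp add: Suc_le_eq card_gt_0_iff)
    then show "0 \<le> (6 + 2 * ln (real (card J))) / \<eta>" using \<eta> by simp
  qed
  finally have "m * (real (card J) / h) \<le> m * ((6 + 2 * ln (real (card J))) / \<eta>)" by (simp add: field_simps)
  then have "real (card J) / h \<le> (6 + 2 * ln (real (card J))) / \<eta>" unfolding mult_le_cancel_left_pos[OF m] .
  then have "h * (real (card J) / h) \<le> h * ((6 + 2 * ln (real (card J))) / \<eta>)" using h by (intro mult_left_mono) auto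
  then show ?thesis using h by simp
qed

subsection \<open>Concentration of eigenvalues\<close>

lemma ln_add_one_le_powr:
  fixes t a :: real
  assumes t: "t \<ge> 0" and a: "1 / 2 \<le> a" "a \<le> 1"
  shows "ln (1 + t) \<le> 3 * t powr a"
proof (cases "t \<le> 1")
  case True
  have "ln (1 + t) \<le> t" using t by (rule ln_add_one_self_le_self)
  also have "t = t powr 1" using t by simp
  also have "\<dots> \<le> t powr a"
  proof (cases "t = 0")
    case False
    then show ?thesis using t True a by (intro powr_mono') auto
  qed simp
  also have "\<dots> \<le> 3 * t powr a" by simp
  finally show ?thesis .
next
  case False
  have "1 powr a \<le> t powr a" using False a by (intro powr_mono2) auto
  then have p1: "1 \<le> t powr a" by simp
  have "a * ln t = ln (t powr a)" using False by (simp add: ln_powr)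
  also have "\<dots> \<le> t powr a" using ln_le_minus_one[of "t powr a"] p1 by linarith
  finally have "a * ln t \<le> t powr a" .
  moreover have "1 / 2 * ln t \<le> a * ln t" using a False by (intro mult_right_mono) auto
  ultimately have "ln t \<le> 2 * t powr a" by linarith
  moreover have "ln (1 + t) \<le> ln (2 * t)" using False by simp
  moreover have "ln (2 * t) = ln 2 + ln t" using False by (simp add: ln_mult)
  moreover have "ln (2::real) \<le> 1" using ln_add_one_self_le_self[of "1::real"] by simp
  ultimately show ?thesis using p1 by linarith
qed

lemma ln_ratio_le_ln:
  assumes "0 < \<eta>1" "\<eta>1 \<le> \<eta>" "r > 0" "r \<le> 2 * \<bar>d\<bar> \<or> r \<le> 2 * \<eta>1"
  shows "ln (cmod (Complex d \<eta>)) - ln (cmod (Complex d \<eta>1)) \<le> ln (1 + 2 * \<eta> / r)"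
proof -
  have pos: "cmod (Complex d \<eta>) > 0" "cmod (Complex d \<eta>1) > 0" using assms by (auto simp: complex_eq_iff)
  have r2: "r / 2 \<le> cmod (Complex d \<eta>1)"
    using abs_Re_le_cmod[of "Complex d \<eta>1"] abs_Im_le_cmod[of "Complex d \<eta>1"] assms by auto
  have "cmod (Complex d \<eta>) \<le> cmod (Complex d \<eta>1) + \<eta>"
  proof -
    have "Complex d \<eta> = Complex d \<eta>1 + \<i> * complex_of_real (\<eta> - \<eta>1)" by (simp add: complex_eq_iff)
    also have "cmod \<dots> \<le> cmod (Complex d \<eta>1) + (\<eta> - \<eta>1)"
      using assms by (intro order_trans[OF norm_triangle_ineq] add_left_mono) (simp add: norm_mult del: of_real_diff)
    finally show ?thesis using assms by simp
  qed
  then have "cmod (Complex d \<eta>) / cmod (Complex d \<eta>1) \<le> 1 + \<eta> / cmod (Complex d \<eta>1)"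
    using pos by (simp add: field_simps)
  also have "\<dots> \<le> 1 + \<eta> / (r / 2)" using assms r2 pos by (intro add_left_mono divide_left_mono) auto
  finally have "cmod (Complex d \<eta>) / cmod (Complex d \<eta>1) \<le> 1 + 2 * \<eta> / r" by (simp add: mult.commute)
  then have "ln (cmod (Complex d \<eta>) / cmod (Complex d \<eta>1)) \<le> ln (1 + 2 * \<eta> / r)"
    using pos by (intro ln_mono) (auto intro!: divide_pos_pos)
  then show ?thesis using pos by (simp add: ln_div)
qed

lemma ln_ratio_le_sq:
  assumes "0 < \<eta>1" "\<eta>1 \<le> \<eta>" "d \<noteq> 0"
  shows "ln (cmod (Complex d \<eta>)) - ln (cmod (Complex d \<eta>1)) \<le> \<eta>\<^sup>2 / (2 * d\<^sup>2)"
proof -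
  have c: "cmod (Complex d t) = sqrt (d\<^sup>2 + t\<^sup>2)" for t by (simp add: complex_norm)
  have d2: "d\<^sup>2 > 0" using assms by simp
  have p: "d\<^sup>2 + t\<^sup>2 > 0" for t using d2 by (intro add_pos_nonneg) auto
  have "ln (cmod (Complex d \<eta>)) - ln (cmod (Complex d \<eta>1)) = (ln (d\<^sup>2 + \<eta>\<^sup>2) - ln (d\<^sup>2 + \<eta>1\<^sup>2)) / 2"
    unfolding c using p by (simp add: ln_sqrt diff_divide_distrib)
  also have "\<dots> \<le> (ln (d\<^sup>2 + \<eta>\<^sup>2) - ln (d\<^sup>2)) / 2" using d2 p[of \<eta>1] by (intro divide_right_mono diff_left_mono ln_mono) auto
  also have "ln (d\<^sup>2 + \<eta>\<^sup>2) - ln (d\<^sup>2) = ln ((d\<^sup>2 + \<eta>\<^sup>2) / d\<^sup>2)" using p d2 by (simp add: ln_div)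
  also have "(d\<^sup>2 + \<eta>\<^sup>2) / d\<^sup>2 = 1 + \<eta>\<^sup>2 / d\<^sup>2" using d2 by (simp add: add_divide_distrib)
  also have "ln (1 + \<eta>\<^sup>2 / d\<^sup>2) / 2 \<le> \<eta>\<^sup>2 / d\<^sup>2 / 2" by (intro divide_right_mono ln_add_one_self_le_self) auto
  finally show ?thesis by (simp add: mult.commute)
qed

lemma dyadic_powr_sum:
  fixes R \<tau> :: real
  assumes R: "0 < R" and \<tau>: "0 < \<tau>"
  shows "(\<Sum>i\<le>I0. (R / 2 ^ i) powr \<tau>) \<le> R powr \<tau> / (1 - 2 powr - \<tau>)"
proof -
  have q: "2 powr - \<tau> < 1" using \<tau> powr_less_mono[of "- \<tau>" 0 2] by simp
  have "(R / 2 ^ i) powr \<tau> = R powr \<tau> * (2 powr - \<tau>) ^ i" for i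
  proof -
    have "R / 2 ^ i = R * 2 powr - real i" using R by (simp add: powr_minus powr_realpow divide_inverse)
    then have "(R / 2 ^ i) powr \<tau> = R powr \<tau> * (2 powr - real i) powr \<tau>" using R by (simp add: powr_mult)
    also have "(2 powr - real i) powr \<tau> = (2 powr - \<tau>) powr real i" by (simp add: powr_powr mult.commute)
    also have "\<dots> = (2 powr - \<tau>) ^ i" by (simp add: powr_realpow)
    finally show ?thesis .
  qed
  then have "(\<Sum>i\<le>I0. (R / 2 ^ i) powr \<tau>) = R powr \<tau> * (\<Sum>i\<le>I0. (2 powr - \<tau>) ^ i)" by (simp add: sum_distrib_left)
  also have "\<dots> \<le> R powr \<tau> * (1 / (1 - 2 powr - \<tau>))"
  proof (rule mult_left_mono)
    have "(\<Sum>i\<le>I0. (2 powr - \<tau>) ^ i) \<le> (\<Sum>i. (2 powr - \<tau>) ^ i)" using q by (intro sum_le_suminf) auto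
    also have "\<dots> = 1 / (1 - 2 powr - \<tau>)" using q by (intro suminf_geometric) auto
    finally show "(\<Sum>i\<le>I0. (2 powr - \<tau>) ^ i) \<le> 1 / (1 - 2 powr - \<tau>)" .
  qed simp
  finally show ?thesis by simp
qed

text \<open>Each eigenvalue is charged to the finest dyadic neighbourhood of \<open>E\<close> that
  contains it. At scale \<rho> it changes the potential by at most
  \<open>3 * (2 * \<eta> / \<rho>) powr a\<close>, while the share of eigenvalues is at most
  \<open>\<rho> powr (a + \<tau>)\<close>; the surplus \<tau> makes the dyadic sum converge. Beyond
  \<open>R\<close> the change is of second order.\<close>

lemma log_potential_difference:
  fixes Lam :: "real set" and \<rho> :: "nat \<Rightarrow> real"
  assumes Lam: "finite Lam" and a: "1 / 2 \<le> a" "a \<le> 1" and \<tau>: "\<tau> > 0" and R: "0 < R"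
    and \<eta>: "R / 2 ^ I0 \<le> \<eta>"
    and cnt: "\<And>i. i \<le> I0 \<Longrightarrow> real (card {x \<in> Lam. \<bar>E - x\<bar> < R / 2 ^ i}) \<le> (R / 2 ^ i) powr (a + \<tau>) * real (card Lam)"
  shows "(\<Sum>x\<in>Lam. ln (cmod (Complex (E - x) \<eta>)) - ln (cmod (Complex (E - x) (R / 2 ^ I0))))
     \<le> real (card Lam) * (3 * (2 * \<eta>) powr a * R powr \<tau> / (1 - 2 powr - \<tau>) + \<eta>\<^sup>2 / (2 * R\<^sup>2))"
proof -
  define \<rho> where "\<rho> = (\<lambda>i::nat. R / 2 ^ i)"
  define \<eta>1 where "\<eta>1 = R / 2 ^ I0"
  have \<rho>: "\<rho> i > 0" for i using R by (simp add: \<rho>_def)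
  have \<eta>1: "0 < \<eta>1" "\<eta>1 \<le> \<eta>" using R \<eta> by (auto simp: \<eta>1_def)
  then have \<eta>0: "\<eta> > 0" by simp
  have each: "ln (cmod (Complex d \<eta>)) - ln (cmod (Complex d \<eta>1)) \<le> (\<Sum>i\<le>I0. if \<bar>d\<bar> < \<rho> i then 3 * (2 * \<eta> / \<rho> i) powr a else 0) + \<eta>\<^sup>2 / (2 * R\<^sup>2)" for d
  proof (cases "\<bar>d\<bar> < R")
    case False
    then have dR: "R\<^sup>2 \<le> d\<^sup>2" "d \<noteq> 0" using R by (auto simp: abs_le_square_iff[symmetric])
    have "ln (cmod (Complex d \<eta>)) - ln (cmod (Complex d \<eta>1)) \<le> \<eta>\<^sup>2 / (2 * d\<^sup>2)" by (rule ln_ratio_le_sq[OF \<eta>1 dR(2)])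
    also have "\<dots> \<le> \<eta>\<^sup>2 / (2 * R\<^sup>2)" using dR R by (intro divide_left_mono) auto
    also have "0 \<le> (\<Sum>i\<le>I0. if \<bar>d\<bar> < \<rho> i then 3 * (2 * \<eta> / \<rho> i) powr a else 0)" by (intro sum_nonneg) auto
    then have "\<eta>\<^sup>2 / (2 * R\<^sup>2) \<le> (\<Sum>i\<le>I0. if \<bar>d\<bar> < \<rho> i then 3 * (2 * \<eta> / \<rho> i) powr a else 0) + \<eta>\<^sup>2 / (2 * R\<^sup>2)" by simp
    finally show ?thesis .
  next
    case True
    define i where "i = Max {i. i \<le> I0 \<and> \<bar>d\<bar> < \<rho> i}"
    have fin: "finite {i. i \<le> I0 \<and> \<bar>d\<bar> < \<rho> i}" by simp
    have "0 \<in> {i. i \<le> I0 \<and> \<bar>d\<bar> < \<rho> i}" using True by (simp add: \<rho>_def)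
    then have i: "i \<le> I0" "\<bar>d\<bar> < \<rho> i" using Max_in[OF fin, folded i_def] by auto
    have "\<rho> i \<le> 2 * \<bar>d\<bar> \<or> \<rho> i \<le> 2 * \<eta>1"
    proof (cases "i = I0")
      case True
      then show ?thesis using \<eta>1 by (simp add: \<rho>_def \<eta>1_def)
    next
      case False
      have "\<not> \<bar>d\<bar> < \<rho> (Suc i)"
      proof
        assume "\<bar>d\<bar> < \<rho> (Suc i)"
        then have "Suc i \<le> i" using False i(1) Max_ge[OF fin, of "Suc i", folded i_def] by simp
        then show False by simp
      qed
      then show ?thesis by (simp add: \<rho>_def)
    qed
    then have "ln (cmod (Complex d \<eta>)) - ln (cmod (Complex d \<eta>1)) \<le> ln (1 + 2 * \<eta> / \<rho> i)" by (rule ln_ratio_le_ln[OF \<eta>1 \<rho>])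
    also have "\<dots> \<le> 3 * (2 * \<eta> / \<rho> i) powr a" using \<eta>0 \<rho>[of i] by (intro ln_add_one_le_powr a) auto
    also have "\<dots> = (\<Sum>i\<in>{i}. if \<bar>d\<bar> < \<rho> i then 3 * (2 * \<eta> / \<rho> i) powr a else 0)" using i by simp
    also have "\<dots> \<le> (\<Sum>i\<le>I0. if \<bar>d\<bar> < \<rho> i then 3 * (2 * \<eta> / \<rho> i) powr a else 0)" using i by (intro sum_mono2) auto
    finally show ?thesis by (smt (verit) divide_nonneg_nonneg zero_le_power2 mult_nonneg_nonneg)
  qed
  have "(\<Sum>x\<in>Lam. ln (cmod (Complex (E - x) \<eta>)) - ln (cmod (Complex (E - x) \<eta>1)))
     \<le> (\<Sum>x\<in>Lam. (\<Sum>i\<le>I0. if \<bar>E - x\<bar> < \<rho> i then 3 * (2 * \<eta> / \<rho> i) powr a else 0) + \<eta>\<^sup>2 / (2 * R\<^sup>2))"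
    by (intro sum_mono each)
  also have "\<dots> = (\<Sum>i\<le>I0. \<Sum>x\<in>Lam. if \<bar>E - x\<bar> < \<rho> i then 3 * (2 * \<eta> / \<rho> i) powr a else 0) + real (card Lam) * (\<eta>\<^sup>2 / (2 * R\<^sup>2))"
    by (subst sum.swap) (simp add: sum.distrib)
  also have "(\<Sum>i\<le>I0. \<Sum>x\<in>Lam. if \<bar>E - x\<bar> < \<rho> i then 3 * (2 * \<eta> / \<rho> i) powr a else 0)
    \<le> (\<Sum>i\<le>I0. real (card Lam) * (3 * (2 * \<eta>) powr a) * \<rho> i powr \<tau>)"
  proof (rule sum_mono)
    fix i assume i: "i \<in> {..I0}"
    have "(\<Sum>x\<in>Lam. if \<bar>E - x\<bar> < \<rho> i then 3 * (2 * \<eta> / \<rho> i) powr a else 0) = (\<Sum>x\<in>{x \<in> Lam. \<bar>E - x\<bar> < \<rho> i}. 3 * (2 * \<eta> / \<rho> i) powr a)"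
      by (rule sum.inter_filter[OF Lam, symmetric])
    also have "\<dots> = real (card {x \<in> Lam. \<bar>E - x\<bar> < \<rho> i}) * (3 * (2 * \<eta> / \<rho> i) powr a)" by simp
    also have "\<dots> \<le> (\<rho> i powr (a + \<tau>) * real (card Lam)) * (3 * (2 * \<eta> / \<rho> i) powr a)"
      using cnt[of i] i by (intro mult_right_mono) (auto simp: \<rho>_def)
    also have "\<dots> = real (card Lam) * (3 * (2 * \<eta>) powr a) * \<rho> i powr \<tau>"
      using \<rho>[of i] \<eta>0 by (simp add: powr_divide powr_add)
    finally show "(\<Sum>x\<in>Lam. if \<bar>E - x\<bar> < \<rho> i then 3 * (2 * \<eta> / \<rho> i) powr a else 0) \<le> real (card Lam) * (3 * (2 * \<eta>) powr a) * \<rho> i powr \<tau>" .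
  qed
  also have "\<dots> = real (card Lam) * (3 * (2 * \<eta>) powr a) * (\<Sum>i\<le>I0. \<rho> i powr \<tau>)" by (simp add: sum_distrib_left)
  also have "\<dots> \<le> real (card Lam) * (3 * (2 * \<eta>) powr a) * (R powr \<tau> / (1 - 2 powr - \<tau>))"
    unfolding \<rho>_def using dyadic_powr_sum[OF R \<tau>] by (intro mult_left_mono) auto
  finally show ?thesis unfolding \<eta>1_def by (simp add: distrib_left)
qed

text \<open>Double counting: an eigenvalue lies within \<rho> of the selected energies of at most
  three cells, its own and the two neighbours.\<close>

lemma crowded_cells:
  fixes A Lam :: "real set"
  assumes \<rho>: "\<rho> > 0" and v: "v > 0" and Lam: "finite Lam"
    and A: "\<And>E. E \<in> A \<Longrightarrow> v * real (card Lam) \<le> real (card {x \<in> Lam. \<bar>E - x\<bar> < \<rho>})" and L0: "card Lam > 0"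
    and J: "finite J" "J = (\<lambda>E. \<lfloor>E / \<rho>\<rfloor>) ` A"
  shows "real (card J) \<le> 3 / v"
proof -
  have "\<exists>E. E \<in> A \<and> \<lfloor>E / \<rho>\<rfloor> = j" if "j \<in> J" for j using that J(2) by auto
  then obtain E where E: "\<And>j. j \<in> J \<Longrightarrow> E j \<in> A" "\<And>j. j \<in> J \<Longrightarrow> \<lfloor>E j / \<rho>\<rfloor> = j" by metis
  have "real (card J) * (v * real (card Lam)) = (\<Sum>j\<in>J. v * real (card Lam))" by simp
  also have "\<dots> \<le> (\<Sum>j\<in>J. real (card {x \<in> Lam. \<bar>E j - x\<bar> < \<rho>}))" by (intro sum_mono A E(1))
  also have "\<dots> = (\<Sum>j\<in>J. \<Sum>x\<in>Lam. if \<bar>E j - x\<bar> < \<rho> then 1 else 0)"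
    using Lam by (simp add: sum.inter_filter[symmetric])
  also have "\<dots> = (\<Sum>x\<in>Lam. \<Sum>j\<in>J. if \<bar>E j - x\<bar> < \<rho> then 1 else 0)" by (rule sum.swap)
  also have "\<dots> \<le> (\<Sum>x\<in>Lam. 3)"
  proof (rule sum_mono)
    fix x
    have "(\<Sum>j\<in>J. if \<bar>E j - x\<bar> < \<rho> then 1 else 0) = real (card {j \<in> J. \<bar>E j - x\<bar> < \<rho>})"
      using J(1) by (simp add: sum.inter_filter[symmetric])
    also have "card {j \<in> J. \<bar>E j - x\<bar> < \<rho>} \<le> card {\<lfloor>x / \<rho>\<rfloor> - 1..\<lfloor>x / \<rho>\<rfloor> + 1}"
    proof (rule card_mono)
      show "{j \<in> J. \<bar>E j - x\<bar> < \<rho>} \<subseteq> {\<lfloor>x / \<rho>\<rfloor> - 1..\<lfloor>x / \<rho>\<rfloor> + 1}"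
      proof
        fix j assume "j \<in> {j \<in> J. \<bar>E j - x\<bar> < \<rho>}"
        then have j: "j \<in> J" "\<bar>E j - x\<bar> < \<rho>" by auto
        have "\<bar>E j - x\<bar> / \<rho> < 1" using j(2) \<rho> by simp
        moreover have "\<bar>E j - x\<bar> / \<rho> = \<bar>E j / \<rho> - x / \<rho>\<bar>" using \<rho> by (simp add: diff_divide_distrib[symmetric])
        ultimately have "\<bar>E j / \<rho> - x / \<rho>\<bar> < 1" by simp
        then show "j \<in> {\<lfloor>x / \<rho>\<rfloor> - 1..\<lfloor>x / \<rho>\<rfloor> + 1}" using E(2)[OF j(1)] by simp linarith
      qed
    qed simp
    finally show "(\<Sum>j\<in>J. if \<bar>E j - x\<bar> < \<rho> then 1 else 0) \<le> (3::real)" by simp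
  qed
  also have "\<dots> = 3 * real (card Lam)" by simp
  finally have "real (card J) * v * real (card Lam) \<le> 3 * real (card Lam)" by (simp only: mult.assoc)
  then have "real (card J) * v \<le> 3" using L0 by simp
  then show ?thesis using v by (simp add: pos_le_divide_eq)
qed

subsection \<open>Covers by intervals\<close>

text \<open>The spectrum is a set of complex numbers, so real intervals are carried into the plane;
  the sequence of covering sets is completed by empty sets, which cost nothing.\<close>

lemma hausdorff_premeasure_le_intervals:
  fixes S :: "real set" and x l :: "'i \<Rightarrow> real"
  assumes s: "s > 0" and I: "finite I" and l: "\<And>i. i \<in> I \<Longrightarrow> 0 \<le> l i \<and> l i \<le> \<delta>" and \<delta>: "\<delta> > 0"
    and cov: "S \<subseteq> (\<Union>i\<in>I. {x i..x i + l i})" and sum: "(\<Sum>i\<in>I. l i powr s) \<le> b"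
  shows "hausdorff_premeasure s \<delta> (complex_of_real ` S) \<le> ennreal b"
proof -
  obtain g where g: "bij_betw g {..<card I} I" using ex_bij_betw_nat_finite[OF I] atLeast0LessThan by metis
  have gI: "g i \<in> I" if "i < card I" for i using g that by (auto simp: bij_betw_def)
  define U where "U = (\<lambda>i. if i < card I then complex_of_real ` {x (g i)..x (g i) + l (g i)} else {})"
  have bd: "bounded (U i)" for i
    unfolding U_def using compact_continuous_image[OF continuous_on_of_real[OF continuous_on_id], of "{x (g i)..x (g i) + l (g i)}"]
    by (auto intro: compact_imp_bounded)
  have diam: "diameter (U i) \<le> l (g i)" if i: "i < card I" for i
  proof (rule diameter_le)
    show "U i \<noteq> {} \<or> 0 \<le> l (g i)" using l[OF gI[OF i]] by simp
    fix z z' assume "z \<in> U i" "z' \<in> U i"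
    then obtain a b where "z = complex_of_real a" "z' = complex_of_real b" "a \<in> {x (g i)..x (g i) + l (g i)}" "b \<in> {x (g i)..x (g i) + l (g i)}"
      using i by (auto simp: U_def)
    then show "norm (z - z') \<le> l (g i)" by (simp flip: of_real_diff) linarith
  qed
  have "hausdorff_cover \<delta> (complex_of_real ` S) U"
    unfolding hausdorff_cover_def
  proof (intro conjI allI bd)
    show "complex_of_real ` S \<subseteq> (\<Union>i. U i)"
    proof
      fix z assume "z \<in> complex_of_real ` S"
      then obtain a where a: "a \<in> S" "z = complex_of_real a" by auto
      then obtain j where j: "j \<in> I" "a \<in> {x j..x j + l j}" using cov by blast
      then obtain i where "i < card I" "g i = j" using bij_betw_imp_surj_on[OF g] by (metis imageE lessThan_iff)
      then show "z \<in> (\<Union>i. U i)" using a(2) j(2) by (auto simp: U_def intro!: exI[of _ i])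
    qed
    show "diameter (U i) \<le> \<delta>" for i
    proof (cases "i < card I")
      case True
      then show ?thesis using diam[OF True] l[OF gI[OF True]] by simp
    next
      case False
      then show ?thesis using \<delta> by (simp add: U_def)
    qed
  qed
  then have "hausdorff_premeasure s \<delta> (complex_of_real ` S) \<le> (\<Sum>i. hausdorff_gauge s (U i))"
    unfolding hausdorff_premeasure_def by (intro INF_lower) simp
  also have "\<dots> = (\<Sum>i<card I. hausdorff_gauge s (U i))"
    by (rule suminf_finite) (auto simp: U_def hausdorff_gauge_def)
  also have "\<dots> \<le> (\<Sum>i<card I. ennreal (l (g i) powr s))"
  proof (rule sum_mono)
    fix i assume "i \<in> {..<card I}"
    then have i: "i < card I" by simp
    have "diameter (U i) powr s \<le> l (g i) powr s" using diam[OF i] diameter_ge_0[OF bd[of i]] s by (intro powr_mono2) auto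
    then show "hausdorff_gauge s (U i) \<le> ennreal (l (g i) powr s)" using s by (simp add: hausdorff_gauge_def ennreal_leI)
  qed
  also have "\<dots> = ennreal (\<Sum>i<card I. l (g i) powr s)" by (simp add: sum_ennreal)
  also have "(\<Sum>i<card I. l (g i) powr s) = (\<Sum>i\<in>I. l i powr s)" by (rule sum.reindex_bij_betw[OF g])
  also have "ennreal \<dots> \<le> ennreal b" by (rule ennreal_leI[OF sum])
  finally show ?thesis .
qed

lemma hausdorff_measure_zeroI:
  assumes "\<And>\<delta> b. \<delta> > 0 \<Longrightarrow> b > 0 \<Longrightarrow> hausdorff_premeasure s \<delta> A \<le> ennreal b"
  shows "hausdorff_measure s A = 0"
proof -
  have "hausdorff_premeasure s \<delta> A = 0" if "\<delta> > 0" for \<delta>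
  proof -
    have "hausdorff_premeasure s \<delta> A \<le> 0 + ennreal b" if "b > 0" for b using assms[OF \<open>\<delta> > 0\<close> that] by simp
    then show ?thesis using ennreal_le_epsilon[of 0 "hausdorff_premeasure s \<delta> A"] by simp
  qed
  then show ?thesis unfolding hausdorff_measure_def by (simp add: SUP_eq_const)
qed

lemma hausdorff_dim_leI:
  assumes "0 \<le> d" "d < D" "\<And>s. d < s \<Longrightarrow> s \<le> D \<Longrightarrow> hausdorff_measure s A = 0"
  shows "hausdorff_dim A \<le> ereal d"
proof (rule ereal_le_epsilon2)
  fix e :: real assume e: "0 < e"
  have "hausdorff_dim A \<le> ereal (min (d + e) D)"
    unfolding hausdorff_dim_def using assms e by (intro INF_lower) auto
  also have "\<dots> \<le> ereal d + ereal e" by simp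
  finally show "hausdorff_dim A \<le> ereal d + ereal e" .
qed

subsection \<open>The covering estimate\<close>

text \<open>All conditions are limits for \<eta> tending to 0. The cutoff
  \<open>R = 2 * \<eta> powr (1 / 4)\<close> tends to 0, as the size of the covering intervals
  requires, but so slowly that \<open>\<eta>^2 / (2 * R^2)\<close>, of order
  \<open>\<eta> powr (3 / 2)\<close>, is negligible against \<open>sqrt \<eta>\<close>. The 11 comes
  from the count \<open>10 / \<eta> + 3\<close> of cells.\<close>

lemma small_scale:
  fixes \<tau> \<sigma> d \<delta> \<kappa> :: real
  assumes \<tau>: "0 < \<tau>" and \<sigma>: "1 / 2 < \<sigma>" and d: "0 < d" and \<delta>: "0 < \<delta>" and \<kappa>: "0 < \<kappa>"
  obtains \<eta> where "0 < \<eta>" "\<eta> < 1 / 4" "2 * \<eta> powr (1 / 4) \<le> \<delta>" "\<eta> \<le> \<delta>"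
    "\<eta> powr (\<sigma> - 1 / 2) * (6 + 2 * ln (11 / \<eta>)) \<le> \<kappa> / 2"
    "3 * (2 * \<eta> powr (1 / 4)) powr \<tau> / d \<le> \<kappa> / 2"
    "3 * (2 * \<eta>) powr (1 / 2 + \<tau>) * (2 * \<eta> powr (1 / 4)) powr \<tau> / d + \<eta>\<^sup>2 / (2 * (2 * \<eta> powr (1 / 4))\<^sup>2) < sqrt \<eta> / 80"
proof -
  have s: "\<sigma> - 1 / 2 > 0" using \<sigma> by simp
  have 1: "eventually (\<lambda>\<eta>::real. 2 * \<eta> powr (1 / 4) < \<delta>) (at_right 0)"
    by (rule order_tendstoD(2)[OF _ \<delta>]) real_asymp
  have 2: "eventually (\<lambda>\<eta>::real. \<eta> < min (1 / 4) \<delta>) (at_right 0)"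
    using \<delta> by (intro eventually_at_rightI[of 0 "min (1 / 4) \<delta>"]) auto
  have "((\<lambda>\<eta>::real. \<eta> powr (\<sigma> - 1 / 2) * (6 + 2 * ln (11 / \<eta>))) \<longlongrightarrow> 0) (at_right 0)"
    using s by real_asymp
  then have 3: "eventually (\<lambda>\<eta>::real. \<eta> powr (\<sigma> - 1 / 2) * (6 + 2 * ln (11 / \<eta>)) < \<kappa> / 2) (at_right 0)"
    using \<kappa> by (intro order_tendstoD) auto
  have "((\<lambda>\<eta>::real. 3 * (2 * \<eta> powr (1 / 4)) powr \<tau> / d) \<longlongrightarrow> 0) (at_right 0)" using \<tau> d by real_asymp
  then have 4: "eventually (\<lambda>\<eta>::real. 3 * (2 * \<eta> powr (1 / 4)) powr \<tau> / d < \<kappa> / 2) (at_right 0)"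
    using \<kappa> by (intro order_tendstoD) auto
  have "((\<lambda>\<eta>::real. 3 * (2 * \<eta>) powr (1 / 2 + \<tau>) * (2 * \<eta> powr (1 / 4)) powr \<tau> / d / sqrt \<eta>) \<longlongrightarrow> 0) (at_right 0)"
    using \<tau> d by real_asymp
  then have 5: "eventually (\<lambda>\<eta>::real. 3 * (2 * \<eta>) powr (1 / 2 + \<tau>) * (2 * \<eta> powr (1 / 4)) powr \<tau> / d / sqrt \<eta> < 1 / 160) (at_right 0)"
    by (rule order_tendstoD) simp
  have "((\<lambda>\<eta>::real. \<eta>\<^sup>2 / (2 * (2 * \<eta> powr (1 / 4))\<^sup>2) / sqrt \<eta>) \<longlongrightarrow> 0) (at_right 0)" by real_asymp
  then have 6: "eventually (\<lambda>\<eta>::real. \<eta>\<^sup>2 / (2 * (2 * \<eta> powr (1 / 4))\<^sup>2) / sqrt \<eta> < 1 / 160) (at_right 0)"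
    by (rule order_tendstoD) simp
  have 7: "eventually (\<lambda>\<eta>::real. \<eta> > 0) (at_right 0)" by (rule eventually_at_right_less)
  have "eventually (\<lambda>\<eta>::real. 0 < \<eta> \<and> \<eta> < min (1 / 4) \<delta> \<and> 2 * \<eta> powr (1 / 4) < \<delta> \<and> \<eta> powr (\<sigma> - 1 / 2) * (6 + 2 * ln (11 / \<eta>)) < \<kappa> / 2
     \<and> 3 * (2 * \<eta> powr (1 / 4)) powr \<tau> / d < \<kappa> / 2
     \<and> 3 * (2 * \<eta>) powr (1 / 2 + \<tau>) * (2 * \<eta> powr (1 / 4)) powr \<tau> / d / sqrt \<eta> < 1 / 160
     \<and> \<eta>\<^sup>2 / (2 * (2 * \<eta> powr (1 / 4))\<^sup>2) / sqrt \<eta> < 1 / 160) (at_right 0)"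
    using 1 2 3 4 5 6 7 by (intro eventually_conj)
  then obtain \<eta> where \<eta>: "0 < \<eta>" "\<eta> < min (1 / 4) \<delta>" "2 * \<eta> powr (1 / 4) < \<delta>" "\<eta> powr (\<sigma> - 1 / 2) * (6 + 2 * ln (11 / \<eta>)) < \<kappa> / 2"
     "3 * (2 * \<eta> powr (1 / 4)) powr \<tau> / d < \<kappa> / 2"
     "3 * (2 * \<eta>) powr (1 / 2 + \<tau>) * (2 * \<eta> powr (1 / 4)) powr \<tau> / d / sqrt \<eta> < 1 / 160"
     "\<eta>\<^sup>2 / (2 * (2 * \<eta> powr (1 / 4))\<^sup>2) / sqrt \<eta> < 1 / 160"
    using eventually_happens'[OF trivial_limit_at_right_real] by blast
  have sq: "sqrt \<eta> > 0" using \<eta> by simp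
  have "3 * (2 * \<eta>) powr (1 / 2 + \<tau>) * (2 * \<eta> powr (1 / 4)) powr \<tau> / d < 1 / 160 * sqrt \<eta>"
    using \<eta>(6) unfolding pos_divide_less_eq[OF sq] .
  moreover have "\<eta>\<^sup>2 / (2 * (2 * \<eta> powr (1 / 4))\<^sup>2) < 1 / 160 * sqrt \<eta>"
    using \<eta>(7) unfolding pos_divide_less_eq[OF sq] .
  ultimately show ?thesis using \<eta>(1-5) by (intro that) auto
qed

lemma finite_floor_image:
  fixes A :: "real set"
  assumes "A \<subseteq> {- 5..5}" "r > 0"
  shows "finite ((\<lambda>E. \<lfloor>E / r\<rfloor>) ` A)" "real (card ((\<lambda>E. \<lfloor>E / r\<rfloor>) ` A)) \<le> 10 / r + 3"
proof -
  have sub: "(\<lambda>E. \<lfloor>E / r\<rfloor>) ` A \<subseteq> {\<lfloor>- 5 / r\<rfloor>..\<lfloor>5 / r\<rfloor>}"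
  proof
    fix j assume "j \<in> (\<lambda>E. \<lfloor>E / r\<rfloor>) ` A"
    then obtain E where "j = \<lfloor>E / r\<rfloor>" "-5 \<le> E" "E \<le> 5" using assms by auto
    moreover from this have "- 5 / r \<le> E / r" "E / r \<le> 5 / r" using assms(2) by (intro divide_right_mono; simp)+
    ultimately show "j \<in> {\<lfloor>- 5 / r\<rfloor>..\<lfloor>5 / r\<rfloor>}" using floor_mono by auto
  qed
  show "finite ((\<lambda>E. \<lfloor>E / r\<rfloor>) ` A)" using sub finite_subset by blast
  have "card ((\<lambda>E. \<lfloor>E / r\<rfloor>) ` A) \<le> card {\<lfloor>- 5 / r\<rfloor>..\<lfloor>5 / r\<rfloor>}" using sub by (intro card_mono) auto
  then have "real (card ((\<lambda>E. \<lfloor>E / r\<rfloor>) ` A)) \<le> real (nat (\<lfloor>5 / r\<rfloor> + 1 - \<lfloor>- 5 / r\<rfloor>))" by simp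
  also have "\<dots> \<le> 10 / r + 3"
  proof -
    have "\<lfloor>- 5 / r\<rfloor> \<le> \<lfloor>5 / r\<rfloor>" using assms(2) by (intro floor_mono divide_right_mono) auto
    then have "real (nat (\<lfloor>5 / r\<rfloor> + 1 - \<lfloor>- 5 / r\<rfloor>)) = of_int \<lfloor>5 / r\<rfloor> + 1 - of_int \<lfloor>- 5 / r\<rfloor>" by simp
    moreover have "of_int \<lfloor>5 / r\<rfloor> \<le> 5 / r" "- 5 / r < of_int \<lfloor>- 5 / r\<rfloor> + 1" by linarith+
    moreover have "- 5 / r = - (5 / r)" "10 / r = 2 * (5 / r)" by simp_all
    ultimately show ?thesis by linarith
  qed
  finally show "real (card ((\<lambda>E. \<lfloor>E / r\<rfloor>) ` A)) \<le> 10 / r + 3" .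
qed

text \<open>The order of choices matters: \<eta> depends on the target only, \<open>C\<close> and
  \<open>r\<close> on \<eta>, the lowest scale on \<open>r\<close>, and \<open>n\<close> on
  \<open>C\<close> and \<open>h\<close>; the bounds for the numbers of cells do not involve
  \<open>n\<close>.\<close>

lemma premeasure_energies:
  assumes irr: "\<alpha> \<notin> \<rat>" and \<sigma>: "1 / 2 < \<sigma>" "\<sigma> \<le> 1" and \<delta>: "\<delta> > 0" and \<kappa>: "\<kappa> > 0"
  shows "hausdorff_premeasure \<sigma> \<delta> (complex_of_real ` amo_energies \<alpha> \<theta>) \<le> ennreal \<kappa>"
proof -
  define S where "S = amo_energies \<alpha> \<theta>"
  \<comment> \<open>The excess over 1/2 is spent in three equal parts: in \<open>a\<close>, to beat
    \<open>sqrt \<eta>\<close>; in the dyadic sum for the potential; and in the dyadic sum over the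
    cover.\<close>
  define \<tau> where "\<tau> = (\<sigma> - 1 / 2) / 3"
  define a where "a = 1 / 2 + \<tau>"
  define d where "d = 1 - 2 powr - \<tau>"
  have \<tau>: "0 < \<tau>" "\<tau> \<le> 1 / 6" using \<sigma> by (auto simp: \<tau>_def)
  have a: "1 / 2 \<le> a" "a \<le> 1" "\<sigma> = a + \<tau> + \<tau>" using \<tau> by (auto simp: a_def \<tau>_def field_simps)
  have d: "d > 0" using \<tau> powr_less_mono[of "- \<tau>" 0 2] by (simp add: d_def)
  obtain \<eta> where \<eta>: "0 < \<eta>" "\<eta> < 1 / 4" "2 * \<eta> powr (1 / 4) \<le> \<delta>" "\<eta> \<le> \<delta>"
    "\<eta> powr (\<sigma> - 1 / 2) * (6 + 2 * ln (11 / \<eta>)) \<le> \<kappa> / 2"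
    "3 * (2 * \<eta> powr (1 / 4)) powr \<tau> / d \<le> \<kappa> / 2"
    "3 * (2 * \<eta>) powr (1 / 2 + \<tau>) * (2 * \<eta> powr (1 / 4)) powr \<tau> / d + \<eta>\<^sup>2 / (2 * (2 * \<eta> powr (1 / 4))\<^sup>2) < sqrt \<eta> / 80"
    by (rule small_scale[OF \<tau>(1) \<sigma>(1) d \<delta> \<kappa>])
  define R where "R = 2 * \<eta> powr (1 / 4)"
  define h where "h = sqrt \<eta>"
  have R: "R > 0" using \<eta> by (simp add: R_def)
  have h: "0 < h" "h \<le> 1" using \<eta> by (auto simp: h_def real_sqrt_le_1_iff)
  have pot: "3 * (2 * \<eta>) powr a * R powr \<tau> / d + \<eta>\<^sup>2 / (2 * R\<^sup>2) < h / 80" using \<eta>(7) by (simp add: R_def a_def h_def)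
  \<comment> \<open>The threshold \<open>h / 40\<close> is shared out: half of it to the potential
    difference, \<open>h / 160\<close> to the growth rate and as much to
    \<open>ln C\<close>.\<close>
  have \<epsilon>: "h / 160 > 0" using h by simp
  obtain C r where C: "C \<ge> 1" "r > 0"
    "\<And>E z y n. E \<in> S \<Longrightarrow> cmod (z - complex_of_real E) \<le> r \<Longrightarrow> cmod z \<le> 5 \<Longrightarrow> cmod (cdet \<alpha> z y n) \<le> C * exp (h / 160 * real n)"
    using uniform_subexponential[OF irr \<epsilon>, of \<theta>] unfolding S_def by metis
  \<comment> \<open>The scales descend until they are at most \<eta> and at most the radius
    \<open>r\<close> within which the subexponential bound holds.\<close>
  obtain I0 :: nat where I0: "R / min r \<eta> < 2 ^ I0" using real_arch_pow[of 2 "R / min r \<eta>"] by auto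
  define \<rho> where "\<rho> = (\<lambda>i::nat. R / 2 ^ i)"
  define \<eta>1 where "\<eta>1 = \<rho> I0"
  have \<rho>: "\<rho> i > 0" "\<rho> i \<le> \<delta>" for i
  proof -
    show "\<rho> i > 0" using R by (simp add: \<rho>_def)
    have "\<rho> i \<le> R / 1" unfolding \<rho>_def using R by (intro divide_left_mono) auto
    then show "\<rho> i \<le> \<delta>" using \<eta>(3) by (simp add: R_def)
  qed
  have "R / 2 ^ I0 \<le> min r \<eta>"
  proof -
    have "0 < min r \<eta>" using C(2) \<eta>(1) by simp
    then have "R < 2 ^ I0 * min r \<eta>" using I0 by (simp add: pos_divide_less_eq)
    then have "R / 2 ^ I0 \<le> 2 ^ I0 * min r \<eta> / 2 ^ I0" by (intro divide_right_mono) auto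
    then show ?thesis by simp
  qed
  then have \<eta>1: "0 < \<eta>1" "\<eta>1 \<le> r" "\<eta>1 \<le> \<eta>" using \<rho>(1)[of I0] by (auto simp: \<eta>1_def \<rho>_def)
  \<comment> \<open>Large enough to absorb \<open>ln C\<close> and, for the resolvent cells, the
    surplus \<open>ln (1 / h)\<close> and the one missing term in the sum over
    \<open>{1..<n}\<close>.\<close>
  obtain n :: nat where n': "real n \<ge> max (ln C / (h / 160)) (max 1 ((ln (1 / h) + h / 20) / (h / 40)))" using real_arch_simple by blast
  have "ln C / (h / 160) \<le> real n" "1 \<le> real n" "(ln (1 / h) + h / 20) / (h / 40) \<le> real n" using n' by auto
  then have n: "ln C \<le> h / 160 * real n" "n \<ge> 1" "ln (1 / h) + h / 20 \<le> h / 40 * real n"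
    using h by (auto simp: pos_divide_le_eq mult.commute)
  obtain y where y: "\<And>j. chain \<alpha> y j \<noteq> 0" "(\<Sum>k\<in>{1..<n}. ln (max \<bar>chain \<alpha> y k\<bar> h)) \<ge> h / 20 * real (card {1..<n})"
    using good_phase[OF h, of "{1..<n}" \<alpha>] by auto
  define c where "c = chain \<alpha> y"
  obtain m X w where bm: "block_measure h c n m X w"
    using green_average[OF h(1), of c n] y(1) abs_chain_le n(2) by (auto simp: c_def)
  define Lam where "Lam = {x::real. jdet c (complex_of_real x) n = 0}"
  have Lam: "finite Lam" "card Lam = n" "\<And>z. jdet c z n = (\<Prod>x\<in>Lam. z - complex_of_real x)"
    unfolding Lam_def by (rule jdet_roots; use y(1) in \<open>simp add: c_def\<close>)+
  have z5: "cmod (Complex E t) \<le> 5" if "E \<in> S" "0 < t" "t \<le> \<eta>" for E t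
    using cmod_le[of "Complex E t"] amo_energies_bound[of E \<alpha> \<theta>] that \<eta>(2) by (simp add: S_def)
  have S5: "S \<subseteq> {- 5..5}" using amo_energies_bound unfolding S_def by fastforce
  define A where "A = {E \<in> S. ln (cmod (jdet c (Complex E \<eta>) n)) \<le> h / 40 * real n}"
  define B where "B = (\<lambda>i. {E \<in> S. \<rho> i powr (a + \<tau>) * real (card Lam) \<le> real (card {x \<in> Lam. \<bar>E - x\<bar> < \<rho> i})})"
  define JA where "JA = (\<lambda>E. \<lfloor>E / \<eta>\<rfloor>) ` A"
  define J where "J = (\<lambda>i. (\<lambda>E. \<lfloor>E / \<rho> i\<rfloor>) ` B i)"
  have cover: "S \<subseteq> A \<union> (\<Union>i\<in>{..I0}. B i)"
  proof
    fix E assume E: "E \<in> S"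
    show "E \<in> A \<union> (\<Union>i\<in>{..I0}. B i)"
    proof (rule ccontr)
      assume neg: "E \<notin> A \<union> (\<Union>i\<in>{..I0}. B i)"
      have lnD: "ln (cmod (jdet c (Complex E t) n)) = (\<Sum>x\<in>Lam. ln (cmod (Complex (E - x) t)))" if "t > 0" for t
      proof -
        have "Complex E t - complex_of_real x = Complex (E - x) t" for x by (simp add: complex_eq_iff)
        then have "cmod (jdet c (Complex E t) n) = (\<Prod>x\<in>Lam. cmod (Complex (E - x) t))" by (simp add: Lam(3) prod_norm)
        also have "ln \<dots> = (\<Sum>x\<in>Lam. ln (cmod (Complex (E - x) t)))" using that Lam(1) by (intro ln_prod) (auto simp: complex_eq_iff)
        finally show ?thesis .
      qed
      have cnt: "real (card {x \<in> Lam. \<bar>E - x\<bar> < R / 2 ^ i}) \<le> (R / 2 ^ i) powr (a + \<tau>) * real (card Lam)" if "i \<le> I0" for i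
      proof -
        have "E \<notin> B i" using neg that by auto
        then show ?thesis using E by (simp add: B_def \<rho>_def)
      qed
      have e1: "R / 2 ^ I0 = \<eta>1" by (simp add: \<eta>1_def \<rho>_def)
      have "(\<Sum>x\<in>Lam. ln (cmod (Complex (E - x) \<eta>)) - ln (cmod (Complex (E - x) (R / 2 ^ I0))))
        \<le> real (card Lam) * (3 * (2 * \<eta>) powr a * R powr \<tau> / (1 - 2 powr - \<tau>) + \<eta>\<^sup>2 / (2 * R\<^sup>2))"
        by (rule log_potential_difference[OF Lam(1) a(1,2) \<tau>(1) R _ cnt]) (use \<eta>1 in \<open>auto simp: \<eta>1_def \<rho>_def\<close>)
      also have "\<dots> \<le> real n * (h / 80)" unfolding Lam(2) d_def[symmetric] using pot by (intro mult_left_mono) auto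
      finally have "ln (cmod (jdet c (Complex E \<eta>) n)) - ln (cmod (jdet c (Complex E \<eta>1) n)) \<le> real n * (h / 80)"
        unfolding lnD[OF \<eta>(1)] lnD[OF \<eta>1(1)] by (simp only: e1 sum_subtractf)
      moreover have "h / 40 * real n < ln (cmod (jdet c (Complex E \<eta>) n))" using neg E by (auto simp: A_def)
      moreover have "ln (cmod (jdet c (Complex E \<eta>1) n)) \<le> h / 80 * real n"
      proof -
        have "Complex E \<eta>1 - complex_of_real E = Complex 0 \<eta>1" by (simp add: complex_eq_iff)
        then have "cmod (Complex E \<eta>1 - complex_of_real E) \<le> r" using \<eta>1 by (simp add: complex_norm)
        then have "cmod (jdet c (Complex E \<eta>1) n) \<le> C * exp (h / 160 * real n)"
          using C(3)[OF E _ z5[OF E \<eta>1(1,3)], of y n] by (simp add: cdet_def c_def)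
        moreover have "cmod (jdet c (Complex E \<eta>1) n) > 0" using jdet_nonzero[of "Complex E \<eta>1" c n] \<eta>1(1) by simp
        ultimately have "ln (cmod (jdet c (Complex E \<eta>1) n)) \<le> ln (C * exp (h / 160 * real n))" using C(1) by (intro ln_mono) auto
        also have "\<dots> = ln C + h / 160 * real n" using C(1) by (simp add: ln_mult)
        finally have "ln (cmod (jdet c (Complex E \<eta>1) n)) \<le> h / 160 * real n + h / 160 * real n" using n(1) by linarith
        then show ?thesis by simp
      qed
      moreover have "h / 40 * real n = h / 80 * real n + real n * (h / 80)" by simp
      ultimately show False by linarith
    qed
  qed
  have AS: "A \<subseteq> {- 5..5}" "B i \<subseteq> {- 5..5}" for i using S5 by (auto simp: A_def B_def)
  have fin: "finite JA" "finite (J i)" for i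
    unfolding JA_def J_def using finite_floor_image(1) AS \<eta>(1) \<rho>(1) by blast+
  have cJA: "real (card JA) * \<eta> powr \<sigma> \<le> \<kappa> / 2"
  proof (cases "JA = {}")
    case False
    have cl: "real (card JA) \<le> 11 / \<eta>"
    proof -
      have "real (card JA) \<le> 10 / \<eta> + 3" unfolding JA_def by (rule finite_floor_image(2)[OF AS(1) \<eta>(1)])
      moreover have "4 \<le> 1 / \<eta>" using \<eta>(1,2) by (simp add: pos_le_divide_eq)
      moreover have "10 / \<eta> = 10 * (1 / \<eta>)" "11 / \<eta> = 11 * (1 / \<eta>)" by simp_all
      ultimately show ?thesis by linarith
    qed
    have cJ0: "real (card JA) > 0" using False fin(1) by (simp add: card_gt_0_iff)
    have bmD: "real m > 0" "\<And>x. w x \<ge> 0" "(\<Sum>x\<in>X. w x) \<le> real m" "finite X"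
      "\<And>z. Im z > 0 \<Longrightarrow> cmod z \<le> 5 \<Longrightarrow>
      (\<Sum>k\<in>{1..<n}. ln (max \<bar>c k\<bar> h)) - ln (cmod (jdet c z n)) \<le> h * (\<Sum>x\<in>X. w x / cmod (z - complex_of_real x)) - real m + ln (1 / h)"
      using bm unfolding block_measure_def by auto
    have "real (card JA) \<le> h / \<eta> * (6 + 2 * ln (real (card JA)))"
    proof (rule resolvent_cells[OF \<eta>(1) h(1) bmD(1-4) _ fin(1) False JA_def])
      fix E assume E: "E \<in> A"
      have "(\<Sum>k\<in>{1..<n}. ln (max \<bar>c k\<bar> h)) - ln (cmod (jdet c (Complex E \<eta>) n))
          \<le> h * (\<Sum>x\<in>X. w x / cmod (Complex E \<eta> - complex_of_real x)) - real m + ln (1 / h)"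
        using E \<eta>(1) by (intro bmD(5) z5) (auto simp: A_def)
      moreover have "ln (cmod (jdet c (Complex E \<eta>) n)) \<le> h / 40 * real n" using E by (simp add: A_def)
      moreover have "h / 20 * real n - h / 20 \<le> (\<Sum>k\<in>{1..<n}. ln (max \<bar>c k\<bar> h))"
        using y(2) n(2) by (simp add: c_def of_nat_diff right_diff_distrib)
      moreover have "h / 20 * real n = h / 40 * real n + h / 40 * real n" by simp
      ultimately have "real m \<le> h * (\<Sum>x\<in>X. w x / cmod (Complex E \<eta> - complex_of_real x))" using n(3) by linarith
      then show "real m / h \<le> (\<Sum>x\<in>X. w x / cmod (Complex E \<eta> - complex_of_real x))" using h by (simp add: pos_divide_le_eq mult.commute)
    qed
    also have "\<dots> \<le> h / \<eta> * (6 + 2 * ln (11 / \<eta>))" using cl cJ0 h \<eta>(1) by (intro mult_left_mono add_left_mono ln_mono) auto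
    finally have "real (card JA) * \<eta> powr \<sigma> \<le> h / \<eta> * (6 + 2 * ln (11 / \<eta>)) * \<eta> powr \<sigma>" by (intro mult_right_mono) auto
    also have "\<dots> = \<eta> powr (\<sigma> - 1 / 2) * (6 + 2 * ln (11 / \<eta>))"
    proof -
      have "h / \<eta> * \<eta> powr \<sigma> = \<eta> powr (1 / 2) * \<eta> powr - 1 * \<eta> powr \<sigma>"
        using \<eta>(1) by (simp add: h_def powr_half_sqrt powr_minus_divide)
      also have "\<dots> = \<eta> powr (\<sigma> - 1 / 2)" unfolding powr_add[symmetric] by (rule arg_cong[where f="\<lambda>x. \<eta> powr x"]) simp
      finally have e: "h / \<eta> * \<eta> powr \<sigma> = \<eta> powr (\<sigma> - 1 / 2)" .
      have "h / \<eta> * (6 + 2 * ln (11 / \<eta>)) * \<eta> powr \<sigma> = (h / \<eta> * \<eta> powr \<sigma>) * (6 + 2 * ln (11 / \<eta>))" by (simp only: mult_ac)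
      then show ?thesis unfolding e .
    qed
    finally show ?thesis using \<eta>(5) by linarith
  qed (use \<kappa> in simp)
  have cJ: "real (card (J i)) * \<rho> i powr \<sigma> \<le> 3 * \<rho> i powr \<tau>" for i
  proof -
    have v: "\<rho> i powr (a + \<tau>) > 0" using \<rho>(1)[of i] by simp
    have "real (card (J i)) \<le> 3 / \<rho> i powr (a + \<tau>)"
      by (rule crowded_cells[OF \<rho>(1)[of i] v Lam(1) _ _ fin(2) J_def[THEN fun_cong]]) (use Lam(2) n(2) in \<open>auto simp: B_def\<close>)
    then have "real (card (J i)) * \<rho> i powr \<sigma> \<le> 3 / \<rho> i powr (a + \<tau>) * \<rho> i powr \<sigma>" by (intro mult_right_mono) auto
    also have "\<dots> = 3 * \<rho> i powr \<tau>" unfolding a(3) powr_add[of _ "a + \<tau>" \<tau>] using v by simp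
    finally show ?thesis .
  qed
  \<comment> \<open>Indices up to \<open>I0\<close> stand for the crowded cells at scale
    \<open>\<rho> k\<close>, and \<open>Suc I0\<close> for the resolvent cells of length
    \<eta>.\<close>
  define len where "len = (\<lambda>k. if k \<le> I0 then \<rho> k else \<eta>)"
  define JJ where "JJ = (\<lambda>k. if k \<le> I0 then J k else JA)"
  have len: "0 < len k" "len k \<le> \<delta>" for k using \<rho> \<eta> by (auto simp: len_def)
  show ?thesis
    unfolding S_def[symmetric]
  proof (rule hausdorff_premeasure_le_intervals[where I="SIGMA k:{..Suc I0}. JJ k" and x="\<lambda>(k, j). of_int j * len k" and l="\<lambda>(k, j). len k"])
    show "finite (SIGMA k:{..Suc I0}. JJ k)" using fin by (intro finite_SigmaI) (auto simp: JJ_def)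
    show "0 \<le> (case i of (k, j) \<Rightarrow> len k) \<and> (case i of (k, j) \<Rightarrow> len k) \<le> \<delta>" for i :: "nat \<times> int"
      using len[of "fst i"] by (auto simp: case_prod_beta)
    have cell: "E \<in> {of_int \<lfloor>E / l\<rfloor> * l..of_int \<lfloor>E / l\<rfloor> * l + l}" if "l > 0" for E l :: real
    proof -
      have "of_int \<lfloor>E / l\<rfloor> * l \<le> E / l * l" "E / l * l \<le> (of_int \<lfloor>E / l\<rfloor> + 1) * l"
        using that by (intro mult_right_mono; linarith)+
      then show ?thesis using that by (simp add: distrib_right)
    qed
    show "S \<subseteq> (\<Union>i\<in>(SIGMA k:{..Suc I0}. JJ k). {(case i of (k, j) \<Rightarrow> of_int j * len k)..(case i of (k, j) \<Rightarrow> of_int j * len k) + (case i of (k, j) \<Rightarrow> len k)})"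
    proof
      fix E assume "E \<in> S"
      then consider "E \<in> A" | i where "i \<le> I0" "E \<in> B i" using cover by blast
      then obtain k where k: "k \<le> Suc I0" "\<lfloor>E / len k\<rfloor> \<in> JJ k"
      proof cases
        case 1
        then show ?thesis by (intro that[of "Suc I0"]) (auto simp: len_def JJ_def JA_def)
      next
        case 2
        then show ?thesis by (intro that[of i]) (auto simp: len_def JJ_def J_def)
      qed
      show "E \<in> (\<Union>i\<in>(SIGMA k:{..Suc I0}. JJ k). {(case i of (k, j) \<Rightarrow> of_int j * len k)..(case i of (k, j) \<Rightarrow> of_int j * len k) + (case i of (k, j) \<Rightarrow> len k)})"
        using k cell[OF len(1)[of k], of E] by (intro UN_I[of "(k, \<lfloor>E / len k\<rfloor>)"]) auto
    qed
    have "(\<Sum>i\<in>(SIGMA k:{..Suc I0}. JJ k). (case i of (k, j) \<Rightarrow> len k) powr \<sigma>) = (\<Sum>k\<le>Suc I0. \<Sum>j\<in>JJ k. len k powr \<sigma>)"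
      using fin by (subst sum.Sigma) (auto simp: JJ_def case_prod_beta)
    also have "\<dots> = (\<Sum>k\<le>I0. real (card (J k)) * \<rho> k powr \<sigma>) + real (card JA) * \<eta> powr \<sigma>"
      by (simp add: JJ_def len_def)
    also have "\<dots> \<le> (\<Sum>k\<le>I0. 3 * \<rho> k powr \<tau>) + \<kappa> / 2" by (intro add_mono sum_mono cJ cJA)
    also have "(\<Sum>k\<le>I0. 3 * \<rho> k powr \<tau>) \<le> 3 * (R powr \<tau> / d)"
      unfolding sum_distrib_left[symmetric] \<rho>_def d_def using dyadic_powr_sum[OF R \<tau>(1), of I0] by simp
    also have "3 * (R powr \<tau> / d) \<le> \<kappa> / 2" using \<eta>(6) by (simp add: R_def)
    finally show "(\<Sum>i\<in>(SIGMA k:{..Suc I0}. JJ k). (case i of (k, j) \<Rightarrow> len k) powr \<sigma>) \<le> \<kappa>" by simp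
  qed (use \<sigma> \<delta> in auto)
qed

theorem theorem1p1:
  fixes \<alpha> \<theta> :: real
  assumes "\<alpha> \<notin> \<rat>"
  shows "hausdorff_dim (ell2_spectrum (critical_amo \<alpha> \<theta>)) \<le> ereal (1 / 2)"
proof (rule hausdorff_dim_leI[where D=1])
  have eq: "ell2_spectrum (critical_amo \<alpha> \<theta>) = complex_of_real ` amo_energies \<alpha> \<theta>"
    using spectrum_real[of _ \<alpha> \<theta>] unfolding amo_energies_def by (force simp: image_iff)
  show "hausdorff_measure s (ell2_spectrum (critical_amo \<alpha> \<theta>)) = 0" if "1 / 2 < s" "s \<le> 1" for s
    unfolding eq by (intro hausdorff_measure_zeroI premeasure_energies assms that)
qed auto

end
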